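(* Let $\Omega\subset\mathbb{R}^N$ ($N\ge 1$) be a bounded and smooth domain and let $1<p<r<\infty$. Let $h:[0,\infty)\to[0,\infty)$ be continuous and nondecreasing, with $h(t)\le C(1+t^{\frac rp-1})$ for some $C>0$ and all $t\ge0$, and with $h>0$ in $(0,\infty)$. Let $g:\Omega\times\mathbb{R}\to\mathbb{R}$ be a Carath\'eodory function such that: (i) there are $C,\sigma>0$ with $\sigma(N-r)\le (r-1)N+r$ such that $|g(x,t)|\le C(1+|t|^{\sigma})$ for all $(x,t)\in\Omega\times\mathbb{R}$; (ii) there exists $q\in(1,p)$ such that for a.e. $x\in\Omega$ the map $t\mapsto\frac{g(x,t)}{t^{q-1}}$ is nonincreasing in $(0,\infty)$. Let $X=W_0^{1,r}(\Omega)$ or $X=W^{1,r}(\Omega)$, and let $I:X\to\mathbb{R}$ be given by $$I(u)=\int_\Omega\left(\frac1p H(|\nabla u|^p)-G(x,u)\right)dx,\qquad H(t)=\int_0^t h(s)\,ds,\quad G(x,t)=\int_0^t g(x,s)\,ds.$$ Let $A$ be the set of nontrivial nonnegative critical points of $I$ in $X$, let $B$ be the set of nonnegative global minimizers of $I$ over $X$, and let $\mathcal{P}^{\circ}$ be the set of strongly positive functions associated with $X$ (defined in the context). Then: (1) If $X=W_0^{1,r}(\Omega)$, then $A\cap\mathcal{P}^{\circ}$ has at most one element, and $B$ has at most one element. (2) If $X=W^{1,r}(\Omega)$ and $A\cap\mathcal{P}^{\circ}$ contains a nonconstant element, then $A\cap\mathcal{P}^{\circ}$ is a singleton. Likewise,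 if $X=W^{1,r}(\Omega)$ and $B$ contains a nonconstant element, then $B$ is a singleton.
   Context: The set $\mathcal{P}^{\circ}$ is defined as follows, with $\nu$ the outward unit normal to $\partial\Omega$: if $X=W_0^{1,r}(\Omega)$, then $\mathcal{P}^{\circ}=\{u\in C_0^1(\overline\Omega): u>0 \text{ in }\Omega,\ \partial_\nu u<0\text{ on }\partial\Omega\}$, where $C_0^1(\overline\Omega)$ denotes the $C^1(\overline\Omega)$ functions vanishing on $\partial\Omega$; if $X=W^{1,r}(\Omega)$, then $\mathcal{P}^{\circ}=\{u\in C^1(\overline\Omega): u>0\text{ on }\overline\Omega\}$. Under the stated assumptions $I$ is a $C^1$ functional on $X$; a critical point of $I$ is $u\in X$ with $I'(u)=0$ in the dual of $X$. A critical point is nontrivial if it is not identically zero. Inequalities between measurable functions (e.g. nonnegativity $u\ge0$) are understood almost everywhere. "Nondecreasing" means $f(t)\le f(s)$ whenever $t<s$; "nonincreasing" means $f(t)\ge f(s)$ whenever $t<s$. *)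

theory Defs
  imports "HOL-Analysis.Analysis"
begin

section \<open>Smooth functions and smooth domains\<close>

definition partial_deriv :: "'a::euclidean_space \<Rightarrow> ('a \<Rightarrow> real) \<Rightarrow> 'a \<Rightarrow> real" where
  "partial_deriv b f x = frechet_derivative f (at x) b"

definition grad :: "('a::euclidean_space \<Rightarrow> real) \<Rightarrow> 'a \<Rightarrow> 'a" where
  "grad f x = (\<Sum>b\<in>Basis. partial_deriv b f x *\<^sub>R b)"

text \<open>Only meaningful for open \<open>U\<close>.\<close>

primrec Ck_on :: "nat \<Rightarrow> 'a::euclidean_space set \<Rightarrow> ('a \<Rightarrow> real) \<Rightarrow> bool" where
  "Ck_on 0 U f \<longleftrightarrow> continuous_on U f"
| "Ck_on (Suc k) U f \<longleftrightarrow>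
     (\<forall>x\<in>U. f differentiable (at x)) \<and> (\<forall>b\<in>Basis. Ck_on k U (partial_deriv b f))"

definition smooth_fun_on :: "'a::euclidean_space set \<Rightarrow> ('a \<Rightarrow> real) \<Rightarrow> bool" where
  "smooth_fun_on U f \<longleftrightarrow> (\<forall>k. Ck_on k U f)"

definition local_defining_function ::
    "'a::euclidean_space set \<Rightarrow> 'a set \<Rightarrow> ('a \<Rightarrow> real) \<Rightarrow> bool" where
  "local_defining_function \<Omega> U \<rho> \<longleftrightarrow>
     open U \<and> smooth_fun_on U \<rho> \<and> (\<forall>y\<in>U. grad \<rho> y \<noteq> 0) \<and> \<Omega> \<inter> U = {y \<in> U. \<rho> y < 0}"

definition bounded_smooth_domain :: "'a::euclidean_space set \<Rightarrow> bool" where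
  "bounded_smooth_domain \<Omega> \<longleftrightarrow>
     open \<Omega> \<and> connected \<Omega> \<and> \<Omega> \<noteq> {} \<and> bounded \<Omega> \<and>
     (\<forall>x\<in>frontier \<Omega>. \<exists>U \<rho>. x \<in> U \<and> local_defining_function \<Omega> U \<rho>)"

text \<open>The direction of \<open>grad \<rho> x\<close> does not depend on the local defining function \<open>\<rho>\<close>, and it
  points out of \<open>\<Omega>\<close> because \<open>\<rho> < 0\<close> inside.\<close>

definition outward_unit_normal :: "'a::euclidean_space set \<Rightarrow> 'a \<Rightarrow> 'a" where
  "outward_unit_normal \<Omega> x =
     (THE \<nu>. \<exists>U \<rho>. x \<in> U \<and> local_defining_function \<Omega> U \<rho> \<and> \<nu> = grad \<rho> x /\<^sub>R norm (grad \<rho> x))"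

section \<open>Sobolev spaces\<close>

text \<open>Elements of Lebesgue and Sobolev spaces over \<open>\<Omega>\<close> are represented by functions on the whole
  type; two functions represent the same element iff they agree almost everywhere in \<open>\<Omega>\<close>.\<close>

definition test_functions :: "'a::euclidean_space set \<Rightarrow> ('a \<Rightarrow> real) set" where
  "test_functions \<Omega> =
     {\<phi>. smooth_fun_on UNIV \<phi> \<and> compact (closure {x. \<phi> x \<noteq> 0}) \<and> closure {x. \<phi> x \<noteq> 0} \<subseteq> \<Omega>}"

definition locally_integrable_on ::
    "('a::euclidean_space \<Rightarrow> 'b::euclidean_space) \<Rightarrow> 'a set \<Rightarrow> bool" where
  "locally_integrable_on f \<Omega> \<longleftrightarrow> (\<forall>K. compact K \<and> K \<subseteq> \<Omega> \<longrightarrow> integrable (lebesgue_on K) f)"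

definition has_weak_gradient ::
    "'a::euclidean_space set \<Rightarrow> ('a \<Rightarrow> real) \<Rightarrow> ('a \<Rightarrow> 'a) \<Rightarrow> bool" where
  "has_weak_gradient \<Omega> u v \<longleftrightarrow>
     locally_integrable_on u \<Omega> \<and> locally_integrable_on v \<Omega> \<and>
     (\<forall>\<phi>\<in>test_functions \<Omega>. \<forall>b\<in>Basis.
        (\<integral>x. u x * partial_deriv b \<phi> x \<partial>(lebesgue_on \<Omega>)) =
        - (\<integral>x. (v x \<bullet> b) * \<phi> x \<partial>(lebesgue_on \<Omega>)))"

text \<open>The weak gradient is unique up to null sets; some version of it is chosen.\<close>

definition weak_grad :: "'a::euclidean_space set \<Rightarrow> ('a \<Rightarrow> real) \<Rightarrow> 'a \<Rightarrow> 'a" where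
  "weak_grad \<Omega> u = (SOME v. has_weak_gradient \<Omega> u v)"

definition Lebesgue_space ::
    "real \<Rightarrow> 'a::euclidean_space set \<Rightarrow> ('a \<Rightarrow> 'b::euclidean_space) set" where
  "Lebesgue_space r \<Omega> =
     {f \<in> borel_measurable (lebesgue_on \<Omega>). integrable (lebesgue_on \<Omega>) (\<lambda>x. norm (f x) powr r)}"

definition W1 :: "real \<Rightarrow> 'a::euclidean_space set \<Rightarrow> ('a \<Rightarrow> real) set" where
  "W1 r \<Omega> = {u \<in> Lebesgue_space r \<Omega>. \<exists>v \<in> Lebesgue_space r \<Omega>. has_weak_gradient \<Omega> u v}"

definition W1_norm :: "real \<Rightarrow> 'a::euclidean_space set \<Rightarrow> ('a \<Rightarrow> real) \<Rightarrow> real" where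
  "W1_norm r \<Omega> u =
     ((\<integral>x. \<bar>u x\<bar> powr r \<partial>(lebesgue_on \<Omega>)) +
      (\<integral>x. norm (weak_grad \<Omega> u x) powr r \<partial>(lebesgue_on \<Omega>))) powr (1 / r)"

definition W1_0 :: "real \<Rightarrow> 'a::euclidean_space set \<Rightarrow> ('a \<Rightarrow> real) set" where
  "W1_0 r \<Omega> =
     {u \<in> W1 r \<Omega>. \<forall>\<epsilon>>0. \<exists>\<phi>\<in>test_functions \<Omega>. W1_norm r \<Omega> (\<lambda>x. u x - \<phi> x) < \<epsilon>}"

section \<open>Strongly positive functions\<close>

text \<open>\<open>u\<close> lies in \<open>C^1\<close> of the closure of \<open>\<Omega>\<close>, and \<open>D\<close> is the continuous extension to the closure
  of its classical gradient in \<open>\<Omega>\<close>.\<close>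

definition C1_closure_gradient ::
    "'a::euclidean_space set \<Rightarrow> ('a \<Rightarrow> real) \<Rightarrow> ('a \<Rightarrow> 'a) \<Rightarrow> bool" where
  "C1_closure_gradient \<Omega> u D \<longleftrightarrow>
     continuous_on (closure \<Omega>) u \<and> continuous_on (closure \<Omega>) D \<and>
     (\<forall>x\<in>\<Omega>. (u has_derivative (\<lambda>y. D x \<bullet> y)) (at x))"

text \<open>Members of the next two sets are determined by their values on the closure of \<open>\<Omega>\<close>. As the sets
  of critical points below are invariant under changes on null sets, a class of functions
  belongs to the intersection exactly if one of its representatives does.\<close>

definition strongly_positive_dirichlet :: "'a::euclidean_space set \<Rightarrow> ('a \<Rightarrow> real) set" where
  "strongly_positive_dirichlet \<Omega> =
     {u. \<exists>D. C1_closure_gradient \<Omega> u D \<and> (\<forall>x\<in>frontier \<Omega>. u x = 0) \<and>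
             (\<forall>x\<in>\<Omega>. 0 < u x) \<and> (\<forall>x\<in>frontier \<Omega>. D x \<bullet> outward_unit_normal \<Omega> x < 0)}"

definition strongly_positive_neumann :: "'a::euclidean_space set \<Rightarrow> ('a \<Rightarrow> real) set" where
  "strongly_positive_neumann \<Omega> =
     {u. (\<exists>D. C1_closure_gradient \<Omega> u D) \<and> (\<forall>x\<in>closure \<Omega>. 0 < u x)}"

section \<open>The functional, its critical points and its minimizers\<close>

definition caratheodory_fun :: "'a::euclidean_space set \<Rightarrow> ('a \<Rightarrow> real \<Rightarrow> real) \<Rightarrow> bool" where
  "caratheodory_fun \<Omega> g \<longleftrightarrow>
     (\<forall>t. (\<lambda>x. g x t) \<in> borel_measurable (lebesgue_on \<Omega>)) \<and>
     (AE x in lebesgue_on \<Omega>. continuous_on UNIV (g x))"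

text \<open>\<open>primitive f t\<close> is the oriented integral of \<open>f\<close> from 0 to \<open>t\<close>, also for negative \<open>t\<close>.\<close>

definition primitive :: "(real \<Rightarrow> real) \<Rightarrow> real \<Rightarrow> real" where
  "primitive f t = (LBINT s=0..ereal t. f s)"

definition energy ::
    "'a::euclidean_space set \<Rightarrow> real \<Rightarrow> (real \<Rightarrow> real) \<Rightarrow> ('a \<Rightarrow> real \<Rightarrow> real) \<Rightarrow> ('a \<Rightarrow> real) \<Rightarrow> real"
  where
  "energy \<Omega> p h g u =
     (\<integral>x. 1 / p * primitive h (norm (weak_grad \<Omega> u x) powr p) - primitive (g x) (u x)
        \<partial>(lebesgue_on \<Omega>))"

text \<open>Frechet derivative \<open>L\<close> at \<open>u\<close> of a functional \<open>J\<close> on a space \<open>X\<close> of functions normed by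
  \<open>nrm\<close>; \<open>L\<close> is a bounded linear functional on \<open>X\<close>.\<close>

definition has_frechet_derivative_in ::
    "('a \<Rightarrow> real) set \<Rightarrow> (('a \<Rightarrow> real) \<Rightarrow> real) \<Rightarrow> (('a \<Rightarrow> real) \<Rightarrow> real) \<Rightarrow> ('a \<Rightarrow> real) \<Rightarrow>
     (('a \<Rightarrow> real) \<Rightarrow> real) \<Rightarrow> bool" where
  "has_frechet_derivative_in X nrm J u L \<longleftrightarrow>
     (\<forall>v\<in>X. \<forall>w\<in>X. \<forall>a b. L (\<lambda>x. a * v x + b * w x) = a * L v + b * L w) \<and>
     (\<exists>K. \<forall>v\<in>X. \<bar>L v\<bar> \<le> K * nrm v) \<and>
     (\<forall>\<epsilon>>0. \<exists>\<delta>>0. \<forall>v\<in>X. nrm v < \<delta> \<longrightarrow> \<bar>J (\<lambda>x. u x + v x) - J u - L v\<bar> \<le> \<epsilon> * nrm v)"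

definition critical_points ::
    "('a \<Rightarrow> real) set \<Rightarrow> (('a \<Rightarrow> real) \<Rightarrow> real) \<Rightarrow> (('a \<Rightarrow> real) \<Rightarrow> real) \<Rightarrow> ('a \<Rightarrow> real) set" where
  "critical_points X nrm J = {u \<in> X. has_frechet_derivative_in X nrm J u (\<lambda>_. 0)}"

definition nontrivial_nonneg_critical_points ::
    "'a::euclidean_space set \<Rightarrow> ('a \<Rightarrow> real) set \<Rightarrow> (('a \<Rightarrow> real) \<Rightarrow> real) \<Rightarrow>
     (('a \<Rightarrow> real) \<Rightarrow> real) \<Rightarrow> ('a \<Rightarrow> real) set" where
  "nontrivial_nonneg_critical_points \<Omega> X nrm J =
     {u \<in> critical_points X nrm J.
        (AE x in lebesgue_on \<Omega>. 0 \<le> u x) \<and> \<not> (AE x in lebesgue_on \<Omega>. u x = 0)}"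

definition nonneg_global_minimizers ::
    "'a::euclidean_space set \<Rightarrow> ('a \<Rightarrow> real) set \<Rightarrow> (('a \<Rightarrow> real) \<Rightarrow> real) \<Rightarrow> ('a \<Rightarrow> real) set" where
  "nonneg_global_minimizers \<Omega> X J =
     {u \<in> X. (AE x in lebesgue_on \<Omega>. 0 \<le> u x) \<and> (\<forall>v\<in>X. J u \<le> J v)}"

section \<open>Cardinality statements modulo equality almost everywhere\<close>

definition at_most_one_ae :: "'a::euclidean_space set \<Rightarrow> ('a \<Rightarrow> real) set \<Rightarrow> bool" where
  "at_most_one_ae \<Omega> S \<longleftrightarrow> (\<forall>u\<in>S. \<forall>v\<in>S. AE x in lebesgue_on \<Omega>. u x = v x)"

definition singleton_ae :: "'a::euclidean_space set \<Rightarrow> ('a \<Rightarrow> real) set \<Rightarrow> bool" where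
  "singleton_ae \<Omega> S \<longleftrightarrow> S \<noteq> {} \<and> at_most_one_ae \<Omega> S"

definition nonconstant_ae :: "'a::euclidean_space set \<Rightarrow> ('a \<Rightarrow> real) \<Rightarrow> bool" where
  "nonconstant_ae \<Omega> u \<longleftrightarrow> \<not> (\<exists>c. AE x in lebesgue_on \<Omega>. u x = c)"

end

(*
  Hidden convexity: for 1 < q < p and nonnegative u, v let w = ((1-t) u^q + t v^q)^(1/q).  Then
  |grad w|^p <= (1-t) |grad u|^p + t |grad v|^p almost everywhere, with equality only if
  grad u = grad v and (u = v or grad u = 0).  Since H is convex and increasing and s |-> G(x, s^(1/q))
  is concave, the energy is convex along t |-> w, and equality forces grad u = grad v.
  For two minimizers the value at t = 1/2 is minimal, hence equality.  For two critical points that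
  are comparable to each other and have bounded gradients, w - u is of order t in the Sobolev norm,
  so the vanishing Frechet derivative and convexity give J u <= J w, and again equality at t = 1/2.
  Comparability of strongly positive functions follows from the boundary condition by integrating
  along the normal until the domain is left.  The growth condition on g makes the energy finite by
  the Sobolev embedding up to the critical exponent, which is obtained from an averaged representation
  along cones contained in the domain together with Maz'ya's truncation of level sets.
*)
theory Submission
  imports Defs
begin

text \<open>The map \<open>qmean\<close> is not differentiable at the origin, where both functions
  may vanish. The Sobolev chain rule is therefore proved for outer functions with bounded continuous
  partial derivatives and carried over by regularisations that send test functions to test
  functions, which also preserves zero boundary values. The chain rule rests on difference quotients
  rather than mollification: for almost every x, u(x + y) - u(x) is the integral of the weak
  gradient along the segment. The same identity yields constancy for zero gradient and, averaged
  over cones, the embedding. Finite energy is essential: the equality case is read off from a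
  vanishing integral of a nonnegative defect, and the defect splits into energies only if these are
  integrable. Neither H nor G need be strict in its convexity or concavity; strictness enters
  through h > 0, which makes H strictly increasing. Two critical points are each compared with their
  midpoint, since that is the value which the convexity estimate has to be played against. Equal
  gradients leave a constant difference: it is zero for Dirichlet conditions, and otherwise a
  nonzero constant would force grad u = 0.\<close>

section \<open>Test functions\<close>

lemma partial_deriv_eq:
  "(f has_derivative f') (at x) \<Longrightarrow> partial_deriv b f x = f' b"
  unfolding partial_deriv_def by (metis frechet_derivative_at)

lemma partial_deriv_eqI:
  "(\<And>x. (f has_derivative f' x) (at x)) \<Longrightarrow> partial_deriv b f = (\<lambda>x. f' x b)"
  by (rule ext) (simp add: partial_deriv_eq)

lemma differentiable_has_derivative_partial:
  "f differentiable (at x) \<Longrightarrow> (f has_derivative (\<lambda>y. partial_deriv y f x)) (at x)"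
  unfolding partial_deriv_def using frechet_derivative_works[of f "at x"] by simp

lemma Ck_on_const [simp]: "Ck_on k UNIV (\<lambda>x. c)"
proof (induction k arbitrary: c)
  case (Suc k)
  have "partial_deriv b (\<lambda>x. c) = (\<lambda>x. 0)" for b :: 'a
    by (rule partial_deriv_eqI[where f' = "\<lambda>_ _. 0"]) simp
  with Suc show ?case by simp
qed simp

text \<open>\<open>Ck_on\<close> asks for continuity only at the top order; at lower orders it has
  to be recovered from differentiability, which is the base case here. The product and power rules
  rely on this because they mix derivatives of different orders.\<close>

lemma Ck_on_SucD: "Ck_on (Suc k) UNIV f \<Longrightarrow> Ck_on k UNIV f"
proof (induction k arbitrary: f)
  case 0
  then show ?case
    by (simp add: continuous_on_eq_continuous_at differentiable_imp_continuous_within)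
next
  case (Suc k)
  then show ?case by (metis Ck_on.simps(2))
qed

lemma Ck_on_add:
  "Ck_on k UNIV f \<Longrightarrow> Ck_on k UNIV g \<Longrightarrow> Ck_on k UNIV (\<lambda>x. f x + g x)"
proof (induction k arbitrary: f g)
  case (Suc k)
  have "partial_deriv b (\<lambda>x. f x + g x) = (\<lambda>x. partial_deriv b f x + partial_deriv b g x)" for b
    using Suc.prems by (intro partial_deriv_eqI has_derivative_add differentiable_has_derivative_partial) auto
  with Suc show ?case by auto
qed (auto intro: continuous_intros)

lemma Ck_on_mult:
  fixes f g :: "'a::euclidean_space \<Rightarrow> real"
  shows "Ck_on k UNIV f \<Longrightarrow> Ck_on k UNIV g \<Longrightarrow> Ck_on k UNIV (\<lambda>x. f x * g x)"
proof (induction k arbitrary: f g)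
  case (Suc k)
  have "partial_deriv b (\<lambda>x. f x * g x) = (\<lambda>x. f x * partial_deriv b g x + partial_deriv b f x * g x)" for b
    using Suc.prems by (intro partial_deriv_eqI has_derivative_mult differentiable_has_derivative_partial) auto
  with Suc show ?case
    using Ck_on_SucD[OF Suc.prems(1)] Ck_on_SucD[OF Suc.prems(2)] by (auto intro!: Ck_on_add)
qed (auto intro: continuous_intros)

lemma Ck_on_cmult: "Ck_on k UNIV f \<Longrightarrow> Ck_on k UNIV (\<lambda>x. c * f x)"
  by (intro Ck_on_mult Ck_on_const)

lemma Ck_on_prod:
  fixes f :: "'i \<Rightarrow> 'a::euclidean_space \<Rightarrow> real"
  shows "(\<And>i. i \<in> I \<Longrightarrow> Ck_on k UNIV (f i)) \<Longrightarrow> Ck_on k UNIV (\<lambda>x. \<Prod>i\<in>I. f i x)"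
  by (induction I rule: infinite_finite_induct) (auto intro!: Ck_on_mult)

text \<open>The exponent is generalised in the induction, since each differentiation lowers it by
  one.\<close>

lemma Ck_on_powr:
  fixes f :: "'a::euclidean_space \<Rightarrow> real"
  assumes pos: "\<And>x. 0 < f x"
  shows "Ck_on k UNIV f \<Longrightarrow> Ck_on k UNIV (\<lambda>x. f x powr \<alpha>)"
proof (induction k arbitrary: \<alpha>)
  case 0
  then show ?case using pos by (auto intro!: continuous_intros simp: less_imp_neq[symmetric])
next
  case (Suc k)
  have der: "((\<lambda>x. f x powr \<alpha>) has_derivative
      (\<lambda>y. partial_deriv y f x * (\<alpha> * f x powr (\<alpha> - 1)))) (at x)" for x
  proof -
    have "f differentiable (at x)" using Suc.prems by auto
    from has_derivative_powr[OF differentiable_has_derivative_partial[OF this], of "\<lambda>_. \<alpha>" "\<lambda>_. 0"]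
    have "((\<lambda>x. f x powr \<alpha>) has_derivative
        (\<lambda>h. f x powr \<alpha> * (0 * ln (f x) + partial_deriv h f x * \<alpha> / f x))) (at x)"
      using pos by auto
    then show ?thesis
      by (rule has_derivative_eq_rhs) (use pos[of x] in \<open>auto simp: fun_eq_iff powr_diff algebra_simps\<close>)
  qed
  have "partial_deriv b (\<lambda>x. f x powr \<alpha>) = (\<lambda>x. partial_deriv b f x * (\<alpha> * f x powr (\<alpha> - 1)))" for b
    by (rule partial_deriv_eqI[OF der])
  moreover have "(\<lambda>x. f x powr \<alpha>) differentiable (at x)" for x
    using der differentiable_def by blast
  ultimately show ?case
    using Suc.IH[OF Ck_on_SucD[OF Suc.prems]] Suc.prems by (auto intro!: Ck_on_mult)
qed

lemma Ck_on_translate: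
  "Ck_on k UNIV f \<Longrightarrow> Ck_on k UNIV (\<lambda>x. f (x - a))"
proof (induction k arbitrary: f)
  case 0
  then show ?case by (auto intro!: continuous_on_compose2[of UNIV f] continuous_intros)
next
  case (Suc k)
  have der: "((\<lambda>x. f (x - a)) has_derivative (\<lambda>y. partial_deriv y f (x - a))) (at x)" for x
  proof -
    have "((\<lambda>x. x - a) has_derivative (\<lambda>y. y)) (at x)"
      by (auto intro!: derivative_eq_intros)
    from diff_chain_at[OF this, of f] Suc.prems show ?thesis
      by (auto simp: o_def dest!: spec[of _ "x - a"] differentiable_has_derivative_partial)
  qed
  have "partial_deriv b (\<lambda>x. f (x - a)) = (\<lambda>x. partial_deriv b f (x - a))" for b
    by (rule partial_deriv_eqI[OF der])
  then show ?case using Suc der differentiable_def by auto blast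
qed

section \<open>Smooth bumps on boxes\<close>

definition flat_exp :: "nat \<Rightarrow> real \<Rightarrow> real" where
  "flat_exp n s = (if 0 < s then exp (- (1 / s)) / s ^ n else 0)"

text \<open>A single term of the exponential series at y = 1/s, the one of order n + 2, beats s^(-n)
  with a factor s^2 to spare. A quadratic bound is what makes the derivative at 0 vanish.\<close>

lemma flat_exp_bound: "\<bar>flat_exp n s\<bar> \<le> fact (n + 2) * s\<^sup>2"
proof (cases "0 < s")
  case True
  define y where "y = 1 / s"
  have y: "0 < y" using True by (simp add: y_def)
  have "(\<Sum>k\<in>{n+2}. y ^ k /\<^sub>R fact k) \<le> exp y"
    unfolding exp_def by (rule sum_le_suminf[OF summable_exp_generic]) (use y in auto)
  then have "y ^ (n + 2) / fact (n + 2) \<le> exp y" by (simp add: divide_inverse mult.commute)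
  then have "y ^ (n+2) \<le> fact (n+2) * exp y"
    by (subst (asm) pos_divide_le_eq) (simp_all only: fact_gt_zero mult.commute)
  then have "y ^ (n+2) * exp (-y) \<le> fact (n+2)" by (simp add: exp_minus field_simps)
  moreover have "y ^ (n+2) * exp (-y) = flat_exp n s / s\<^sup>2"
    using True by (simp add: flat_exp_def y_def field_simps power2_eq_square)
  ultimately have "flat_exp n s / s\<^sup>2 \<le> fact (n+2)" by simp
  then have "flat_exp n s \<le> fact (n+2) * s\<^sup>2" using True by (simp add: divide_le_eq)
  then show ?thesis using True by (simp add: flat_exp_def)
next
  case False
  then show ?thesis by (simp add: flat_exp_def)
qed

text \<open>The factor s^(-n) in \<open>flat_exp\<close> is carried along for this formula: with it
  the family is closed under differentiation up to linear combinations, so smoothness follows by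
  induction for all n at once.\<close>

lemma flat_exp_deriv:
  "(flat_exp n has_real_derivative flat_exp (n+2) s - real n * flat_exp (n+1) s) (at s)"
proof -
  consider "0 < s" | "s < 0" | "s = 0" by linarith
  then show ?thesis
  proof cases
    case 1
    have "((\<lambda>s. exp (- (1 / s)) / s ^ n) has_real_derivative
            flat_exp (n+2) s - real n * flat_exp (n+1) s) (at s)"
    proof (cases n)
      case 0
      then show ?thesis using 1
        by (auto intro!: derivative_eq_intros simp: flat_exp_def field_simps power2_eq_square)
    next
      case (Suc m)
      have "((\<lambda>s. s ^ n) has_real_derivative real n * s ^ m) (at s)"
        using DERIV_pow[of n s UNIV] Suc by simp
      then show ?thesis using 1 Suc
        by (auto intro!: derivative_eq_intros simp: flat_exp_def simp del: power_Suc)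
          (simp add: field_simps power2_eq_square)
    qed
    then show ?thesis
      by (rule DERIV_cong_ev[THEN iffD1, rotated -1])
        (use 1 in \<open>auto simp: flat_exp_def eventually_nhds intro!: exI[of _ "{0<..}"]\<close>)
  next
    case 2
    have "((\<lambda>s. 0) has_real_derivative flat_exp (n+2) s - real n * flat_exp (n+1) s) (at s)"
      using 2 by (auto simp: flat_exp_def)
    then show ?thesis
      by (rule DERIV_cong_ev[THEN iffD1, rotated -1])
        (use 2 in \<open>auto simp: flat_exp_def eventually_nhds intro!: exI[of _ "{..<0}"]\<close>)
  next
    case 3
    have "(\<lambda>h. (flat_exp n (0 + h) - flat_exp n 0) / h) \<midarrow>0\<rightarrow> 0"
    proof (rule Lim_null_comparison)
      show "\<forall>\<^sub>F h in at 0. norm ((flat_exp n (0 + h) - flat_exp n 0) / h) \<le> fact (n+2) * \<bar>h\<bar>"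
      proof (rule eventually_at_topological[THEN iffD2], intro exI[of _ UNIV] conjI ballI impI)
        fix h :: real assume "h \<noteq> 0"
        have "\<bar>flat_exp n h\<bar> / \<bar>h\<bar> \<le> fact (n+2) * \<bar>h\<bar>"
          using flat_exp_bound[of n h] \<open>h \<noteq> 0\<close>
          by (simp add: divide_le_eq power2_eq_square mult.assoc)
        then show "norm ((flat_exp n (0 + h) - flat_exp n 0) / h) \<le> fact (n+2) * \<bar>h\<bar>"
          by (simp add: flat_exp_def[of n 0])
      qed auto
      show "(\<lambda>h. fact (n+2) * \<bar>h\<bar>) \<midarrow>0\<rightarrow> (0::real)"
        by (auto intro!: tendsto_eq_intros)
    qed
    then show ?thesis using 3 by (simp add: DERIV_def flat_exp_def[of _ 0])
  qed
qed

lemma Ck_on_flat_exp: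
  "Ck_on k UNIV (\<lambda>x::'a::euclidean_space. flat_exp n (m * (x \<bullet> c) + l))"
proof (induction k arbitrary: n)
  case 0
  have "continuous_on UNIV (flat_exp n)"
    by (meson DERIV_isCont continuous_at_imp_continuous_on flat_exp_deriv)
  then show ?case by (auto intro!: continuous_on_compose2[of UNIV "flat_exp n"] continuous_intros)
next
  case (Suc k)
  have der: "((\<lambda>x. flat_exp n (m * (x \<bullet> c) + l)) has_derivative
      (\<lambda>y. (m * (y \<bullet> c)) * (flat_exp (n+2) (m * (x \<bullet> c) + l) - real n * flat_exp (n+1) (m * (x \<bullet> c) + l)))) (at x)"
    for x
  proof -
    have 1: "((\<lambda>x. m * (x \<bullet> c) + l) has_derivative (\<lambda>y. m * (y \<bullet> c))) (at x)"
      by (auto intro!: derivative_eq_intros)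
    from diff_chain_at[OF this has_field_derivative_imp_has_derivative[OF flat_exp_deriv[of n]]]
    show ?thesis by (simp add: o_def mult.commute)
  qed
  have "partial_deriv b (\<lambda>x. flat_exp n (m * (x \<bullet> c) + l)) =
     (\<lambda>x. (m * (b \<bullet> c)) * (flat_exp (n+2) (m * (x \<bullet> c) + l) + (- real n) * flat_exp (n+1) (m * (x \<bullet> c) + l)))" for b
    by (subst partial_deriv_eqI[OF der]) (simp add: algebra_simps)
  moreover have "Ck_on k UNIV (\<lambda>x. (m * (b \<bullet> c)) * (flat_exp (n+2) (m * (x \<bullet> c) + l) + (- real n) * flat_exp (n+1) (m * (x \<bullet> c) + l)))" for b
    by (intro Ck_on_mult Ck_on_add Ck_on_const Suc.IH)
  ultimately show ?case using der differentiable_def by auto blast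
qed

text \<open>The index n steepens the profile: exp(-1/(n s)) tends to 1 for s > 0, so the bumps
  converge pointwise to the indicator of the open box. The arguments are written in the affine form
  that \<open>Ck_on_flat_exp\<close> accepts; \<open>box_bump_alt\<close> is the readable
  form.\<close>

definition box_bump :: "'a::euclidean_space \<Rightarrow> 'a \<Rightarrow> nat \<Rightarrow> 'a \<Rightarrow> real" where
  "box_bump l u n x =
     (\<Prod>b\<in>Basis. flat_exp 0 (real (Suc n) * (x \<bullet> b) + - (real (Suc n) * (l \<bullet> b))) *
                flat_exp 0 (- real (Suc n) * (x \<bullet> b) + real (Suc n) * (u \<bullet> b)))"

lemma box_bump_alt:
  "box_bump l u n x =
     (\<Prod>b\<in>Basis. flat_exp 0 (real (Suc n) * (x \<bullet> b - l \<bullet> b)) * flat_exp 0 (real (Suc n) * (u \<bullet> b - x \<bullet> b)))"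
  unfolding box_bump_def by (intro prod.cong refl arg_cong2[of _ _ _ _ "(*)"] arg_cong[of _ _ "flat_exp 0"]) (auto simp: algebra_simps)

lemma flat_exp_0: "flat_exp 0 s = (if 0 < s then exp (- (1 / s)) else 0)"
  by (simp add: flat_exp_def)

lemma box_bump_outside: "x \<notin> box l u \<Longrightarrow> box_bump l u n x = 0"
  unfolding box_bump_alt by (auto simp: mem_box flat_exp_0 zero_less_mult_iff)

lemma box_bump_range: "0 \<le> box_bump l u n x" "box_bump l u n x \<le> 1"
  unfolding box_bump_def
  by (auto intro!: prod_nonneg prod_le_1 mult_nonneg_nonneg mult_le_one simp: flat_exp_0)

lemma box_bump_tendsto: "(\<lambda>n. box_bump l u n x) \<longlonglongrightarrow> indicator (box l u) x"
proof (cases "x \<in> box l u")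
  case True
  have *: "(\<lambda>n. flat_exp 0 (real (Suc n) * s)) \<longlonglongrightarrow> 1" if "0 < s" for s
  proof -
    have "(\<lambda>n. - (inverse s * inverse (real (Suc n)))) \<longlonglongrightarrow> - (inverse s * 0)"
      by (intro tendsto_intros LIMSEQ_inverse_real_of_nat)
    from tendsto_exp[OF this] show ?thesis using that
      by (simp add: flat_exp_0 inverse_eq_divide zero_less_mult_iff mult.commute del: of_nat_Suc)
  qed
  have "(\<lambda>n. box_bump l u n x) \<longlonglongrightarrow> (\<Prod>b\<in>(Basis::'a set). 1 * 1)"
    unfolding box_bump_alt by (intro tendsto_prod tendsto_mult *) (use True in \<open>auto simp: mem_box\<close>)
  then show ?thesis using True by simp
next
  case False
  then show ?thesis by (simp add: box_bump_outside)
qed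

lemma box_bump_test: "cbox l u \<subseteq> \<Omega> \<Longrightarrow> box_bump l u n \<in> test_functions \<Omega>"
proof -
  assume sub: "cbox l u \<subseteq> \<Omega>"
  have "{x. box_bump l u n x \<noteq> 0} \<subseteq> cbox l u"
    using box_bump_outside box_subset_cbox by blast
  then have cl: "closure {x. box_bump l u n x \<noteq> 0} \<subseteq> cbox l u"
    by (rule closure_minimal) (rule closed_cbox)
  then have "compact (closure {x. box_bump l u n x \<noteq> 0})"
    by (meson bounded_cbox bounded_subset closed_closure compact_eq_bounded_closed)
  moreover have "Ck_on k UNIV (box_bump l u n)" for k
    unfolding box_bump_def[abs_def] by (intro Ck_on_prod Ck_on_mult Ck_on_flat_exp)
  ultimately show ?thesis using cl sub unfolding test_functions_def smooth_fun_on_def by auto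
qed

section \<open>Gradients, supports and translates of test functions\<close>

lemma grad_inner:
  assumes "f differentiable (at x)"
  shows "grad f x \<bullet> y = partial_deriv y f x"
proof -
  interpret linear "\<lambda>y. partial_deriv y f x"
    using differentiable_has_derivative_partial[OF assms] has_derivative_linear by blast
  have "partial_deriv y f x = partial_deriv (\<Sum>b\<in>Basis. (y \<bullet> b) *\<^sub>R b) f x"
    by (simp add: euclidean_representation)
  also have "\<dots> = (\<Sum>b\<in>Basis. (y \<bullet> b) * partial_deriv b f x)" by (simp add: sum scaleR)
  also have "\<dots> = grad f x \<bullet> y"
    unfolding grad_def by (simp add: inner_sum_left inner_commute[of y] mult.commute)
  finally show ?thesis ..
qed

lemma has_derivative_grad:
  "f differentiable (at x) \<Longrightarrow> (f has_derivative (\<lambda>y. grad f x \<bullet> y)) (at x)"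
  using differentiable_has_derivative_partial by (simp add: grad_inner)

lemma grad_eqI:
  assumes "(f has_derivative (\<lambda>y. D \<bullet> y)) (at x)"
  shows "grad f x = D"
  unfolding grad_def partial_deriv_eq[OF assms] by (simp add: euclidean_representation)

lemma continuous_on_grad:
  assumes "\<And>b. b \<in> Basis \<Longrightarrow> continuous_on A (partial_deriv b f)"
  shows "continuous_on A (grad f)"
  unfolding grad_def[abs_def] using assms by (auto intro!: continuous_intros)

definition supp :: "('a::topological_space \<Rightarrow> real) \<Rightarrow> 'a set" where
  "supp \<phi> = closure {x. \<phi> x \<noteq> 0}"

lemma test_functions_iff:
  "\<phi> \<in> test_functions \<Omega> \<longleftrightarrow> (\<forall>k. Ck_on k UNIV \<phi>) \<and> compact (supp \<phi>) \<and> supp \<phi> \<subseteq> \<Omega>"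
  unfolding test_functions_def smooth_fun_on_def supp_def by auto

lemma supp_outside: "x \<notin> supp \<phi> \<Longrightarrow> \<phi> x = 0"
  unfolding supp_def by (metis (mono_tags, lifting) closure_subset mem_Collect_eq subsetD)

lemma test_functionsD:
  assumes "\<phi> \<in> test_functions \<Omega>"
  shows "compact (supp \<phi>)" "supp \<phi> \<subseteq> \<Omega>" "\<phi> differentiable (at x)"
    "continuous_on UNIV \<phi>" "continuous_on UNIV (grad \<phi>)"
    "(\<phi> has_derivative (\<lambda>y. grad \<phi> x \<bullet> y)) (at x)"
    "partial_deriv y \<phi> x = grad \<phi> x \<bullet> y"
proof -
  have C: "Ck_on k UNIV \<phi>" for k
    using assms unfolding test_functions_iff by auto
  have s: "compact (supp \<phi>)" "supp \<phi> \<subseteq> \<Omega>"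
    using assms unfolding test_functions_iff by auto
  show "compact (supp \<phi>)" "supp \<phi> \<subseteq> \<Omega>" by fact+
  show d: "\<phi> differentiable (at x)" for x using C[of 1] by simp
  show "continuous_on UNIV \<phi>" using C[of 0] by simp
  show "continuous_on UNIV (grad \<phi>)" using C[of 1] by (intro continuous_on_grad) simp
  show "(\<phi> has_derivative (\<lambda>y. grad \<phi> x \<bullet> y)) (at x)" by (rule has_derivative_grad[OF d])
  show "partial_deriv y \<phi> x = grad \<phi> x \<bullet> y" by (simp add: grad_inner[OF d])
qed

lemma grad_supp_outside: "x \<notin> supp \<phi> \<Longrightarrow> grad \<phi> x = 0"
proof -
  assume x: "x \<notin> supp \<phi>"
  have "open (- supp \<phi>)" by (simp add: supp_def open_Compl)
  have "((\<lambda>_. 0) has_derivative (\<lambda>_. 0)) (at x)" by simp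
  then have "(\<phi> has_derivative (\<lambda>_. 0)) (at x)"
    by (rule has_derivative_transform_within_open[OF _ \<open>open (- supp \<phi>)\<close>])
      (use x supp_outside in auto)
  then have "(\<phi> has_derivative (\<lambda>y. 0 \<bullet> y)) (at x)" by simp
  then show "grad \<phi> x = 0" by (rule grad_eqI)
qed

lemma test_functions_measurable [measurable_dest]:
  assumes "\<phi> \<in> test_functions \<Omega>"
  shows "\<phi> \<in> borel_measurable borel" "grad \<phi> \<in> borel_measurable borel"
  using test_functionsD(4,5)[OF assms] by (auto intro: borel_measurable_continuous_onI)

lemma test_functions_bounded:
  assumes "\<phi> \<in> test_functions \<Omega>"
  obtains M where "0 < M" "\<And>x. \<bar>\<phi> x\<bar> \<le> M" "\<And>x. norm (grad \<phi> x) \<le> M"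
proof -
  have "compact (\<phi> ` supp \<phi>)" "compact (grad \<phi> ` supp \<phi>)"
    using test_functionsD[OF assms] by (auto intro!: compact_continuous_image intro: continuous_on_subset)
  then obtain A B where A: "\<And>x. x \<in> supp \<phi> \<Longrightarrow> norm (\<phi> x) \<le> A"
    and B: "\<And>x. x \<in> supp \<phi> \<Longrightarrow> norm (grad \<phi> x) \<le> B"
    by (metis compact_imp_bounded bounded_iff imageI)
  show thesis
  proof (rule that[of "max 1 (max A B)"])
    show "\<bar>\<phi> x\<bar> \<le> max 1 (max A B)" for x
    proof (cases "x \<in> supp \<phi>")
      case True
      then show ?thesis using A[of x] by simp
    next
      case False
      then show ?thesis by (simp add: supp_outside)
    qed
    show "norm (grad \<phi> x) \<le> max 1 (max A B)" for x
    proof (cases "x \<in> supp \<phi>")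
      case True
      then show ?thesis using B[of x] by simp
    next
      case False
      then show ?thesis by (simp add: grad_supp_outside)
    qed
  qed simp
qed

lemma supp_translate:
  fixes \<phi> :: "'a::euclidean_space \<Rightarrow> real"
  shows "supp (\<lambda>x. \<phi> (x - a)) = (+) a ` supp \<phi>"
proof -
  have "{x. \<phi> (x - a) \<noteq> 0} = (+) a ` {x. \<phi> x \<noteq> 0}"
  proof (intro equalityI subsetI)
    fix x assume "x \<in> {x. \<phi> (x - a) \<noteq> 0}"
    then show "x \<in> (+) a ` {x. \<phi> x \<noteq> 0}" by (intro image_eqI[of _ _ "x - a"]) auto
  qed auto
  then show ?thesis unfolding supp_def by (simp add: closure_translation)
qed

lemma test_functions_translate:
  assumes "\<phi> \<in> test_functions \<Omega>" "\<And>x. x \<in> supp \<phi> \<Longrightarrow> a + x \<in> \<Omega>'"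
  shows "(\<lambda>x. \<phi> (x - a)) \<in> test_functions \<Omega>'"
  using assms unfolding test_functions_iff supp_translate
  by (auto intro: Ck_on_translate compact_translation)

lemma grad_translate:
  assumes "\<phi> \<in> test_functions \<Omega>"
  shows "grad (\<lambda>x. \<phi> (x - a)) x = grad \<phi> (x - a)"
proof (rule grad_eqI)
  have "((\<lambda>x. x - a) has_derivative (\<lambda>y. y)) (at x)"
    by (auto intro!: derivative_eq_intros)
  from diff_chain_at[OF this test_functionsD(6)[OF assms]]
  show "((\<lambda>x. \<phi> (x - a)) has_derivative (\<lambda>y. grad \<phi> (x - a) \<bullet> y)) (at x)"
    by (simp add: o_def)
qed

section \<open>Translation invariance and the fundamental lemma of the calculus of
  variations\<close>

lemma integrable_lborel_translate_iff [simp]: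
  fixes f :: "'a::euclidean_space \<Rightarrow> 'b::{banach, second_countable_topology}"
  shows "integrable lborel (\<lambda>x. f (a + x)) \<longleftrightarrow> integrable lborel f"
proof -
  have *: "integrable lborel (\<lambda>x. f (a + x))" if "integrable lborel f" for f :: "'a \<Rightarrow> 'b" and a
    using that integrable_distr[of "(+) a" lborel borel f] by (simp add: lborel_distr_plus)
  from *[of f a] *[of "\<lambda>x. f (a + x)" "-a"] show ?thesis by auto
qed

lemma integral_lborel_translate [simp]:
  fixes f :: "'a::euclidean_space \<Rightarrow> 'b::{banach, second_countable_topology}"
  shows "(\<integral>x. f (a + x) \<partial>lborel) = (\<integral>x. f x \<partial>lborel)"
proof (cases "integrable lborel f")
  case True
  then have "f \<in> borel_measurable borel" by (auto dest: borel_measurable_integrable)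
  then show ?thesis
    using integral_distr[of "(+) a" lborel borel f] by (simp add: lborel_distr_plus)
next
  case False
  then show ?thesis by (simp add: not_integrable_integral_eq)
qed

lemma nn_integral_lborel_translate:
  "f \<in> borel_measurable borel \<Longrightarrow> (\<integral>\<^sup>+x. f (a + x) \<partial>lborel) = (\<integral>\<^sup>+x. f x \<partial>(lborel :: 'a::euclidean_space measure))"
  using nn_integral_distr[of "(+) a" lborel borel f] by (simp add: lborel_distr_plus)

lemma AE_lborel_translate:
  assumes "AE x in lborel. P x"
  shows "AE x in lborel. P (a + x :: 'a::euclidean_space)"
  using assms by (subst (asm) lborel_distr_plus[of a, symmetric]) (rule AE_distrD, auto)

text \<open>Open boxes form an intersection-stable generator of the Borel sets, and the sets over
  which f integrates to zero are closed under complements and countable disjoint unions.\<close>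

lemma AE_zero_of_box_integrals:
  fixes f :: "'a::euclidean_space \<Rightarrow> real"
  assumes f: "integrable lborel f"
    and z: "\<And>l u. (\<integral>x. indicator (box l u) x * f x \<partial>lborel) = 0"
  shows "AE x in lborel. f x = 0"
proof (rule density_unique_real)
  show "integrable lborel f" "integrable lborel (\<lambda>x. 0::real)" using f by auto
  note [measurable] = borel_measurable_integrable[OF f]
  let ?E = "range (\<lambda>(a, b). box a b::'a set)"
  have int: "integrable lborel (\<lambda>x. indicator A x * f x)" if "A \<in> sets borel" for A
    using integrable_mult_indicator[OF _ f, of A] that by simp
  fix A :: "'a set" assume "A \<in> sets lborel"
  then have "A \<in> sigma_sets UNIV ?E" by (simp add: borel_eq_box)
  have "Int_stable ?E" by (auto simp: Int_stable_def box_Int_box)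
  moreover have "?E \<subseteq> Pow UNIV" by simp
  ultimately have "(\<integral>x. indicator A x * f x \<partial>lborel) = 0"
    using \<open>A \<in> sigma_sets UNIV ?E\<close>
  proof (induction rule: sigma_sets_induct_disjoint)
    case (basic A)
    then show ?case using z by auto
  next
    case (compl A)
    then have A: "A \<in> sets borel" by (simp add: borel_eq_box)
    \<comment> \<open>Complements require the integral over the whole space to vanish; it is the
      limit of the integrals over boxes that exhaust the space.\<close>
    let ?B = "\<lambda>n::nat. box (- (real n *\<^sub>R One)) (real n *\<^sub>R One) :: 'a set"
    have "(\<lambda>n. \<integral>x. indicator (?B n) x * f x \<partial>lborel) \<longlonglongrightarrow> (\<integral>x. f x \<partial>lborel)"
    proof (rule integral_dominated_convergence[where w = "\<lambda>x. norm (f x)"])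
      show "AE x in lborel. (\<lambda>n. indicator (?B n) x * f x) \<longlonglongrightarrow> f x"
      proof (rule AE_I2)
        fix x :: 'a
        have "x \<in> (\<Union>n. ?B n)" unfolding UN_box_eq_UNIV by simp
        then obtain N where N: "x \<in> ?B N" by auto
        have "?B N \<subseteq> ?B n" if "N \<le> n" for n
          using that by (auto simp: mem_box dest!: bspec)
        then have "\<forall>\<^sub>F n in sequentially. indicator (?B n) x * f x = f x"
          using N by (auto intro!: eventually_sequentiallyI[of N] simp: indicator_def)
        then show "(\<lambda>n. indicator (?B n) x * f x) \<longlonglongrightarrow> f x" by (rule tendsto_eventually)
      qed
    qed (use f in \<open>auto simp: indicator_def\<close>)
    then have "(\<integral>x. f x \<partial>lborel) = 0" using z by (simp add: LIMSEQ_const_iff)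
    moreover have "(\<integral>x. indicator (UNIV - A) x * f x \<partial>lborel) = (\<integral>x. f x - indicator A x * f x \<partial>lborel)"
      by (intro Bochner_Integration.integral_cong) (auto simp: indicator_def)
    ultimately show ?case using compl(2) f int[OF A] by simp
  next
    case (union A)
    then have A: "\<And>i. A i \<in> sets lborel" by (auto simp: borel_eq_box)
    have "(LINT x:(\<Union>i. A i)|lborel. f x) = (\<Sum>i. (LINT x:A i|lborel. f x))"
    proof (rule lebesgue_integral_countable_add)
      show "set_integrable lborel (\<Union> (range A)) f"
        unfolding set_integrable_def using int[of "\<Union>(range A)"] A by auto
    qed (use A union(1) in \<open>auto simp: disjoint_family_on_def\<close>)
    then show ?case using union(3) by (simp add: set_lebesgue_integral_def)
  qed simp_all
  then show "(LINT x:A|lborel. f x) = (LINT x:A|lborel. 0)"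
    by (simp add: set_lebesgue_integral_def)
qed

lemma set_integrable_bounded_mult:
  fixes f g :: "'a::euclidean_space \<Rightarrow> real"
  assumes f: "set_integrable lborel K f" and [measurable]: "g \<in> borel_measurable borel"
    and b: "\<And>x. \<bar>g x\<bar> \<le> M" and z: "\<And>x. x \<notin> K \<Longrightarrow> g x = 0"
  shows "integrable lborel (\<lambda>x. f x * g x)"
proof -
  have "integrable lborel (\<lambda>x. (indicator K x *\<^sub>R f x) * g x)"
  proof (rule Bochner_Integration.integrable_bound)
    show "integrable lborel (\<lambda>x. M * (indicator K x *\<^sub>R f x))"
      using f unfolding set_integrable_def by simp
    show "(\<lambda>x. (indicator K x *\<^sub>R f x) * g x) \<in> borel_measurable lborel"
      using f unfolding set_integrable_def by (auto dest: borel_measurable_integrable)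
    show "AE x in lborel. norm ((indicator K x *\<^sub>R f x) * g x) \<le> norm (M * (indicator K x *\<^sub>R f x))"
    proof (rule AE_I2)
      fix x show "norm ((indicator K x *\<^sub>R f x) * g x) \<le> norm (M * (indicator K x *\<^sub>R f x))"
        using b[of x] by (simp add: abs_mult mult.commute mult_right_mono)
    qed
  qed
  moreover have "(\<lambda>x. (indicator K x *\<^sub>R f x) * g x) = (\<lambda>x. f x * g x)"
    using z by (auto simp: fun_eq_iff indicator_def)
  ultimately show ?thesis by simp
qed

text \<open>The integral over a box whose closure lies in the open set is a limit of pairings with
  \<open>box_bump\<close>, hence zero. As f is only locally integrable, the conclusion is drawn box
  by box and collected over a countable cover.\<close>

lemma fundamental_lemma:
  fixes f :: "'a::euclidean_space \<Rightarrow> real"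
  assumes O: "open O'"
    and f: "\<And>K. compact K \<Longrightarrow> K \<subseteq> O' \<Longrightarrow> set_integrable lborel K f"
    and z: "\<And>\<phi>. \<phi> \<in> test_functions O' \<Longrightarrow> (\<integral>x. f x * \<phi> x \<partial>lborel) = 0"
  shows "AE x in lborel. x \<in> O' \<longrightarrow> f x = 0"
proof -
  have box0: "(\<integral>x. indicator (box l u) x * f x \<partial>lborel) = 0" if sub: "cbox l u \<subseteq> O'" for l u
  proof -
    have fK: "integrable lborel (\<lambda>x. indicator (cbox l u) x * f x)"
      using f[OF compact_cbox sub] by (simp add: set_integrable_def)
    note [measurable] = borel_measurable_integrable[OF fK]
      test_functions_measurable(1)[OF box_bump_test[OF sub]]
    have eq: "f x * box_bump l u n x = (indicator (cbox l u) x * f x) * box_bump l u n x" for x n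
      using box_bump_outside[of x l u n] box_subset_cbox[of l u] by (auto simp: indicator_def)
    have eq2: "indicator (box l u) x * f x = (indicator (cbox l u) x * f x) * indicator (box l u) x" for x
      using box_subset_cbox[of l u] by (auto simp: indicator_def)
    have "(\<lambda>n. \<integral>x. f x * box_bump l u n x \<partial>lborel) \<longlonglongrightarrow> (\<integral>x. indicator (box l u) x * f x \<partial>lborel)"
      unfolding eq eq2
    proof (rule integral_dominated_convergence[where w = "\<lambda>x. norm (indicator (cbox l u) x * f x)"])
      show "AE x in lborel. (\<lambda>n. (indicator (cbox l u) x * f x) * box_bump l u n x)
          \<longlonglongrightarrow> (indicator (cbox l u) x * f x) * indicator (box l u) x"
        by (intro AE_I2 tendsto_intros box_bump_tendsto)
      show "AE x in lborel. norm ((indicator (cbox l u) x * f x) * box_bump l u n x)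
              \<le> norm (indicator (cbox l u) x * f x)" for n
        using box_bump_range[of l u n] by (auto simp: abs_mult intro!: mult_left_le)
    qed (use fK in auto)
    then show ?thesis using z[OF box_bump_test[OF sub]] by (simp add: LIMSEQ_const_iff)
  qed
  have AE_box: "AE x in lborel. x \<in> cbox a b \<longrightarrow> f x = 0" if sub: "cbox a b \<subseteq> O'" for a b
  proof -
    \<comment> \<open>Cut off outside the open box, f is integrable on the whole space, and its
      integrals over arbitrary boxes become integrals of f over intersections, which are boxes
      again.\<close>
    have fK: "integrable lborel (\<lambda>x. indicator (box a b) x * f x)"
      using set_integrable_subset[OF f[OF compact_cbox sub], of "box a b"] box_subset_cbox[of a b]
      by (simp add: set_integrable_def)
    have "AE x in lborel. indicator (box a b) x * f x = 0"
    proof (rule AE_zero_of_box_integrals[OF fK])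
      fix l u
      obtain l' u' where eq: "box l u \<inter> box a b = box l' u'" by (auto simp: box_Int_box)
      \<comment> \<open>An empty intersection may be described by corners far away from O', so the
        inclusion is available only in the nonempty case; in the empty case the integral is zero
        anyway.\<close>
      have "cbox l' u' \<subseteq> O' \<or> box l' u' = {}"
      proof (cases "box l' u' = {}")
        case False
        then have "cbox l' u' = closure (box l' u')" by simp
        also have "\<dots> \<subseteq> cbox a b"
          using eq box_subset_cbox[of a b] by (intro closure_minimal) auto
        finally show ?thesis using sub by auto
      qed simp
      then have "(\<integral>x. indicator (box l' u') x * f x \<partial>lborel) = 0" using box0 by auto
      moreover have "indicator (box l' u') x * f x = indicator (box l u) x * (indicator (box a b) x * f x)" for x
        unfolding eq[symmetric] by (simp add: indicator_def)
      ultimately show "(\<integral>x. indicator (box l u) x * (indicator (box a b) x * f x) \<partial>lborel) = 0" by simp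
    qed
    moreover have "AE x in lborel. x \<notin> cbox a b - box a b"
      by (intro AE_not_in null_sets_cbox_Diff_box)
    ultimately show ?thesis by eventually_elim (auto simp: indicator_def split: if_splits)
  qed
  obtain \<D> where D: "countable \<D>" "\<And>X. X \<in> \<D> \<Longrightarrow> X \<subseteq> O' \<and> (\<exists>a b. X = cbox a b)" "\<Union>\<D> = O'"
  proof -
    show ?thesis
      by (rule that[of "(\<lambda>f. cbox (\<Sum>i\<in>Basis. fst (f i) *\<^sub>R i) (\<Sum>i\<in>Basis. snd (f i) *\<^sub>R i)) `
          {f \<in> Basis \<rightarrow>\<^sub>E \<rat> \<times> \<rat>. cbox (\<Sum>i\<in>Basis. fst (f i) *\<^sub>R i) (\<Sum>i\<in>Basis. snd (f i) *\<^sub>R i) \<subseteq> O'}"])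
        (use open_UNION_cbox[OF O] in \<open>auto intro!: countable_image countable_Collect countable_PiE countable_SIGMA countable_rat\<close>)
  qed
  have "AE x in lborel. \<forall>X\<in>\<D>. x \<in> X \<longrightarrow> f x = 0"
    using D(1,2) AE_box by (subst AE_ball_countable) blast+
  then show ?thesis
  proof eventually_elim
    case (elim x)
    then show ?case using D(3) by blast
  qed
qed

section \<open>Weak gradients\<close>

text \<open>Borel measurability, in place of Lebesgue measurability on \<Omega>, makes u(x + s y)
  jointly measurable in s and x for the product of the Borel structures, as Fubini along segments
  demands. \<open>has_weak_gradient_iff\<close> leads back to almost everywhere classes.\<close>

definition locint :: "'a::euclidean_space set \<Rightarrow> ('a \<Rightarrow> 'b::euclidean_space) \<Rightarrow> bool" where
  "locint \<Omega> f \<longleftrightarrow> f \<in> borel_measurable borel \<and>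
     (\<forall>K. compact K \<and> K \<subseteq> \<Omega> \<longrightarrow> integrable lborel (\<lambda>x. indicator K x *\<^sub>R f x))"

lemma locintD:
  assumes "locint \<Omega> f"
  shows "f \<in> borel_measurable borel"
    "compact K \<Longrightarrow> K \<subseteq> \<Omega> \<Longrightarrow> integrable lborel (\<lambda>x. indicator K x *\<^sub>R f x)"
  using assms unfolding locint_def by auto

lemma locint_measurable [measurable_dest]: "locint \<Omega> f \<Longrightarrow> f \<in> borel_measurable borel"
  unfolding locint_def by auto

lemma locint_inner:
  assumes "locint \<Omega> V"
  shows "locint \<Omega> (\<lambda>x. V x \<bullet> y)"
proof -
  have "integrable lborel (\<lambda>x. (indicator K x *\<^sub>R V x) \<bullet> y)" if "compact K" "K \<subseteq> \<Omega>" for K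
    by (intro integrable_inner_left locintD(2)[OF assms] that)
  moreover note [measurable] = locintD(1)[OF assms]
  ultimately show ?thesis unfolding locint_def by (auto simp: inner_scaleR_left)
qed

lemma locint_bound:
  assumes f: "locint \<Omega> f" and [measurable]: "g \<in> borel_measurable borel"
    and le: "AE x in lborel. x \<in> \<Omega> \<longrightarrow> norm (g x) \<le> norm (f x)"
  shows "locint \<Omega> g"
  unfolding locint_def
proof (intro conjI allI impI, fact, elim conjE)
  fix K assume K: "compact K" "K \<subseteq> \<Omega>"
  then have [measurable]: "K \<in> sets borel" by (simp add: borel_compact)
  show "integrable lborel (\<lambda>x. indicator K x *\<^sub>R g x)"
  proof (rule Bochner_Integration.integrable_bound[OF locintD(2)[OF f K]])
    show "AE x in lborel. norm (indicator K x *\<^sub>R g x) \<le> norm (indicator K x *\<^sub>R f x)"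
      using le by eventually_elim (use K in \<open>auto simp: indicator_def\<close>)
  qed simp
qed

lemma locint_const: "locint \<Omega> (\<lambda>x. c)"
  unfolding locint_def by (auto intro!: borel_integrable_compact)

lemma locint_add: "locint \<Omega> f \<Longrightarrow> locint \<Omega> g \<Longrightarrow> locint \<Omega> (\<lambda>x. f x + g x)"
  unfolding locint_def by (auto simp: scaleR_add_right)

lemma locint_scaleR: "locint \<Omega> f \<Longrightarrow> locint \<Omega> (\<lambda>x. c *\<^sub>R f x)"
  unfolding locint_def by (auto simp: scaleR_left_commute[of _ c] simp del: scaleR_scaleR)

lemma locint_norm: "locint \<Omega> f \<Longrightarrow> locint \<Omega> (\<lambda>x. norm (f x))"
proof -
  assume f: "locint \<Omega> f"
  note [measurable] = locintD(1)[OF f]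
  show ?thesis by (rule locint_bound[OF f]) auto
qed

lemma locint_mono: "locint \<Omega> f \<Longrightarrow> \<Omega>' \<subseteq> \<Omega> \<Longrightarrow> locint \<Omega>' f"
  unfolding locint_def by auto

lemma locint_mult_test:
  fixes f g :: "'a::euclidean_space \<Rightarrow> real"
  assumes f: "locint \<Omega> f" and [measurable]: "g \<in> borel_measurable borel"
    and b: "\<And>x. \<bar>g x\<bar> \<le> M" and K: "compact K" "K \<subseteq> \<Omega>" and z: "\<And>x. x \<notin> K \<Longrightarrow> g x = 0"
  shows "integrable lborel (\<lambda>x. f x * g x)"
  by (rule set_integrable_bounded_mult[OF _ _ b z])
    (use locintD(2)[OF f K] in \<open>auto simp: set_integrable_def\<close>)

lemma fundamental_lemma_locint:
  fixes f :: "'a::euclidean_space \<Rightarrow> real"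
  assumes "open O'" "locint O' f" "\<And>\<phi>. \<phi> \<in> test_functions O' \<Longrightarrow> (\<integral>x. f x * \<phi> x \<partial>lborel) = 0"
  shows "AE x in lborel. x \<in> O' \<longrightarrow> f x = 0"
  using assms by (intro fundamental_lemma) (auto simp: set_integrable_def locint_def)

text \<open>The direction y ranges over the whole space because the identity is used along arbitrary
  segments; \<open>wgradI_Basis\<close> recovers it from the coordinate directions.\<close>

definition wgrad :: "'a::euclidean_space set \<Rightarrow> ('a \<Rightarrow> real) \<Rightarrow> ('a \<Rightarrow> 'a) \<Rightarrow> bool" where
  "wgrad \<Omega> u V \<longleftrightarrow> locint \<Omega> u \<and> locint \<Omega> V \<and>
     (\<forall>\<phi>\<in>test_functions \<Omega>. \<forall>y.
        (\<integral>x. u x * (grad \<phi> x \<bullet> y) \<partial>lborel) = - (\<integral>x. (V x \<bullet> y) * \<phi> x \<partial>lborel))"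

lemma wgradD:
  assumes "wgrad \<Omega> u V"
  shows "locint \<Omega> u" "locint \<Omega> V"
    "\<phi> \<in> test_functions \<Omega> \<Longrightarrow>
      (\<integral>x. u x * (grad \<phi> x \<bullet> y) \<partial>lborel) = - (\<integral>x. (V x \<bullet> y) * \<phi> x \<partial>lborel)"
  using assms unfolding wgrad_def by auto

lemma test_mult_integrable:
  assumes \<phi>: "\<phi> \<in> test_functions \<Omega>" and f: "locint \<Omega> (f :: 'a::euclidean_space \<Rightarrow> real)"
  shows "integrable lborel (\<lambda>x. f x * \<phi> x)" "integrable lborel (\<lambda>x. f x * (grad \<phi> x \<bullet> y))"
proof -
  note [measurable] = test_functions_measurable[OF \<phi>]
  obtain M where M: "0 < M" "\<And>x. \<bar>\<phi> x\<bar> \<le> M" "\<And>x. norm (grad \<phi> x) \<le> M"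
    using test_functions_bounded[OF \<phi>] by metis
  note s = test_functionsD(1,2)[OF \<phi>]
  show "integrable lborel (\<lambda>x. f x * \<phi> x)"
    by (rule locint_mult_test[OF f _ M(2) s]) (auto simp: supp_outside)
  have "\<bar>grad \<phi> x \<bullet> y\<bar> \<le> M * norm y" for x
    using Cauchy_Schwarz_ineq2[of "grad \<phi> x" y] M(3)[of x]
    by (meson mult_right_mono norm_ge_zero order_trans)
  then show "integrable lborel (\<lambda>x. f x * (grad \<phi> x \<bullet> y))"
    by (intro locint_mult_test[OF f _ _ s, where M = "M * norm y"]) (auto simp: grad_supp_outside)
qed

lemma wgradI_Basis:
  assumes u: "locint \<Omega> u" and V: "locint \<Omega> V"
    and eq: "\<And>\<phi> b. \<phi> \<in> test_functions \<Omega> \<Longrightarrow> b \<in> Basis \<Longrightarrow>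
      (\<integral>x. u x * (grad \<phi> x \<bullet> b) \<partial>lborel) = - (\<integral>x. (V x \<bullet> b) * \<phi> x \<partial>lborel)"
  shows "wgrad \<Omega> u V"
  unfolding wgrad_def
proof (intro conjI ballI allI u V)
  fix \<phi> y assume \<phi>: "\<phi> \<in> test_functions \<Omega>"
  have 1: "u x * (grad \<phi> x \<bullet> y) = (\<Sum>b\<in>Basis. (y \<bullet> b) * (u x * (grad \<phi> x \<bullet> b)))" for x
    by (subst euclidean_inner[of _ y]) (simp add: sum_distrib_left ac_simps)
  have 2: "(V x \<bullet> y) * \<phi> x = (\<Sum>b\<in>Basis. (y \<bullet> b) * ((V x \<bullet> b) * \<phi> x))" for x
    by (subst euclidean_inner[of _ y]) (simp add: sum_distrib_left sum_distrib_right ac_simps)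
  show "(\<integral>x. u x * (grad \<phi> x \<bullet> y) \<partial>lborel) = - (\<integral>x. (V x \<bullet> y) * \<phi> x \<partial>lborel)"
  proof -
    have "(\<integral>x. (\<Sum>b\<in>Basis. (y \<bullet> b) * (u x * (grad \<phi> x \<bullet> b))) \<partial>lborel)
        = (\<Sum>b\<in>Basis. (y \<bullet> b) * (\<integral>x. u x * (grad \<phi> x \<bullet> b) \<partial>lborel))"
      by (subst Bochner_Integration.integral_sum) (auto intro!: test_mult_integrable[OF \<phi> u])
    also have "\<dots> = - (\<Sum>b\<in>Basis. (y \<bullet> b) * (\<integral>x. (V x \<bullet> b) * \<phi> x \<partial>lborel))"
      by (simp add: eq[OF \<phi>] sum_negf)
    also have "(\<Sum>b\<in>Basis. (y \<bullet> b) * (\<integral>x. (V x \<bullet> b) * \<phi> x \<partial>lborel)) =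
        (\<integral>x. (\<Sum>b\<in>Basis. (y \<bullet> b) * ((V x \<bullet> b) * \<phi> x)) \<partial>lborel)"
      by (subst Bochner_Integration.integral_sum) (auto intro!: test_mult_integrable[OF \<phi>] locint_inner[OF V])
    finally show ?thesis unfolding 1 2 .
  qed
qed

lemma open_countable_Union_cbox:
  fixes O' :: "'a::euclidean_space set"
  assumes "open O'"
  obtains \<D> where "countable \<D>" "\<And>X. X \<in> \<D> \<Longrightarrow> compact X \<and> X \<subseteq> O'" "\<Union>\<D> = O'"
proof -
  let ?c = "\<lambda>f::'a \<Rightarrow> real \<times> real. cbox (\<Sum>i\<in>Basis. fst (f i) *\<^sub>R i) (\<Sum>i\<in>Basis. snd (f i) *\<^sub>R i)"
  let ?I = "{f \<in> Basis \<rightarrow>\<^sub>E \<rat> \<times> \<rat>. ?c f \<subseteq> O'}"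
  show thesis
  proof (rule that[of "?c ` ?I"])
    show "countable (?c ` ?I)"
      by (intro countable_image countable_Collect countable_PiE countable_SIGMA countable_rat) auto
    show "\<And>X. X \<in> ?c ` ?I \<Longrightarrow> compact X \<and> X \<subseteq> O'" using compact_cbox by fastforce
    show "\<Union>(?c ` ?I) = O'" using open_UNION_cbox[OF assms] by simp
  qed
qed

lemma AE_open_compactI:
  fixes O' :: "'a::euclidean_space set"
  assumes "open O'" and K: "\<And>K. compact K \<Longrightarrow> K \<subseteq> O' \<Longrightarrow> AE x in M. x \<in> K \<longrightarrow> P x"
  shows "AE x in M. x \<in> O' \<longrightarrow> P x"
proof -
  obtain \<D> where D: "countable \<D>" "\<And>X. X \<in> \<D> \<Longrightarrow> compact X \<and> X \<subseteq> O'" "\<Union>\<D> = O'"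
    using open_countable_Union_cbox[OF \<open>open O'\<close>] by blast
  have "AE x in M. \<forall>X\<in>\<D>. x \<in> X \<longrightarrow> P x"
    using D(1,2) K by (subst AE_ball_countable) blast+
  then show ?thesis
  proof eventually_elim
    case (elim x)
    then show ?case using D(3) by blast
  qed
qed

text \<open>This is the room for small shifts: moving a support by less than \<delta> stays inside
  one compact subset of \<Omega>, where local integrability applies. Compactness holds because the
  union is the sum of two compact sets.\<close>

lemma compact_fat:
  fixes C :: "'a::euclidean_space set"
  assumes "compact C" "C \<subseteq> \<Omega>" "open \<Omega>"
  obtains \<delta> where "0 < \<delta>" "compact (\<Union>x\<in>C. cball x \<delta>)" "(\<Union>x\<in>C. cball x \<delta>) \<subseteq> \<Omega>"
proof -
  obtain \<delta> where d: "0 < \<delta>" "(\<Union>x\<in>C. cball x \<delta>) \<subseteq> \<Omega>"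
    using compact_subset_open_imp_cball_epsilon_subset[OF assms(1,3,2)] .
  have eq: "(\<Union>x\<in>C. cball x \<delta>) = (\<Union>x\<in>C. \<Union>y\<in>cball 0 \<delta>. {x + y})"
  proof (intro equalityI subsetI)
    fix z assume "z \<in> (\<Union>x\<in>C. cball x \<delta>)"
    then obtain x where "x \<in> C" "dist x z \<le> \<delta>" by auto
    then have "x \<in> C" "z - x \<in> cball 0 \<delta>" "z \<in> {x + (z - x)}" by (auto simp: dist_norm norm_minus_commute)
    then show "z \<in> (\<Union>x\<in>C. \<Union>y\<in>cball 0 \<delta>. {x + y})" by blast
  qed (force simp: dist_norm)
  have "compact (\<Union>x\<in>C. \<Union>y\<in>cball 0 \<delta>. {x + y})"
    by (rule compact_sums'[OF assms(1) compact_cball])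
  then show thesis using that[OF d(1) _ d(2)] unfolding eq by simp
qed

section \<open>Difference quotients and integrals along segments\<close>

lemma dist_segment: "dist x (x + s *\<^sub>R y) = \<bar>s\<bar> * norm (y::'a::euclidean_space)"
  by (simp add: dist_norm)

text \<open>A translation moves the difference quotient from w to the test function, where it
  converges boundedly with supports in one compact set. Local integrability of w suffices, so the
  lemma identifies the limit even before w is known to have a weak gradient.\<close>

lemma summation_by_parts:
  fixes w :: "'a::euclidean_space \<Rightarrow> real"
  assumes \<Omega>: "open \<Omega>" and w: "locint \<Omega> w" and \<phi>: "\<phi> \<in> test_functions \<Omega>"
    and h: "h \<longlonglongrightarrow> 0" "\<And>n. h n \<noteq> 0"
  shows "(\<lambda>n. \<integral>x. (w (x + h n *\<^sub>R y) - w x) / h n * \<phi> x \<partial>lborel) \<longlonglongrightarrow>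
    - (\<integral>x. w x * (grad \<phi> x \<bullet> y) \<partial>lborel)"
proof -
  note [measurable] = test_functions_measurable[OF \<phi>] locintD(1)[OF w]
  obtain M where M: "0 < M" "\<And>x. \<bar>\<phi> x\<bar> \<le> M" "\<And>x. norm (grad \<phi> x) \<le> M"
    using test_functions_bounded[OF \<phi>] by metis
  obtain \<delta> where d: "0 < \<delta>" "compact (\<Union>x\<in>supp \<phi>. cball x \<delta>)" "(\<Union>x\<in>supp \<phi>. cball x \<delta>) \<subseteq> \<Omega>"
    using compact_fat[OF test_functionsD(1,2)[OF \<phi>] \<Omega>] .
  define K where "K = (\<Union>x\<in>supp \<phi>. cball x \<delta>)"
  have [measurable]: "K \<in> sets borel" using d(2) by (simp add: K_def borel_compact)
  \<comment> \<open>The backward difference quotient of \<phi>, which is what the translation turns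
    the forward quotient of w into. Its limit is minus the directional derivative.\<close>
  define q where "q n x = (\<phi> (x - h n *\<^sub>R y) - \<phi> x) / h n" for n x
  have [measurable]: "q n \<in> borel_measurable borel" for n unfolding q_def by measurable
  have "(\<lambda>n. \<bar>h n\<bar> * norm y) \<longlonglongrightarrow> \<bar>0\<bar> * norm y" by (intro tendsto_intros h)
  then have "\<forall>\<^sub>F n in sequentially. \<bar>h n\<bar> * norm y < \<delta>"
    using d(1) by (intro order_tendstoD(2)) auto
  then obtain N where N: "\<And>n. N \<le> n \<Longrightarrow> \<bar>h n\<bar> * norm y < \<delta>"
    unfolding eventually_sequentially by blast
  have der: "((\<lambda>s. \<phi> (x - s *\<^sub>R y)) has_real_derivative - (grad \<phi> (x - s *\<^sub>R y) \<bullet> y)) (at s)" for x s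
  proof -
    have 1: "((\<lambda>s. x - s *\<^sub>R y) has_derivative (\<lambda>t. - (t *\<^sub>R y))) (at s)"
      by (auto intro!: derivative_eq_intros)
    from diff_chain_at[OF this test_functionsD(6)[OF \<phi>]]
    have "((\<lambda>s. \<phi> (x - s *\<^sub>R y)) has_derivative (\<lambda>t. grad \<phi> (x - s *\<^sub>R y) \<bullet> - (t *\<^sub>R y))) (at s)"
      by (simp add: o_def)
    then show ?thesis unfolding has_field_derivative_def
      by (rule has_derivative_eq_rhs) (auto simp: fun_eq_iff)
  qed
  have qb: "\<bar>q n x\<bar> \<le> M * norm y" for n x
  proof -
    have "\<bar>\<phi> (x - h n *\<^sub>R y) - \<phi> (x - 0 *\<^sub>R y)\<bar> \<le> (M * norm y) * \<bar>h n - 0\<bar>"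
    proof (rule field_differentiable_bound[of UNIV "\<lambda>s. \<phi> (x - s *\<^sub>R y)", simplified real_norm_def])
      fix s :: real
      show "((\<lambda>s. \<phi> (x - s *\<^sub>R y)) has_real_derivative - (grad \<phi> (x - s *\<^sub>R y) \<bullet> y)) (at s within UNIV)"
        using der by simp
      show "\<bar>- (grad \<phi> (x - s *\<^sub>R y) \<bullet> y)\<bar> \<le> M * norm y"
        using Cauchy_Schwarz_ineq2[of "grad \<phi> (x - s *\<^sub>R y)" y] M(3)
        by (simp add: abs_minus_cancel) (meson mult_right_mono norm_ge_zero order_trans)
    qed auto
    then show ?thesis using h(2)[of n] by (simp add: q_def divide_le_eq)
  qed
  have q0: "q n x = 0" if "N \<le> n" "x \<notin> K" for n x
  proof -
    have "x \<notin> supp \<phi>" using that d(1) by (force simp: K_def)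
    moreover have "x - h n *\<^sub>R y \<notin> supp \<phi>"
    proof
      assume "x - h n *\<^sub>R y \<in> supp \<phi>"
      moreover have "dist (x - h n *\<^sub>R y) x \<le> \<delta>" using N[OF that(1)] by (simp add: dist_norm)
      ultimately show False using that(2) by (auto simp: K_def)
    qed
    ultimately show ?thesis by (simp add: q_def supp_outside)
  qed
  have int: "integrable lborel (\<lambda>x. w x * q n x)" if "N \<le> n" for n
    using d q0[OF that] by (intro locint_mult_test[OF w _ qb, where K = K]) (auto simp: K_def)
  have eq: "(\<integral>x. (w (x + h n *\<^sub>R y) - w x) / h n * \<phi> x \<partial>lborel) = (\<integral>x. w x * q n x \<partial>lborel)"
    if n: "N \<le> n" for n
  proof -
    have i1: "integrable lborel (\<lambda>x. w x * \<phi> x)" by (rule test_mult_integrable[OF \<phi> w])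
    have i2: "integrable lborel (\<lambda>x. w x * \<phi> (x - h n *\<^sub>R y))"
    proof -
      have "w x * \<phi> (x - h n *\<^sub>R y) = h n * (w x * q n x) + w x * \<phi> x" for x
        using h(2)[of n] by (simp add: q_def field_simps)
      then show ?thesis using int[OF n] i1 by simp
    qed
    have i3: "integrable lborel (\<lambda>x. w (x + h n *\<^sub>R y) * \<phi> x)"
      using i2 integrable_lborel_translate_iff[of "\<lambda>x. w x * \<phi> (x - h n *\<^sub>R y)" "h n *\<^sub>R y"]
      by (simp add: add.commute)
    have "(\<integral>x. (w (x + h n *\<^sub>R y) - w x) / h n * \<phi> x \<partial>lborel)
        = (\<integral>x. (w (x + h n *\<^sub>R y) * \<phi> x - w x * \<phi> x) / h n \<partial>lborel)"
      by (intro Bochner_Integration.integral_cong) (auto simp: field_simps)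
    also have "\<dots> = ((\<integral>x. w (x + h n *\<^sub>R y) * \<phi> x \<partial>lborel) - (\<integral>x. w x * \<phi> x \<partial>lborel)) / h n"
      using i1 i3 by simp
    also have "(\<integral>x. w (x + h n *\<^sub>R y) * \<phi> x \<partial>lborel) = (\<integral>x. w x * \<phi> (x - h n *\<^sub>R y) \<partial>lborel)"
      using integral_lborel_translate[of "\<lambda>x. w x * \<phi> (x - h n *\<^sub>R y)" "h n *\<^sub>R y"]
      by (simp add: add.commute)
    also have "(\<dots> - (\<integral>x. w x * \<phi> x \<partial>lborel)) / h n = (\<integral>x. (w x * \<phi> (x - h n *\<^sub>R y) - w x * \<phi> x) / h n \<partial>lborel)"
      using i1 i2 by simp
    also have "\<dots> = (\<integral>x. w x * q n x \<partial>lborel)"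
      by (intro Bochner_Integration.integral_cong) (auto simp: field_simps q_def)
    finally show ?thesis .
  qed
  have "(\<lambda>n. \<integral>x. w x * q (n + N) x \<partial>lborel) \<longlonglongrightarrow> (\<integral>x. w x * - (grad \<phi> x \<bullet> y) \<partial>lborel)"
  proof (rule integral_dominated_convergence[where w = "\<lambda>x. (M * norm y) * norm (indicator K x *\<^sub>R w x)"])
    show "integrable lborel (\<lambda>x. (M * norm y) * norm (indicator K x *\<^sub>R w x))"
      by (intro integrable_mult_right integrable_norm locintD(2)[OF w]) (use d in \<open>auto simp: K_def\<close>)
    show "AE x in lborel. (\<lambda>n. w x * q (n + N) x) \<longlonglongrightarrow> w x * - (grad \<phi> x \<bullet> y)"
    proof (intro AE_I2 tendsto_intros)
      fix x
      have "((\<lambda>s. (\<phi> (x - s *\<^sub>R y) - \<phi> x) / s) \<longlongrightarrow> - (grad \<phi> x \<bullet> y)) (at 0)"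
        using der[of x 0] by (simp add: DERIV_def)
      moreover have "filterlim h (at 0) sequentially" using h by (simp add: filterlim_at)
      ultimately have "(\<lambda>n. q n x) \<longlonglongrightarrow> - (grad \<phi> x \<bullet> y)"
        unfolding q_def by (rule filterlim_compose[of _ _ _ h])
      then show "(\<lambda>n. q (n + N) x) \<longlonglongrightarrow> - (grad \<phi> x \<bullet> y)" by (rule LIMSEQ_ignore_initial_segment)
    qed
    show "AE x in lborel. norm (w x * q (n + N) x) \<le> (M * norm y) * norm (indicator K x *\<^sub>R w x)" for n
    proof (rule AE_I2)
      fix x
      show "norm (w x * q (n + N) x) \<le> (M * norm y) * norm (indicator K x *\<^sub>R w x)"
      proof (cases "x \<in> K")
        case True
        then show ?thesis using mult_left_mono[OF qb[of "n + N" x], of "\<bar>w x\<bar>"]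
          by (simp add: abs_mult mult.commute)
      next
        case False
        then show ?thesis using q0[of "n + N" x] by simp
      qed
    qed
  qed measurable
  moreover define A where "A n = (\<integral>x. (w (x + h n *\<^sub>R y) - w x) / h n * \<phi> x \<partial>lborel)" for n
  ultimately have "(\<lambda>n. A (n + N)) \<longlonglongrightarrow> - (\<integral>x. w x * (grad \<phi> x \<bullet> y) \<partial>lborel)"
    using eq by simp
  from LIMSEQ_offset[OF this] show ?thesis unfolding A_def .
qed

text \<open>The parameter interval has finite length, so a bound on the integrals of |F s| that is
  uniform in s gives integrability on the product.\<close>

lemma pair_integrable_strip:
  fixes F :: "real \<Rightarrow> 'a::euclidean_space \<Rightarrow> real"
  assumes [measurable]: "case_prod F \<in> borel_measurable (borel \<Otimes>\<^sub>M borel)"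
    and i: "\<And>s. 0 \<le> s \<Longrightarrow> s \<le> 1 \<Longrightarrow> integrable lborel (F s)"
    and c: "\<And>s. 0 \<le> s \<Longrightarrow> s \<le> 1 \<Longrightarrow> (\<integral>x. \<bar>F s x\<bar> \<partial>lborel) \<le> c"
  shows "integrable (lborel \<Otimes>\<^sub>M lborel) (\<lambda>(s, x). indicator {0..1} s * F s x)"
proof (rule lborel_pair.Fubini_integrable)
  have "sets (lborel \<Otimes>\<^sub>M lborel :: (real \<times> 'a) measure) = sets (borel \<Otimes>\<^sub>M borel)"
    by (intro sets_pair_measure_cong) auto
  then have [measurable]: "case_prod F \<in> borel_measurable (lborel \<Otimes>\<^sub>M lborel)"
    using assms(1) measurable_cong_sets by blast
  have "(\<lambda>(s, x). indicator {0..1} s * F s x) = (\<lambda>p. indicator {0..1::real} (fst p) * case_prod F p)"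
    by auto
  then show "(\<lambda>(s, x). indicator {0..1} s * F s x) \<in> borel_measurable (lborel \<Otimes>\<^sub>M lborel)"
    by simp
  have eq: "(\<integral>y. norm (case (s, y) of (s, x) \<Rightarrow> indicator {0..1} s * F s x) \<partial>lborel)
      = indicator {0..1} s * (\<integral>x. \<bar>F s x\<bar> \<partial>lborel)" for s
    by (simp add: abs_mult)
  show "integrable lborel (\<lambda>s. \<integral>y. norm (case (s, y) of (s, x) \<Rightarrow> indicator {0..1} s * F s x) \<partial>lborel)"
    unfolding eq
  proof (rule Bochner_Integration.integrable_bound[of _ "\<lambda>s. c * indicator {0..1::real} s"])
    show "AE s in lborel. norm (indicator {0..1} s * (\<integral>x. \<bar>F s x\<bar> \<partial>lborel)) \<le> norm (c * indicator {0..1} s)"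
    proof (rule AE_I2)
      fix s :: real
      have "0 \<le> (\<integral>x. \<bar>F s x\<bar> \<partial>lborel)" by simp
      then show "norm (indicator {0..1} s * (\<integral>x. \<bar>F s x\<bar> \<partial>lborel)) \<le> norm (c * indicator {0..1} s)"
        using c[of s] by (auto simp: indicator_def)
    qed
    show "(\<lambda>s. indicator {0..1} s * (\<integral>x. \<bar>F s x\<bar> \<partial>lborel)) \<in> borel_measurable lborel"
      by measurable
  qed simp
  show "AE s in lborel. integrable lborel (\<lambda>y. case (s, y) of (s, x) \<Rightarrow> indicator {0..1} s * F s x)"
  proof (rule AE_I2)
    fix s :: real
    show "integrable lborel (\<lambda>y. case (s, y) of (s, x) \<Rightarrow> indicator {0..1} s * F s x)"
      using i[of s] by (cases "s \<in> {0..1}") auto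
  qed
qed

lemma compact_sweep:
  fixes K :: "'a::euclidean_space set"
  assumes "compact K"
  shows "compact ((\<lambda>(x, s). x + s *\<^sub>R y) ` (K \<times> {0..1::real}))"
  by (intro compact_continuous_image compact_Times assms compact_Icc)
    (auto simp: case_prod_beta intro!: continuous_intros)

text \<open>The translates K + s y with s between 0 and 1 sweep out one compact subset of \<Omega>.
  Translation invariance bounds each slice by the integral of |W| over that set, uniformly in
  s.\<close>

lemma strip_integrable:
  fixes W :: "'a::euclidean_space \<Rightarrow> real"
  assumes W: "locint \<Omega> W" and K: "compact K" "\<And>x s. x \<in> K \<Longrightarrow> 0 \<le> s \<Longrightarrow> s \<le> 1 \<Longrightarrow> x + s *\<^sub>R y \<in> \<Omega>"
    and [measurable]: "g \<in> borel_measurable borel" and b: "\<And>x. \<bar>g x\<bar> \<le> M" and z: "\<And>x. x \<notin> K \<Longrightarrow> g x = 0"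
  shows "integrable (lborel \<Otimes>\<^sub>M lborel) (\<lambda>(s, x). indicator {0..1} s * (W (x + s *\<^sub>R y) * g x))"
proof -
  define S where "S = (\<lambda>(x, s). x + s *\<^sub>R y) ` (K \<times> {0..1::real})"
  have S: "compact S" "S \<subseteq> \<Omega>" using compact_sweep[OF K(1)] K(2) by (auto simp: S_def)
  have [measurable]: "S \<in> sets borel" using S by (simp add: borel_compact)
  note [measurable] = locintD(1)[OF W]
  have WS: "integrable lborel (\<lambda>x. indicator S x * W x)" using locintD(2)[OF W S] by simp
  have le: "\<bar>W (x + s *\<^sub>R y) * g x\<bar> \<le> M * \<bar>indicator S (s *\<^sub>R y + x) * W (s *\<^sub>R y + x)\<bar>"
    if "0 \<le> s" "s \<le> 1" for x s
  proof (cases "x \<in> K")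
    case True
    then have "x + s *\<^sub>R y \<in> S" using that unfolding S_def by (intro image_eqI[of _ _ "(x, s)"]) auto
    then show ?thesis using mult_left_mono[OF b[of x], of "\<bar>W (x + s *\<^sub>R y)\<bar>"]
      by (simp add: abs_mult add.commute mult.commute)
  next
    case False
    then show ?thesis using z b[of x] by simp
  qed
  have int: "integrable lborel (\<lambda>x. W (x + s *\<^sub>R y) * g x)" if "0 \<le> s" "s \<le> 1" for s
  proof (rule Bochner_Integration.integrable_bound)
    show "integrable lborel (\<lambda>x. M * \<bar>indicator S (s *\<^sub>R y + x) * W (s *\<^sub>R y + x)\<bar>)"
      using integrable_lborel_translate_iff[of "\<lambda>x. indicator S x * W x" "s *\<^sub>R y"] WS
      by (intro integrable_mult_right integrable_abs) simp
    show "AE x in lborel. norm (W (x + s *\<^sub>R y) * g x) \<le> norm (M * \<bar>indicator S (s *\<^sub>R y + x) * W (s *\<^sub>R y + x)\<bar>)"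
    proof (rule AE_I2)
      fix x show "norm (W (x + s *\<^sub>R y) * g x) \<le> norm (M * \<bar>indicator S (s *\<^sub>R y + x) * W (s *\<^sub>R y + x)\<bar>)"
        using le[OF that, of x] by (metis abs_ge_self order_trans real_norm_def)
    qed
  qed simp
  show ?thesis
  proof (rule pair_integrable_strip)
    show "(\<lambda>(s, x). W (x + s *\<^sub>R y) * g x) \<in> borel_measurable (borel \<Otimes>\<^sub>M borel)" by measurable
    show "integrable lborel (\<lambda>x. W (x + s *\<^sub>R y) * g x)" if "0 \<le> s" "s \<le> 1" for s by (rule int[OF that])
    show "(\<integral>x. \<bar>W (x + s *\<^sub>R y) * g x\<bar> \<partial>lborel) \<le> M * (\<integral>x. \<bar>indicator S x * W x\<bar> \<partial>lborel)"
      if s: "0 \<le> s" "s \<le> 1" for s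
    proof -
      have "(\<integral>x. \<bar>W (x + s *\<^sub>R y) * g x\<bar> \<partial>lborel)
          \<le> (\<integral>x. M * \<bar>indicator S (s *\<^sub>R y + x) * W (s *\<^sub>R y + x)\<bar> \<partial>lborel)"
        using integrable_lborel_translate_iff[of "\<lambda>x. indicator S x * W x" "s *\<^sub>R y"] WS
        by (intro integral_mono integrable_abs int[OF s] integrable_mult_right le[OF s]) simp
      also have "\<dots> = M * (\<integral>x. \<bar>indicator S x * W x\<bar> \<partial>lborel)"
        using integral_lborel_translate[of "\<lambda>x. \<bar>indicator S x * W x\<bar>" "s *\<^sub>R y"] by simp
      finally show ?thesis .
    qed
  qed
qed

text \<open>Both sides are tested with \<phi>. Fubini and a translation replace \<phi> by its
  translates \<phi>(z - s y), for which the weak gradient identity holds; integrating the derivative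
  of s \<mapsto> \<phi>(z - s y) returns the difference of u. The exceptional null set depends on
  y.\<close>

lemma wgrad_translation:
  fixes u :: "'a::euclidean_space \<Rightarrow> real"
  assumes w: "wgrad \<Omega> u V" and O: "open O'"
    and seg: "\<And>x s. x \<in> O' \<Longrightarrow> 0 \<le> s \<Longrightarrow> s \<le> 1 \<Longrightarrow> x + s *\<^sub>R y \<in> \<Omega>"
  shows "AE x in lborel. x \<in> O' \<longrightarrow>
     integrable lborel (\<lambda>s. indicator {0..1} s * (V (x + s *\<^sub>R y) \<bullet> y)) \<and>
     u (x + y) - u x = (\<integral>s. indicator {0..1} s * (V (x + s *\<^sub>R y) \<bullet> y) \<partial>lborel)"
proof -
  define W where "W x = V x \<bullet> y" for x
  define I where "I x = (\<integral>s. indicator {0..1} s * W (x + s *\<^sub>R y) \<partial>lborel)" for x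
  note u = wgradD(1)[OF w]
  have W: "locint \<Omega> W" unfolding W_def by (intro locint_inner wgradD(2)[OF w])
  note [measurable] = locintD(1)[OF W] locintD(1)[OF u]
  have I_meas [measurable]: "I \<in> borel_measurable borel" unfolding I_def by measurable
  have strip: "integrable (lborel \<Otimes>\<^sub>M lborel) (\<lambda>(s, x). indicator {0..1} s * (W (x + s *\<^sub>R y) * indicator K x))"
    if K: "compact K" "K \<subseteq> O'" for K
    by (intro strip_integrable[OF W K(1), where M = 1] borel_measurable_indicator)
      (use K seg in \<open>auto simp: borel_compact indicator_def\<close>)
  have AEint: "AE x in lborel. x \<in> O' \<longrightarrow> integrable lborel (\<lambda>s. indicator {0..1} s * W (x + s *\<^sub>R y))"
  proof (rule AE_open_compactI[OF O])
    fix K assume K: "compact K" "K \<subseteq> O'"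
    from lborel_pair.AE_integrable_snd[OF strip[OF this]]
    show "AE x in lborel. x \<in> K \<longrightarrow> integrable lborel (\<lambda>s. indicator {0..1} s * W (x + s *\<^sub>R y))"
      by eventually_elim auto
  qed
  have I: "locint O' I"
    unfolding locint_def
  proof (intro conjI allI impI I_meas, elim conjE)
    fix K assume K: "compact K" "K \<subseteq> O'"
    from lborel_pair.integrable_snd[OF strip[OF this]]
    have "integrable lborel (\<lambda>x. \<integral>s. indicator {0..1} s * W (x + s *\<^sub>R y) * indicator K x \<partial>lborel)"
      by (simp add: mult.assoc)
    then show "integrable lborel (\<lambda>x. indicator K x *\<^sub>R I x)" unfolding I_def
      by (simp add: mult.commute)
  qed
  have sub: "O' \<subseteq> \<Omega>" using seg[of _ 0] by auto
  have uy: "locint O' (\<lambda>x. u (x + y))"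
    unfolding locint_def
  proof (intro conjI allI impI, measurable, elim conjE)
    fix K assume K: "compact K" "K \<subseteq> O'"
    then have [measurable]: "K \<in> sets borel" by (simp add: borel_compact)
    have "compact ((+) y ` K)" "(+) y ` K \<subseteq> \<Omega>"
      using compact_translation[OF K(1), of y] K seg[of _ 1] by (auto simp: add.commute)
    from locintD(2)[OF u this]
    have "integrable lborel (\<lambda>x. indicator ((+) y ` K) (y + x) *\<^sub>R u (y + x))"
      using integrable_lborel_translate_iff[of "\<lambda>x. indicator ((+) y ` K) x *\<^sub>R u x" y] by simp
    moreover have "indicator ((+) y ` K) (y + x) *\<^sub>R u (y + x) = indicator K x *\<^sub>R u (x + y)" for x
      by (auto simp: indicator_def add.commute)
    ultimately show "integrable lborel (\<lambda>x. indicator K x *\<^sub>R u (x + y))" by simp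
  qed
  define f where "f x = (u (x + y) + (-1) *\<^sub>R u x) + (-1) *\<^sub>R I x" for x
  have f: "locint O' f"
    unfolding f_def by (intro locint_add locint_scaleR uy I locint_mono[OF u sub])
  have "AE x in lborel. x \<in> O' \<longrightarrow> f x = 0"
  proof (rule fundamental_lemma_locint[OF O f])
    fix \<phi> assume \<phi>: "\<phi> \<in> test_functions O'"
    note [measurable] = test_functions_measurable[OF \<phi>]
    note sp = test_functionsD(1,2)[OF \<phi>]
    obtain M where M: "0 < M" "\<And>x. \<bar>\<phi> x\<bar> \<le> M" "\<And>x. norm (grad \<phi> x) \<le> M"
      using test_functions_bounded[OF \<phi>] by metis
    have \<phi>s: "(\<lambda>x. \<phi> (x - s *\<^sub>R y)) \<in> test_functions \<Omega>" if "0 \<le> s" "s \<le> 1" for s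
      by (rule test_functions_translate[OF \<phi>]) (use seg[OF _ that] sp in \<open>auto simp: add.commute\<close>)
    have strip\<phi>: "integrable (lborel \<Otimes>\<^sub>M lborel) (\<lambda>(s, x). indicator {0..1} s * (W (x + s *\<^sub>R y) * \<phi> x))"
      by (rule strip_integrable[OF W sp(1) _ _ M(2)]) (use sp seg in \<open>auto simp: supp_outside\<close>)
    define S where "S = (\<lambda>(x, s). x + s *\<^sub>R y) ` (supp \<phi> \<times> {0..1::real})"
    have S: "compact S" "S \<subseteq> \<Omega>" using compact_sweep[OF sp(1)] sp(2) seg by (auto simp: S_def)
    have [measurable]: "S \<in> sets borel" using S by (simp add: borel_compact)
    have gS: "grad \<phi> (z - s *\<^sub>R y) = 0" if "z \<notin> S" "0 \<le> s" "s \<le> 1" for z s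
    proof (rule grad_supp_outside, rule notI)
      assume "z - s *\<^sub>R y \<in> supp \<phi>"
      then have "z \<in> S" using that unfolding S_def by (intro image_eqI[of _ _ "(z - s *\<^sub>R y, s)"]) auto
      then show False using that by simp
    qed
    have gb: "\<bar>grad \<phi> x \<bullet> y\<bar> \<le> M * norm y" for x
      using Cauchy_Schwarz_ineq2[of "grad \<phi> x" y] M(3)[of x]
      by (meson mult_right_mono norm_ge_zero order_trans)
    have uS: "integrable lborel (\<lambda>x. indicator S x * u x)" using locintD(2)[OF u S] by simp
    let ?f = "\<lambda>s z. u z * (grad \<phi> (z - s *\<^sub>R y) \<bullet> y)"
    have le: "\<bar>?f s z\<bar> \<le> (M * norm y) * \<bar>indicator S z * u z\<bar>"
      if "0 \<le> s" "s \<le> 1" for z s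
      using mult_left_mono[OF gb, of "\<bar>u z\<bar>" "z - s *\<^sub>R y"] gS[OF _ that, of z]
      by (cases "z \<in> S") (auto simp: abs_mult mult.commute)
    have int_ug: "integrable lborel (\<lambda>z. ?f s z)" if "0 \<le> s" "s \<le> 1" for s
      using test_mult_integrable(2)[OF \<phi>s[OF that] u, of y] by (simp add: grad_translate[OF \<phi>])
    have strip_u: "integrable (lborel \<Otimes>\<^sub>M lborel) (\<lambda>(s, z). indicator {0..1} s * ?f s z)"
    proof (rule pair_integrable_strip[OF _ int_ug])
      show "(\<lambda>(s, z). ?f s z) \<in> borel_measurable (borel \<Otimes>\<^sub>M borel)" by measurable
      show "(\<integral>x. \<bar>u x * (grad \<phi> (x - s *\<^sub>R y) \<bullet> y)\<bar> \<partial>lborel) \<le> (\<integral>z. (M * norm y) * \<bar>indicator S z * u z\<bar> \<partial>lborel)"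
        if s: "0 \<le> s" "s \<le> 1" for s
        by (intro integral_mono integrable_abs int_ug s le integrable_mult_right uS)
    qed
    have e1: "(\<integral>x. u (x + y) * \<phi> x \<partial>lborel) = (\<integral>x. u x * \<phi> (x - y) \<partial>lborel)"
      using integral_lborel_translate[of "\<lambda>x. u x * \<phi> (x - y)" y] by (simp add: add.commute)
    have "(\<integral>x. I x * \<phi> x \<partial>lborel) = (\<integral>x. (\<integral>s. indicator {0..1} s * (W (x + s *\<^sub>R y) * \<phi> x) \<partial>lborel) \<partial>lborel)"
      unfolding I_def by (subst mult.assoc[symmetric]) simp
    also have "\<dots> = (\<integral>s. (\<integral>x. indicator {0..1} s * (W (x + s *\<^sub>R y) * \<phi> x) \<partial>lborel) \<partial>lborel)"
      by (rule lborel_pair.Fubini_integral[OF strip\<phi>])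
    \<comment> \<open>For fixed s this is the weak gradient identity for the translated test
      function, admissible because the translated support stays in \<Omega>.\<close>
    also have "\<dots> = (\<integral>s. - (\<integral>z. indicator {0..1} s * ?f s z \<partial>lborel) \<partial>lborel)"
    proof (rule Bochner_Integration.integral_cong)
      fix s :: real
      show "(\<integral>x. indicator {0..1} s * (W (x + s *\<^sub>R y) * \<phi> x) \<partial>lborel)
          = - (\<integral>z. indicator {0..1} s * ?f s z \<partial>lborel)"
      proof (cases "s \<in> {0..1}")
        case True
        then have s: "0 \<le> s" "s \<le> 1" by auto
        have "(\<integral>x. W (x + s *\<^sub>R y) * \<phi> x \<partial>lborel) = (\<integral>z. W z * \<phi> (z - s *\<^sub>R y) \<partial>lborel)"
          using integral_lborel_translate[of "\<lambda>x. W x * \<phi> (x - s *\<^sub>R y)" "s *\<^sub>R y"] by (simp add: add.commute)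
        also have "\<dots> = - (\<integral>z. ?f s z \<partial>lborel)"
          using wgradD(3)[OF w \<phi>s[OF s], of y] by (simp add: grad_translate[OF \<phi>] W_def)
        finally show ?thesis using True by simp
      qed simp
    qed simp
    also have "\<dots> = - (\<integral>z. (\<integral>s. indicator {0..1} s * ?f s z \<partial>lborel) \<partial>lborel)"
      using lborel_pair.Fubini_integral[OF strip_u] by simp
    also have "\<dots> = - (\<integral>z. u z * \<phi> z - u z * \<phi> (z - y) \<partial>lborel)"
    proof (intro arg_cong[of _ _ uminus] Bochner_Integration.integral_cong refl)
      fix z
      have "(\<integral>s. indicator {0..1} s *\<^sub>R ?f s z \<partial>lborel)
          = (- u z * \<phi> (z - 1 *\<^sub>R y)) - (- u z * \<phi> (z - 0 *\<^sub>R y))"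
      proof (rule integral_FTC_atLeastAtMost)
        fix s :: real
        have 1: "((\<lambda>s. z - s *\<^sub>R y) has_derivative (\<lambda>t. - (t *\<^sub>R y))) (at s)"
          by (auto intro!: derivative_eq_intros)
        have 2: "((\<lambda>s. \<phi> (z - s *\<^sub>R y)) has_derivative (\<lambda>t. grad \<phi> (z - s *\<^sub>R y) \<bullet> - (t *\<^sub>R y))) (at s)"
          using diff_chain_at[OF 1 test_functionsD(6)[OF \<phi>]] by (simp add: o_def)
        have "((\<lambda>s. - u z * \<phi> (z - s *\<^sub>R y)) has_vector_derivative ?f s z) (at s)"
          unfolding has_vector_derivative_def
          by (rule has_derivative_eq_rhs[OF has_derivative_mult_right[OF 2]]) (auto simp: fun_eq_iff)
        then show "((\<lambda>s. - u z * \<phi> (z - s *\<^sub>R y)) has_vector_derivative ?f s z) (at s within {0..1})"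
          by (rule has_vector_derivative_at_within)
      next
        show "continuous_on {0..1} (\<lambda>s. ?f s z)"
          by (intro continuous_intros continuous_on_compose2[OF test_functionsD(5)[OF \<phi>]]) auto
      qed simp
      then show "(\<integral>s. indicator {0..1} s * ?f s z \<partial>lborel) = u z * \<phi> z - u z * \<phi> (z - y)"
        by simp
    qed
    finally have e2: "(\<integral>x. I x * \<phi> x \<partial>lborel) = - (\<integral>z. u z * \<phi> z - u z * \<phi> (z - y) \<partial>lborel)" .
    have i1: "integrable lborel (\<lambda>x. u x * \<phi> x)"
      using test_mult_integrable(1)[OF \<phi> locint_mono[OF u sub]] .
    have i2: "integrable lborel (\<lambda>x. u x * \<phi> (x - y))"
      using test_mult_integrable(1)[OF \<phi>s[of 1] u] by simp
    have i3: "integrable lborel (\<lambda>x. u (x + y) * \<phi> x)"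
      using test_mult_integrable(1)[OF \<phi> uy] .
    have i4: "integrable lborel (\<lambda>x. I x * \<phi> x)"
      using test_mult_integrable(1)[OF \<phi> I] .
    have "(\<integral>x. f x * \<phi> x \<partial>lborel) = (\<integral>x. u (x + y) * \<phi> x - u x * \<phi> x - I x * \<phi> x \<partial>lborel)"
      by (intro Bochner_Integration.integral_cong) (auto simp: f_def algebra_simps)
    also have "\<dots> = 0" using i1 i2 i3 i4 e1 e2 by simp
    finally show "(\<integral>x. f x * \<phi> x \<partial>lborel) = 0" .
  qed
  with AEint show ?thesis
    by eventually_elim (auto simp: f_def I_def W_def)
qed

text \<open>The translation formula for one fixed length \<eta> provides, for almost every x, an
  integrable function on a segment. Each shorter increment is the integral of that same function
  over a shrinking interval, hence tends to 0.\<close>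

lemma AE_translate_tendsto:
  fixes u :: "'a::euclidean_space \<Rightarrow> real"
  assumes w: "wgrad \<Omega> u V" and \<Omega>: "open \<Omega>" and h: "h \<longlonglongrightarrow> 0" "\<And>n. 0 \<le> h n"
  shows "AE x in lborel. x \<in> \<Omega> \<longrightarrow> (\<lambda>n. u (x + h n *\<^sub>R y)) \<longlonglongrightarrow> u x"
proof (rule AE_open_compactI[OF \<Omega>])
  let ?i = "\<lambda>x z s. indicator {0..1} s * (V (x + s *\<^sub>R z) \<bullet> z)"
  fix K assume K: "compact K" "K \<subseteq> \<Omega>"
  obtain \<delta> where d: "0 < \<delta>" "compact (\<Union>x\<in>K. cball x \<delta>)" "(\<Union>x\<in>K. cball x \<delta>) \<subseteq> \<Omega>"
    using compact_fat[OF K \<Omega>] by metis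
  define O' where "O' = (\<Union>x\<in>K. ball x (\<delta>/2))"
  have O: "open O'" "K \<subseteq> O'" using d(1) by (auto simp: O'_def)
  \<comment> \<open>Chosen so that \<eta> times the length of y is at most \<delta>/2; the summand 1
    covers y = 0.\<close>
  define \<eta> where "\<eta> = \<delta> / (2 * (norm y + 1))"
  have \<eta>: "0 < \<eta>" "\<eta> * norm y \<le> \<delta>/2"
  proof -
    have p: "0 < norm y + 1" by (smt (verit) norm_ge_zero)
    then show "0 < \<eta>" using d(1) by (simp add: \<eta>_def)
    show "\<eta> * norm y \<le> \<delta>/2" using p d(1) by (simp add: \<eta>_def field_simps)
  qed
  have seg: "x + (s * t) *\<^sub>R y \<in> \<Omega>" if a: "x \<in> O'" "0 \<le> s" "s \<le> 1" "0 \<le> t" "t \<le> \<eta>" for x s t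
  proof -
    obtain c where "c \<in> K" "x \<in> ball c (\<delta>/2)" using a(1) unfolding O'_def by blast
    then have c: "c \<in> K" "dist c x < \<delta>/2" by auto
    have "s * t \<le> 1 * \<eta>" using that by (intro mult_mono) auto
    then have "(s * t) * norm y \<le> \<eta> * norm y" by (intro mult_right_mono) auto
    then have "dist x (x + (s * t) *\<^sub>R y) \<le> \<delta>/2" using \<eta>(2) that by (simp add: dist_segment)
    then have "dist c (x + (s * t) *\<^sub>R y) \<le> \<delta>"
      using c(2) dist_triangle[of c "x + (s * t) *\<^sub>R y" x] by linarith
    then show ?thesis using c(1) d(3) by (auto simp: subset_iff)
  qed
  note [measurable] = locintD(1)[OF wgradD(2)[OF w]]
  have "\<forall>\<^sub>F n in sequentially. h n < \<eta>" using h \<eta>(1) by (intro order_tendstoD(2)) auto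
  then obtain N where N: "\<And>n. N \<le> n \<Longrightarrow> h n < \<eta>" unfolding eventually_sequentially by blast
  have A: "AE x in lborel. \<forall>n. N \<le> n \<longrightarrow> x \<in> O' \<longrightarrow>
     u (x + h n *\<^sub>R y) - u x = (\<integral>s. ?i x (h n *\<^sub>R y) s \<partial>lborel)"
    unfolding AE_all_countable
  proof
    fix n
    show "AE x in lborel. N \<le> n \<longrightarrow> x \<in> O' \<longrightarrow>
     u (x + h n *\<^sub>R y) - u x = (\<integral>s. ?i x (h n *\<^sub>R y) s \<partial>lborel)"
    proof (cases "N \<le> n")
      case True
      have "AE x in lborel. x \<in> O' \<longrightarrow>
         integrable lborel (?i x (h n *\<^sub>R y)) \<and>
         u (x + h n *\<^sub>R y) - u x = (\<integral>s. ?i x (h n *\<^sub>R y) s \<partial>lborel)"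
        by (rule wgrad_translation[OF w O(1)]) (use seg N[OF True] h(2)[of n] in auto)
      then show ?thesis by eventually_elim auto
    qed simp
  qed
  have B: "AE x in lborel. x \<in> O' \<longrightarrow>
     integrable lborel (?i x (\<eta> *\<^sub>R y)) \<and>
     u (x + \<eta> *\<^sub>R y) - u x = (\<integral>s. ?i x (\<eta> *\<^sub>R y) s \<partial>lborel)"
    by (rule wgrad_translation[OF w O(1)]) (use seg \<eta> in auto)
  show "AE x in lborel. x \<in> K \<longrightarrow> (\<lambda>n. u (x + h n *\<^sub>R y)) \<longlonglongrightarrow> u x"
    using A B
  proof (eventually_elim, intro impI)
    fix x assume A: "\<forall>n. N \<le> n \<longrightarrow> x \<in> O' \<longrightarrow>
     u (x + h n *\<^sub>R y) - u x = (\<integral>s. ?i x (h n *\<^sub>R y) s \<partial>lborel)"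
      and B: "x \<in> O' \<longrightarrow>
       integrable lborel (?i x (\<eta> *\<^sub>R y)) \<and>
       u (x + \<eta> *\<^sub>R y) - u x = (\<integral>s. ?i x (\<eta> *\<^sub>R y) s \<partial>lborel)"
      and "x \<in> K"
    then have xO: "x \<in> O'" using O(2) by auto
    \<comment> \<open>The substitution \<sigma> = t s turns the formulas for the different lengths t
      into integrals of one common integrand over {0..t}, so that a single dominating function
      serves all of them.\<close>
    define g where "g t \<sigma> = indicator {0..t} \<sigma> * (V (x + \<sigma> *\<^sub>R y) \<bullet> y)" for t \<sigma> :: real
    have gm [measurable]: "g t \<in> borel_measurable borel" for t unfolding g_def by measurable
    have g: "t * g t (0 + t * s) = indicator {0..1} s * (V (x + s *\<^sub>R (t *\<^sub>R y)) \<bullet> (t *\<^sub>R y))" if "0 < t" for t s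
      using that by (auto simp: g_def indicator_def mult.commute zero_le_mult_iff)
    have "integrable lborel (\<lambda>s. \<eta> * g \<eta> (0 + \<eta> * s))"
      unfolding g[OF \<eta>(1)] using B xO by blast
    then have "integrable lborel (\<lambda>s. g \<eta> (0 + \<eta> * s))" using \<eta>(1) by simp
    then have gi: "integrable lborel (g \<eta>)" using \<eta>(1) by (subst (asm) lborel_integrable_real_affine_iff) auto
    have eq: "u (x + h (n + N) *\<^sub>R y) - u x = (\<integral>\<sigma>. g (h (n + N)) \<sigma> \<partial>lborel)" for n
    proof (cases "h (n + N) = 0")
      case True
      have "AE \<sigma> in lborel. g 0 \<sigma> = 0"
        using AE_lborel_singleton[of "0::real"] by eventually_elim (auto simp: g_def indicator_def)
      then have "(\<integral>\<sigma>. g 0 \<sigma> \<partial>lborel) = 0" by (rule integral_eq_zero_AE)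
      then show ?thesis using True by simp
    next
      case False
      then have p: "0 < h (n + N)" using h(2)[of "n + N"] by linarith
      have "u (x + h (n + N) *\<^sub>R y) - u x = (\<integral>s. h (n + N) * g (h (n + N)) (0 + h (n + N) * s) \<partial>lborel)"
        unfolding g[OF p] using A xO by simp
      also have "\<dots> = (\<integral>\<sigma>. g (h (n + N)) \<sigma> \<partial>lborel)"
        using lborel_integral_real_affine[of "h (n + N)" "g (h (n + N))" 0] p by simp
      finally show ?thesis .
    qed
    have "(\<lambda>n. \<integral>\<sigma>. g (h (n + N)) \<sigma> \<partial>lborel) \<longlonglongrightarrow> (\<integral>\<sigma>. 0 \<partial>(lborel :: real measure))"
    proof (rule integral_dominated_convergence[where w = "\<lambda>\<sigma>. norm (g \<eta> \<sigma>)"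
          and s = "\<lambda>n. g (h (n + N))" and f = "\<lambda>_. 0"])
      show "AE \<sigma> in lborel. (\<lambda>n. g (h (n + N)) \<sigma>) \<longlonglongrightarrow> 0"
        using AE_lborel_singleton[of "0::real"]
      proof eventually_elim
        case (elim \<sigma>)
        have "\<forall>\<^sub>F n in sequentially. g (h (n + N)) \<sigma> = 0"
        proof (cases "\<sigma> < 0")
          case True
          then show ?thesis by (simp add: g_def)
        next
          case False
          then have "\<forall>\<^sub>F n in sequentially. h (n + N) < \<sigma>"
            using elim LIMSEQ_ignore_initial_segment[OF h(1), of N] by (intro order_tendstoD(2)) auto
          then show ?thesis by eventually_elim (simp add: g_def)
        qed
        then show ?case by (rule tendsto_eventually)
      qed
      show "AE \<sigma> in lborel. norm (g (h (n + N)) \<sigma>) \<le> norm (g \<eta> \<sigma>)" for n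
        using N[of "n + N"] by (auto simp: g_def indicator_def)
    qed (use gi in auto)
    then have "(\<lambda>n. u (x + h (n + N) *\<^sub>R y) - u x) \<longlonglongrightarrow> 0" by (simp add: eq)
    then have "(\<lambda>n. u (x + h (n + N) *\<^sub>R y)) \<longlonglongrightarrow> u x" by (simp add: LIM_zero_iff)
    then show "(\<lambda>n. u (x + h n *\<^sub>R y)) \<longlonglongrightarrow> u x" by (rule LIMSEQ_offset)
  qed
qed

text \<open>The factors m n stand for slopes of an outer function. Once the difference quotient is
  replaced by an average of W over the segment, a translation frees W of the shift and moves it to m
  n, which is why convergence is assumed at the points z - (s h n) y. Eventual integrability is
  recorded so that two such integrals can be added.\<close>

lemma slope_integral_tendsto:
  fixes u :: "'a::euclidean_space \<Rightarrow> real"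
  assumes w: "wgrad \<Omega> u V" and \<Omega>: "open \<Omega>" and \<phi>: "\<phi> \<in> test_functions \<Omega>"
    and h: "h \<longlonglongrightarrow> 0" "\<And>n. 0 < h n"
    and m [measurable]: "\<And>n. m n \<in> borel_measurable borel" "m0 \<in> borel_measurable borel"
    and L: "\<And>n x. \<bar>m n x\<bar> \<le> L"
    and lim: "\<And>s. 0 \<le> s \<Longrightarrow> s \<le> 1 \<Longrightarrow>
       AE z in lborel. z \<in> \<Omega> \<longrightarrow> (\<lambda>n. m n (z - (s * h n) *\<^sub>R y)) \<longlonglongrightarrow> m0 z"
  shows "(\<lambda>n. \<integral>x. m n x * ((u (x + h n *\<^sub>R y) - u x) / h n) * \<phi> x \<partial>lborel)
     \<longlonglongrightarrow> (\<integral>z. m0 z * (V z \<bullet> y) * \<phi> z \<partial>lborel)"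
    "eventually (\<lambda>n. integrable lborel (\<lambda>x. m n x * ((u (x + h n *\<^sub>R y) - u x) / h n) * \<phi> x)) sequentially"
proof -
  define W where "W x = V x \<bullet> y" for x
  let ?q = "\<lambda>n s z. m n (z - (s * h n) *\<^sub>R y) * \<phi> (z - (s * h n) *\<^sub>R y)"
  let ?W = "\<lambda>n s x. W (x + s *\<^sub>R (h n *\<^sub>R y)) * (m n x * \<phi> x)"
  let ?A = "\<lambda>n x. m n x * ((u (x + h n *\<^sub>R y) - u x) / h n) * \<phi> x"
  have W: "locint \<Omega> W" unfolding W_def by (intro locint_inner wgradD(2)[OF w])
  note [measurable] = locintD(1)[OF W] test_functions_measurable[OF \<phi>] locintD(1)[OF wgradD(1)[OF w]]
  obtain M where M: "0 < M" "\<And>x. \<bar>\<phi> x\<bar> \<le> M" "\<And>x. norm (grad \<phi> x) \<le> M"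
    using test_functions_bounded[OF \<phi>] by metis
  have L0: "0 \<le> L" using L[of 0 0] by linarith
  note sp = test_functionsD(1,2)[OF \<phi>]
  obtain \<delta> where d: "0 < \<delta>" "compact (\<Union>x\<in>supp \<phi>. cball x \<delta>)" "(\<Union>x\<in>supp \<phi>. cball x \<delta>) \<subseteq> \<Omega>"
    using compact_fat[OF sp \<Omega>] by metis
  define K where "K = (\<Union>x\<in>supp \<phi>. cball x \<delta>)"
  define O' where "O' = (\<Union>x\<in>supp \<phi>. ball x (\<delta>/2))"
  have O: "open O'" "supp \<phi> \<subseteq> O'" using d(1) by (auto simp: O'_def)
  have [measurable]: "K \<in> sets borel" using d(2) by (simp add: K_def borel_compact)
  have "(\<lambda>n. h n * norm y) \<longlonglongrightarrow> 0 * norm y" by (intro tendsto_intros h)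
  then have "\<forall>\<^sub>F n in sequentially. h n * norm y < \<delta>/2"
    using d(1) by (intro order_tendstoD(2)) auto
  then obtain N where N: "\<And>n. N \<le> n \<Longrightarrow> h n * norm y < \<delta>/2"
    unfolding eventually_sequentially by blast
  have sh: "(s * h n) * norm y \<le> \<delta>/2" if "0 \<le> s" "s \<le> 1" "N \<le> n" for s n
  proof -
    have "(s * h n) * norm y \<le> (1 * h n) * norm y"
      using that h(2)[of n] by (intro mult_right_mono) auto
    then show ?thesis using N[OF that(3)] by simp
  qed
  have seg: "x + s *\<^sub>R (h n *\<^sub>R y) \<in> \<Omega>" if a: "x \<in> O'" "0 \<le> s" "s \<le> 1" "N \<le> n" for x s n
  proof -
    obtain c where "c \<in> supp \<phi>" "x \<in> ball c (\<delta>/2)" using a(1) unfolding O'_def by blast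
    then have c: "c \<in> supp \<phi>" "dist c x < \<delta>/2" by auto
    have "dist x (x + (s * h n) *\<^sub>R y) \<le> \<delta>/2" using sh[OF a(2,3,4)] a h(2)[of n] by (simp add: dist_segment abs_mult)
    then have "dist c (x + (s * h n) *\<^sub>R y) \<le> \<delta>"
      using c(2) dist_triangle[of c "x + (s * h n) *\<^sub>R y" x] by linarith
    then show ?thesis using c(1) d(3) by (auto simp: subset_iff)
  qed
  have \<phi>0: "\<phi> (z - (s * h n) *\<^sub>R y) = 0" if "z \<notin> K" "0 \<le> s" "s \<le> 1" "N \<le> n" for z s n
  proof (rule supp_outside[of _ \<phi>], rule notI)
    assume *: "z - (s * h n) *\<^sub>R y \<in> supp \<phi>"
    have "dist (z - (s * h n) *\<^sub>R y) z \<le> \<delta>"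
      using sh[OF that(2,3,4)] that h(2)[of n] d(1) by (simp add: dist_norm abs_mult)
    then have "z \<in> cball (z - (s * h n) *\<^sub>R y) \<delta>" by simp
    then have "z \<in> K" using * unfolding K_def by blast
    then show False using that by simp
  qed
  define J where "J n s = (\<integral>z. W z * (?q n s z) \<partial>lborel)" for n s
  have WK: "integrable lborel (\<lambda>x. indicator K x * W x)"
    using locintD(2)[OF W] d by (simp add: K_def)
  have Jle: "\<bar>W z * (?q n s z)\<bar> \<le> (L * M) * \<bar>indicator K z * W z\<bar>"
    if "0 \<le> s" "s \<le> 1" "N \<le> n" for z s n
  proof (cases "z \<in> K")
    case True
    have "\<bar>?q n s z\<bar> \<le> L * M"
      unfolding abs_mult by (intro mult_mono L M(2) L0) auto
    from mult_left_mono[OF this, of "\<bar>W z\<bar>"] show ?thesis using True by (simp add: abs_mult mult.commute)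
  next
    case False
    then show ?thesis using \<phi>0[OF False that] by simp
  qed
  have Jint: "integrable lborel (\<lambda>z. W z * (?q n s z))"
    if "0 \<le> s" "s \<le> 1" "N \<le> n" for s n
  proof (rule Bochner_Integration.integrable_bound)
    show "integrable lborel (\<lambda>z. (L * M) * \<bar>indicator K z * W z\<bar>)"
      by (intro integrable_mult_right integrable_abs WK)
    show "AE z in lborel. norm (W z * (?q n s z))
        \<le> norm ((L * M) * \<bar>indicator K z * W z\<bar>)"
    proof (rule AE_I2)
      fix z show "norm (W z * (?q n s z))
        \<le> norm ((L * M) * \<bar>indicator K z * W z\<bar>)"
        using Jle[OF that, of z] by (metis abs_ge_self order_trans real_norm_def)
    qed
  qed measurable
  have Jm [measurable]: "J n \<in> borel_measurable borel" for n
    unfolding J_def by measurable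
  have strip: "integrable (lborel \<Otimes>\<^sub>M lborel)
     (\<lambda>(s, x). indicator {0..1} s * (?W n s x))" if n: "N \<le> n" for n
  proof (rule strip_integrable[OF W sp(1), where M = "L * M"])
    show "\<bar>m n x * \<phi> x\<bar> \<le> L * M" for x unfolding abs_mult by (intro mult_mono L M(2) L0) auto
    show "\<And>x s. x \<in> supp \<phi> \<Longrightarrow> 0 \<le> s \<Longrightarrow> s \<le> 1 \<Longrightarrow> x + s *\<^sub>R h n *\<^sub>R y \<in> \<Omega>" using seg O(2) n by blast
  qed (auto simp: supp_outside)
  have AEeq: "AE x in lborel. ?A n x
        = (\<integral>s. indicator {0..1} s * (?W n s x) \<partial>lborel)" if n: "N \<le> n" for n
  proof -
    have "AE x in lborel. x \<in> O' \<longrightarrow>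
         integrable lborel (\<lambda>s. indicator {0..1} s * (V (x + s *\<^sub>R (h n *\<^sub>R y)) \<bullet> (h n *\<^sub>R y))) \<and>
         u (x + h n *\<^sub>R y) - u x = (\<integral>s. indicator {0..1} s * (V (x + s *\<^sub>R (h n *\<^sub>R y)) \<bullet> (h n *\<^sub>R y)) \<partial>lborel)"
      by (rule wgrad_translation[OF w O(1) seg[OF _ _ _ n]])
    then show ?thesis
    proof eventually_elim
      case (elim x)
      show ?case
      proof (cases "x \<in> supp \<phi>")
        case True
        then have "u (x + h n *\<^sub>R y) - u x = (\<integral>s. h n * (indicator {0..1} s * W (x + s *\<^sub>R (h n *\<^sub>R y))) \<partial>lborel)"
          using elim O(2) by (auto simp: W_def ac_simps simp del: scaleR_scaleR)
        also have "\<dots> = h n * (\<integral>s. indicator {0..1} s * W (x + s *\<^sub>R (h n *\<^sub>R y)) \<partial>lborel)"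
          by simp
        finally have "(u (x + h n *\<^sub>R y) - u x) / h n = (\<integral>s. indicator {0..1} s * W (x + s *\<^sub>R (h n *\<^sub>R y)) \<partial>lborel)"
          using h(2)[of n] by simp
        then have "?A n x
           = (\<integral>s. indicator {0..1} s * W (x + s *\<^sub>R (h n *\<^sub>R y)) \<partial>lborel) * (m n x * \<phi> x)"
          by (simp only: ac_simps)
        also have "\<dots> = (\<integral>s. (indicator {0..1} s * W (x + s *\<^sub>R (h n *\<^sub>R y))) * (m n x * \<phi> x) \<partial>lborel)"
          by simp
        finally show ?thesis by (simp only: mult.assoc)
      next
        case False
        then show ?thesis by (simp add: supp_outside)
      qed
    qed
  qed
  have eq: "(\<integral>x. ?A n x \<partial>lborel) = (\<integral>s. indicator {0..1} s * J n s \<partial>lborel)"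
    if n: "N \<le> n" for n
  proof -
    have "(\<integral>x. ?A n x \<partial>lborel)
        = (\<integral>x. (\<integral>s. indicator {0..1} s * (?W n s x) \<partial>lborel) \<partial>lborel)"
      by (intro integral_cong_AE AEeq[OF n]) measurable
    also have "\<dots> = (\<integral>s. (\<integral>x. indicator {0..1} s * (?W n s x) \<partial>lborel) \<partial>lborel)"
      by (rule lborel_pair.Fubini_integral[OF strip[OF n]])
    also have "\<dots> = (\<integral>s. indicator {0..1} s * J n s \<partial>lborel)"
    proof (intro Bochner_Integration.integral_cong refl)
      fix s :: real
      have "(\<integral>x. ?W n s x \<partial>lborel) = J n s"
        unfolding J_def
        using integral_lborel_translate[of "\<lambda>z. W z * (?q n s z)" "(s * h n) *\<^sub>R y"]
        by (simp add: add.commute)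
      then show "(\<integral>x. indicator {0..1} s * (?W n s x) \<partial>lborel) = indicator {0..1} s * J n s"
        by simp
    qed
    finally show ?thesis .
  qed
  show "eventually (\<lambda>n. integrable lborel (\<lambda>x. ?A n x)) sequentially"
  proof (rule eventually_sequentiallyI[of N])
    fix n assume n: "N \<le> n"
    have "integrable lborel (\<lambda>x. \<integral>s. indicator {0..1} s * (?W n s x) \<partial>lborel)"
      by (rule lborel_pair.integrable_snd[OF strip[OF n]])
    then show "integrable lborel (\<lambda>x. ?A n x)"
      by (rule integrable_cong_AE[THEN iffD1, rotated -1]) (use AEeq[OF n] in auto)
  qed
  define J0 where "J0 = (\<integral>z. W z * (m0 z * \<phi> z) \<partial>lborel)"
  have Jlim: "(\<lambda>n. J (n + N) s) \<longlonglongrightarrow> J0" if s: "0 \<le> s" "s \<le> 1" for s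
    unfolding J_def J0_def
  proof (rule integral_dominated_convergence[where w = "\<lambda>z. (L * M) * \<bar>indicator K z * W z\<bar>"])
    show "AE z in lborel. (\<lambda>n. W z * (?q (n + N) s z))
        \<longlonglongrightarrow> W z * (m0 z * \<phi> z)"
      using lim[OF s]
    proof eventually_elim
      case (elim z)
      have "(\<lambda>n. z - (s * h n) *\<^sub>R y) \<longlonglongrightarrow> z - (s * 0) *\<^sub>R y" by (intro tendsto_intros h)
      then have z: "(\<lambda>n. z - (s * h n) *\<^sub>R y) \<longlonglongrightarrow> z" by simp
      have "isCont \<phi> z" using test_functionsD(4)[OF \<phi>] by (simp add: continuous_on_eq_continuous_at)
      then have p: "(\<lambda>n. \<phi> (z - (s * h n) *\<^sub>R y)) \<longlonglongrightarrow> \<phi> z" by (rule isCont_tendsto_compose[OF _ z])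
      have "(\<lambda>n. ?q n s z) \<longlonglongrightarrow> m0 z * \<phi> z"
      proof (cases "z \<in> supp \<phi>")
        case True
        then have "z \<in> \<Omega>" using sp(2) by auto
        then show ?thesis using elim by (intro tendsto_mult p) auto
      next
        \<comment> \<open>Such z may lie outside \<Omega>, where nothing is known about the limit of
          m n; boundedness of m n and continuity of \<phi> force the product to 0.\<close>
        case False
        then have \<phi>z: "\<phi> z = 0" by (rule supp_outside)
        have "(\<lambda>n. L * \<bar>\<phi> (z - (s * h n) *\<^sub>R y)\<bar>) \<longlonglongrightarrow> L * \<bar>\<phi> z\<bar>" by (intro tendsto_intros p)
        then have lim0: "(\<lambda>n. L * \<bar>\<phi> (z - (s * h n) *\<^sub>R y)\<bar>) \<longlonglongrightarrow> 0" using \<phi>z by simp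
        have "(\<lambda>n. ?q n s z) \<longlonglongrightarrow> 0"
        proof (rule Lim_null_comparison[OF _ lim0])
          show "\<forall>\<^sub>F n in sequentially. norm (?q n s z) \<le> L * \<bar>\<phi> (z - (s * h n) *\<^sub>R y)\<bar>"
            using L by (intro always_eventually allI) (simp add: abs_mult mult_right_mono)
        qed
        then show ?thesis using \<phi>z by simp
      qed
      then have "(\<lambda>n. W z * (?q n s z)) \<longlonglongrightarrow> W z * (m0 z * \<phi> z)"
        by (rule tendsto_mult_left)
      then show ?case by (rule LIMSEQ_ignore_initial_segment)
    qed
    show "AE z in lborel. norm (W z * (?q (n + N) s z))
        \<le> (L * M) * \<bar>indicator K z * W z\<bar>" for n
      using Jle[OF s, of "n + N"] by (intro AE_I2) simp
    show "integrable lborel (\<lambda>z. (L * M) * \<bar>indicator K z * W z\<bar>)"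
      by (intro integrable_mult_right integrable_abs WK)
  qed measurable
  define c where "c = (L * M) * (\<integral>z. \<bar>indicator K z * W z\<bar> \<partial>lborel)"
  have Jc: "\<bar>J n s\<bar> \<le> c" if "0 \<le> s" "s \<le> 1" "N \<le> n" for n s
  proof -
    have "\<bar>J n s\<bar> \<le> (\<integral>z. \<bar>W z * (?q n s z)\<bar> \<partial>lborel)"
      unfolding J_def by (rule integral_abs_bound)
    also have "\<dots> \<le> (\<integral>z. (L * M) * \<bar>indicator K z * W z\<bar> \<partial>lborel)"
      by (intro integral_mono integrable_abs Jint that Jle integrable_mult_right WK)
    finally show ?thesis by (simp add: c_def)
  qed
  have "(\<lambda>n. \<integral>s. indicator {0..1} s * J (n + N) s \<partial>lborel) \<longlonglongrightarrow> (\<integral>s. indicator {0..1::real} s * J0 \<partial>lborel)"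
  proof (rule integral_dominated_convergence[where w = "\<lambda>s. indicator {0..1} s * c"])
    show "AE s in lborel. (\<lambda>n. indicator {0..1} s * J (n + N) s) \<longlonglongrightarrow> indicator {0..1::real} s * J0"
    proof (rule AE_I2)
      fix s :: real
      show "(\<lambda>n. indicator {0..1} s * J (n + N) s) \<longlonglongrightarrow> indicator {0..1::real} s * J0"
        by (cases "s \<in> {0..1}") (use Jlim[of s] in auto)
    qed
    show "AE s in lborel. norm (indicator {0..1} s * J (n + N) s) \<le> indicator {0..1} s * c" for n
      using Jc[of _ "n + N"] by (intro AE_I2) (auto simp: indicator_def)
  qed auto
  moreover define A where "A n = (\<integral>x. ?A n x \<partial>lborel)" for n
  ultimately have "(\<lambda>n. A (n + N)) \<longlonglongrightarrow> J0" using eq by simp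
  from LIMSEQ_offset[OF this]
  show "(\<lambda>n. \<integral>x. ?A n x \<partial>lborel)
     \<longlonglongrightarrow> (\<integral>z. m0 z * (V z \<bullet> y) * \<phi> z \<partial>lborel)"
    by (simp add: A_def J0_def W_def ac_simps)
qed

text \<open>The two points are the base and the tip of the difference quotient after the
  translation; they lie on the line through z at the parameters - s h n and (1 - s) h n.\<close>

lemma AE_shift_between_tendsto:
  fixes u :: "'a::euclidean_space \<Rightarrow> real"
  assumes w: "wgrad \<Omega> u V" and \<Omega>: "open \<Omega>" and h: "h \<longlonglongrightarrow> 0" "\<And>n. 0 < h n" and s: "0 \<le> s" "s \<le> 1"
  shows "AE z in lborel. z \<in> \<Omega> \<longrightarrow> (\<lambda>n. u (z - (s * h n) *\<^sub>R y)) \<longlonglongrightarrow> u z \<and>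
     (\<lambda>n. u (z - (s * h n) *\<^sub>R y + h n *\<^sub>R y)) \<longlonglongrightarrow> u z"
proof -
  have "(\<lambda>n. s * h n) \<longlonglongrightarrow> s * 0" "(\<lambda>n. (1 - s) * h n) \<longlonglongrightarrow> (1 - s) * 0" by (intro tendsto_intros h)+
  then have lim: "(\<lambda>n. s * h n) \<longlonglongrightarrow> 0" "(\<lambda>n. (1 - s) * h n) \<longlonglongrightarrow> 0" by simp_all
  have pos: "0 \<le> s * h n" "0 \<le> (1 - s) * h n" for n using s h(2)[of n] by auto
  have e: "z + (s * h n) *\<^sub>R (- y) = z - (s * h n) *\<^sub>R y"
    "z + ((1 - s) * h n) *\<^sub>R y = z - (s * h n) *\<^sub>R y + h n *\<^sub>R y" for z n
    by (auto simp: algebra_simps)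
  show ?thesis
    using AE_translate_tendsto[OF w \<Omega> lim(1) pos(1), of "- y", unfolded e]
      AE_translate_tendsto[OF w \<Omega> lim(2) pos(2), of y, unfolded e]
    by eventually_elim blast
qed

section \<open>The chain rule for weak gradients\<close>

definition slope :: "(real \<Rightarrow> real) \<Rightarrow> (real \<Rightarrow> real) \<Rightarrow> real \<Rightarrow> real \<Rightarrow> real" where
  "slope f f' a b = (if a = b then f' a else (f b - f a) / (b - a))"

text \<open>This is true on the diagonal as well, so increments factor through slopes without
  exceptional points. The diagonal value f' a makes every slope a value of f' between a and b, which
  gives both the bound and the limit below.\<close>

lemma slope_mult: "slope f f' a b * (b - a) = f b - f a"
  by (simp add: slope_def)

lemma slope_mean_value:
  assumes "\<And>x. (f has_real_derivative f' x) (at x)"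
  obtains c where "min a b \<le> c" "c \<le> max a b" "slope f f' a b = f' c"
proof -
  consider "a = b" | "a < b" | "b < a" by linarith
  then show thesis
  proof cases
    case 1
    then show ?thesis using that[of a] by (simp add: slope_def)
  next
    case 2
    obtain z where "a < z" "z < b" "f b - f a = (b - a) * f' z"
      using MVT2[OF 2, of f f'] assms by auto
    then show ?thesis using that[of z] 2 by (simp add: slope_def)
  next
    case 3
    obtain z where "b < z" "z < a" "f a - f b = (a - b) * f' z"
      using MVT2[OF 3, of f f'] assms by auto
    then have "slope f f' a b = f' z" using 3 by (simp add: slope_def field_simps)
    then show ?thesis using that[of z] 3 \<open>b < z\<close> \<open>z < a\<close> by simp
  qed
qed

lemma slope_tendsto:
  assumes F: "\<And>a b. ((\<lambda>a. F a b) has_real_derivative F1 (a, b)) (at a)" and c: "continuous_on UNIV F1"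
    and a: "a \<longlonglongrightarrow> x" "a' \<longlonglongrightarrow> x" "b \<longlonglongrightarrow> (y::real)"
  shows "(\<lambda>n. slope (\<lambda>t. F t (b n)) (\<lambda>t. F1 (t, b n)) (a n) (a' n)) \<longlonglongrightarrow> F1 (x, y)"
proof -
  have "\<exists>c. min (a n) (a' n) \<le> c \<and> c \<le> max (a n) (a' n) \<and>
     slope (\<lambda>t. F t (b n)) (\<lambda>t. F1 (t, b n)) (a n) (a' n) = F1 (c, b n)" for n
    using slope_mean_value[of "\<lambda>t. F t (b n)" "\<lambda>t. F1 (t, b n)" "a n" "a' n"] F by metis
  then obtain c where c: "\<And>n. min (a n) (a' n) \<le> c n" "\<And>n. c n \<le> max (a n) (a' n)"
    "\<And>n. slope (\<lambda>t. F t (b n)) (\<lambda>t. F1 (t, b n)) (a n) (a' n) = F1 (c n, b n)" by metis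
  have "(\<lambda>n. min (a n) (a' n)) \<longlonglongrightarrow> min x x" "(\<lambda>n. max (a n) (a' n)) \<longlonglongrightarrow> max x x"
    by (intro tendsto_min tendsto_max a)+
  then have "c \<longlonglongrightarrow> x"
    by (intro tendsto_sandwich[of "\<lambda>n. min (a n) (a' n)" c _ "\<lambda>n. max (a n) (a' n)"]) (use c in auto)
  then have "(\<lambda>n. (c n, b n)) \<longlonglongrightarrow> (x, y)" by (intro tendsto_Pair a)
  moreover have "isCont F1 (x, y)" using \<open>continuous_on UNIV F1\<close> by (simp add: continuous_on_eq_continuous_at)
  ultimately have "(\<lambda>n. F1 (c n, b n)) \<longlonglongrightarrow> F1 (x, y)" by (metis isCont_tendsto_compose)
  then show ?thesis using c(3) by simp
qed

lemma slope_abs_le: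
  assumes "\<And>x. (f has_real_derivative f' x) (at x)" "\<And>x. \<bar>f' x\<bar> \<le> L"
  shows "\<bar>slope f f' a b\<bar> \<le> L"
  using slope_mean_value[OF assms(1), of a b] assms(2) by metis

locale C1_pair =
  fixes F :: "real \<Rightarrow> real \<Rightarrow> real" and F1 F2 :: "real \<times> real \<Rightarrow> real" and L :: real
  assumes deriv1: "\<And>a b. ((\<lambda>a. F a b) has_real_derivative F1 (a, b)) (at a)"
    and deriv2: "\<And>a b. ((\<lambda>b. F a b) has_real_derivative F2 (a, b)) (at b)"
    and cont: "continuous_on UNIV F1" "continuous_on UNIV F2"
    and bnd: "\<And>z. \<bar>F1 z\<bar> \<le> L" "\<And>z. \<bar>F2 z\<bar> \<le> L"
begin

lemma L_nonneg: "0 \<le> L" using bnd(1)[of undefined] by linarith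

lemma lipschitz: "\<bar>F a' b' - F a b\<bar> \<le> L * (\<bar>a' - a\<bar> + \<bar>b' - b\<bar>)"
proof -
  have "F a' b' - F a b = slope (\<lambda>t. F t b') (\<lambda>t. F1 (t, b')) a a' * (a' - a) + slope (F a) (\<lambda>t. F2 (a, t)) b b' * (b' - b)"
    by (simp add: slope_mult)
  also have "\<bar>\<dots>\<bar> \<le> L * \<bar>a' - a\<bar> + L * \<bar>b' - b\<bar>"
    using slope_abs_le[of "\<lambda>t. F t b'" "\<lambda>t. F1 (t, b')" L a a'] slope_abs_le[of "F a" "\<lambda>t. F2 (a, t)" L b b']
      deriv1 deriv2 bnd
    by (intro order_trans[OF abs_triangle_ineq] add_mono) (auto simp: abs_mult intro!: mult_right_mono)
  finally show ?thesis by (simp add: algebra_simps)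
qed

lemma F_cont: "continuous_on UNIV (\<lambda>z. F (fst z) (snd z))"
proof (rule continuous_on_sequentiallyI)
  fix u :: "nat \<Rightarrow> real \<times> real" and z assume u: "u \<longlonglongrightarrow> z"
  have "(\<lambda>n. L * (\<bar>fst (u n) - fst z\<bar> + \<bar>snd (u n) - snd z\<bar>)) \<longlonglongrightarrow> L * (\<bar>fst z - fst z\<bar> + \<bar>snd z - snd z\<bar>)"
    by (intro tendsto_intros u)
  then have lim: "(\<lambda>n. L * (\<bar>fst (u n) - fst z\<bar> + \<bar>snd (u n) - snd z\<bar>)) \<longlonglongrightarrow> 0" by simp
  have "(\<lambda>n. F (fst (u n)) (snd (u n)) - F (fst z) (snd z)) \<longlonglongrightarrow> 0"
    by (rule Lim_null_comparison[OF _ lim]) (simp add: lipschitz)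
  then show "(\<lambda>n. F (fst (u n)) (snd (u n))) \<longlonglongrightarrow> F (fst z) (snd z)" by (simp add: LIM_zero_iff)
qed

lemma F_meas [measurable (raw)]:
  assumes [measurable]: "f \<in> borel_measurable M" "g \<in> borel_measurable M"
  shows "(\<lambda>x. F (f x) (g x)) \<in> borel_measurable M" "(\<lambda>x. F1 (f x, g x)) \<in> borel_measurable M"
    "(\<lambda>x. F2 (f x, g x)) \<in> borel_measurable M"
proof -
  have c: "(\<lambda>z. F (fst z) (snd z)) \<in> borel_measurable borel" "F1 \<in> borel_measurable borel" "F2 \<in> borel_measurable borel"
    using F_cont cont by (auto intro: borel_measurable_continuous_onI)
  have p: "(\<lambda>x. (f x, g x)) \<in> M \<rightarrow>\<^sub>M borel" by (simp add: borel_prod[symmetric])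
  show "(\<lambda>x. F (f x) (g x)) \<in> borel_measurable M" using measurable_compose[OF p c(1)] by simp
  show "(\<lambda>x. F1 (f x, g x)) \<in> borel_measurable M" using measurable_compose[OF p c(2)] by simp
  show "(\<lambda>x. F2 (f x, g x)) \<in> borel_measurable M" using measurable_compose[OF p c(3)] by simp
qed

text \<open>The difference quotients of F(u, v), tested with \<phi>, have two limits:
  \<open>summation_by_parts\<close> gives the distributional derivative, and
  \<open>slope_integral_tendsto\<close>, applied to each variable, gives the claimed
  gradient.\<close>

theorem wgrad_chain:
  fixes u v :: "'a::euclidean_space \<Rightarrow> real"
  assumes u: "wgrad \<Omega> u V" and v: "wgrad \<Omega> v W" and \<Omega>: "open \<Omega>"
  shows "wgrad \<Omega> (\<lambda>x. F (u x) (v x)) (\<lambda>x. F1 (u x, v x) *\<^sub>R V x + F2 (u x, v x) *\<^sub>R W x)"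
proof -
  note lu = wgradD(1,2)[OF u] note lv = wgradD(1,2)[OF v]
  note [measurable] = locintD(1)[OF lu(1)] locintD(1)[OF lu(2)] locintD(1)[OF lv(1)] locintD(1)[OF lv(2)]
  define w where "w x = F (u x) (v x)" for x
  define G where "G x = F1 (u x, v x) *\<^sub>R V x + F2 (u x, v x) *\<^sub>R W x" for x
  have w: "locint \<Omega> w"
  proof (rule locint_bound)
    show "locint \<Omega> (\<lambda>x. \<bar>F 0 0\<bar> + L *\<^sub>R (norm (u x) + norm (v x)))"
      by (intro locint_add locint_const locint_scaleR locint_norm lu lv)
    show "AE x in lborel. x \<in> \<Omega> \<longrightarrow> norm (w x) \<le> norm (\<bar>F 0 0\<bar> + L *\<^sub>R (norm (u x) + norm (v x)))"
    proof (intro AE_I2 impI)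
      fix x
      have "0 \<le> L * (\<bar>u x\<bar> + \<bar>v x\<bar>)" using L_nonneg by simp
      then show "norm (w x) \<le> norm (\<bar>F 0 0\<bar> + L *\<^sub>R (norm (u x) + norm (v x)))"
        using lipschitz[of "u x" "v x" 0 0] by (simp add: w_def)
    qed
  qed (simp add: w_def[abs_def])
  have G: "locint \<Omega> G"
  proof (rule locint_bound)
    show "locint \<Omega> (\<lambda>x. L *\<^sub>R (norm (V x) + norm (W x)))"
      by (intro locint_add locint_scaleR locint_norm lu lv)
    show "AE x in lborel. x \<in> \<Omega> \<longrightarrow> norm (G x) \<le> norm (L *\<^sub>R (norm (V x) + norm (W x)))"
    proof (intro AE_I2 impI)
      fix x
      have "norm (G x) \<le> \<bar>F1 (u x, v x)\<bar> * norm (V x) + \<bar>F2 (u x, v x)\<bar> * norm (W x)"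
        unfolding G_def by (rule norm_triangle_le) simp
      also have "\<dots> \<le> L * norm (V x) + L * norm (W x)" by (intro add_mono mult_right_mono bnd) auto
      finally show "norm (G x) \<le> norm (L *\<^sub>R (norm (V x) + norm (W x)))"
        using L_nonneg by (simp add: algebra_simps)
    qed
  qed (simp add: G_def[abs_def])
  have "wgrad \<Omega> w G"
    unfolding wgrad_def
  proof (intro conjI ballI allI w G)
    fix \<phi> y assume \<phi>: "\<phi> \<in> test_functions \<Omega>"
    define h where "h n = inverse (real (Suc n))" for n
    have h: "h \<longlonglongrightarrow> 0" "\<And>n. 0 < h n" unfolding h_def using LIMSEQ_inverse_real_of_nat by auto
    have h0: "h n \<noteq> 0" for n using h(2)[of n] by simp
    define m1 where "m1 n x = slope (\<lambda>t. F t (v (x + h n *\<^sub>R y))) (\<lambda>t. F1 (t, v (x + h n *\<^sub>R y))) (u x) (u (x + h n *\<^sub>R y))" for n x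
    define m2 where "m2 n x = slope (F (u x)) (\<lambda>t. F2 (u x, t)) (v x) (v (x + h n *\<^sub>R y))" for n x
    let ?A = "\<lambda>n x. m1 n x * ((u (x + h n *\<^sub>R y) - u x) / h n) * \<phi> x" and ?B = "\<lambda>n x. m2 n x * ((v (x + h n *\<^sub>R y) - v x) / h n) * \<phi> x"
    let ?F = "\<lambda>z. F1 (u z, v z) * (V z \<bullet> y) * \<phi> z" and ?G = "\<lambda>z. F2 (u z, v z) * (W z \<bullet> y) * \<phi> z"
    have [measurable]: "m1 n \<in> borel_measurable borel" "m2 n \<in> borel_measurable borel" for n
      unfolding m1_def m2_def slope_def by measurable
    have mb1: "\<bar>m1 n x\<bar> \<le> L" for n x unfolding m1_def by (rule slope_abs_le) (auto intro: deriv1 bnd)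
    have lim1: "AE z in lborel. z \<in> \<Omega> \<longrightarrow> (\<lambda>n. m1 n (z - (s * h n) *\<^sub>R y)) \<longlonglongrightarrow> F1 (u z, v z)"
        if s: "0 \<le> s" "s \<le> 1" for s
        using AE_shift_between_tendsto[OF u \<Omega> h s, of y] AE_shift_between_tendsto[OF v \<Omega> h s, of y]
        by eventually_elim (auto simp: m1_def intro!: slope_tendsto deriv1 cont)
    have 1: "(\<lambda>n. \<integral>x. ?A n x \<partial>lborel)
        \<longlonglongrightarrow> (\<integral>z. ?F z \<partial>lborel)"
       "eventually (\<lambda>n. integrable lborel (\<lambda>x. ?A n x)) sequentially"
      by (rule slope_integral_tendsto[OF u \<Omega> \<phi> h _ _ mb1 lim1]; measurable)+
    have mb2: "\<bar>m2 n x\<bar> \<le> L" for n x unfolding m2_def by (rule slope_abs_le) (auto intro: deriv2 bnd)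
      \<comment> \<open>\<open>slope_tendsto\<close> varies the first argument, so the second
        derivative is fed to it with the variables exchanged.\<close>
      have sw: "continuous_on UNIV (\<lambda>p. F2 (snd p, fst p))"
        by (intro continuous_on_compose2[OF cont(2)] continuous_intros) auto
    have lim2: "AE z in lborel. z \<in> \<Omega> \<longrightarrow> (\<lambda>n. m2 n (z - (s * h n) *\<^sub>R y)) \<longlonglongrightarrow> F2 (u z, v z)"
        if s: "0 \<le> s" "s \<le> 1" for s
        using AE_shift_between_tendsto[OF u \<Omega> h s, of y] AE_shift_between_tendsto[OF v \<Omega> h s, of y]
      proof (eventually_elim, intro impI)
        fix z assume "z \<in> \<Omega>"
          "z \<in> \<Omega> \<longrightarrow> (\<lambda>n. u (z - (s * h n) *\<^sub>R y)) \<longlonglongrightarrow> u z \<and> (\<lambda>n. u (z - (s * h n) *\<^sub>R y + h n *\<^sub>R y)) \<longlonglongrightarrow> u z"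
          "z \<in> \<Omega> \<longrightarrow> (\<lambda>n. v (z - (s * h n) *\<^sub>R y)) \<longlonglongrightarrow> v z \<and> (\<lambda>n. v (z - (s * h n) *\<^sub>R y + h n *\<^sub>R y)) \<longlonglongrightarrow> v z"
        then show "(\<lambda>n. m2 n (z - (s * h n) *\<^sub>R y)) \<longlonglongrightarrow> F2 (u z, v z)"
          using slope_tendsto[of "\<lambda>a b. F b a" "\<lambda>p. F2 (snd p, fst p)", OF _ sw] deriv2
          by (simp add: m2_def)
      qed
    have 2: "(\<lambda>n. \<integral>x. ?B n x \<partial>lborel)
        \<longlonglongrightarrow> (\<integral>z. ?G z \<partial>lborel)"
       "eventually (\<lambda>n. integrable lborel (\<lambda>x. ?B n x)) sequentially"
      by (rule slope_integral_tendsto[OF v \<Omega> \<phi> h _ _ mb2 lim2]; measurable)+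
    have 3: "eventually (\<lambda>n. (\<integral>x. ?A n x \<partial>lborel)
          + (\<integral>x. ?B n x \<partial>lborel)
        = (\<integral>x. (w (x + h n *\<^sub>R y) - w x) / h n * \<phi> x \<partial>lborel)) sequentially"
      using 1(2) 2(2)
    proof eventually_elim
      case (elim n)
      have "(w (x + h n *\<^sub>R y) - w x) / h n * \<phi> x =
         ?A n x + ?B n x" for x
      proof -
        \<comment> \<open>An exact splitting: the first argument moves while the second already has
          its new value, then the second moves while the first keeps its old value.\<close>
        have "w (x + h n *\<^sub>R y) - w x = m1 n x * (u (x + h n *\<^sub>R y) - u x) + m2 n x * (v (x + h n *\<^sub>R y) - v x)"
          unfolding m1_def m2_def slope_mult w_def by simp
        then show ?thesis by (simp only: add_divide_distrib distrib_right times_divide_eq_right)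
      qed
      then show ?case using elim by simp
    qed
    have "(\<lambda>n. (\<integral>x. ?A n x \<partial>lborel)
          + (\<integral>x. ?B n x \<partial>lborel)) \<longlonglongrightarrow>
          (\<integral>z. ?F z \<partial>lborel) + (\<integral>z. ?G z \<partial>lborel)"
      by (intro tendsto_add 1(1) 2(1))
    then have "(\<lambda>n. \<integral>x. (w (x + h n *\<^sub>R y) - w x) / h n * \<phi> x \<partial>lborel) \<longlonglongrightarrow>
          (\<integral>z. ?F z \<partial>lborel) + (\<integral>z. ?G z \<partial>lborel)"
      by (rule Lim_transform_eventually[OF _ 3])
    then have eq: "- (\<integral>x. w x * (grad \<phi> x \<bullet> y) \<partial>lborel) =
        (\<integral>z. ?F z \<partial>lborel) + (\<integral>z. ?G z \<partial>lborel)"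
      using summation_by_parts[OF \<Omega> w \<phi> h(1) h0, of y] LIMSEQ_unique by blast
    have i: "integrable lborel (\<lambda>z. ?F z)"
      "integrable lborel (\<lambda>z. ?G z)"
    proof -
      have b: "norm (c * (d \<bullet> y)) \<le> norm (L *\<^sub>R (d \<bullet> y))" if "\<bar>c\<bar> \<le> L" for c and d :: 'a
        using that L_nonneg by (simp add: abs_mult mult_right_mono)
      have "locint \<Omega> (\<lambda>z. F1 (u z, v z) * (V z \<bullet> y))" "locint \<Omega> (\<lambda>z. F2 (u z, v z) * (W z \<bullet> y))"
        using locint_bound[OF locint_scaleR[OF locint_inner[OF lu(2)], of L y], of "\<lambda>z. F1 (u z, v z) * (V z \<bullet> y)"]
          locint_bound[OF locint_scaleR[OF locint_inner[OF lv(2)], of L y], of "\<lambda>z. F2 (u z, v z) * (W z \<bullet> y)"]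
          b bnd by auto
      then show "integrable lborel (\<lambda>z. ?F z)"
        "integrable lborel (\<lambda>z. ?G z)"
        by (auto intro: test_mult_integrable[OF \<phi>])
    qed
    have "(\<integral>x. (G x \<bullet> y) * \<phi> x \<partial>lborel) = (\<integral>z. ?F z + ?G z \<partial>lborel)"
      by (intro Bochner_Integration.integral_cong) (auto simp: G_def inner_simps algebra_simps)
    then show "(\<integral>x. w x * (grad \<phi> x \<bullet> y) \<partial>lborel) = - (\<integral>x. (G x \<bullet> y) * \<phi> x \<partial>lborel)"
      using eq i by simp
  qed
  then show ?thesis by (simp add: w_def[abs_def] G_def[abs_def])
qed

end

section \<open>Uniqueness, limits and classical gradients\<close>

lemma integral_test_cong_AE:
  fixes f g \<phi> :: "'a::euclidean_space \<Rightarrow> real"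
  assumes [measurable]: "f \<in> borel_measurable borel" "g \<in> borel_measurable borel" "\<phi> \<in> borel_measurable borel"
    and eq: "AE x in lborel. x \<in> \<Omega> \<longrightarrow> f x = g x" and z: "\<And>x. x \<notin> \<Omega> \<Longrightarrow> \<phi> x = 0"
  shows "(\<integral>x. f x * \<phi> x \<partial>lborel) = (\<integral>x. g x * \<phi> x \<partial>lborel)"
proof (rule integral_cong_AE)
  show "AE x in lborel. f x * \<phi> x = g x * \<phi> x"
    using eq
  proof eventually_elim
    case (elim x)
    then show ?case using z[of x] by (cases "x \<in> \<Omega>") auto
  qed
qed measurable

lemma test_outside:
  assumes "\<phi> \<in> test_functions \<Omega>" "x \<notin> \<Omega>"
  shows "\<phi> x = 0" "grad \<phi> x = 0"
  using test_functionsD(2)[OF assms(1)] assms(2) supp_outside[of x \<phi>] grad_supp_outside[of x \<phi>] by auto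

lemma wgrad_cong_AE:
  assumes w: "wgrad \<Omega> u V" and [measurable]: "u' \<in> borel_measurable borel" "V' \<in> borel_measurable borel"
    and eq: "AE x in lborel. x \<in> \<Omega> \<longrightarrow> u x = u' x \<and> V x = V' x"
  shows "wgrad \<Omega> u' V'"
  unfolding wgrad_def
proof (intro conjI ballI allI)
  note l = wgradD(1,2)[OF w]
  note [measurable] = locintD(1)[OF l(1)] locintD(1)[OF l(2)]
  show "locint \<Omega> u'" by (rule locint_bound[OF l(1)]) (use eq in auto)
  show "locint \<Omega> V'" by (rule locint_bound[OF l(2)]) (use eq in auto)
  fix \<phi> and y :: 'a assume \<phi>: "\<phi> \<in> test_functions \<Omega>"
  note [measurable] = test_functions_measurable[OF \<phi>]
  have "(\<integral>x. u' x * (grad \<phi> x \<bullet> y) \<partial>lborel) = (\<integral>x. u x * (grad \<phi> x \<bullet> y) \<partial>lborel)"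
    by (rule integral_test_cong_AE[where \<Omega> = \<Omega>]) (use eq test_outside[OF \<phi>] in auto)
  moreover have "(\<integral>x. (V' x \<bullet> y) * \<phi> x \<partial>lborel) = (\<integral>x. (V x \<bullet> y) * \<phi> x \<partial>lborel)"
    by (rule integral_test_cong_AE[where \<Omega> = \<Omega>]) (use eq test_outside[OF \<phi>] in auto)
  ultimately show "(\<integral>x. u' x * (grad \<phi> x \<bullet> y) \<partial>lborel) = - (\<integral>x. (V' x \<bullet> y) * \<phi> x \<partial>lborel)"
    using wgradD(3)[OF w \<phi>] by simp
qed

lemma wgrad_unique:
  fixes u :: "'a::euclidean_space \<Rightarrow> real"
  assumes \<Omega>: "open \<Omega>" and u: "wgrad \<Omega> u V" and v: "wgrad \<Omega> v W"
    and eq: "AE x in lborel. x \<in> \<Omega> \<longrightarrow> u x = v x"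
  shows "AE x in lborel. x \<in> \<Omega> \<longrightarrow> V x = W x"
proof -
  note [measurable] = locintD(1)[OF wgradD(1)[OF u]] locintD(1)[OF wgradD(2)[OF u]]
    locintD(1)[OF wgradD(1)[OF v]] locintD(1)[OF wgradD(2)[OF v]]
  have "AE x in lborel. x \<in> \<Omega> \<longrightarrow> V x \<bullet> b + (-1) *\<^sub>R (W x \<bullet> b) = 0" for b
  proof (rule fundamental_lemma_locint[OF \<Omega>])
    show "locint \<Omega> (\<lambda>x. V x \<bullet> b + (-1) *\<^sub>R (W x \<bullet> b))"
      by (intro locint_add locint_scaleR locint_inner wgradD[OF u] wgradD[OF v])
    fix \<phi> assume \<phi>: "\<phi> \<in> test_functions \<Omega>"
    note [measurable] = test_functions_measurable[OF \<phi>]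
    have "(\<integral>x. (V x \<bullet> b) * \<phi> x \<partial>lborel) = (\<integral>x. (W x \<bullet> b) * \<phi> x \<partial>lborel)"
      using wgradD(3)[OF u \<phi>, of b] wgradD(3)[OF v \<phi>, of b]
        integral_test_cong_AE[of u v "\<lambda>x. grad \<phi> x \<bullet> b" \<Omega>] eq test_outside[OF \<phi>] by auto
    moreover have "integrable lborel (\<lambda>x. (V x \<bullet> b) * \<phi> x)" "integrable lborel (\<lambda>x. (W x \<bullet> b) * \<phi> x)"
      by (intro test_mult_integrable[OF \<phi>] locint_inner wgradD[OF u] wgradD[OF v])+
    moreover have "(\<integral>x. (V x \<bullet> b + (-1) *\<^sub>R (W x \<bullet> b)) * \<phi> x \<partial>lborel) = (\<integral>x. (V x \<bullet> b) * \<phi> x - (W x \<bullet> b) * \<phi> x \<partial>lborel)"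
      by (intro Bochner_Integration.integral_cong) (auto simp: algebra_simps)
    ultimately show "(\<integral>x. (V x \<bullet> b + (-1) *\<^sub>R (W x \<bullet> b)) * \<phi> x \<partial>lborel) = 0" by simp
  qed
  then have "AE x in lborel. \<forall>b\<in>Basis. x \<in> \<Omega> \<longrightarrow> V x \<bullet> b + (-1) *\<^sub>R (W x \<bullet> b) = 0"
    by (subst AE_ball_countable) (auto intro: countable_finite)
  then show ?thesis
  proof (eventually_elim, intro impI)
    fix x assume "\<forall>b\<in>Basis. x \<in> \<Omega> \<longrightarrow> V x \<bullet> b + (-1) *\<^sub>R (W x \<bullet> b) = 0" "x \<in> \<Omega>"
    then have "V x \<bullet> b = W x \<bullet> b" if "b \<in> Basis" for b using that by auto
    then show "V x = W x" by (rule euclidean_eqI)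
  qed
qed

lemma wgrad_lincomb:
  assumes "wgrad \<Omega> u V" "wgrad \<Omega> v W" "open \<Omega>"
  shows "wgrad \<Omega> (\<lambda>x. a * u x + b * v x) (\<lambda>x. a *\<^sub>R V x + b *\<^sub>R W x)"
proof -
  interpret C1_pair "\<lambda>s t. a * s + b * t" "\<lambda>_. a" "\<lambda>_. b" "max \<bar>a\<bar> \<bar>b\<bar>"
    by unfold_locales (auto intro!: derivative_eq_intros)
  show ?thesis using wgrad_chain[OF assms] .
qed

text \<open>Weak gradients survive dominated pointwise limits. This is the passage from the chain
  rule for C1 functions to outer functions with singular points such as
  \<open>qmean\<close>.\<close>

lemma wgrad_dominated_limit:
  fixes u :: "'a::euclidean_space \<Rightarrow> real"
  assumes w: "\<And>n::nat. wgrad \<Omega> (f n) (F n)"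
    and [measurable]: "u \<in> borel_measurable borel" "V \<in> borel_measurable borel"
    and g: "locint \<Omega> (g :: 'a \<Rightarrow> real)" and G: "locint \<Omega> (G :: 'a \<Rightarrow> real)"
    and le: "\<And>n. AE x in lborel. x \<in> \<Omega> \<longrightarrow> \<bar>f n x\<bar> \<le> g x"
      "\<And>n. AE x in lborel. x \<in> \<Omega> \<longrightarrow> norm (F n x) \<le> G x"
    and lim: "AE x in lborel. x \<in> \<Omega> \<longrightarrow> (\<lambda>n. f n x) \<longlonglongrightarrow> u x"
      "AE x in lborel. x \<in> \<Omega> \<longrightarrow> (\<lambda>n. F n x) \<longlonglongrightarrow> V x"
  shows "wgrad \<Omega> u V"
proof -
  note [measurable] = locintD(1)[OF g] locintD(1)[OF G] locintD(1)[OF wgradD(1)[OF w]] locintD(1)[OF wgradD(2)[OF w]]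
  have "AE x in lborel. \<forall>n. x \<in> \<Omega> \<longrightarrow> \<bar>f n x\<bar> \<le> g x" unfolding AE_all_countable using le(1) by blast
  with lim(1) have "AE x in lborel. x \<in> \<Omega> \<longrightarrow> norm (u x) \<le> norm (g x)"
  proof (eventually_elim, intro impI)
    fix x assume a: "x \<in> \<Omega> \<longrightarrow> (\<lambda>n. f n x) \<longlonglongrightarrow> u x" "\<forall>n. x \<in> \<Omega> \<longrightarrow> \<bar>f n x\<bar> \<le> g x" "x \<in> \<Omega>"
    then have "(\<lambda>n. norm (f n x)) \<longlonglongrightarrow> norm (u x)" by (intro tendsto_norm) auto
    then have "norm (u x) \<le> g x" by (rule LIMSEQ_le_const2) (use a in auto)
    then show "norm (u x) \<le> norm (g x)" by simp
  qed
  then have lu: "locint \<Omega> u" by (intro locint_bound[OF g]) auto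
  have "AE x in lborel. \<forall>n. x \<in> \<Omega> \<longrightarrow> norm (F n x) \<le> G x" unfolding AE_all_countable using le(2) by blast
  with lim(2) have "AE x in lborel. x \<in> \<Omega> \<longrightarrow> norm (V x) \<le> norm (G x)"
  proof (eventually_elim, intro impI)
    fix x assume a: "x \<in> \<Omega> \<longrightarrow> (\<lambda>n. F n x) \<longlonglongrightarrow> V x" "\<forall>n. x \<in> \<Omega> \<longrightarrow> norm (F n x) \<le> G x" "x \<in> \<Omega>"
    then have "(\<lambda>n. norm (F n x)) \<longlonglongrightarrow> norm (V x)" by (intro tendsto_norm) auto
    then have "norm (V x) \<le> G x" by (rule LIMSEQ_le_const2) (use a in auto)
    then show "norm (V x) \<le> norm (G x)" by simp
  qed
  then have lV: "locint \<Omega> V" by (intro locint_bound[OF G]) auto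
  show ?thesis
    unfolding wgrad_def
  proof (intro conjI ballI allI lu lV)
    fix \<phi> and y :: 'a assume \<phi>: "\<phi> \<in> test_functions \<Omega>"
    note [measurable] = test_functions_measurable[OF \<phi>]
    have 1: "(\<lambda>n. \<integral>x. f n x * (grad \<phi> x \<bullet> y) \<partial>lborel) \<longlonglongrightarrow> (\<integral>x. u x * (grad \<phi> x \<bullet> y) \<partial>lborel)"
    proof (rule integral_dominated_convergence[where w = "\<lambda>x. \<bar>g x * (grad \<phi> x \<bullet> y)\<bar>"])
      show "AE x in lborel. (\<lambda>n. f n x * (grad \<phi> x \<bullet> y)) \<longlonglongrightarrow> u x * (grad \<phi> x \<bullet> y)"
        using lim(1)
      proof eventually_elim
        case (elim x)
        then show ?case using test_outside(2)[OF \<phi>, of x] by (cases "x \<in> \<Omega>") (auto intro: tendsto_mult_right)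
      qed
      show "AE x in lborel. norm (f n x * (grad \<phi> x \<bullet> y)) \<le> \<bar>g x * (grad \<phi> x \<bullet> y)\<bar>" for n
        using le(1)[of n]
      proof eventually_elim
        case (elim x)
        then show ?case using test_outside(2)[OF \<phi>, of x]
          by (cases "x \<in> \<Omega>") (auto simp: abs_mult intro!: mult_right_mono)
      qed
      show "integrable lborel (\<lambda>x. \<bar>g x * (grad \<phi> x \<bullet> y)\<bar>)"
        by (intro integrable_abs test_mult_integrable[OF \<phi> g])
    qed measurable
    have 2: "(\<lambda>n. \<integral>x. (F n x \<bullet> y) * \<phi> x \<partial>lborel) \<longlonglongrightarrow> (\<integral>x. (V x \<bullet> y) * \<phi> x \<partial>lborel)"
    proof (rule integral_dominated_convergence[where w = "\<lambda>x. norm y * \<bar>G x * \<phi> x\<bar>"])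
      show "AE x in lborel. (\<lambda>n. (F n x \<bullet> y) * \<phi> x) \<longlonglongrightarrow> (V x \<bullet> y) * \<phi> x"
        using lim(2)
      proof eventually_elim
        case (elim x)
        then show ?case using test_outside(1)[OF \<phi>, of x]
          by (cases "x \<in> \<Omega>") (auto intro!: tendsto_mult_right tendsto_inner)
      qed
      show "AE x in lborel. norm ((F n x \<bullet> y) * \<phi> x) \<le> norm y * \<bar>G x * \<phi> x\<bar>" for n
        using le(2)[of n]
      proof eventually_elim
        case (elim x)
        show ?case
        proof (cases "x \<in> \<Omega>")
          case True
          have "\<bar>F n x \<bullet> y\<bar> \<le> norm (F n x) * norm y" by (rule Cauchy_Schwarz_ineq2)
          also have "\<dots> \<le> \<bar>G x\<bar> * norm y" using elim True by (intro mult_right_mono) auto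
          finally have "\<bar>F n x \<bullet> y\<bar> * \<bar>\<phi> x\<bar> \<le> (\<bar>G x\<bar> * norm y) * \<bar>\<phi> x\<bar>" by (rule mult_right_mono) simp
          then show ?thesis by (simp add: abs_mult ac_simps)
        qed (simp add: test_outside(1)[OF \<phi>])
      qed
      show "integrable lborel (\<lambda>x. norm y * \<bar>G x * \<phi> x\<bar>)"
        by (intro integrable_mult_right integrable_abs test_mult_integrable[OF \<phi> G])
    qed measurable
    have "(\<lambda>n. \<integral>x. f n x * (grad \<phi> x \<bullet> y) \<partial>lborel) \<longlonglongrightarrow> - (\<integral>x. (V x \<bullet> y) * \<phi> x \<partial>lborel)"
      using tendsto_minus[OF 2] by (simp add: wgradD(3)[OF w \<phi>])
    then show "(\<integral>x. u x * (grad \<phi> x \<bullet> y) \<partial>lborel) = - (\<integral>x. (V x \<bullet> y) * \<phi> x \<partial>lborel)"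
      using 1 LIMSEQ_unique by blast
  qed
qed

lemma locint_continuous:
  fixes f :: "'a::euclidean_space \<Rightarrow> 'b::euclidean_space"
  assumes "open \<Omega>" "continuous_on \<Omega> f"
  shows "locint \<Omega> (\<lambda>x. indicator \<Omega> x *\<^sub>R f x)"
  unfolding locint_def
proof (intro conjI allI impI)
  show "(\<lambda>x. indicator \<Omega> x *\<^sub>R f x) \<in> borel_measurable borel"
    using assms by (intro borel_measurable_continuous_on_indicator) auto
  fix K assume K: "compact K \<and> K \<subseteq> \<Omega>"
  then have "integrable lborel (\<lambda>x. indicator K x *\<^sub>R f x)"
    using assms(2) by (intro borel_integrable_compact) (auto intro: continuous_on_subset)
  moreover have "indicator K x *\<^sub>R f x = indicator K x *\<^sub>R (indicator \<Omega> x *\<^sub>R f x)" for x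
    using K by (auto simp: indicator_def)
  ultimately show "integrable lborel (\<lambda>x. indicator K x *\<^sub>R (indicator \<Omega> x *\<^sub>R f x))" by simp
qed

text \<open>By the mean value theorem the difference quotients are bounded on the support of a test
  function, and they converge to the classical derivative; \<open>summation_by_parts\<close>
  identifies the limit. The indicator removes the arbitrary values of u outside \<Omega>.\<close>

lemma wgrad_C1:
  fixes u :: "'a::euclidean_space \<Rightarrow> real"
  assumes \<Omega>: "open \<Omega>" and der: "\<And>x. x \<in> \<Omega> \<Longrightarrow> (u has_derivative (\<lambda>y. D x \<bullet> y)) (at x)"
    and D: "continuous_on \<Omega> D"
  shows "wgrad \<Omega> (\<lambda>x. indicator \<Omega> x * u x) (\<lambda>x. indicator \<Omega> x *\<^sub>R D x)"
proof -
  have uc: "continuous_on \<Omega> u"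
    using der by (meson continuous_at_imp_continuous_on has_derivative_continuous)
  define w where "w x = indicator \<Omega> x *\<^sub>R u x" for x
  define E where "E x = indicator \<Omega> x *\<^sub>R D x" for x
  have w: "locint \<Omega> w" and E: "locint \<Omega> E"
    unfolding w_def E_def by (intro locint_continuous \<Omega> uc D)+
  note [measurable] = locintD(1)[OF w] locintD(1)[OF E]
  have "wgrad \<Omega> w E" unfolding wgrad_def
  proof (intro conjI ballI allI w E)
    fix \<phi> and y :: 'a assume \<phi>: "\<phi> \<in> test_functions \<Omega>"
    note [measurable] = test_functions_measurable[OF \<phi>]
    note sp = test_functionsD(1,2)[OF \<phi>]
    obtain \<delta> where d: "0 < \<delta>" "compact (\<Union>x\<in>supp \<phi>. cball x \<delta>)" "(\<Union>x\<in>supp \<phi>. cball x \<delta>) \<subseteq> \<Omega>"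
      using compact_fat[OF sp \<Omega>] by metis
    define K where "K = (\<Union>x\<in>supp \<phi>. cball x \<delta>)"
    have "compact (D ` K)" unfolding K_def by (intro compact_continuous_image continuous_on_subset[OF D] d)
    then obtain B where B: "\<And>x. x \<in> K \<Longrightarrow> norm (D x) \<le> B"
      by (metis compact_imp_bounded bounded_iff imageI)
    define h where "h n = inverse (real (Suc n))" for n
    have h: "h \<longlonglongrightarrow> 0" "\<And>n. 0 < h n" unfolding h_def using LIMSEQ_inverse_real_of_nat by auto
    have h0: "h n \<noteq> 0" for n using h(2)[of n] by simp
    have "(\<lambda>n. h n * norm y) \<longlonglongrightarrow> 0 * norm y" by (intro tendsto_intros h)
    then have "\<forall>\<^sub>F n in sequentially. h n * norm y < \<delta>"
      using d(1) by (intro order_tendstoD(2)) auto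
    then obtain N where N: "\<And>n. N \<le> n \<Longrightarrow> h n * norm y < \<delta>"
      unfolding eventually_sequentially by blast
    have der1: "((\<lambda>t. u (x + t *\<^sub>R y)) has_real_derivative D (x + t *\<^sub>R y) \<bullet> y) (at t)" if "x + t *\<^sub>R y \<in> \<Omega>" for x t
    proof -
      have 1: "((\<lambda>t. x + t *\<^sub>R y) has_derivative (\<lambda>t. t *\<^sub>R y)) (at t)"
        by (auto intro!: derivative_eq_intros)
      have "((\<lambda>t. u (x + t *\<^sub>R y)) has_derivative (\<lambda>s. D (x + t *\<^sub>R y) \<bullet> (s *\<^sub>R y))) (at t)"
        using diff_chain_at[OF 1 der[OF that]] by (simp add: o_def)
      then show ?thesis unfolding has_field_derivative_def
        by (rule has_derivative_eq_rhs) (auto simp: fun_eq_iff)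
    qed
    have inK: "x + t *\<^sub>R y \<in> K" if "x \<in> supp \<phi>" "0 \<le> t" "t \<le> h n" "N \<le> n" for x t n
    proof -
      have "t * norm y \<le> h n * norm y" using that by (intro mult_right_mono) auto
      then have "x + t *\<^sub>R y \<in> cball x \<delta>" using N[OF that(4)] that(2) by (simp add: dist_segment)
      then show ?thesis using that(1) unfolding K_def by blast
    qed
    have inO: "x + t *\<^sub>R y \<in> \<Omega>" if "x \<in> supp \<phi>" "0 \<le> t" "t \<le> h n" "N \<le> n" for x t n
      using inK[OF that] d(3) unfolding K_def by blast
    have bd: "\<bar>(w (x + h n *\<^sub>R y) - w x) / h n * \<phi> x\<bar> \<le> \<bar>B * norm y * \<phi> x\<bar>" if n: "N \<le> n" for n x
    proof (cases "x \<in> supp \<phi>")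
      case True
      obtain z where z: "0 < z" "z < h n" "u (x + h n *\<^sub>R y) - u (x + 0 *\<^sub>R y) = (h n - 0) * (D (x + z *\<^sub>R y) \<bullet> y)"
        using MVT2[of 0 "h n" "\<lambda>t. u (x + t *\<^sub>R y)" "\<lambda>t. D (x + t *\<^sub>R y) \<bullet> y"] h(2)[of n] der1 inO[OF True _ _ n] by metis
      have "\<bar>D (x + z *\<^sub>R y) \<bullet> y\<bar> \<le> norm (D (x + z *\<^sub>R y)) * norm y" by (rule Cauchy_Schwarz_ineq2)
      also have "\<dots> \<le> B * norm y" using z by (intro mult_right_mono B inK[OF True _ _ n]) auto
      finally have le: "\<bar>D (x + z *\<^sub>R y) \<bullet> y\<bar> \<le> B * norm y" .
      have "w (x + h n *\<^sub>R y) - w x = h n * (D (x + z *\<^sub>R y) \<bullet> y)"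
        using z(3) inO[OF True, of "h n" n] inO[OF True, of 0 n] n h(2)[of n] by (simp add: w_def)
      then have "(w (x + h n *\<^sub>R y) - w x) / h n = D (x + z *\<^sub>R y) \<bullet> y" using h0[of n] by simp
      moreover have "\<bar>D (x + z *\<^sub>R y) \<bullet> y\<bar> \<le> \<bar>B * norm y\<bar>" using le by linarith
      ultimately show ?thesis unfolding abs_mult[of _ "\<phi> x"] by (metis abs_ge_zero mult_right_mono)
    qed (simp add: supp_outside)
    have "(\<lambda>n. \<integral>x. (w (x + h (n + N) *\<^sub>R y) - w x) / h (n + N) * \<phi> x \<partial>lborel) \<longlonglongrightarrow> (\<integral>x. (E x \<bullet> y) * \<phi> x \<partial>lborel)"
    proof (rule integral_dominated_convergence[where w = "\<lambda>x. \<bar>B * norm y * \<phi> x\<bar>"])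
      show "AE x in lborel. (\<lambda>n. (w (x + h (n + N) *\<^sub>R y) - w x) / h (n + N) * \<phi> x) \<longlonglongrightarrow> (E x \<bullet> y) * \<phi> x"
      proof (rule AE_I2)
        fix x
        show "(\<lambda>n. (w (x + h (n + N) *\<^sub>R y) - w x) / h (n + N) * \<phi> x) \<longlonglongrightarrow> (E x \<bullet> y) * \<phi> x"
        proof (cases "x \<in> supp \<phi>")
          case True
          then have x: "x \<in> \<Omega>" using sp by auto
          have "((\<lambda>s. (u (x + s *\<^sub>R y) - u x) / s) \<longlongrightarrow> D x \<bullet> y) (at 0)"
            using der1[of x 0] x by (simp add: DERIV_def)
          moreover have "filterlim (\<lambda>n. h (n + N)) (at 0) sequentially"
            using LIMSEQ_ignore_initial_segment[OF h(1), of N] h0 by (simp add: filterlim_at)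
          ultimately have "(\<lambda>n. (u (x + h (n + N) *\<^sub>R y) - u x) / h (n + N)) \<longlonglongrightarrow> D x \<bullet> y"
            by (rule filterlim_compose[of _ _ _ "\<lambda>n. h (n + N)"])
          moreover have "w (x + h (n + N) *\<^sub>R y) - w x = u (x + h (n + N) *\<^sub>R y) - u x" for n
            using inO[OF True, of "h (n + N)" "n + N"] x h(2)[of "n + N"] by (simp add: w_def)
          ultimately have "(\<lambda>n. (w (x + h (n + N) *\<^sub>R y) - w x) / h (n + N)) \<longlonglongrightarrow> E x \<bullet> y"
            using x by (simp add: E_def)
          then show ?thesis by (rule tendsto_mult_right)
        qed (simp add: supp_outside)
      qed
      show "integrable lborel (\<lambda>x. \<bar>B * norm y * \<phi> x\<bar>)"
        using test_mult_integrable(1)[OF \<phi> locint_const[of \<Omega> "B * norm y"]] by (intro integrable_abs) simp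
      show "AE x in lborel. norm ((w (x + h (n + N) *\<^sub>R y) - w x) / h (n + N) * \<phi> x) \<le> \<bar>B * norm y * \<phi> x\<bar>" for n
        using bd[of "n + N"] by (intro AE_I2) simp
    qed measurable
    from LIMSEQ_offset[where k = N and f = "\<lambda>n. \<integral>x. (w (x + h n *\<^sub>R y) - w x) / h n * \<phi> x \<partial>lborel", OF this]
    have "- (\<integral>x. w x * (grad \<phi> x \<bullet> y) \<partial>lborel) = (\<integral>x. (E x \<bullet> y) * \<phi> x \<partial>lborel)"
      using summation_by_parts[OF \<Omega> w \<phi> h(1) h0, of y] LIMSEQ_unique by blast
    then show "(\<integral>x. w x * (grad \<phi> x \<bullet> y) \<partial>lborel) = - (\<integral>x. (E x \<bullet> y) * \<phi> x \<partial>lborel)" by simp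
  qed
  then show ?thesis by (simp add: w_def[abs_def] E_def[abs_def])
qed

lemma wgrad_test:
  assumes "\<phi> \<in> test_functions \<Omega>'"
  shows "wgrad UNIV \<phi> (grad \<phi>)"
  using wgrad_C1[of UNIV \<phi> "grad \<phi>"] test_functionsD(5,6)[OF assms] by simp

lemma not_AE_outside_open:
  fixes O' :: "'a::euclidean_space set"
  assumes "open O'" "O' \<noteq> {}" "AE x in lborel. x \<in> O' \<longrightarrow> P x"
  obtains x where "x \<in> O'" "P x"
proof (rule ccontr)
  assume "\<not> thesis"
  then have "x \<notin> O' \<or> \<not> P x" for x using that by blast
  then have "AE x in lborel. x \<notin> O'" using assms(3) by auto
  then have "O' \<in> null_sets lborel" using assms(1) by (subst AE_iff_null_sets) auto
  then have "negligible O'" by (simp add: negligible_iff_null_sets null_sets_completionI)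
  then show False using open_not_negligible[OF assms(1,2)] by blast
qed

text \<open>For each y the translation formula gives u(x + y) = u(x) for almost every x. Exchanging
  the two quantifiers by Fubini yields one x for which this holds for almost every y, so u equals
  u(x) almost everywhere in the ball.\<close>

lemma wgrad_zero_ball:
  fixes u :: "'a::euclidean_space \<Rightarrow> real"
  assumes w: "wgrad \<Omega> u (\<lambda>_. 0)" and B: "ball a \<rho> \<subseteq> \<Omega>" and \<rho>: "0 < \<rho>"
  obtains c where "AE x in lborel. x \<in> ball a \<rho> \<longrightarrow> u x = c"
proof -
  note [measurable] = locintD(1)[OF wgradD(1)[OF w]]
  have "AE x in lborel. x \<in> ball a \<rho> \<and> x + y \<in> ball a \<rho> \<longrightarrow> u (x + y) = u x" for y
  proof -
    define O' where "O' = ball a \<rho> \<inter> (\<lambda>x. x + y) -` ball a \<rho>"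
    have O: "open O'" unfolding O'_def by (intro open_Int open_ball open_vimage continuous_intros)
    have seg: "x + s *\<^sub>R y \<in> \<Omega>" if "x \<in> O'" "0 \<le> s" "s \<le> 1" for x s
    proof -
      have "(1 - s) *\<^sub>R x + s *\<^sub>R (x + y) \<in> ball a \<rho>"
        using that by (intro convexD[OF convex_ball]) (auto simp: O'_def)
      moreover have "(1 - s) *\<^sub>R x + s *\<^sub>R (x + y) = x + s *\<^sub>R y" by (simp add: algebra_simps)
      ultimately show ?thesis using B by auto
    qed
    have "AE x in lborel. x \<in> O' \<longrightarrow> integrable lborel (\<lambda>s. indicator {0..1::real} s * ((0::'a) \<bullet> y)) \<and>
        u (x + y) - u x = (\<integral>s. indicator {0..1::real} s * ((0::'a) \<bullet> y) \<partial>lborel)"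
    proof (rule wgrad_translation[OF w O])
      show "x + s *\<^sub>R y \<in> \<Omega>" if "x \<in> O'" "0 \<le> s" "s \<le> 1" for x s by (rule seg[OF that])
    qed
    then show ?thesis by eventually_elim (auto simp: O'_def)
  qed
  then have "AE y in lborel. AE x in lborel. x \<in> ball a \<rho> \<and> x + y \<in> ball a \<rho> \<longrightarrow> u (x + y) = u x" by simp
  then have "AE x in lborel. AE y in lborel. x \<in> ball a \<rho> \<and> x + y \<in> ball a \<rho> \<longrightarrow> u (x + y) = u x"
  proof (rule lborel_pair.AE_commute[THEN iffD1, rotated])
    show "{z \<in> space (lborel \<Otimes>\<^sub>M lborel). snd z \<in> ball a \<rho> \<and> snd z + fst z \<in> ball a \<rho> \<longrightarrow>
        u (snd z + fst z) = u (snd z)} \<in> sets (lborel \<Otimes>\<^sub>M lborel)"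
    proof -
      have f: "fst \<in> lborel \<Otimes>\<^sub>M lborel \<rightarrow>\<^sub>M (borel :: 'a measure)" "snd \<in> lborel \<Otimes>\<^sub>M lborel \<rightarrow>\<^sub>M (borel :: 'a measure)"
        by (metis measurable_fst measurable_lborel1, metis measurable_snd measurable_lborel1)
      note [measurable] = f measurable_compose[OF f(2), of u] measurable_compose[OF borel_measurable_add[OF f(2,1)], of u]
      show ?thesis unfolding mem_ball by measurable
    qed
  qed
  then have "AE x in lborel. x \<in> ball a \<rho> \<longrightarrow> (AE y in lborel. x + y \<in> ball a \<rho> \<longrightarrow> u (x + y) = u x)"
    by eventually_elim auto
  then obtain x where x: "x \<in> ball a \<rho>" "AE y in lborel. x + y \<in> ball a \<rho> \<longrightarrow> u (x + y) = u x"
    by (rule not_AE_outside_open[rotated 2]) (use \<rho> in auto)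
  have "AE z in lborel. x + (- x + z) \<in> ball a \<rho> \<longrightarrow> u (x + (- x + z)) = u x"
    by (rule AE_lborel_translate[OF x(2)])
  then show thesis by (intro that[of "u x"]) simp
qed

text \<open>Constants of overlapping balls agree because the overlap is open and nonempty, hence not
  a null set. The constant is thus a locally constant function of the centre, and connectedness
  finishes the argument.\<close>

lemma wgrad_zero_constant:
  fixes u :: "'a::euclidean_space \<Rightarrow> real"
  assumes w: "wgrad \<Omega> u (\<lambda>_. 0)" and \<Omega>: "open \<Omega>" "connected \<Omega>"
  obtains c where "AE x in lborel. x \<in> \<Omega> \<longrightarrow> u x = c"
proof -
  have "\<exists>\<rho> c. 0 < \<rho> \<and> ball a \<rho> \<subseteq> \<Omega> \<and> (AE x in lborel. x \<in> ball a \<rho> \<longrightarrow> u x = c)" if "a \<in> \<Omega>" for a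
  proof -
    obtain \<rho> where r: "0 < \<rho>" "ball a \<rho> \<subseteq> \<Omega>" using \<Omega>(1) \<open>a \<in> \<Omega>\<close> open_contains_ball by blast
    obtain c where "AE x in lborel. x \<in> ball a \<rho> \<longrightarrow> u x = c" using wgrad_zero_ball[OF w r(2,1)] .
    then show ?thesis using r by blast
  qed
  then obtain \<rho> c where rc: "\<And>a. a \<in> \<Omega> \<Longrightarrow> 0 < \<rho> a" "\<And>a. a \<in> \<Omega> \<Longrightarrow> ball a (\<rho> a) \<subseteq> \<Omega>"
    "\<And>a. a \<in> \<Omega> \<Longrightarrow> AE x in lborel. x \<in> ball a (\<rho> a) \<longrightarrow> u x = c a"
    by metis
  have "c constant_on \<Omega>"
  proof (rule locally_constant_imp_constant[OF \<Omega>(2)], intro exI conjI ballI)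
    fix a assume a: "a \<in> \<Omega>"
    show "openin (top_of_set \<Omega>) (ball a (\<rho> a))" using rc(2)[OF a] \<Omega>(1) by (simp add: openin_open_eq)
    show "a \<in> ball a (\<rho> a)" using rc(1)[OF a] by simp
    fix b assume b: "b \<in> ball a (\<rho> a)"
    then have b': "b \<in> \<Omega>" using rc(2)[OF a] by auto
    have "AE x in lborel. x \<in> ball a (\<rho> a) \<inter> ball b (\<rho> b) \<longrightarrow> u x = c a \<and> u x = c b"
      using rc(3)[OF a] rc(3)[OF b'] by eventually_elim auto
    then obtain x where "u x = c a \<and> u x = c b"
    proof (rule not_AE_outside_open[rotated 2])
      have "b \<in> ball a (\<rho> a) \<inter> ball b (\<rho> b)" using b rc(1)[OF b'] by simp
      then show "ball a (\<rho> a) \<inter> ball b (\<rho> b) \<noteq> {}" by blast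
    qed auto
    then show "c b = c a" by simp
  qed
  then obtain k where k: "\<And>a. a \<in> \<Omega> \<Longrightarrow> c a = k" unfolding constant_on_def by blast
  have "AE x in lborel. x \<in> \<Omega> \<longrightarrow> u x = k"
  proof (rule AE_open_compactI[OF \<Omega>(1)])
    fix K assume K: "compact K" "K \<subseteq> \<Omega>"
    have "K \<subseteq> (\<Union>a\<in>K. ball a (\<rho> a))" using K rc(1) by force
    then obtain A where A: "A \<subseteq> K" "finite A" "K \<subseteq> (\<Union>a\<in>A. ball a (\<rho> a))"
      using compactE_image[OF K(1), of K "\<lambda>a. ball a (\<rho> a)"] by auto
    have "AE x in lborel. \<forall>a\<in>A. x \<in> ball a (\<rho> a) \<longrightarrow> u x = k"
      using A K rc(3) k by (subst AE_ball_countable) (auto intro: countable_finite)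
    then show "AE x in lborel. x \<in> K \<longrightarrow> u x = k"
    proof eventually_elim
      case (elim x)
      then show ?case using A(3) by blast
    qed
  qed
  then show thesis by (rule that)
qed

section \<open>Sobolev functions\<close>

lemma AE_lebesgue_on_iff:
  assumes "open \<Omega>"
  shows "(AE x in lebesgue_on \<Omega>. P x) \<longleftrightarrow> (AE x in lborel. x \<in> \<Omega> \<longrightarrow> P x)"
  using assms by (simp add: AE_restrict_space_iff AE_completion_iff)

lemma lebesgue_on_borel_version:
  fixes f :: "'a::euclidean_space \<Rightarrow> 'b::euclidean_space"
  assumes "open \<Omega>" "f \<in> borel_measurable (lebesgue_on \<Omega>)"
  obtains f' where "f' \<in> borel_measurable borel" "AE x in lborel. x \<in> \<Omega> \<longrightarrow> f x = f' x"
proof -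
  have S: "\<Omega> \<in> sets lebesgue" using assms(1) by auto
  have m: "(\<lambda>x. if x \<in> \<Omega> then f x \<bullet> b else 0) \<in> borel_measurable lebesgue" for b
    by (rule borel_measurable_if_I[OF _ S]) (use assms(2) in measurable)
  have "\<exists>g\<in>borel_measurable lborel. AE x in lborel. (if x \<in> \<Omega> then f x \<bullet> b else 0) = g x" for b
    by (rule completion_ex_borel_measurable_real[OF m])
  then have "\<forall>b. \<exists>g. g \<in> borel_measurable borel \<and> (AE x in lborel. (if x \<in> \<Omega> then f x \<bullet> b else 0) = g x)"
    unfolding measurable_lborel2 by blast
  then have "\<exists>g. \<forall>b. g b \<in> borel_measurable borel \<and> (AE x in lborel. (if x \<in> \<Omega> then f x \<bullet> b else 0) = g b x)"
    by (rule choice)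
  then obtain g where g: "\<And>b. g b \<in> borel_measurable borel"
    "\<And>b. AE x in lborel. (if x \<in> \<Omega> then f x \<bullet> b else 0) = g b x"
    by blast
  note [measurable] = g(1)
  show thesis
  proof (rule that[of "\<lambda>x. \<Sum>b\<in>Basis. g b x *\<^sub>R b"])
    have "AE x in lborel. \<forall>b\<in>Basis. (if x \<in> \<Omega> then f x \<bullet> b else 0) = g b x"
      using g(2) by (subst AE_ball_countable) (auto intro: countable_finite)
    then show "AE x in lborel. x \<in> \<Omega> \<longrightarrow> f x = (\<Sum>b\<in>Basis. g b x *\<^sub>R b)"
    proof (eventually_elim, intro impI)
      fix x assume "\<forall>b\<in>Basis. (if x \<in> \<Omega> then f x \<bullet> b else 0) = g b x" "x \<in> \<Omega>"
      then have "(\<Sum>b\<in>Basis. g b x *\<^sub>R b) = (\<Sum>b\<in>Basis. (f x \<bullet> b) *\<^sub>R b)" by (intro sum.cong) auto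
      then show "f x = (\<Sum>b\<in>Basis. g b x *\<^sub>R b)" by (simp add: euclidean_representation)
    qed
  qed measurable
qed

lemma lebesgue_on_measurable_AE:
  fixes f f' :: "'a::euclidean_space \<Rightarrow> 'b::euclidean_space"
  assumes \<Omega>: "open \<Omega>" and [measurable]: "f' \<in> borel_measurable borel"
    and eq: "AE x in lborel. x \<in> \<Omega> \<longrightarrow> f x = f' x"
  shows "f \<in> borel_measurable (lebesgue_on \<Omega>)"
proof -
  have [measurable]: "\<Omega> \<in> sets borel" using \<Omega> by simp
  have S: "\<Omega> \<in> sets lebesgue" using \<Omega> by auto
  have "(\<lambda>x. if x \<in> \<Omega> then f' x else 0) \<in> borel_measurable borel" by measurable
  then have "(\<lambda>x. if x \<in> \<Omega> then f' x else 0) \<in> borel_measurable lebesgue" by (simp add: measurable_completion)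
  then have "(\<lambda>x. if x \<in> \<Omega> then f x else 0) \<in> borel_measurable lebesgue"
    by (rule borel_measurable_AE) (use AE_completion[OF eq] in \<open>eventually_elim, auto\<close>)
  then show ?thesis by (rule borel_measurable_if_D)
qed

lemma integral_lebesgue_on_borel:
  fixes f f' :: "'a::euclidean_space \<Rightarrow> 'b::euclidean_space"
  assumes \<Omega>: "\<Omega> \<in> sets borel" and [measurable]: "f' \<in> borel_measurable borel"
    and eq: "AE x in lborel. x \<in> \<Omega> \<longrightarrow> f x = f' x"
    and f: "f \<in> borel_measurable (lebesgue_on \<Omega>)"
  shows "integrable (lebesgue_on \<Omega>) f \<longleftrightarrow> integrable lborel (\<lambda>x. indicator \<Omega> x *\<^sub>R f' x)"
    "(\<integral>x. f x \<partial>lebesgue_on \<Omega>) = (\<integral>x. indicator \<Omega> x *\<^sub>R f' x \<partial>lborel)"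
proof -
  have [measurable]: "\<Omega> \<in> sets borel" by fact
  have S: "\<Omega> \<inter> space lebesgue \<in> sets lebesgue" using \<Omega> by auto
  have f'm: "f' \<in> borel_measurable (lebesgue_on \<Omega>)"
    by (intro measurable_restrict_space1 measurable_completion) simp
  have ae: "AE x in lebesgue_on \<Omega>. f x = f' x"
    using eq S by (simp add: AE_restrict_space_iff AE_completion_iff)
  have m: "(\<lambda>x. indicator \<Omega> x *\<^sub>R f' x) \<in> borel_measurable lborel" by measurable
  have "integrable (lebesgue_on \<Omega>) f \<longleftrightarrow> integrable (lebesgue_on \<Omega>) f'"
    by (rule integrable_cong_AE[OF f f'm ae])
  also have "\<dots> \<longleftrightarrow> integrable lborel (\<lambda>x. indicator \<Omega> x *\<^sub>R f' x)"
    using integrable_completion[OF m] by (simp add: integrable_restrict_space[OF S])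
  finally show "integrable (lebesgue_on \<Omega>) f \<longleftrightarrow> integrable lborel (\<lambda>x. indicator \<Omega> x *\<^sub>R f' x)" .
  have "(\<integral>x. f x \<partial>lebesgue_on \<Omega>) = (\<integral>x. f' x \<partial>lebesgue_on \<Omega>)"
    by (rule integral_cong_AE[OF f f'm ae])
  also have "\<dots> = (\<integral>x. indicator \<Omega> x *\<^sub>R f' x \<partial>lborel)"
    using integral_completion[OF m] by (simp add: integral_restrict_space[OF S])
  finally show "(\<integral>x. f x \<partial>lebesgue_on \<Omega>) = (\<integral>x. indicator \<Omega> x *\<^sub>R f' x \<partial>lborel)" .
qed

lemma locally_integrable_measurable:
  fixes f :: "'a::euclidean_space \<Rightarrow> 'b::euclidean_space"
  assumes \<Omega>: "open \<Omega>" and f: "locally_integrable_on f \<Omega>"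
  shows "f \<in> borel_measurable (lebesgue_on \<Omega>)"
proof -
  obtain \<D> where D: "countable \<D>" "\<And>X. X \<in> \<D> \<Longrightarrow> compact X \<and> X \<subseteq> \<Omega>" "\<Union>\<D> = \<Omega>"
    using open_countable_Union_cbox[OF \<Omega>] by blast
  have S: "X \<in> sets lebesgue" if "X \<in> \<D>" for X
    using D(2)[OF that] by (simp add: borel_compact)
  have O: "\<Omega> \<in> sets lebesgue" using \<Omega> by auto
  show ?thesis
  proof (rule measurable_piecewise_restrict[OF D(1)])
    show "X \<inter> space (lebesgue_on \<Omega>) \<in> sets (lebesgue_on \<Omega>)" if "X \<in> \<D>" for X
      using S[OF that] D(2)[OF that] O by (auto simp: sets_restrict_space image_iff intro!: bexI[of _ X])
    show "space (lebesgue_on \<Omega>) \<subseteq> \<Union>\<D>" using D(3) by simp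
    fix X assume X: "X \<in> \<D>"
    have "restrict_space (lebesgue_on \<Omega>) X = lebesgue_on (\<Omega> \<inter> X)"
      using S[OF X] O by (intro restrict_restrict_space) auto
    also have "\<Omega> \<inter> X = X" using D(2)[OF X] by auto
    finally have e: "restrict_space (lebesgue_on \<Omega>) X = lebesgue_on X" .
    show "f \<in> borel_measurable (restrict_space (lebesgue_on \<Omega>) X)"
      unfolding e using f D(2)[OF X] by (auto simp: locally_integrable_on_def)
  qed
qed

lemma locint_iff_locally_integrable:
  fixes f :: "'a::euclidean_space \<Rightarrow> 'b::euclidean_space"
  assumes \<Omega>: "open \<Omega>" and f': "f' \<in> borel_measurable borel"
    and eq: "AE x in lborel. x \<in> \<Omega> \<longrightarrow> f x = f' x"
  shows "locint \<Omega> f' \<longleftrightarrow> locally_integrable_on f \<Omega>"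
proof -
  have "integrable (lebesgue_on K) f \<longleftrightarrow> integrable lborel (\<lambda>x. indicator K x *\<^sub>R f' x)"
    if K: "compact K" "K \<subseteq> \<Omega>" for K
  proof (rule integral_lebesgue_on_borel[OF _ f'])
    show "K \<in> sets borel" using K by (simp add: borel_compact)
    show "AE x in lborel. x \<in> K \<longrightarrow> f x = f' x" using eq by eventually_elim (use K in auto)
    have "f \<in> borel_measurable (lebesgue_on \<Omega>)" by (rule lebesgue_on_measurable_AE[OF \<Omega> f' eq])
    moreover have "lebesgue_on K = restrict_space (lebesgue_on \<Omega>) K"
      using K \<Omega> by (subst restrict_restrict_space) (auto simp: borel_compact Int_absorb1 Int_absorb2 Int_commute)
    ultimately show "f \<in> borel_measurable (lebesgue_on K)" by (simp add: measurable_restrict_space1)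
  qed
  then show ?thesis unfolding locint_def locally_integrable_on_def using f' by auto
qed

text \<open>The bridge between the two notions: statements about almost everywhere classes are
  proved by choosing Borel versions, applying the result for \<open>wgrad\<close>, and
  returning.\<close>

lemma has_weak_gradient_iff:
  fixes u :: "'a::euclidean_space \<Rightarrow> real"
  assumes \<Omega>: "open \<Omega>" and [measurable]: "u' \<in> borel_measurable borel" "V' \<in> borel_measurable borel"
    and eq: "AE x in lborel. x \<in> \<Omega> \<longrightarrow> u x = u' x" "AE x in lborel. x \<in> \<Omega> \<longrightarrow> V x = V' x"
  shows "has_weak_gradient \<Omega> u V \<longleftrightarrow> wgrad \<Omega> u' V'"
proof -
  have l: "locint \<Omega> u' \<longleftrightarrow> locally_integrable_on u \<Omega>" "locint \<Omega> V' \<longleftrightarrow> locally_integrable_on V \<Omega>"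
    by (rule locint_iff_locally_integrable[OF \<Omega> _ eq(1)], simp, rule locint_iff_locally_integrable[OF \<Omega> _ eq(2)], simp)
  have [measurable]: "u \<in> borel_measurable (lebesgue_on \<Omega>)" "V \<in> borel_measurable (lebesgue_on \<Omega>)"
    using lebesgue_on_measurable_AE[OF \<Omega> _ eq(1)] lebesgue_on_measurable_AE[OF \<Omega> _ eq(2)] by auto
  have O: "\<Omega> \<in> sets borel" using \<Omega> by simp
  have tm: "f \<in> borel_measurable (lebesgue_on \<Omega>)" if "f \<in> borel_measurable borel" for f :: "'a \<Rightarrow> 'b::euclidean_space"
    using that by (intro measurable_restrict_space1 measurable_completion) simp
  have i1: "(\<integral>x. u x * partial_deriv b \<phi> x \<partial>lebesgue_on \<Omega>) = (\<integral>x. u' x * (grad \<phi> x \<bullet> b) \<partial>lborel)"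
    if \<phi>: "\<phi> \<in> test_functions \<Omega>" for \<phi> b
  proof -
    note [measurable] = test_functions_measurable[OF \<phi>] tm[OF test_functions_measurable(2)[OF \<phi>]]
    have "(\<integral>x. u x * (grad \<phi> x \<bullet> b) \<partial>lebesgue_on \<Omega>) = (\<integral>x. indicator \<Omega> x *\<^sub>R (u' x * (grad \<phi> x \<bullet> b)) \<partial>lborel)"
      by (rule integral_lebesgue_on_borel[OF O]) (use eq in auto)
    also have "\<dots> = (\<integral>x. u' x * (grad \<phi> x \<bullet> b) \<partial>lborel)"
      using test_outside[OF \<phi>] by (intro Bochner_Integration.integral_cong) (auto simp: indicator_def)
    finally show ?thesis by (simp add: test_functionsD(7)[OF \<phi>])
  qed
  have i2: "(\<integral>x. (V x \<bullet> b) * \<phi> x \<partial>lebesgue_on \<Omega>) = (\<integral>x. (V' x \<bullet> b) * \<phi> x \<partial>lborel)"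
    if \<phi>: "\<phi> \<in> test_functions \<Omega>" for \<phi> b
  proof -
    note [measurable] = test_functions_measurable[OF \<phi>] tm[OF test_functions_measurable(1)[OF \<phi>]]
    have "(\<integral>x. (V x \<bullet> b) * \<phi> x \<partial>lebesgue_on \<Omega>) = (\<integral>x. indicator \<Omega> x *\<^sub>R ((V' x \<bullet> b) * \<phi> x) \<partial>lborel)"
      by (rule integral_lebesgue_on_borel[OF O]) (use eq in auto)
    also have "\<dots> = (\<integral>x. (V' x \<bullet> b) * \<phi> x \<partial>lborel)"
      using test_outside[OF \<phi>] by (intro Bochner_Integration.integral_cong) (auto simp: indicator_def)
    finally show ?thesis .
  qed
  show ?thesis
  proof
    assume "has_weak_gradient \<Omega> u V"
    then show "wgrad \<Omega> u' V'"
      unfolding has_weak_gradient_def by (intro wgradI_Basis) (auto simp: l i1 i2)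
  next
    assume "wgrad \<Omega> u' V'"
    then show "has_weak_gradient \<Omega> u V"
      unfolding has_weak_gradient_def wgrad_def by (auto simp: l i1 i2)
  qed
qed

lemma has_weak_gradientE:
  fixes u :: "'a::euclidean_space \<Rightarrow> real"
  assumes \<Omega>: "open \<Omega>" and w: "has_weak_gradient \<Omega> u V"
  obtains u' V' where "wgrad \<Omega> u' V'" "AE x in lborel. x \<in> \<Omega> \<longrightarrow> u x = u' x" "AE x in lborel. x \<in> \<Omega> \<longrightarrow> V x = V' x"
proof -
  have "u \<in> borel_measurable (lebesgue_on \<Omega>)" "V \<in> borel_measurable (lebesgue_on \<Omega>)"
    using w by (auto simp: has_weak_gradient_def intro: locally_integrable_measurable[OF \<Omega>])
  then have m: "u \<in> borel_measurable (lebesgue_on \<Omega>)" "V \<in> borel_measurable (lebesgue_on \<Omega>)" .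
  obtain u' where u': "u' \<in> borel_measurable borel" "AE x in lborel. x \<in> \<Omega> \<longrightarrow> u x = u' x"
    using lebesgue_on_borel_version[OF \<Omega> m(1)] .
  obtain V' where V': "V' \<in> borel_measurable borel" "AE x in lborel. x \<in> \<Omega> \<longrightarrow> V x = V' x"
    using lebesgue_on_borel_version[OF \<Omega> m(2)] .
  have "wgrad \<Omega> u' V'" using has_weak_gradient_iff[OF \<Omega> u'(1) V'(1) u'(2) V'(2)] w by simp
  then show thesis using u' V' that by blast
qed

lemma wgrad_borelD:
  assumes "wgrad \<Omega> u V"
  shows "u \<in> borel_measurable borel" "V \<in> borel_measurable borel"
  using wgradD(1,2)[OF assms] by (auto dest: locintD(1))

lemma has_weak_gradientI:
  fixes u :: "'a::euclidean_space \<Rightarrow> real"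
  assumes \<Omega>: "open \<Omega>" and w: "wgrad \<Omega> u' V'"
    and eq: "AE x in lborel. x \<in> \<Omega> \<longrightarrow> u x = u' x" "AE x in lborel. x \<in> \<Omega> \<longrightarrow> V x = V' x"
  shows "has_weak_gradient \<Omega> u V"
  using has_weak_gradient_iff[OF \<Omega> wgrad_borelD[OF w] eq] w by simp

lemma (in C1_pair) hwg_chain:
  assumes \<Omega>: "open \<Omega>" and u: "has_weak_gradient \<Omega> u V" and v: "has_weak_gradient \<Omega> v W"
  shows "has_weak_gradient \<Omega> (\<lambda>x. F (u x) (v x)) (\<lambda>x. F1 (u x, v x) *\<^sub>R V x + F2 (u x, v x) *\<^sub>R W x)"
proof -
  obtain u' V' where 1: "wgrad \<Omega> u' V'" "AE x in lborel. x \<in> \<Omega> \<longrightarrow> u x = u' x" "AE x in lborel. x \<in> \<Omega> \<longrightarrow> V x = V' x"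
    using has_weak_gradientE[OF \<Omega> u] .
  obtain v' W' where 2: "wgrad \<Omega> v' W'" "AE x in lborel. x \<in> \<Omega> \<longrightarrow> v x = v' x" "AE x in lborel. x \<in> \<Omega> \<longrightarrow> W x = W' x"
    using has_weak_gradientE[OF \<Omega> v] .
  show ?thesis
  proof (rule has_weak_gradientI[OF \<Omega> wgrad_chain[OF 1(1) 2(1) \<Omega>]])
    show "AE x in lborel. x \<in> \<Omega> \<longrightarrow> F (u x) (v x) = F (u' x) (v' x)"
      using 1(2) 2(2) by eventually_elim auto
    show "AE x in lborel. x \<in> \<Omega> \<longrightarrow> F1 (u x, v x) *\<^sub>R V x + F2 (u x, v x) *\<^sub>R W x =
        F1 (u' x, v' x) *\<^sub>R V' x + F2 (u' x, v' x) *\<^sub>R W' x"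
      using 1(2) 2(2) 1(3) 2(3) by eventually_elim auto
  qed
qed

context
  fixes \<Omega> :: "'a::euclidean_space set"
  assumes \<Omega>: "open \<Omega>"
begin

lemma hwg_measurable:
  assumes "has_weak_gradient \<Omega> u V"
  shows "u \<in> borel_measurable (lebesgue_on \<Omega>)" "V \<in> borel_measurable (lebesgue_on \<Omega>)"
  using assms by (auto simp: has_weak_gradient_def intro: locally_integrable_measurable[OF \<Omega>])

lemma hwg_unique:
  assumes u: "has_weak_gradient \<Omega> u V" and v: "has_weak_gradient \<Omega> v W"
    and eq: "AE x in lebesgue_on \<Omega>. u x = v x"
  shows "AE x in lebesgue_on \<Omega>. V x = W x"
proof -
  obtain u' V' where 1: "wgrad \<Omega> u' V'" "AE x in lborel. x \<in> \<Omega> \<longrightarrow> u x = u' x" "AE x in lborel. x \<in> \<Omega> \<longrightarrow> V x = V' x"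
    using has_weak_gradientE[OF \<Omega> u] .
  obtain v' W' where 2: "wgrad \<Omega> v' W'" "AE x in lborel. x \<in> \<Omega> \<longrightarrow> v x = v' x" "AE x in lborel. x \<in> \<Omega> \<longrightarrow> W x = W' x"
    using has_weak_gradientE[OF \<Omega> v] .
  have "AE x in lborel. x \<in> \<Omega> \<longrightarrow> u' x = v' x"
    using eq 1(2) 2(2) unfolding AE_lebesgue_on_iff[OF \<Omega>] by eventually_elim auto
  from wgrad_unique[OF \<Omega> 1(1) 2(1) this] 1(3) 2(3)
  show ?thesis unfolding AE_lebesgue_on_iff[OF \<Omega>] by eventually_elim auto
qed

lemma hwg_lincomb:
  assumes "has_weak_gradient \<Omega> u V" "has_weak_gradient \<Omega> v W"
  shows "has_weak_gradient \<Omega> (\<lambda>x. a * u x + b * v x) (\<lambda>x. a *\<^sub>R V x + b *\<^sub>R W x)"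
proof -
  interpret C1_pair "\<lambda>s t. a * s + b * t" "\<lambda>_. a" "\<lambda>_. b" "max \<bar>a\<bar> \<bar>b\<bar>"
    by unfold_locales (auto intro!: derivative_eq_intros)
  show ?thesis using hwg_chain[OF \<Omega> assms] .
qed

lemma hwg_dominated_limit:
  fixes u :: "'a \<Rightarrow> real"
  assumes w: "\<And>n::nat. has_weak_gradient \<Omega> (f n) (F n)"
    and g: "locally_integrable_on (g :: 'a \<Rightarrow> real) \<Omega>" and G: "locally_integrable_on (G :: 'a \<Rightarrow> real) \<Omega>"
    and le: "\<And>n. AE x in lebesgue_on \<Omega>. \<bar>f n x\<bar> \<le> g x" "\<And>n. AE x in lebesgue_on \<Omega>. norm (F n x) \<le> G x"
    and lim: "AE x in lebesgue_on \<Omega>. (\<lambda>n. f n x) \<longlonglongrightarrow> u x" "AE x in lebesgue_on \<Omega>. (\<lambda>n. F n x) \<longlonglongrightarrow> V x"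
  shows "has_weak_gradient \<Omega> u V"
proof -
  have "\<exists>p. wgrad \<Omega> (fst p) (snd p) \<and> (AE x in lborel. x \<in> \<Omega> \<longrightarrow> f n x = fst p x) \<and> (AE x in lborel. x \<in> \<Omega> \<longrightarrow> F n x = snd p x)" for n
  proof -
    obtain u' V' where "wgrad \<Omega> u' V'" "AE x in lborel. x \<in> \<Omega> \<longrightarrow> f n x = u' x" "AE x in lborel. x \<in> \<Omega> \<longrightarrow> F n x = V' x"
      using has_weak_gradientE[OF \<Omega> w[of n]] .
    then show ?thesis by (intro exI[of _ "(u', V')"]) simp
  qed
  then obtain p where "\<forall>n. wgrad \<Omega> (fst (p n)) (snd (p n)) \<and> (AE x in lborel. x \<in> \<Omega> \<longrightarrow> f n x = fst (p n) x) \<and>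
      (AE x in lborel. x \<in> \<Omega> \<longrightarrow> F n x = snd (p n) x)"
    using choice[of "\<lambda>n p. wgrad \<Omega> (fst p) (snd p) \<and> (AE x in lborel. x \<in> \<Omega> \<longrightarrow> f n x = fst p x) \<and>
      (AE x in lborel. x \<in> \<Omega> \<longrightarrow> F n x = snd p x)"] by blast
  then have p: "\<And>n. wgrad \<Omega> (fst (p n)) (snd (p n))" "\<And>n. AE x in lborel. x \<in> \<Omega> \<longrightarrow> f n x = fst (p n) x"
     "\<And>n. AE x in lborel. x \<in> \<Omega> \<longrightarrow> F n x = snd (p n) x" by blast+
  have P: "AE x in lborel. \<forall>n. x \<in> \<Omega> \<longrightarrow> f n x = fst (p n) x" "AE x in lborel. \<forall>n. x \<in> \<Omega> \<longrightarrow> F n x = snd (p n) x"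
    unfolding AE_all_countable using p(2,3) by blast+
  note L = lim[unfolded AE_lebesgue_on_iff[OF \<Omega>]]
  have fm: "f n \<in> borel_measurable (lebesgue_on \<Omega>)" "F n \<in> borel_measurable (lebesgue_on \<Omega>)" for n
    using hwg_measurable[OF w[of n]] by auto
  obtain g' where g': "g' \<in> borel_measurable borel" "AE x in lborel. x \<in> \<Omega> \<longrightarrow> g x = g' x"
    using lebesgue_on_borel_version[OF \<Omega> locally_integrable_measurable[OF \<Omega> g]] .
  obtain G' where G': "G' \<in> borel_measurable borel" "AE x in lborel. x \<in> \<Omega> \<longrightarrow> G x = G' x"
    using lebesgue_on_borel_version[OF \<Omega> locally_integrable_measurable[OF \<Omega> G]] .
  have pm: "fst (p n) \<in> borel_measurable borel" "snd (p n) \<in> borel_measurable borel" for n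
    using wgrad_borelD[OF p(1)] by auto
  \<comment> \<open>The given u and V are known only as almost everywhere limits. Borel versions are
    rebuilt as limits of the Borel versions of the sequence, with V' set to 0 where the gradients do
    not converge.\<close>
  define u' where "u' x = lim (\<lambda>n. fst (p n) x)" for x
  define C where "C = {x. convergent (\<lambda>n. snd (p n) x)}"
  have C [measurable]: "C \<in> sets borel"
    unfolding C_def using pm(2) by (simp add: Cauchy_convergent_iff[symmetric]) measurable
  define V' where "V' x = (if x \<in> C then lim (\<lambda>n. snd (p n) x) else 0)" for x
  have u'm: "u' \<in> borel_measurable borel" unfolding u'_def
    using pm(1) by (intro borel_measurable_lim_metric) auto
  have V'm: "V' \<in> borel_measurable borel"
  proof (rule borel_measurable_LIMSEQ_metric)
    show "(\<lambda>x. if x \<in> C then snd (p n) x else 0) \<in> borel_measurable borel" for n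
      using pm(2) by measurable
    show "(\<lambda>n. if x \<in> C then snd (p n) x else 0) \<longlonglongrightarrow> V' x" for x
      by (simp add: V'_def C_def convergent_LIMSEQ_iff)
  qed
  have eu: "AE x in lborel. x \<in> \<Omega> \<longrightarrow> u x = u' x"
    using P(1) L(1) by eventually_elim (auto simp: u'_def limI)
  have eV: "AE x in lborel. x \<in> \<Omega> \<longrightarrow> V x = V' x"
    using P(2) L(2) by eventually_elim (auto simp: V'_def C_def limI convergent_def)
  have "wgrad \<Omega> u' V'"
  proof (rule wgrad_dominated_limit[OF p(1) u'm V'm])
    show "locint \<Omega> g'" using locint_iff_locally_integrable[OF \<Omega> g'] g by simp
    show "locint \<Omega> G'" using locint_iff_locally_integrable[OF \<Omega> G'] G by simp
    show "AE x in lborel. x \<in> \<Omega> \<longrightarrow> \<bar>fst (p n) x\<bar> \<le> g' x" for n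
      using le(1)[of n, unfolded AE_lebesgue_on_iff[OF \<Omega>]] p(2)[of n] g'(2) by eventually_elim auto
    show "AE x in lborel. x \<in> \<Omega> \<longrightarrow> norm (snd (p n) x) \<le> G' x" for n
      using le(2)[of n, unfolded AE_lebesgue_on_iff[OF \<Omega>]] p(3)[of n] G'(2) by eventually_elim auto
    show "AE x in lborel. x \<in> \<Omega> \<longrightarrow> (\<lambda>n. fst (p n) x) \<longlonglongrightarrow> u' x"
      using P(1) L(1) eu by eventually_elim auto
    show "AE x in lborel. x \<in> \<Omega> \<longrightarrow> (\<lambda>n. snd (p n) x) \<longlonglongrightarrow> V' x"
      using P(2) L(2) eV by eventually_elim auto
  qed
  then show ?thesis by (rule has_weak_gradientI[OF \<Omega> _ eu eV])
qed

lemma hwg_C1: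
  assumes "\<And>x. x \<in> \<Omega> \<Longrightarrow> (u has_derivative (\<lambda>y. D x \<bullet> y)) (at x)" "continuous_on \<Omega> D"
  shows "has_weak_gradient \<Omega> u D"
  by (rule has_weak_gradientI[OF \<Omega> wgrad_C1[OF \<Omega> assms]]) auto

lemma hwg_test:
  assumes "\<phi> \<in> test_functions \<Omega>'"
  shows "has_weak_gradient \<Omega> \<phi> (grad \<phi>)"
  using test_functionsD(5,6)[OF assms] by (intro hwg_C1) (auto intro: continuous_on_subset)

lemma hwg_zero_constant:
  assumes w: "has_weak_gradient \<Omega> u V" and z: "AE x in lebesgue_on \<Omega>. V x = 0" and c: "connected \<Omega>"
  obtains k where "AE x in lebesgue_on \<Omega>. u x = k"
proof -
  obtain u' V' where 1: "wgrad \<Omega> u' V'" "AE x in lborel. x \<in> \<Omega> \<longrightarrow> u x = u' x" "AE x in lborel. x \<in> \<Omega> \<longrightarrow> V x = V' x"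
    using has_weak_gradientE[OF \<Omega> w] .
  have "wgrad \<Omega> u' (\<lambda>_. 0)"
  proof (rule wgrad_cong_AE[OF 1(1)])
    show "AE x in lborel. x \<in> \<Omega> \<longrightarrow> u' x = u' x \<and> V' x = 0"
      using 1(3) z[unfolded AE_lebesgue_on_iff[OF \<Omega>]] by eventually_elim auto
  qed (use wgrad_borelD[OF 1(1)] in auto)
  from wgrad_zero_constant[OF this \<Omega> c] obtain k where "AE x in lborel. x \<in> \<Omega> \<longrightarrow> u' x = k" .
  with 1(2) have "AE x in lborel. x \<in> \<Omega> \<longrightarrow> u x = k" by eventually_elim auto
  then show thesis using that unfolding AE_lebesgue_on_iff[OF \<Omega>] by blast
qed

text \<open>\<open>weak_grad\<close> is an arbitrary choice; uniqueness up to null sets lets it be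
  replaced by whatever weak gradient has been computed.\<close>

lemma weak_grad_works:
  assumes "has_weak_gradient \<Omega> u V"
  shows "has_weak_gradient \<Omega> u (weak_grad \<Omega> u)" "AE x in lebesgue_on \<Omega>. weak_grad \<Omega> u x = V x"
proof -
  show 1: "has_weak_gradient \<Omega> u (weak_grad \<Omega> u)"
    unfolding weak_grad_def by (rule someI[of "has_weak_gradient \<Omega> u", OF assms])
  show "AE x in lebesgue_on \<Omega>. weak_grad \<Omega> u x = V x"
    by (rule hwg_unique[OF 1 assms]) simp
qed

end

section \<open>Lebesgue and Sobolev spaces of order r on a bounded open set\<close>

lemma powr_add_le:
  fixes a b r :: real
  assumes "0 \<le> a" "0 \<le> b" "0 \<le> r"
  shows "(a + b) powr r \<le> 2 powr r * (a powr r + b powr r)"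
proof -
  have "(a + b) powr r \<le> (2 * max a b) powr r" using assms by (intro powr_mono2) auto
  also have "\<dots> = 2 powr r * max a b powr r" using assms by (intro powr_mult)
  also have "max a b powr r \<le> a powr r + b powr r" by (auto simp: max_def)
  finally show ?thesis by simp
qed

locale bounded_open =
  fixes \<Omega> :: "'a::euclidean_space set" and r :: real
  assumes \<Omega>: "open \<Omega>" and bdd: "bounded \<Omega>" and r: "1 \<le> r"
begin

abbreviation "M \<equiv> lebesgue_on \<Omega>"

text \<open>The r-th power of the Lebesgue norm. Convergence questions are settled with powers and
  the constant 2^r of \<open>powr_add_le\<close>, which takes the place of the Minkowski
  inequality.\<close>

definition Nr :: "('a \<Rightarrow> 'b::euclidean_space) \<Rightarrow> real" where
  "Nr f = (\<integral>x. norm (f x) powr r \<partial>M)"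

abbreviation Lr :: "('a \<Rightarrow> 'b::euclidean_space) set" where
  "Lr \<equiv> Lebesgue_space r \<Omega>"

lemma Lr_iff: "f \<in> Lr \<longleftrightarrow> f \<in> borel_measurable M \<and> integrable M (\<lambda>x. norm (f x) powr r)"
  by (auto simp: Lebesgue_space_def)

lemma finite_measure_M: "finite_measure M"
  by (rule finite_measure_lebesgue_on) (rule lmeasurable_open[OF bdd \<Omega>])

lemma integrable_M_const [simp]: "integrable M (\<lambda>x. c :: 'b::{banach, second_countable_topology})"
  using finite_measure_M by (rule finite_measure.integrable_const)

lemma Lr_measurable [measurable_dest]: "f \<in> Lr \<Longrightarrow> f \<in> borel_measurable M"
  by (simp add: Lr_iff)

lemma Lr_integrable_powr: "f \<in> Lr \<Longrightarrow> integrable M (\<lambda>x. norm (f x) powr r)"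
  by (simp add: Lr_iff)

lemma Lr_bound:
  fixes f :: "'a \<Rightarrow> 'b::euclidean_space" and g :: "'a \<Rightarrow> 'c::euclidean_space"
  assumes g: "g \<in> Lr" and [measurable]: "f \<in> borel_measurable M"
    and le: "AE x in M. norm (f x) \<le> c * norm (g x)"
  shows "f \<in> Lr" "Nr f \<le> \<bar>c\<bar> powr r * Nr g"
proof -
  have le': "AE x in M. norm (f x) powr r \<le> \<bar>c\<bar> powr r * norm (g x) powr r"
    using le
  proof eventually_elim
    case (elim x)
    then have "norm (f x) \<le> \<bar>c\<bar> * norm (g x)" by (smt (verit) mult_right_mono norm_ge_zero)
    then have "norm (f x) powr r \<le> (\<bar>c\<bar> * norm (g x)) powr r" using r by (intro powr_mono2) auto
    then show ?case by (simp add: powr_mult)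
  qed
  have i: "integrable M (\<lambda>x. \<bar>c\<bar> powr r * norm (g x) powr r)"
    using g by (intro integrable_mult_right) (simp add: Lr_iff)
  have i2: "integrable M (\<lambda>x. norm (f x) powr r)"
    by (rule Bochner_Integration.integrable_bound[OF i]) (use le' in auto)
  then show "f \<in> Lr" by (simp add: Lr_iff)
  have "Nr f \<le> (\<integral>x. \<bar>c\<bar> powr r * norm (g x) powr r \<partial>M)"
    unfolding Nr_def by (rule integral_mono_AE[OF i2 i le'])
  then show "Nr f \<le> \<bar>c\<bar> powr r * Nr g" by (simp add: Nr_def)
qed

lemma Lr_add_bound:
  fixes f :: "'a \<Rightarrow> 'b::euclidean_space" and g :: "'a \<Rightarrow> 'c::euclidean_space" and h :: "'a \<Rightarrow> 'd::euclidean_space"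
  assumes g: "g \<in> Lr" and h: "h \<in> Lr" and [measurable]: "f \<in> borel_measurable M"
    and le: "AE x in M. norm (f x) \<le> norm (g x) + norm (h x)"
  shows "f \<in> Lr" "Nr f \<le> 2 powr r * (Nr g + Nr h)"
proof -
  have le': "AE x in M. norm (f x) powr r \<le> 2 powr r * (norm (g x) powr r + norm (h x) powr r)"
    using le
  proof eventually_elim
    case (elim x)
    then have "norm (f x) powr r \<le> (norm (g x) + norm (h x)) powr r" using r by (intro powr_mono2) auto
    also have "\<dots> \<le> 2 powr r * (norm (g x) powr r + norm (h x) powr r)" using r by (intro powr_add_le) auto
    finally show ?case .
  qed
  have i: "integrable M (\<lambda>x. 2 powr r * (norm (g x) powr r + norm (h x) powr r))"
    using g h by (intro integrable_mult_right Bochner_Integration.integrable_add) (auto simp: Lr_iff)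
  have i2: "integrable M (\<lambda>x. norm (f x) powr r)"
    by (rule Bochner_Integration.integrable_bound[OF i]) (use le' in auto)
  then show "f \<in> Lr" by (simp add: Lr_iff)
  have "Nr f \<le> (\<integral>x. 2 powr r * (norm (g x) powr r + norm (h x) powr r) \<partial>M)"
    unfolding Nr_def by (rule integral_mono_AE[OF i2 i le'])
  also have "\<dots> = 2 powr r * (Nr g + Nr h)"
    using g h by (simp add: Nr_def Lr_iff)
  finally show "Nr f \<le> 2 powr r * (Nr g + Nr h)" .
qed

lemma Nr_nonneg: "0 \<le> Nr f"
  unfolding Nr_def by simp

lemma Nr_cong_AE: "AE x in M. f x = g x \<Longrightarrow> f \<in> borel_measurable M \<Longrightarrow> g \<in> borel_measurable M \<Longrightarrow> Nr f = Nr g"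
  unfolding Nr_def by (rule integral_cong_AE) auto

lemma Lr_const: "(\<lambda>x. c) \<in> Lr"
  by (simp add: Lr_iff)

lemma Lr_add: "f \<in> Lr \<Longrightarrow> g \<in> Lr \<Longrightarrow> (\<lambda>x. f x + g x) \<in> Lr"
  by (rule Lr_add_bound(1)[of f g]) (auto simp: Lr_iff norm_triangle_ineq)

lemma Lr_scaleR: "f \<in> Lr \<Longrightarrow> (\<lambda>x. c *\<^sub>R f x) \<in> Lr"
  by (rule Lr_bound[of f _ "\<bar>c\<bar>"]) (auto simp: Lr_iff)

lemma Lr_diff: "f \<in> Lr \<Longrightarrow> g \<in> Lr \<Longrightarrow> (\<lambda>x. f x - g x) \<in> Lr"
  by (rule Lr_add_bound(1)[of f g]) (auto simp: Lr_iff norm_triangle_ineq4)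

lemma Lr_norm: "f \<in> Lr \<Longrightarrow> (\<lambda>x. norm (f x)) \<in> Lr"
  by (rule Lr_bound[of f _ 1]) (auto simp: Lr_iff)

lemma Lr_cong_AE: "f \<in> Lr \<Longrightarrow> g \<in> borel_measurable M \<Longrightarrow> AE x in M. f x = g x \<Longrightarrow> g \<in> Lr"
  by (rule Lr_bound[of f _ 1]) auto

text \<open>Below the threshold \<eta> the first summand suffices; above it (a / \<eta>) powr (r -
  1) is at least 1. With its free threshold this replaces the Hoelder inequality on sets of finite
  measure.\<close>

lemma le_add_powr: "0 < \<eta> \<Longrightarrow> 0 \<le> a \<Longrightarrow> a \<le> \<eta> + \<eta> powr (1 - r) * a powr r" for a \<eta> :: real
proof (cases "a \<le> \<eta>")
  case False
  assume \<eta>: "0 < \<eta>"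
  have "a = a powr (1 - r) * a powr r" using False \<eta> by (simp flip: powr_add)
  also have "\<dots> \<le> \<eta> powr (1 - r) * a powr r"
    using False \<eta> r by (intro mult_right_mono powr_mono2') auto
  finally show ?thesis using \<eta> by simp
qed (auto intro: add_increasing2)

lemma Lr_integrable: "f \<in> Lr \<Longrightarrow> integrable M f"
proof -
  assume f: "f \<in> Lr"
  show ?thesis
  proof (rule Bochner_Integration.integrable_bound)
    show "integrable M (\<lambda>x. 1 + norm (f x) powr r)" using f by (simp add: Lr_iff)
    show "AE x in M. norm (f x) \<le> norm (1 + norm (f x) powr r)"
    proof (rule AE_I2)
      fix x show "norm (f x) \<le> norm (1 + norm (f x) powr r)" using le_add_powr[of 1 "norm (f x)"] by simp
    qed
  qed (use f in \<open>simp add: Lr_iff\<close>)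
qed

lemma Lr_locally_integrable: "f \<in> Lr \<Longrightarrow> locally_integrable_on f \<Omega>"
  unfolding locally_integrable_on_def
proof (intro allI impI, elim conjE)
  fix K assume f: "f \<in> Lr" and K: "compact K" "K \<subseteq> \<Omega>"
  have "integrable (restrict_space M K) f"
  proof (subst integrable_restrict_space)
    have "K = K \<inter> \<Omega>" using K by auto
    then show KM: "K \<inter> space M \<in> sets M" using K \<Omega>
      by (auto simp: sets_restrict_space borel_compact intro!: image_eqI[of _ _ K])
    then have [measurable]: "K \<in> sets M" using K by (simp add: Int_absorb2)
    show "integrable M (\<lambda>x. indicator K x *\<^sub>R f x)"
      by (rule Bochner_Integration.integrable_bound[OF Lr_integrable[OF f]])
        (use f in \<open>auto simp: indicator_def Lr_iff\<close>)
  qed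
  moreover have "restrict_space M K = lebesgue_on K"
    using K \<Omega> by (subst restrict_restrict_space) (auto simp: borel_compact Int_absorb1)
  ultimately show "integrable (lebesgue_on K) f" by simp
qed

text \<open>The threshold inequality bounds the integral by \<eta> times the measure of \<Omega>
  plus a multiple of \<open>Nr\<close>; \<eta> is fixed before the index is chosen. The summand 1 in
  the choice of \<eta> guards against division by a zero measure.\<close>

lemma Lr_tendsto_L1:
  fixes f :: "nat \<Rightarrow> 'a \<Rightarrow> 'b::euclidean_space"
  assumes f: "\<And>n. f n \<in> Lr" and 0: "(\<lambda>n. Nr (f n)) \<longlonglongrightarrow> 0"
  shows "(\<lambda>n. \<integral>x. norm (f n x) \<partial>M) \<longlonglongrightarrow> 0"
proof (rule LIMSEQ_I)
  fix e :: real assume e: "0 < e"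
  define m where "m = measure M (space M)"
  define \<eta> where "\<eta> = e / (2 * (m + 1))"
  have m0: "0 \<le> m" by (simp add: m_def)
  have \<eta>0: "0 < \<eta>" "\<eta> * m \<le> e / 2" using e m0 by (auto simp: \<eta>_def field_simps)
  then have \<eta>: "0 < \<eta>" "\<eta> * m < e / 2 + e / 4" using e by auto
  have le: "(\<integral>x. norm (f n x) \<partial>M) \<le> \<eta> * m + \<eta> powr (1 - r) * Nr (f n)" for n
  proof -
    have i: "integrable M (\<lambda>x. \<eta> + \<eta> powr (1 - r) * norm (f n x) powr r)"
      using Lr_integrable_powr[OF f[of n]] by simp
    have "(\<integral>x. norm (f n x) \<partial>M) \<le> (\<integral>x. \<eta> + \<eta> powr (1 - r) * norm (f n x) powr r \<partial>M)"
      by (rule integral_mono[OF integrable_norm[OF Lr_integrable[OF f]] i]) (simp add: le_add_powr[OF \<eta>(1)])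
    also have "\<dots> = \<eta> * m + \<eta> powr (1 - r) * Nr (f n)"
      using f[of n] by (simp add: Nr_def Lr_iff m_def)
    finally show ?thesis .
  qed
  have "(\<lambda>n. \<eta> powr (1 - r) * Nr (f n)) \<longlonglongrightarrow> \<eta> powr (1 - r) * 0" by (intro tendsto_intros 0)
  then have "\<forall>\<^sub>F n in sequentially. \<eta> powr (1 - r) * Nr (f n) < e / 4"
    using e by (intro order_tendstoD(2)) auto
  then obtain N where N: "\<And>n. N \<le> n \<Longrightarrow> \<eta> powr (1 - r) * Nr (f n) < e / 4"
    unfolding eventually_sequentially by blast
  show "\<exists>N. \<forall>n\<ge>N. norm ((\<integral>x. norm (f n x) \<partial>M) - 0) < e"
  proof (intro exI[of _ N] allI impI)
    fix n assume "N \<le> n"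
    have "0 \<le> (\<integral>x. norm (f n x) \<partial>M)" by simp
    then show "norm ((\<integral>x. norm (f n x) \<partial>M) - 0) < e"
      using le[of n] N[OF \<open>N \<le> n\<close>] \<eta>(2) by simp
  qed
qed

lemma Lr_tendsto_AE_subseq:
  fixes f :: "nat \<Rightarrow> 'a \<Rightarrow> 'b::euclidean_space"
  assumes f: "\<And>n. f n \<in> Lr" and 0: "(\<lambda>n. Nr (f n)) \<longlonglongrightarrow> 0"
  obtains s :: "nat \<Rightarrow> nat" where "strict_mono s" "AE x in M. (\<lambda>n. f (s n) x) \<longlonglongrightarrow> 0"
  using tendsto_L1_AE_subseq[OF Lr_integrable[OF f] Lr_tendsto_L1[OF f 0]] by blast

lemma Lr_dominated:
  fixes f :: "nat \<Rightarrow> 'a \<Rightarrow> 'b::euclidean_space"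
  assumes m: "\<And>n. f n \<in> borel_measurable M" and g: "g \<in> Lr"
    and le: "\<And>n. AE x in M. norm (f n x) \<le> norm (g x)" and lim: "AE x in M. (\<lambda>n. f n x) \<longlonglongrightarrow> 0"
  shows "(\<lambda>n. Nr (f n)) \<longlonglongrightarrow> 0"
proof -
  note [measurable] = m
  have "(\<lambda>n. \<integral>x. norm (f n x) powr r \<partial>M) \<longlonglongrightarrow> (\<integral>x. 0 \<partial>M)"
  proof (rule integral_dominated_convergence[where w = "\<lambda>x. norm (g x) powr r"])
    show "AE x in M. (\<lambda>n. norm (f n x) powr r) \<longlonglongrightarrow> 0"
      using lim
    proof eventually_elim
      case (elim x)
      have "(\<lambda>n. norm (f n x) powr r) \<longlonglongrightarrow> norm (0 :: 'b) powr r"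
        by (rule tendsto_powr'[OF tendsto_norm[OF elim] tendsto_const]) (use r in auto)
      then show ?case using r by simp
    qed
    show "AE x in M. norm (norm (f n x) powr r) \<le> norm (g x) powr r" for n
      using le[of n] by eventually_elim (use r in \<open>auto intro: powr_mono2\<close>)
    show "integrable M (\<lambda>x. norm (g x) powr r)" using g by (simp add: Lr_iff)
  qed measurable
  then show ?thesis by (simp add: Nr_def)
qed

abbreviation "gr u \<equiv> weak_grad \<Omega> u"

lemma W1D:
  assumes "u \<in> W1 r \<Omega>"
  shows "u \<in> Lr" "gr u \<in> Lr" "has_weak_gradient \<Omega> u (gr u)"
proof -
  obtain V where V: "u \<in> Lr" "V \<in> Lr" "has_weak_gradient \<Omega> u V" using assms by (auto simp: W1_def)
  note w = weak_grad_works[OF \<Omega> V(3)]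
  show "u \<in> Lr" "has_weak_gradient \<Omega> u (gr u)" by fact+
  show "gr u \<in> Lr"
    by (rule Lr_cong_AE[OF V(2) hwg_measurable(2)[OF \<Omega> w(1)]]) (use w(2) in auto)
qed

lemma W1I:
  assumes "u \<in> Lr" "V \<in> Lr" "has_weak_gradient \<Omega> u V"
  shows "u \<in> W1 r \<Omega>" "AE x in M. gr u x = V x"
  using assms weak_grad_works[OF \<Omega> assms(3)] by (auto simp: W1_def)

lemma W1_lincomb:
  assumes "u \<in> W1 r \<Omega>" "v \<in> W1 r \<Omega>"
  shows "(\<lambda>x. a * u x + b * v x) \<in> W1 r \<Omega>" "AE x in M. gr (\<lambda>x. a * u x + b * v x) x = a *\<^sub>R gr u x + b *\<^sub>R gr v x"
proof -
  have "(\<lambda>x. a * u x + b * v x) \<in> Lr"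
    using Lr_add[OF Lr_scaleR[OF W1D(1)[OF assms(1)]] Lr_scaleR[OF W1D(1)[OF assms(2)]]] by simp
  moreover have "(\<lambda>x. a *\<^sub>R gr u x + b *\<^sub>R gr v x) \<in> Lr"
    using assms by (intro Lr_add Lr_scaleR W1D)
  moreover have "has_weak_gradient \<Omega> (\<lambda>x. a * u x + b * v x) (\<lambda>x. a *\<^sub>R gr u x + b *\<^sub>R gr v x)"
    using assms by (intro hwg_lincomb[OF \<Omega>] W1D)
  ultimately show "(\<lambda>x. a * u x + b * v x) \<in> W1 r \<Omega>" "AE x in M. gr (\<lambda>x. a * u x + b * v x) x = a *\<^sub>R gr u x + b *\<^sub>R gr v x"
    by (rule W1I)+
qed

lemma W1_diff:
  assumes "u \<in> W1 r \<Omega>" "v \<in> W1 r \<Omega>"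
  shows "(\<lambda>x. u x - v x) \<in> W1 r \<Omega>" "AE x in M. gr (\<lambda>x. u x - v x) x = gr u x - gr v x"
  using W1_lincomb[OF assms, of 1 "-1"] by auto

lemma test_Lr:
  assumes "\<phi> \<in> test_functions \<Omega>"
  shows "\<phi> \<in> Lr" "grad \<phi> \<in> Lr"
proof -
  obtain B where B: "0 < B" "\<And>x. \<bar>\<phi> x\<bar> \<le> B" "\<And>x. norm (grad \<phi> x) \<le> B"
    using test_functions_bounded[OF assms] by metis
  have m: "f \<in> borel_measurable M" if "f \<in> borel_measurable borel" for f :: "'a \<Rightarrow> 'b::euclidean_space"
    using that by (intro measurable_restrict_space1 measurable_completion) simp
  note [measurable] = m[OF test_functions_measurable(1)[OF assms]] m[OF test_functions_measurable(2)[OF assms]]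
  show "\<phi> \<in> Lr" "grad \<phi> \<in> Lr"
    by (rule Lr_bound(1)[OF Lr_const[of "1::real"], of _ B], measurable, simp add: B)+
qed

lemma test_W1:
  assumes "\<phi> \<in> test_functions \<Omega>"
  shows "\<phi> \<in> W1 r \<Omega>" "AE x in M. gr \<phi> x = grad \<phi> x"
  using W1I[OF test_Lr[OF assms] hwg_test[OF \<Omega> assms]] by auto

lemma W1_norm_eq: "W1_norm r \<Omega> u = (Nr u + Nr (gr u)) powr (1 / r)"
  by (simp add: W1_norm_def Nr_def)

lemma W1_norm_less_iff: "0 < \<epsilon> \<Longrightarrow> W1_norm r \<Omega> u < \<epsilon> \<longleftrightarrow> Nr u + Nr (gr u) < \<epsilon> powr r"
proof -
  assume e: "0 < \<epsilon>"
  have n: "0 \<le> Nr u + Nr (gr u)" by (intro add_nonneg_nonneg Nr_nonneg)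
  have "(Nr u + Nr (gr u)) powr (1 / r) < \<epsilon> \<longleftrightarrow> ((Nr u + Nr (gr u)) powr (1 / r)) powr r < \<epsilon> powr r"
    using e r by (smt (verit) powr_ge_zero powr_less_mono2 powr_mono2)
  also have "((Nr u + Nr (gr u)) powr (1 / r)) powr r = Nr u + Nr (gr u)"
    using n r by (simp add: powr_powr)
  finally show ?thesis by (simp add: W1_norm_eq)
qed

definition W1_tendsto :: "(nat \<Rightarrow> 'a \<Rightarrow> real) \<Rightarrow> ('a \<Rightarrow> real) \<Rightarrow> bool" where
  "W1_tendsto f u \<longleftrightarrow> (\<lambda>n. Nr (\<lambda>x. f n x - u x)) \<longlonglongrightarrow> 0 \<and> (\<lambda>n. Nr (\<lambda>x. gr (f n) x - gr u x)) \<longlonglongrightarrow> 0"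

lemma Nr_diff_commute: "Nr (\<lambda>x. f x - g x) = Nr (\<lambda>x. g x - f x)"
  unfolding Nr_def by (simp add: norm_minus_commute)

lemma Nr_gr_diff:
  assumes "u \<in> W1 r \<Omega>" "v \<in> W1 r \<Omega>"
  shows "Nr (gr (\<lambda>x. u x - v x)) = Nr (\<lambda>x. gr u x - gr v x)"
proof (rule Nr_cong_AE[OF W1_diff(2)[OF assms]])
  note [measurable] = Lr_measurable[OF W1D(2)[OF assms(1)]] Lr_measurable[OF W1D(2)[OF assms(2)]]
    Lr_measurable[OF W1D(2)[OF W1_diff(1)[OF assms]]]
  show "gr (\<lambda>x. u x - v x) \<in> borel_measurable M" "(\<lambda>x. gr u x - gr v x) \<in> borel_measurable M" by measurable
qed

lemma W1_0D: "u \<in> W1_0 r \<Omega> \<Longrightarrow> u \<in> W1 r \<Omega>"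
  by (simp add: W1_0_def)

lemma W1_0_sequence:
  assumes "u \<in> W1_0 r \<Omega>"
  obtains \<phi> where "\<And>n. \<phi> n \<in> test_functions \<Omega>" "W1_tendsto \<phi> u"
proof -
  have u: "u \<in> W1 r \<Omega>" using assms by (rule W1_0D)
  have "\<exists>\<phi>\<in>test_functions \<Omega>. W1_norm r \<Omega> (\<lambda>x. u x - \<phi> x) < inverse (real (Suc n))" for n
    using assms by (simp add: W1_0_def)
  then obtain \<phi> where p: "\<And>n. \<phi> n \<in> test_functions \<Omega>" "\<And>n. W1_norm r \<Omega> (\<lambda>x. u x - \<phi> n x) < inverse (real (Suc n))"
    by metis
  have le: "Nr (\<lambda>x. u x - \<phi> n x) + Nr (\<lambda>x. gr u x - gr (\<phi> n) x) \<le> inverse (real (Suc n)) powr r" for n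
  proof -
    have "0 < inverse (real (Suc n))" by simp
    from W1_norm_less_iff[OF this, THEN iffD1, OF p(2)]
    show ?thesis unfolding Nr_gr_diff[OF u test_W1(1)[OF p(1)]] by (rule less_imp_le)
  qed
  have 0: "(\<lambda>n. inverse (real (Suc n)) powr r) \<longlonglongrightarrow> 0"
    using tendsto_powr'[OF LIMSEQ_inverse_real_of_nat tendsto_const[of r]] r by simp
  have le1: "Nr (\<lambda>x. u x - \<phi> n x) \<le> inverse (real (Suc n)) powr r" for n
    using le[of n] Nr_nonneg[of "\<lambda>x. gr u x - gr (\<phi> n) x"] by linarith
  have le2: "Nr (\<lambda>x. gr u x - gr (\<phi> n) x) \<le> inverse (real (Suc n)) powr r" for n
    using le[of n] Nr_nonneg[of "\<lambda>x. u x - \<phi> n x"] by linarith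
  have "(\<lambda>n. Nr (\<lambda>x. u x - \<phi> n x)) \<longlonglongrightarrow> 0"
    by (rule tendsto_sandwich[OF _ _ tendsto_const 0]) (simp_all add: Nr_nonneg le1 del: of_nat_Suc)
  moreover have "(\<lambda>n. Nr (\<lambda>x. gr u x - gr (\<phi> n) x)) \<longlonglongrightarrow> 0"
    by (rule tendsto_sandwich[OF _ _ tendsto_const 0]) (simp_all add: Nr_nonneg le2 del: of_nat_Suc)
  ultimately have "(\<lambda>n. Nr (\<lambda>x. \<phi> n x - u x)) \<longlonglongrightarrow> 0" "(\<lambda>n. Nr (\<lambda>x. gr (\<phi> n) x - gr u x)) \<longlonglongrightarrow> 0"
    by (simp_all add: Nr_diff_commute[of u] Nr_diff_commute[of "gr u"])
  then have "W1_tendsto \<phi> u" unfolding W1_tendsto_def by simp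
  then show thesis using p(1) that by blast
qed

lemma W1_0_closed:
  assumes u: "u \<in> W1 r \<Omega>" and f: "\<And>n. f n \<in> W1_0 r \<Omega>" and lim: "W1_tendsto f u"
  shows "u \<in> W1_0 r \<Omega>"
  unfolding W1_0_def
proof (intro CollectI conjI allI impI u)
  fix \<epsilon> :: real assume \<epsilon>: "0 < \<epsilon>"
  \<comment> \<open>Each of the two differences costs 2^r times 2 \<delta>, so the total is 4 times
    2^r times \<delta>, which is half of \<epsilon> powr r.\<close>
  define \<delta> where "\<delta> = \<epsilon> powr r / (8 * 2 powr r)"
  have \<delta>: "0 < \<delta>" using \<epsilon> by (simp add: \<delta>_def)
  have "\<forall>\<^sub>F n in sequentially. Nr (\<lambda>x. f n x - u x) < \<delta>" "\<forall>\<^sub>F n in sequentially. Nr (\<lambda>x. gr (f n) x - gr u x) < \<delta>"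
    using order_tendstoD(2)[OF conjunct1[OF lim[unfolded W1_tendsto_def]] \<delta>]
      order_tendstoD(2)[OF conjunct2[OF lim[unfolded W1_tendsto_def]] \<delta>] by simp_all
  then have "\<forall>\<^sub>F n in sequentially. Nr (\<lambda>x. f n x - u x) < \<delta> \<and> Nr (\<lambda>x. gr (f n) x - gr u x) < \<delta>" by eventually_elim simp
  then obtain n where n: "Nr (\<lambda>x. f n x - u x) < \<delta>" "Nr (\<lambda>x. gr (f n) x - gr u x) < \<delta>"
    unfolding eventually_sequentially by blast
  obtain \<phi> where \<phi>: "\<And>n. \<phi> n \<in> test_functions \<Omega>" "W1_tendsto \<phi> (f n)" using W1_0_sequence[OF f[of n]] by metis
  have "\<forall>\<^sub>F m in sequentially. Nr (\<lambda>x. \<phi> m x - f n x) < \<delta>" "\<forall>\<^sub>F m in sequentially. Nr (\<lambda>x. gr (\<phi> m) x - gr (f n) x) < \<delta>"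
    using order_tendstoD(2)[OF conjunct1[OF \<phi>(2)[unfolded W1_tendsto_def]] \<delta>]
      order_tendstoD(2)[OF conjunct2[OF \<phi>(2)[unfolded W1_tendsto_def]] \<delta>] by simp_all
  then have "\<forall>\<^sub>F m in sequentially. Nr (\<lambda>x. \<phi> m x - f n x) < \<delta> \<and> Nr (\<lambda>x. gr (\<phi> m) x - gr (f n) x) < \<delta>" by eventually_elim simp
  then obtain m where m: "Nr (\<lambda>x. \<phi> m x - f n x) < \<delta>" "Nr (\<lambda>x. gr (\<phi> m) x - gr (f n) x) < \<delta>"
    unfolding eventually_sequentially by blast
  have W: "f n \<in> W1 r \<Omega>" "\<phi> m \<in> W1 r \<Omega>" using f \<phi>(1) by (auto intro: W1_0D test_W1)
  note L = W1D(1,2)[OF W(1)] W1D(1,2)[OF W(2)] W1D(1,2)[OF u]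
  have tri: "norm (a - c) \<le> norm (b - a) + norm (c - b)" for a b c :: "'z::euclidean_space"
    using norm_triangle_ineq[of "a - b" "b - c"] by (simp add: norm_minus_commute)
  have "Nr (\<lambda>x. u x - \<phi> m x) \<le> 2 powr r * (Nr (\<lambda>x. f n x - u x) + Nr (\<lambda>x. \<phi> m x - f n x))"
    by (rule Lr_add_bound(2)[OF Lr_diff Lr_diff Lr_measurable[OF Lr_diff] AE_I2[OF tri]]) (rule L)+
  also have "\<dots> < 2 powr r * (\<delta> + \<delta>)" using n m by (intro mult_strict_left_mono add_strict_mono) auto
  finally have 1: "Nr (\<lambda>x. u x - \<phi> m x) < 2 powr r * (\<delta> + \<delta>)" .
  have "Nr (\<lambda>x. gr u x - gr (\<phi> m) x) \<le> 2 powr r * (Nr (\<lambda>x. gr (f n) x - gr u x) + Nr (\<lambda>x. gr (\<phi> m) x - gr (f n) x))"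
    by (rule Lr_add_bound(2)[OF Lr_diff Lr_diff Lr_measurable[OF Lr_diff] AE_I2[OF tri]]) (rule L)+
  also have "\<dots> < 2 powr r * (\<delta> + \<delta>)" using n m by (intro mult_strict_left_mono add_strict_mono) auto
  finally have 2: "Nr (\<lambda>x. gr u x - gr (\<phi> m) x) < 2 powr r * (\<delta> + \<delta>)" .
  have "2 powr r * (\<delta> + \<delta>) + 2 powr r * (\<delta> + \<delta>) < \<epsilon> powr r"
  proof -
    have "2 powr r * (\<delta> + \<delta>) + 2 powr r * (\<delta> + \<delta>) = \<epsilon> powr r / 2" by (simp add: \<delta>_def)
    moreover have "0 < \<epsilon> powr r" using \<epsilon> by simp
    ultimately show ?thesis by linarith
  qed
  with 1 2 have "Nr (\<lambda>x. u x - \<phi> m x) + Nr (gr (\<lambda>x. u x - \<phi> m x)) < \<epsilon> powr r"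
    unfolding Nr_gr_diff[OF u W(2)] by linarith
  then have "W1_norm r \<Omega> (\<lambda>x. u x - \<phi> m x) < \<epsilon>" using W1_norm_less_iff[OF \<epsilon>] by simp
  then show "\<exists>\<phi>\<in>test_functions \<Omega>. W1_norm r \<Omega> (\<lambda>x. u x - \<phi> x) < \<epsilon>" using \<phi>(1) by blast
qed

lemma test_W1_0:
  assumes "\<phi> \<in> test_functions \<Omega>"
  shows "\<phi> \<in> W1_0 r \<Omega>"
proof -
  have "Nr (\<lambda>x. \<phi> x - \<phi> x) + Nr (\<lambda>x. gr \<phi> x - gr \<phi> x) = 0" using r by (simp add: Nr_def)
  then have "W1_norm r \<Omega> (\<lambda>x. \<phi> x - \<phi> x) = 0"
    using Nr_gr_diff[OF test_W1(1)[OF assms] test_W1(1)[OF assms]] by (simp add: W1_norm_eq)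
  then show ?thesis using assms test_W1(1)[OF assms] unfolding W1_0_def by force
qed

end

section \<open>Chain rules and regularised limits in Sobolev spaces\<close>

lemma (in C1_pair) uniform_bound: "\<bar>F a b\<bar> \<le> \<bar>F 0 0\<bar> + L * (\<bar>a\<bar> + \<bar>b\<bar>)"
  using lipschitz[of a b 0 0] by simp

lemma C1_pair_lincomb: "C1_pair (\<lambda>s t. a * s + b * t) (\<lambda>_. a) (\<lambda>_. b) (max \<bar>a\<bar> \<bar>b\<bar>)"
  by unfold_locales (auto intro!: derivative_eq_intros)

lemma supp_pair_subset:
  assumes "F 0 0 = 0"
  shows "supp (\<lambda>x. F (\<phi> x) (\<psi> x)) \<subseteq> supp \<phi> \<union> supp \<psi>"
proof -
  have "{x. F (\<phi> x) (\<psi> x) \<noteq> 0} \<subseteq> {x. \<phi> x \<noteq> 0} \<union> {x. \<psi> x \<noteq> 0}" using assms by auto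
  from closure_mono[OF this] show ?thesis unfolding supp_def by (simp only: closure_Un)
qed

lemma test_functions_pair:
  assumes "\<phi> \<in> test_functions \<Omega>" "\<psi> \<in> test_functions \<Omega>" "F 0 0 = 0"
    and "\<And>k. Ck_on k UNIV (\<lambda>x. F (\<phi> x) (\<psi> x))"
  shows "(\<lambda>x. F (\<phi> x) (\<psi> x)) \<in> test_functions \<Omega>"
proof -
  have "compact (supp \<phi> \<union> supp \<psi>)" using assms(1,2) by (auto simp: test_functions_iff)
  then have "compact (supp (\<lambda>x. F (\<phi> x) (\<psi> x)))"
    using supp_pair_subset[of F \<phi> \<psi>] assms(3)
    by (metis bounded_subset closed_closure compact_eq_bounded_closed supp_def)
  then show ?thesis
    using assms supp_pair_subset[of F \<phi> \<psi>] unfolding test_functions_iff by blast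
qed

lemma test_functions_Ck: "\<phi> \<in> test_functions \<Omega> \<Longrightarrow> Ck_on k UNIV \<phi>"
  by (simp add: test_functions_iff)

context bounded_open
begin

lemma W1_chain:
  assumes C: "C1_pair F F1 F2 L" and u: "u \<in> W1 r \<Omega>" and v: "v \<in> W1 r \<Omega>"
  shows "(\<lambda>x. F (u x) (v x)) \<in> W1 r \<Omega>"
    "AE x in M. gr (\<lambda>x. F (u x) (v x)) x = F1 (u x, v x) *\<^sub>R gr u x + F2 (u x, v x) *\<^sub>R gr v x"
proof -
  interpret C1_pair F F1 F2 L by fact
  note U = W1D[OF u] note V = W1D[OF v]
  note [measurable] = Lr_measurable[OF U(1)] Lr_measurable[OF U(2)] Lr_measurable[OF V(1)] Lr_measurable[OF V(2)]
  have n: "norm (F (u x) (v x)) \<le> norm (\<bar>F 0 0\<bar> + L * norm (u x)) + norm (L * norm (v x))" for x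
    using uniform_bound[of "u x" "v x"] L_nonneg by (simp add: distrib_left add_nonneg_nonneg)
  have 1: "(\<lambda>x. F (u x) (v x)) \<in> Lr"
  proof (rule Lr_add_bound(1)[OF _ _ _ AE_I2[OF n]])
    show "(\<lambda>x. \<bar>F 0 0\<bar> + L * norm (u x)) \<in> Lr"
      using Lr_add[OF Lr_const Lr_scaleR[OF Lr_norm[OF U(1)]]] by simp
    show "(\<lambda>x. L * norm (v x)) \<in> Lr" using Lr_scaleR[OF Lr_norm[OF V(1)]] by simp
  qed measurable
  have 2: "(\<lambda>x. F1 (u x, v x) *\<^sub>R gr u x) \<in> Lr"
    by (rule Lr_bound(1)[OF U(2), of _ L]) (use bnd in \<open>auto intro!: mult_right_mono\<close>)
  have 3: "(\<lambda>x. F2 (u x, v x) *\<^sub>R gr v x) \<in> Lr"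
    by (rule Lr_bound(1)[OF V(2), of _ L]) (use bnd in \<open>auto intro!: mult_right_mono\<close>)
  show "(\<lambda>x. F (u x) (v x)) \<in> W1 r \<Omega>"
    "AE x in M. gr (\<lambda>x. F (u x) (v x)) x = F1 (u x, v x) *\<^sub>R gr u x + F2 (u x, v x) *\<^sub>R gr v x"
    by (rule W1I[OF 1 Lr_add[OF 2 3] hwg_chain[OF \<Omega> U(3) V(3)]])+
qed

lemma tendsto_Nr_le:
  assumes "\<And>n. Nr (f n) \<le> c * (g n + h n)" "g \<longlonglongrightarrow> 0" "h \<longlonglongrightarrow> 0"
  shows "(\<lambda>n. Nr (f n)) \<longlonglongrightarrow> 0"
proof (rule tendsto_sandwich[OF _ _ tendsto_const])
  have "(\<lambda>n. c * (g n + h n)) \<longlonglongrightarrow> c * (0 + 0)" by (intro tendsto_intros assms)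
  then show "(\<lambda>n. c * (g n + h n)) \<longlonglongrightarrow> 0" by simp
qed (use assms(1) in \<open>auto simp: Nr_nonneg\<close>)

lemma W1_tendsto_subseq: "W1_tendsto f u \<Longrightarrow> strict_mono s \<Longrightarrow> W1_tendsto (\<lambda>n. f (s n)) u"
  unfolding W1_tendsto_def using LIMSEQ_subseq_LIMSEQ[of _ 0 s] by (auto simp: o_def)

text \<open>The difference of the gradients splits into A, where bounded factors meet converging
  gradients, and B, where converging factors meet fixed gradients. Only B requires almost everywhere
  convergence, since F1 and F2 are continuous but not Lipschitz.\<close>

lemma W1_tendsto_chain_AE:
  assumes C: "C1_pair F F1 F2 L" and u: "u \<in> W1 r \<Omega>" and v: "v \<in> W1 r \<Omega>"
    and f: "\<And>n. f n \<in> W1 r \<Omega>" and g: "\<And>n. g n \<in> W1 r \<Omega>"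
    and lim: "W1_tendsto f u" "W1_tendsto g v"
    and ae: "AE x in M. (\<lambda>n. f n x) \<longlonglongrightarrow> u x" "AE x in M. (\<lambda>n. g n x) \<longlonglongrightarrow> v x"
  shows "W1_tendsto (\<lambda>n x. F (f n x) (g n x)) (\<lambda>x. F (u x) (v x))"
  unfolding W1_tendsto_def
proof
  interpret C1_pair F F1 F2 L by fact
  note U = W1D[OF u] note V = W1D[OF v] note f' = W1D[OF f] note g' = W1D[OF g]
  note [measurable] = Lr_measurable[OF U(1)] Lr_measurable[OF U(2)] Lr_measurable[OF V(1)] Lr_measurable[OF V(2)]
    Lr_measurable[OF f'(1)] Lr_measurable[OF f'(2)] Lr_measurable[OF g'(1)] Lr_measurable[OF g'(2)]
  note lim' = lim[unfolded W1_tendsto_def]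
  have sc: "Nr (\<lambda>x. L *\<^sub>R k x) \<le> L powr r * Nr k" if "k \<in> Lr" for k :: "'a \<Rightarrow> 'b::euclidean_space"
    using Lr_bound(2)[OF that, of "\<lambda>x. L *\<^sub>R k x" L] that L_nonneg by (simp add: Lr_measurable)
  show "(\<lambda>n. Nr (\<lambda>x. F (f n x) (g n x) - F (u x) (v x))) \<longlonglongrightarrow> 0"
  proof (rule tendsto_Nr_le[OF _ conjunct1[OF lim'(1)] conjunct1[OF lim'(2)]])
    fix n
    have "Nr (\<lambda>x. F (f n x) (g n x) - F (u x) (v x)) \<le> 2 powr r * (Nr (\<lambda>x. L *\<^sub>R (f n x - u x)) + Nr (\<lambda>x. L *\<^sub>R (g n x - v x)))"
      by (rule Lr_add_bound(2)[OF Lr_scaleR[OF Lr_diff[OF f'(1) U(1)]] Lr_scaleR[OF Lr_diff[OF g'(1) V(1)]]])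
        (use lipschitz L_nonneg in \<open>auto simp: abs_mult distrib_left\<close>)
    also have "\<dots> \<le> 2 powr r * (L powr r * Nr (\<lambda>x. f n x - u x) + L powr r * Nr (\<lambda>x. g n x - v x))"
      by (intro mult_left_mono add_mono sc Lr_diff f' g' U V) auto
    finally show "Nr (\<lambda>x. F (f n x) (g n x) - F (u x) (v x)) \<le> (2 powr r * L powr r) * (Nr (\<lambda>x. f n x - u x) + Nr (\<lambda>x. g n x - v x))"
      by (simp add: algebra_simps)
  qed
  define A where "A n x = F1 (f n x, g n x) *\<^sub>R (gr (f n) x - gr u x) + F2 (f n x, g n x) *\<^sub>R (gr (g n) x - gr v x)" for n x
  define B where "B n x = (F1 (f n x, g n x) - F1 (u x, v x)) *\<^sub>R gr u x + (F2 (f n x, g n x) - F2 (u x, v x)) *\<^sub>R gr v x" for n x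
  have [measurable]: "A n \<in> borel_measurable M" "B n \<in> borel_measurable M" for n
    unfolding A_def[abs_def] B_def[abs_def] by measurable
  have An: "norm (A n x) \<le> norm (L *\<^sub>R (gr (f n) x - gr u x)) + norm (L *\<^sub>R (gr (g n) x - gr v x))" for n x
    unfolding A_def using bnd L_nonneg
    by (intro order_trans[OF norm_triangle_ineq] add_mono) (auto intro!: mult_right_mono)
  have AL: "A n \<in> Lr" for n
    by (rule Lr_add_bound(1)[OF _ _ _ AE_I2[OF An]]) (auto intro!: Lr_scaleR Lr_diff f' g' U V)
  have A0: "(\<lambda>n. Nr (A n)) \<longlonglongrightarrow> 0"
  proof (rule tendsto_Nr_le[OF _ conjunct2[OF lim'(1)] conjunct2[OF lim'(2)]])
    fix n
    have "Nr (A n) \<le> 2 powr r * (Nr (\<lambda>x. L *\<^sub>R (gr (f n) x - gr u x)) + Nr (\<lambda>x. L *\<^sub>R (gr (g n) x - gr v x)))"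
      by (rule Lr_add_bound(2)[OF _ _ _ AE_I2[OF An]]) (auto intro!: Lr_scaleR Lr_diff f' g' U V)
    also have "\<dots> \<le> 2 powr r * (L powr r * Nr (\<lambda>x. gr (f n) x - gr u x) + L powr r * Nr (\<lambda>x. gr (g n) x - gr v x))"
      by (intro mult_left_mono add_mono sc Lr_diff f' g' U V) auto
    finally show "Nr (A n) \<le> (2 powr r * L powr r) * (Nr (\<lambda>x. gr (f n) x - gr u x) + Nr (\<lambda>x. gr (g n) x - gr v x))"
      by (simp add: algebra_simps)
  qed
  have GL: "(\<lambda>x. (2 * L) *\<^sub>R (norm (gr u x) + norm (gr v x))) \<in> Lr"
    by (intro Lr_scaleR Lr_add Lr_norm U V)
  have Bn: "norm (B n x) \<le> norm ((2 * L) *\<^sub>R (norm (gr u x) + norm (gr v x)))" for n x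
  proof -
    have "\<bar>F1 (f n x, g n x) - F1 (u x, v x)\<bar> \<le> 2 * L" "\<bar>F2 (f n x, g n x) - F2 (u x, v x)\<bar> \<le> 2 * L"
      using bnd(1)[of "(f n x, g n x)"] bnd(1)[of "(u x, v x)"] bnd(2)[of "(f n x, g n x)"] bnd(2)[of "(u x, v x)"]
      by linarith+
    then have "norm (B n x) \<le> (2 * L) * norm (gr u x) + (2 * L) * norm (gr v x)"
      unfolding B_def by (intro order_trans[OF norm_triangle_ineq] add_mono) (auto intro!: mult_right_mono)
    then show ?thesis using L_nonneg by (simp add: algebra_simps)
  qed
  have BL: "B n \<in> Lr" for n
    by (rule Lr_bound(1)[OF GL, of _ 1]) (use Bn in auto)
  have B0: "(\<lambda>n. Nr (B n)) \<longlonglongrightarrow> 0"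
  proof (rule Lr_dominated[OF _ GL])
    show "AE x in M. (\<lambda>n. B n x) \<longlonglongrightarrow> 0"
      using ae
    proof eventually_elim
      case (elim x)
      then have "(\<lambda>n. (f n x, g n x)) \<longlonglongrightarrow> (u x, v x)" by (intro tendsto_Pair)
      then have "(\<lambda>n. F1 (f n x, g n x)) \<longlonglongrightarrow> F1 (u x, v x)" "(\<lambda>n. F2 (f n x, g n x)) \<longlonglongrightarrow> F2 (u x, v x)"
        using cont by (auto simp: continuous_on_eq_continuous_at intro!: isCont_tendsto_compose[of "(u x, v x)" F1] isCont_tendsto_compose[of "(u x, v x)" F2])
      then have "(\<lambda>n. B n x) \<longlonglongrightarrow> (F1 (u x, v x) - F1 (u x, v x)) *\<^sub>R gr u x + (F2 (u x, v x) - F2 (u x, v x)) *\<^sub>R gr v x"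
        unfolding B_def by (intro tendsto_intros)
      then show ?case by simp
    qed
  qed (use Bn in auto)
  show "(\<lambda>n. Nr (\<lambda>x. gr (\<lambda>x. F (f n x) (g n x)) x - gr (\<lambda>x. F (u x) (v x)) x)) \<longlonglongrightarrow> 0"
  proof (rule tendsto_Nr_le[OF _ A0 B0])
    fix n
    note W = W1D(2)[OF W1_chain(1)[OF C f g]] W1D(2)[OF W1_chain(1)[OF C u v]]
    show "Nr (\<lambda>x. gr (\<lambda>x. F (f n x) (g n x)) x - gr (\<lambda>x. F (u x) (v x)) x) \<le> 2 powr r * (Nr (A n) + Nr (B n))"
    proof (rule Lr_add_bound(2)[OF AL BL Lr_measurable[OF Lr_diff[OF W]]])
      show "AE x in M. norm (gr (\<lambda>x. F (f n x) (g n x)) x - gr (\<lambda>x. F (u x) (v x)) x) \<le> norm (A n x) + norm (B n x)"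
        using W1_chain(2)[OF C f[of n] g[of n]] W1_chain(2)[OF C u v]
      proof eventually_elim
        case (elim x)
        have "gr (\<lambda>x. F (f n x) (g n x)) x - gr (\<lambda>x. F (u x) (v x)) x = A n x + B n x"
          unfolding elim A_def B_def by (simp add: algebra_simps)
        then show ?case by (simp add: norm_triangle_ineq)
      qed
    qed
  qed
qed

text \<open>The two sequences are paired into one with values in the product space, so that a single
  subsequence serves both.\<close>

lemma W1_tendsto_common_subseq:
  assumes u: "u \<in> W1 r \<Omega>" and v: "v \<in> W1 r \<Omega>"
    and f: "\<And>n. f n \<in> W1 r \<Omega>" and g: "\<And>n. g n \<in> W1 r \<Omega>"
    and lim: "W1_tendsto f u" "W1_tendsto g v"
  obtains s :: "nat \<Rightarrow> nat" where "strict_mono s"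
    "AE x in M. (\<lambda>n. f (s n) x) \<longlonglongrightarrow> u x" "AE x in M. (\<lambda>n. g (s n) x) \<longlonglongrightarrow> v x"
proof -
  note lim' = lim[unfolded W1_tendsto_def]
  note U = W1D(1)[OF u] note V = W1D(1)[OF v] note f' = W1D(1)[OF f] note g' = W1D(1)[OF g]
  define h where "h n x = (f n x - u x, g n x - v x)" for n x
  have m: "h n \<in> borel_measurable M" for n
    unfolding h_def[abs_def] using Lr_measurable[OF Lr_diff[OF f' U]] Lr_measurable[OF Lr_diff[OF g' V]]
    by (simp add: borel_prod[symmetric])
  have n: "norm (h n x) \<le> norm (f n x - u x) + norm (g n x - v x)" for n x
    unfolding h_def by (rule norm_Pair_le)
  have h: "h n \<in> Lr" for n
    by (rule Lr_add_bound(1)[OF Lr_diff[OF f' U] Lr_diff[OF g' V] m AE_I2[OF n]])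
  have h0: "(\<lambda>n. Nr (h n)) \<longlonglongrightarrow> 0"
    by (rule tendsto_Nr_le[OF Lr_add_bound(2)[OF Lr_diff[OF f' U] Lr_diff[OF g' V] m AE_I2[OF n]]
        conjunct1[OF lim'(1)] conjunct1[OF lim'(2)]])
  obtain s where s: "strict_mono s" "AE x in M. (\<lambda>n. h (s n) x) \<longlonglongrightarrow> 0" using Lr_tendsto_AE_subseq[OF h h0] .
  show thesis
  proof (rule that[OF s(1)])
    show "AE x in M. (\<lambda>n. f (s n) x) \<longlonglongrightarrow> u x"
      using s(2)
    proof eventually_elim
      case (elim x)
      then show ?case using tendsto_fst[OF elim] by (simp add: h_def LIM_zero_iff)
    qed
    show "AE x in M. (\<lambda>n. g (s n) x) \<longlonglongrightarrow> v x"
      using s(2)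
    proof eventually_elim
      case (elim x)
      then show ?case using tendsto_snd[OF elim] by (simp add: h_def LIM_zero_iff)
    qed
  qed
qed

text \<open>Zero boundary values are preserved as soon as the outer function maps pairs of test
  functions to test functions: the images approximate, along a subsequence that converges almost
  everywhere.\<close>

lemma W1_0_chain:
  assumes C: "C1_pair F F1 F2 L" and u: "u \<in> W1_0 r \<Omega>" and v: "v \<in> W1_0 r \<Omega>"
    and t: "\<And>\<phi> \<psi>. \<phi> \<in> test_functions \<Omega> \<Longrightarrow> \<psi> \<in> test_functions \<Omega> \<Longrightarrow> (\<lambda>x. F (\<phi> x) (\<psi> x)) \<in> test_functions \<Omega>"
  shows "(\<lambda>x. F (u x) (v x)) \<in> W1_0 r \<Omega>"
proof -
  note U = W1_0D[OF u] note V = W1_0D[OF v]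
  obtain \<phi> where p: "\<And>n. \<phi> n \<in> test_functions \<Omega>" "W1_tendsto \<phi> u" using W1_0_sequence[OF u] by metis
  obtain \<psi> where q: "\<And>n. \<psi> n \<in> test_functions \<Omega>" "W1_tendsto \<psi> v" using W1_0_sequence[OF v] by metis
  obtain s where s: "strict_mono s"
    "AE x in M. (\<lambda>n. \<phi> (s n) x) \<longlonglongrightarrow> u x" "AE x in M. (\<lambda>n. \<psi> (s n) x) \<longlonglongrightarrow> v x"
    using W1_tendsto_common_subseq[OF U V test_W1(1)[OF p(1)] test_W1(1)[OF q(1)] p(2) q(2)] .
  show ?thesis
  proof (rule W1_0_closed[OF W1_chain(1)[OF C U V]])
    show "W1_tendsto (\<lambda>n x. F (\<phi> (s n) x) (\<psi> (s n) x)) (\<lambda>x. F (u x) (v x))"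
      by (rule W1_tendsto_chain_AE[OF C U V test_W1(1)[OF p(1)] test_W1(1)[OF q(1)]
            W1_tendsto_subseq[OF p(2) s(1)] W1_tendsto_subseq[OF q(2) s(1)] s(2,3)])
    show "(\<lambda>x. F (\<phi> (s n) x) (\<psi> (s n) x)) \<in> W1_0 r \<Omega>" for n
      by (rule test_W1_0[OF t[OF p(1) q(1)]])
  qed
qed

lemma W1_0_lincomb:
  assumes "u \<in> W1_0 r \<Omega>" "v \<in> W1_0 r \<Omega>"
  shows "(\<lambda>x. a * u x + b * v x) \<in> W1_0 r \<Omega>"
proof (rule W1_0_chain[OF C1_pair_lincomb assms])
  fix \<phi> \<psi> assume t: "\<phi> \<in> test_functions \<Omega>" "\<psi> \<in> test_functions \<Omega>"
  show "(\<lambda>x. a * \<phi> x + b * \<psi> x) \<in> test_functions \<Omega>"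
    by (rule test_functions_pair[OF t]) (auto intro!: Ck_on_add Ck_on_cmult test_functions_Ck[OF t(1)] test_functions_Ck[OF t(2)])
qed

lemma W1_0_diff:
  assumes "u \<in> W1_0 r \<Omega>" "v \<in> W1_0 r \<Omega>"
  shows "(\<lambda>x. u x - v x) \<in> W1_0 r \<Omega>"
  using W1_0_lincomb[OF assms, of 1 "-1"] by simp

text \<open>The common Lipschitz constant L, together with F n 0 0 = 0, dominates values and
  gradients by fixed functions of class \<open>Lr\<close>. Convergence in the Sobolev norm is stated
  separately because it is what carries zero boundary values to the limit.\<close>

lemma W1_regularized_limit:
  assumes C: "\<And>n::nat. C1_pair (F n) (F1 n) (F2 n) L" and F0: "\<And>n. F n 0 0 = 0"
    and u: "u \<in> W1 r \<Omega>" and v: "v \<in> W1 r \<Omega>"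
    and lim: "\<And>x. (\<lambda>n. F n (u x) (v x)) \<longlonglongrightarrow> w x" "\<And>x. (\<lambda>n. F1 n (u x, v x)) \<longlonglongrightarrow> f1 x"
      "\<And>x. (\<lambda>n. F2 n (u x, v x)) \<longlonglongrightarrow> f2 x"
  shows "w \<in> W1 r \<Omega>" "AE x in M. gr w x = f1 x *\<^sub>R gr u x + f2 x *\<^sub>R gr v x"
    "W1_tendsto (\<lambda>n x. F n (u x) (v x)) w"
proof -
  note U = W1D[OF u] note V = W1D[OF v]
  note [measurable] = Lr_measurable[OF U(1)] Lr_measurable[OF U(2)] Lr_measurable[OF V(1)] Lr_measurable[OF V(2)]
    C1_pair.F_meas[OF C]
  note L0 = C1_pair.L_nonneg[OF C] note bnd = C1_pair.bnd[OF C]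
  define G where "G x = f1 x *\<^sub>R gr u x + f2 x *\<^sub>R gr v x" for x
  define g where "g x = L *\<^sub>R (norm (u x) + norm (v x))" for x
  define g' where "g' x = L *\<^sub>R (norm (gr u x) + norm (gr v x))" for x
  have g: "g \<in> Lr" unfolding g_def[abs_def] by (intro Lr_scaleR Lr_add Lr_norm U V)
  have g': "g' \<in> Lr" unfolding g'_def[abs_def] by (intro Lr_scaleR Lr_add Lr_norm U V)
  have f12 [measurable]: "w \<in> borel_measurable M" "f1 \<in> borel_measurable M" "f2 \<in> borel_measurable M"
    by (rule borel_measurable_LIMSEQ_metric[OF _ lim(1)], measurable)
      (rule borel_measurable_LIMSEQ_metric[OF _ lim(2)], measurable,
        rule borel_measurable_LIMSEQ_metric[OF _ lim(3)], measurable)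
  have Gm [measurable]: "G \<in> borel_measurable M" unfolding G_def[abs_def] by measurable
  have Fb: "\<bar>F n (u x) (v x)\<bar> \<le> g x" for n x
    using C1_pair.uniform_bound[OF C, of n "u x" "v x"] by (simp add: F0 g_def)
  define H where "H n x = F1 n (u x, v x) *\<^sub>R gr u x + F2 n (u x, v x) *\<^sub>R gr v x" for n x
  have Hm [measurable]: "H n \<in> borel_measurable M" for n unfolding H_def[abs_def] by measurable
  have Hb: "norm (H n x) \<le> g' x" for n x
  proof -
    have "norm (H n x) \<le> L * norm (gr u x) + L * norm (gr v x)"
      unfolding H_def using bnd by (intro order_trans[OF norm_triangle_ineq] add_mono) (auto intro!: mult_right_mono)
    then show ?thesis by (simp add: g'_def algebra_simps)
  qed
  have HG: "(\<lambda>n. H n x) \<longlonglongrightarrow> G x" for x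
    unfolding H_def G_def by (intro tendsto_intros lim)
  have wb: "\<bar>w x\<bar> \<le> g x" for x
    by (rule LIMSEQ_le_const2[OF tendsto_rabs[OF lim(1)]]) (use Fb in auto)
  have Gb: "norm (G x) \<le> g' x" for x
    by (rule LIMSEQ_le_const2[OF tendsto_norm[OF HG]]) (use Hb in auto)
  have wL: "w \<in> Lr"
  proof (rule Lr_bound(1)[OF g, of _ 1])
    show "AE x in M. norm (w x) \<le> 1 * norm (g x)"
      using wb by (intro AE_I2) (smt (verit) real_norm_def)
  qed simp
  have GL: "G \<in> Lr"
  proof (rule Lr_bound(1)[OF g', of _ 1])
    show "AE x in M. norm (G x) \<le> 1 * norm (g' x)"
      using Gb by (intro AE_I2) (smt (verit) real_norm_def)
  qed simp
  have FW: "(\<lambda>x. F n (u x) (v x)) \<in> W1 r \<Omega>" for n by (rule W1_chain(1)[OF C u v])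
  have hw: "has_weak_gradient \<Omega> w G"
  proof (rule hwg_dominated_limit[OF \<Omega>, where f = "\<lambda>n x. F n (u x) (v x)" and F = H])
    show "has_weak_gradient \<Omega> (\<lambda>x. F n (u x) (v x)) (H n)" for n
      unfolding H_def[abs_def] by (rule C1_pair.hwg_chain[OF C \<Omega> U(3) V(3)])
    show "locally_integrable_on g \<Omega>" "locally_integrable_on g' \<Omega>" by (intro Lr_locally_integrable g g')+
  qed (use Fb Hb HG lim in auto)
  show w: "w \<in> W1 r \<Omega>" by (rule W1I(1)[OF wL GL hw])
  show gw: "AE x in M. gr w x = f1 x *\<^sub>R gr u x + f2 x *\<^sub>R gr v x"
    using W1I(2)[OF wL GL hw] by (simp add: G_def)
  have a: "(\<lambda>n. Nr (\<lambda>x. F n (u x) (v x) - w x)) \<longlonglongrightarrow> 0"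
  proof (rule Lr_dominated[OF _ Lr_scaleR[OF g, of 2]])
    show "AE x in M. norm (F n (u x) (v x) - w x) \<le> norm (2 *\<^sub>R g x)" for n
    proof (rule AE_I2)
      fix x show "norm (F n (u x) (v x) - w x) \<le> norm (2 *\<^sub>R g x)" using Fb[of n x] wb[of x] by simp
    qed
    show "AE x in M. (\<lambda>n. F n (u x) (v x) - w x) \<longlonglongrightarrow> 0" using lim(1) by (simp add: LIM_zero_iff)
  qed measurable
  have b: "(\<lambda>n. Nr (\<lambda>x. H n x - G x)) \<longlonglongrightarrow> 0"
  proof (rule Lr_dominated[OF _ Lr_scaleR[OF g', of 2]])
    show "AE x in M. norm (H n x - G x) \<le> norm (2 *\<^sub>R g' x)" for n
    proof (rule AE_I2)
      fix x show "norm (H n x - G x) \<le> norm (2 *\<^sub>R g' x)"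
        using Hb[of n x] Gb[of x] norm_triangle_ineq4[of "H n x" "G x"] by simp
    qed
    show "AE x in M. (\<lambda>n. H n x - G x) \<longlonglongrightarrow> 0" using HG by (simp add: LIM_zero_iff)
  qed measurable
  have "Nr (\<lambda>x. gr (\<lambda>x. F n (u x) (v x)) x - gr w x) = Nr (\<lambda>x. H n x - G x)" for n
  proof (rule Nr_cong_AE)
    show "AE x in M. gr (\<lambda>x. F n (u x) (v x)) x - gr w x = H n x - G x"
      using W1_chain(2)[OF C u v, of n] gw by eventually_elim (simp add: H_def G_def)
    show "(\<lambda>x. gr (\<lambda>x. F n (u x) (v x)) x - gr w x) \<in> borel_measurable M"
      by (rule Lr_measurable[OF Lr_diff[OF W1D(2)[OF FW] W1D(2)[OF w]]])
  qed measurable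
  then show "W1_tendsto (\<lambda>n x. F n (u x) (v x)) w" unfolding W1_tendsto_def using a b by simp
qed

end

section \<open>Power means of Sobolev functions\<close>

text \<open>Absolute values make the mean total. This matters even for nonnegative functions,
  because the test functions that approximate them may change sign.\<close>

definition qmean :: "real \<Rightarrow> real \<Rightarrow> real \<Rightarrow> real \<Rightarrow> real" where
  "qmean q t a b = ((1 - t) * \<bar>a\<bar> powr q + t * \<bar>b\<bar> powr q) powr (1 / q)"

text \<open>The partial derivative in the first variable; the other one arises by exchanging t with
  1 - t and a with b. At a = 0, and in particular at the origin where the mean is not
  differentiable, the value is 0, which is also the limit of the regularised derivatives.\<close>

definition qmean_deriv :: "real \<Rightarrow> real \<Rightarrow> real \<Rightarrow> real \<Rightarrow> real" where
  "qmean_deriv q t a b = (1 - t) * ((1 - t) * \<bar>a\<bar> powr q + t * \<bar>b\<bar> powr q) powr (1 / q - 1) * (\<bar>a\<bar> powr (q - 1) * sgn a)"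

definition qreg_sum :: "real \<Rightarrow> real \<Rightarrow> real \<Rightarrow> real \<Rightarrow> real \<Rightarrow> real" where
  "qreg_sum q t \<epsilon> a b = (1 - t) * (a\<^sup>2 + \<epsilon>\<^sup>2) powr (q / 2) + t * (b\<^sup>2 + \<epsilon>\<^sup>2) powr (q / 2)"

text \<open>Replacing |a| by the root of a^2 + \<epsilon>^2 keeps the base of every power positive,
  so the result is smooth. Subtracting \<epsilon> restores the value 0 at the origin, and with it
  compact supports.\<close>

definition qreg :: "real \<Rightarrow> real \<Rightarrow> real \<Rightarrow> real \<Rightarrow> real \<Rightarrow> real" where
  "qreg q t \<epsilon> a b = qreg_sum q t \<epsilon> a b powr (1 / q) - \<epsilon>"

definition qreg_deriv :: "real \<Rightarrow> real \<Rightarrow> real \<Rightarrow> real \<Rightarrow> real \<Rightarrow> real" where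
  "qreg_deriv q t \<epsilon> a b = (1 - t) * qreg_sum q t \<epsilon> a b powr (1 / q - 1) * ((a\<^sup>2 + \<epsilon>\<^sup>2) powr (q / 2 - 1) * a)"

lemma sum_squares_powr:
  fixes a \<epsilon> :: real
  assumes "0 < \<epsilon>"
  shows "0 < a\<^sup>2 + \<epsilon>\<^sup>2" "0 < (a\<^sup>2 + \<epsilon>\<^sup>2) powr s"
proof -
  show "0 < a\<^sup>2 + \<epsilon>\<^sup>2" using assms by (intro add_nonneg_pos) auto
  then show "0 < (a\<^sup>2 + \<epsilon>\<^sup>2) powr s" by (metis less_irrefl powr_gt_zero)
qed

lemma qreg_sum_pos:
  assumes "0 < t" "t < 1" "0 < \<epsilon>"
  shows "0 < qreg_sum q t \<epsilon> a b"
  unfolding qreg_sum_def using assms sum_squares_powr(2)[OF assms(3)] by (intro add_pos_pos mult_pos_pos) auto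

lemma qreg_sum_commute: "qreg_sum q (1 - t) \<epsilon> b a = qreg_sum q t \<epsilon> a b"
  by (simp add: qreg_sum_def)

lemma qreg_commute: "qreg q (1 - t) \<epsilon> b a = qreg q t \<epsilon> a b"
  by (simp add: qreg_def qreg_sum_commute)

lemma qreg_zero: "0 < \<epsilon> \<Longrightarrow> 0 < q \<Longrightarrow> qreg q t \<epsilon> 0 0 = 0"
proof -
  assume "0 < \<epsilon>" "0 < q"
  have "qreg_sum q t \<epsilon> 0 0 = (\<epsilon>\<^sup>2) powr (q / 2)" by (simp add: qreg_sum_def algebra_simps)
  also have "\<dots> = \<epsilon> powr q" using \<open>0 < \<epsilon>\<close> by (simp add: powr_powr flip: powr_numeral)
  finally show ?thesis using \<open>0 < \<epsilon>\<close> \<open>0 < q\<close> by (simp add: qreg_def powr_powr)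
qed

lemma qreg_has_derivative:
  assumes q: "1 < q" and t: "0 < t" "t < 1" and \<epsilon>: "0 < \<epsilon>"
  shows "((\<lambda>a. qreg q t \<epsilon> a b) has_real_derivative qreg_deriv q t \<epsilon> a b) (at a)"
proof -
  have 1: "((\<lambda>a. (a\<^sup>2 + \<epsilon>\<^sup>2) powr (q / 2)) has_real_derivative (q / 2) * (a\<^sup>2 + \<epsilon>\<^sup>2) powr (q / 2 - 1) * (2 * a)) (at a)"
    using sum_squares_powr(1)[OF \<epsilon>, of a]
    by (auto intro!: derivative_eq_intros DERIV_fun_powr simp: powr_diff field_simps)
  have "((\<lambda>a. qreg_sum q t \<epsilon> a b) has_real_derivative (1 - t) * ((q / 2) * (a\<^sup>2 + \<epsilon>\<^sup>2) powr (q / 2 - 1) * (2 * a)) + 0) (at a)"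
    unfolding qreg_sum_def by (intro DERIV_add DERIV_cmult 1 DERIV_const)
  then have 2: "((\<lambda>a. qreg_sum q t \<epsilon> a b) has_real_derivative (1 - t) * q * ((a\<^sup>2 + \<epsilon>\<^sup>2) powr (q / 2 - 1) * a)) (at a)"
    by (rule DERIV_cong) simp
  from DERIV_fun_powr[OF 2 qreg_sum_pos[OF t \<epsilon>], of "1 / q"]
  have "((\<lambda>a. qreg_sum q t \<epsilon> a b powr (1 / q)) has_real_derivative
    1 / q * qreg_sum q t \<epsilon> a b powr (1 / q - of_nat 1) * ((1 - t) * q * ((a\<^sup>2 + \<epsilon>\<^sup>2) powr (q / 2 - 1) * a))) (at a)" .
  then have "((\<lambda>a. qreg q t \<epsilon> a b) has_real_derivative
    1 / q * qreg_sum q t \<epsilon> a b powr (1 / q - of_nat 1) * ((1 - t) * q * ((a\<^sup>2 + \<epsilon>\<^sup>2) powr (q / 2 - 1) * a)) - 0) (at a)"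
    unfolding qreg_def by (intro DERIV_diff DERIV_const)
  then show ?thesis
    by (rule DERIV_cong) (use q in \<open>simp add: qreg_deriv_def\<close>)
qed

text \<open>The exponent 1/q - 1 is negative, so the second summand of \<open>qreg_sum\<close> may
  be dropped. With |a| at most P powr (1/2), homogeneity leaves P to the power 0: the bound is
  uniform in \<epsilon>, as the limit requires.\<close>

lemma qreg_deriv_bound:
  assumes q: "1 < q" and t: "0 < t" "t < 1" and \<epsilon>: "0 < \<epsilon>"
  shows "\<bar>qreg_deriv q t \<epsilon> a b\<bar> \<le> 1"
proof -
  define P where "P = a\<^sup>2 + \<epsilon>\<^sup>2"
  define S where "S = qreg_sum q t \<epsilon> a b"
  have P: "0 < P" using sum_squares_powr(1)[OF \<epsilon>] by (simp add: P_def)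
  have aP: "\<bar>a\<bar> \<le> P powr (1/2)"
    using real_sqrt_le_mono[of "a\<^sup>2" P] by (simp add: P_def powr_half_sqrt)
  have SP: "(1 - t) * P powr (q/2) \<le> S" using t by (simp add: S_def P_def qreg_sum_def)
  have p0: "0 < (1 - t) * P powr (q/2)" using t P by simp
  have "S powr (1/q - 1) \<le> ((1 - t) * P powr (q/2)) powr (1/q - 1)"
    using p0 SP q by (intro powr_mono2') auto
  also have "\<dots> = (1 - t) powr (1/q - 1) * P powr ((q/2) * (1/q - 1))"
    using t by (simp add: powr_mult powr_powr)
  finally have S: "S powr (1/q - 1) \<le> (1 - t) powr (1/q - 1) * P powr ((q/2) * (1/q - 1))" .
  have "\<bar>qreg_deriv q t \<epsilon> a b\<bar> = (1 - t) * S powr (1/q - 1) * (P powr (q/2 - 1) * \<bar>a\<bar>)"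
    using t by (simp add: qreg_deriv_def S_def P_def abs_mult)
  also have "\<dots> \<le> (1 - t) * ((1 - t) powr (1/q - 1) * P powr ((q/2) * (1/q - 1))) * (P powr (q/2 - 1) * P powr (1/2))"
    using t by (intro mult_mono mult_left_mono S aP) auto
  also have "\<dots> = ((1 - t) powr 1 * (1 - t) powr (1/q - 1)) * (P powr ((q/2) * (1/q - 1)) * (P powr (q/2 - 1) * P powr (1/2)))"
    using t by simp
  also have "\<dots> = (1 - t) powr (1/q) * P powr ((q/2) * (1/q - 1) + (q/2 - 1) + 1/2)"
    unfolding powr_add[symmetric] by (simp add: add.assoc)
  also have "(q/2) * (1/q - 1) + (q/2 - 1) + 1/2 = 0" using q by (simp add: field_simps)
  also have "(1 - t) powr (1/q) * P powr 0 \<le> 1" using t q P by (simp add: powr_le1)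
  finally show ?thesis .
qed

lemma qreg_deriv_continuous:
  assumes t: "0 < t" "t < 1" and \<epsilon>: "0 < \<epsilon>"
  shows "continuous_on UNIV (\<lambda>z. qreg_deriv q t \<epsilon> (fst z) (snd z))"
proof -
  have "qreg_sum q t \<epsilon> a b \<noteq> 0" for a b using qreg_sum_pos[OF t \<epsilon>, of q a b] by simp
  moreover have "a\<^sup>2 + \<epsilon>\<^sup>2 \<noteq> 0" for a :: real using sum_squares_powr(1)[OF \<epsilon>, of a] by linarith
  ultimately show ?thesis
    unfolding qreg_deriv_def qreg_sum_def by (intro continuous_intros) auto
qed

lemma C1_pair_qreg:
  assumes q: "1 < q" and t: "0 < t" "t < 1" and \<epsilon>: "0 < \<epsilon>"
  shows "C1_pair (qreg q t \<epsilon>) (\<lambda>z. qreg_deriv q t \<epsilon> (fst z) (snd z)) (\<lambda>z. qreg_deriv q (1 - t) \<epsilon> (snd z) (fst z)) 1"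
proof
  have t': "0 < 1 - t" "1 - t < 1" using t by auto
  show "((\<lambda>a. qreg q t \<epsilon> a b) has_real_derivative qreg_deriv q t \<epsilon> (fst (a, b)) (snd (a, b))) (at a)" for a b
    using qreg_has_derivative[OF q t \<epsilon>] by simp
  show "(qreg q t \<epsilon> a has_real_derivative qreg_deriv q (1 - t) \<epsilon> (snd (a, b)) (fst (a, b))) (at b)" for a b
    using qreg_has_derivative[OF q t' \<epsilon>, of a b] by (simp add: qreg_commute)
  show "continuous_on UNIV (\<lambda>z. qreg_deriv q t \<epsilon> (fst z) (snd z))"
    by (rule qreg_deriv_continuous[OF t \<epsilon>])
  have "continuous_on UNIV (\<lambda>z. (snd z, fst z) :: real \<times> real)" by (intro continuous_intros)
  from continuous_on_compose2[OF qreg_deriv_continuous[OF t' \<epsilon>, of q] this]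
  show "continuous_on UNIV (\<lambda>z. qreg_deriv q (1 - t) \<epsilon> (snd z) (fst z))" by simp
qed (use qreg_deriv_bound[OF q _ _ \<epsilon>] t in auto)

lemma square_powr_half: "((a::real)\<^sup>2) powr s = \<bar>a\<bar> powr (2 * s)"
proof -
  have "a\<^sup>2 = \<bar>a\<bar> powr 2" by (cases "a = 0") (auto simp: powr_numeral)
  then show ?thesis by (simp only: powr_powr)
qed

lemma qreg_sum_tendsto:
  assumes q: "1 < q" and e: "e \<longlonglongrightarrow> 0"
  shows "(\<lambda>n. qreg_sum q t (e n) a b) \<longlonglongrightarrow> (1 - t) * \<bar>a\<bar> powr q + t * \<bar>b\<bar> powr q"
proof -
  have "(\<lambda>n. (a\<^sup>2 + (e n)\<^sup>2) powr (q / 2)) \<longlonglongrightarrow> (a\<^sup>2 + 0\<^sup>2) powr (q / 2)" for a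
    by (intro tendsto_powr' tendsto_intros e) (use q in \<open>auto intro!: always_eventually\<close>)
  then have lim: "(\<lambda>n. (a\<^sup>2 + (e n)\<^sup>2) powr (q / 2)) \<longlonglongrightarrow> \<bar>a\<bar> powr q" for a
    by (simp add: square_powr_half)
  show ?thesis unfolding qreg_sum_def by (intro tendsto_add tendsto_mult_left lim)
qed

lemma qreg_tendsto:
  assumes q: "1 < q" and t: "0 < t" "t < 1" and e: "e \<longlonglongrightarrow> 0" "\<And>n. 0 < e n"
  shows "(\<lambda>n. qreg q t (e n) a b) \<longlonglongrightarrow> qmean q t a b"
proof -
  have "(\<lambda>n. qreg_sum q t (e n) a b powr (1 / q)) \<longlonglongrightarrow> qmean q t a b"
    unfolding qmean_def
    by (intro tendsto_powr' qreg_sum_tendsto[OF q e(1)] tendsto_const)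
      (use q qreg_sum_pos[OF t e(2)] in \<open>auto intro!: always_eventually less_imp_le\<close>)
  from tendsto_diff[OF this e(1)] show ?thesis by (simp add: qreg_def)
qed

lemma qreg_deriv_tendsto:
  assumes q: "1 < q" and t: "0 < t" "t < 1" and e: "e \<longlonglongrightarrow> 0"
  shows "(\<lambda>n. qreg_deriv q t (e n) a b) \<longlonglongrightarrow> qmean_deriv q t a b"
proof (cases "a = 0")
  case True
  then show ?thesis by (simp add: qreg_deriv_def qmean_deriv_def)
next
  case False
  have S0: "(1 - t) * \<bar>a\<bar> powr q + t * \<bar>b\<bar> powr q \<noteq> 0"
  proof -
    have "0 < (1 - t) * \<bar>a\<bar> powr q" "0 \<le> t * \<bar>b\<bar> powr q" using t False by auto
    then show ?thesis by linarith
  qed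
  have "(\<lambda>n. (a\<^sup>2 + (e n)\<^sup>2) powr (q / 2 - 1)) \<longlonglongrightarrow> (a\<^sup>2 + 0\<^sup>2) powr (q / 2 - 1)"
    by (intro tendsto_powr tendsto_intros e) (use False in auto)
  then have "(\<lambda>n. (a\<^sup>2 + (e n)\<^sup>2) powr (q / 2 - 1) * a) \<longlonglongrightarrow> \<bar>a\<bar> powr (q - 2) * a"
    by (intro tendsto_mult_right) (simp add: square_powr_half right_diff_distrib)
  also have "\<bar>a\<bar> powr (q - 2) * a = \<bar>a\<bar> powr (q - 1) * sgn a"
  proof -
    have "\<bar>a\<bar> powr (q - 1) = \<bar>a\<bar> powr (q - 2) * \<bar>a\<bar> powr 1" unfolding powr_add[symmetric] by simp
    then have "\<bar>a\<bar> powr (q - 1) * sgn a = \<bar>a\<bar> powr (q - 2) * (\<bar>a\<bar> * sgn a)" using False by simp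
    also have "\<bar>a\<bar> * sgn a = a" by (rule abs_mult_sgn)
    finally show ?thesis ..
  qed
  finally have lim: "(\<lambda>n. (a\<^sup>2 + (e n)\<^sup>2) powr (q / 2 - 1) * a) \<longlonglongrightarrow> \<bar>a\<bar> powr (q - 1) * sgn a" .
  show ?thesis
    unfolding qreg_deriv_def qmean_deriv_def
    by (rule tendsto_mult[OF tendsto_mult[OF tendsto_const tendsto_powr[OF qreg_sum_tendsto[OF q e] tendsto_const S0]] lim])
qed

lemma Ck_on_qreg:
  assumes q: "1 < q" and t: "0 < t" "t < 1" and \<epsilon>: "0 < \<epsilon>"
    and "Ck_on k UNIV \<phi>" "Ck_on k UNIV \<psi>"
  shows "Ck_on k UNIV (\<lambda>x. qreg q t \<epsilon> (\<phi> x) (\<psi> x))"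
proof -
  have sq: "Ck_on k UNIV (\<lambda>x. ((f x)\<^sup>2 + \<epsilon>\<^sup>2) powr (q / 2))" if "Ck_on k UNIV f" for f :: "'a \<Rightarrow> real"
    unfolding power2_eq_square[of "f _"]
    by (intro Ck_on_powr Ck_on_add Ck_on_mult that Ck_on_const)
      (use sum_squares_powr(1)[OF \<epsilon>] in \<open>simp add: power2_eq_square\<close>)
  have "Ck_on k UNIV (\<lambda>x. qreg_sum q t \<epsilon> (\<phi> x) (\<psi> x))"
    unfolding qreg_sum_def by (intro Ck_on_add Ck_on_cmult sq assms)
  then have "Ck_on k UNIV (\<lambda>x. qreg_sum q t \<epsilon> (\<phi> x) (\<psi> x) powr (1 / q) + - \<epsilon>)"
    by (intro Ck_on_add Ck_on_powr Ck_on_const qreg_sum_pos[OF t \<epsilon>])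
  then show ?thesis by (simp add: qreg_def)
qed

context bounded_open
begin

lemma W1_qmean:
  assumes q: "1 < q" and t: "0 < t" "t < 1" and u: "u \<in> W1 r \<Omega>" and v: "v \<in> W1 r \<Omega>"
  shows "(\<lambda>x. qmean q t (u x) (v x)) \<in> W1 r \<Omega>"
    "AE x in M. gr (\<lambda>x. qmean q t (u x) (v x)) x =
       qmean_deriv q t (u x) (v x) *\<^sub>R gr u x + qmean_deriv q (1 - t) (v x) (u x) *\<^sub>R gr v x"
    "u \<in> W1_0 r \<Omega> \<Longrightarrow> v \<in> W1_0 r \<Omega> \<Longrightarrow> (\<lambda>x. qmean q t (u x) (v x)) \<in> W1_0 r \<Omega>"
proof -
  define e where "e n = inverse (real (Suc n))" for n
  have e: "e \<longlonglongrightarrow> 0" "\<And>n. 0 < e n" unfolding e_def using LIMSEQ_inverse_real_of_nat by auto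
  have t': "0 < 1 - t" "1 - t < 1" using t by auto
  have q0: "0 < q" using q by simp
  have l1: "(\<lambda>n. qreg_deriv q t (e n) (fst (u x, v x)) (snd (u x, v x))) \<longlonglongrightarrow> qmean_deriv q t (u x) (v x)" for x
    using qreg_deriv_tendsto[OF q t e(1)] by simp
  have l2: "(\<lambda>n. qreg_deriv q (1 - t) (e n) (snd (u x, v x)) (fst (u x, v x))) \<longlonglongrightarrow> qmean_deriv q (1 - t) (v x) (u x)" for x
    using qreg_deriv_tendsto[OF q t' e(1)] by simp
  note R = W1_regularized_limit[OF C1_pair_qreg[OF q t e(2)] qreg_zero[OF e(2) q0] u v
      qreg_tendsto[OF q t e] l1 l2]
  show "(\<lambda>x. qmean q t (u x) (v x)) \<in> W1 r \<Omega>"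
    "AE x in M. gr (\<lambda>x. qmean q t (u x) (v x)) x =
       qmean_deriv q t (u x) (v x) *\<^sub>R gr u x + qmean_deriv q (1 - t) (v x) (u x) *\<^sub>R gr v x" by (rule R)+
  assume 0: "u \<in> W1_0 r \<Omega>" "v \<in> W1_0 r \<Omega>"
  show "(\<lambda>x. qmean q t (u x) (v x)) \<in> W1_0 r \<Omega>"
  proof (rule W1_0_closed[OF R(1) _ R(3)])
    fix n
    show "(\<lambda>x. qreg q t (e n) (u x) (v x)) \<in> W1_0 r \<Omega>"
    proof (rule W1_0_chain[OF C1_pair_qreg[OF q t e(2)] 0])
      fix \<phi> \<psi> assume p: "\<phi> \<in> test_functions \<Omega>" "\<psi> \<in> test_functions \<Omega>"
      show "(\<lambda>x. qreg q t (e n) (\<phi> x) (\<psi> x)) \<in> test_functions \<Omega>"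
        by (rule test_functions_pair[OF p])
          (use q e(2) in \<open>auto intro!: qreg_zero Ck_on_qreg[OF q t] test_functions_Ck[OF p(1)] test_functions_Ck[OF p(2)]\<close>)
    qed
  qed
qed

text \<open>Extended by zero, w has vanishing weak gradient on the whole space and is therefore
  constant there. It is 0 outside a ball containing the bounded set \<Omega>, so the constant is 0.
  This takes the place of a Poincare inequality.\<close>

lemma W1_0_zero_gradient:
  assumes w: "w \<in> W1_0 r \<Omega>" and z: "AE x in M. gr w x = 0"
  shows "AE x in M. w x = 0"
proof -
  note W = W1D[OF W1_0D[OF w]]
  note [measurable] = Lr_measurable[OF W(1)]
  have OS: "\<Omega> \<in> sets lebesgue" using \<Omega> by auto
  obtain \<phi> where p: "\<And>n. \<phi> n \<in> test_functions \<Omega>" "W1_tendsto \<phi> w" using W1_0_sequence[OF w] by metis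
  note lim = p(2)[unfolded W1_tendsto_def]
  have d1: "(\<lambda>x. \<phi> n x - w x) \<in> Lr" for n by (intro Lr_diff test_Lr p W)
  have "Nr (\<lambda>x. gr (\<phi> n) x - gr w x) = Nr (grad (\<phi> n))" for n
  proof (rule Nr_cong_AE)
    show "AE x in M. gr (\<phi> n) x - gr w x = grad (\<phi> n) x"
      using z test_W1(2)[OF p(1)[of n]] by eventually_elim simp
    show "(\<lambda>x. gr (\<phi> n) x - gr w x) \<in> borel_measurable M"
      by (intro Lr_measurable Lr_diff W1D(2) test_W1 p W1_0D w)
    show "grad (\<phi> n) \<in> borel_measurable M" by (intro Lr_measurable test_Lr p)
  qed
  then have L0: "(\<lambda>n. Nr (grad (\<phi> n))) \<longlonglongrightarrow> 0" using lim by simp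
  note l1 = Lr_tendsto_L1[OF d1 conjunct1[OF lim]] Lr_tendsto_L1[OF test_Lr(2)[OF p(1)] L0]
  define w' where "w' x = (if x \<in> \<Omega> then w x else 0)" for x
  have iw: "integrable lebesgue w'"
    unfolding w'_def using Lr_integrable[OF W(1)] Lebesgue_Measure.integrable_restrict_UNIV[OF OS] by blast
  have "has_weak_gradient UNIV w' (\<lambda>_. 0)"
    unfolding has_weak_gradient_def
  proof (intro conjI ballI)
    show "locally_integrable_on w' UNIV"
      unfolding locally_integrable_on_def
    proof (intro allI impI, elim conjE)
      fix K :: "'a set" assume "compact K"
      then have K: "K \<in> sets lebesgue" by (simp add: borel_compact)
      have "integrable lebesgue (\<lambda>x. if x \<in> K then w' x else 0)"
        by (rule Bochner_Integration.integrable_bound[OF iw])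
          (use K iw in \<open>auto intro!: measurable_If_set borel_measurable_integrable\<close>)
      then show "integrable (lebesgue_on K) w'" using Lebesgue_Measure.integrable_restrict_UNIV[OF K] by blast
    qed
    show "locally_integrable_on (\<lambda>_::'a. 0 :: 'a) UNIV" by (simp add: locally_integrable_on_def)
    fix \<psi> :: "'a \<Rightarrow> real" and b :: 'a assume \<psi>: "\<psi> \<in> test_functions UNIV" and b: "b \<in> Basis"
    let ?I = "\<lambda>f. \<integral>x. f x * (grad \<psi> x \<bullet> b) \<partial>M"
    obtain B where B: "0 < B" "\<And>x. \<bar>\<psi> x\<bar> \<le> B" "\<And>x. norm (grad \<psi> x) \<le> B"
      using test_functions_bounded[OF \<psi>] by metis
    have m: "f \<in> borel_measurable M" if "f \<in> borel_measurable borel" for f :: "'a \<Rightarrow> 'b::euclidean_space"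
      using that by (intro measurable_restrict_space1 measurable_completion) simp
    note [measurable] = m[OF test_functions_measurable(1)[OF \<psi>]] m[OF test_functions_measurable(2)[OF \<psi>]]
      test_functions_measurable[OF \<psi>]
    have gb: "\<bar>grad \<psi> x \<bullet> b\<bar> \<le> B" for x
      using Cauchy_Schwarz_ineq2[of "grad \<psi> x" b] B(3)[of x] b by simp
    have bm: "integrable M (\<lambda>x. f x * g x)" "\<bar>\<integral>x. f x * g x \<partial>M\<bar> \<le> B * (\<integral>x. norm (f x) \<partial>M)"
      if f: "integrable M f" and [measurable]: "g \<in> borel_measurable M" and g: "\<And>x. \<bar>g x\<bar> \<le> B" for f g :: "'a \<Rightarrow> real"
    proof -
      note [measurable] = borel_measurable_integrable[OF f]
      have le: "norm (f x * g x) \<le> norm (B * norm (f x))" for x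
        using mult_left_mono[OF g, of "\<bar>f x\<bar>" x] B(1) by (simp add: abs_mult mult.commute)
      show i: "integrable M (\<lambda>x. f x * g x)"
        by (rule Bochner_Integration.integrable_bound[of _ "\<lambda>x. B * norm (f x)"])
          (use le f in \<open>auto intro!: integrable_mult_right integrable_norm\<close>)
      have "\<bar>\<integral>x. f x * g x \<partial>M\<bar> \<le> (\<integral>x. \<bar>f x * g x\<bar> \<partial>M)" by (rule integral_abs_bound)
      also have "\<dots> \<le> (\<integral>x. B * norm (f x) \<partial>M)"
        using le B(1) by (intro integral_mono integrable_abs i integrable_mult_right integrable_norm f) auto
      finally show "\<bar>\<integral>x. f x * g x \<partial>M\<bar> \<le> B * (\<integral>x. norm (f x) \<partial>M)" by simp
    qed
    \<comment> \<open>The support of \<psi> may leave \<Omega>; integration by parts is legitimate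
      because \<open>\<phi> n\<close> is a test function of \<Omega>, and its integrals over
      \<Omega> and over the whole space agree.\<close>
    have i0: "(?I (\<phi> n)) = - (\<integral>x. (grad (\<phi> n) x \<bullet> b) * \<psi> x \<partial>M)" for n
    proof -
      note [measurable] = test_functions_measurable[OF p(1)[of n]]
      note [measurable] = m[OF test_functions_measurable(1)[OF p(1)[of n]]] m[OF test_functions_measurable(2)[OF p(1)[of n]]]
      have O: "\<Omega> \<in> sets borel" using \<Omega> by simp
      have "(?I (\<phi> n)) = (\<integral>x. indicator \<Omega> x *\<^sub>R (\<phi> n x * (grad \<psi> x \<bullet> b)) \<partial>lborel)"
        by (rule integral_lebesgue_on_borel[OF O]) auto
      also have "\<dots> = (\<integral>x. \<phi> n x * (grad \<psi> x \<bullet> b) \<partial>lborel)"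
        using test_outside[OF p(1)] by (intro Bochner_Integration.integral_cong) (auto simp: indicator_def)
      also have "\<dots> = - (\<integral>x. (grad (\<phi> n) x \<bullet> b) * \<psi> x \<partial>lborel)"
        by (rule wgradD(3)[OF wgrad_test[OF p(1)] \<psi>])
      also have "(\<integral>x. (grad (\<phi> n) x \<bullet> b) * \<psi> x \<partial>lborel) = (\<integral>x. indicator \<Omega> x *\<^sub>R ((grad (\<phi> n) x \<bullet> b) * \<psi> x) \<partial>lborel)"
        using test_outside[OF p(1)] by (intro Bochner_Integration.integral_cong) (auto simp: indicator_def)
      also have "\<dots> = (\<integral>x. (grad (\<phi> n) x \<bullet> b) * \<psi> x \<partial>M)"
        by (rule integral_lebesgue_on_borel(2)[OF O, symmetric]) auto
      finally show ?thesis .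
    qed
    have ip: "integrable M (\<phi> n)" "integrable M (\<lambda>x. grad (\<phi> n) x \<bullet> b)" for n
      by (intro integrable_inner_left Lr_integrable test_Lr p)+
    have iwM: "integrable M w" by (rule Lr_integrable[OF W(1)])
    have 1: "(\<lambda>n. (?I (\<phi> n)) - (?I w)) \<longlonglongrightarrow> 0"
    proof (rule Lim_null_comparison)
      have "(\<lambda>n. B * (\<integral>x. norm (\<phi> n x - w x) \<partial>M)) \<longlonglongrightarrow> B * 0" by (intro tendsto_intros l1)
      then show "(\<lambda>n. B * (\<integral>x. norm (\<phi> n x - w x) \<partial>M)) \<longlonglongrightarrow> 0" by simp
      show "\<forall>\<^sub>F n in sequentially. norm ((?I (\<phi> n)) - (?I w))
          \<le> B * (\<integral>x. norm (\<phi> n x - w x) \<partial>M)"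
      proof (intro always_eventually allI)
        fix n
        have "(?I (\<phi> n)) - (?I w)
            = (\<integral>x. (\<phi> n x - w x) * (grad \<psi> x \<bullet> b) \<partial>M)"
          using bm(1)[OF ip(1) _ gb] bm(1)[OF iwM _ gb] by (simp add: left_diff_distrib)
        then show "norm ((?I (\<phi> n)) - (?I w))
          \<le> B * (\<integral>x. norm (\<phi> n x - w x) \<partial>M)"
          using bm(2)[OF Bochner_Integration.integrable_diff[OF ip(1) iwM] _ gb] by simp
      qed
    qed
    have 2: "(\<lambda>n. ?I (\<phi> n)) \<longlonglongrightarrow> 0"
    proof (rule Lim_null_comparison)
      have "(\<lambda>n. B * (\<integral>x. norm (grad (\<phi> n) x) \<partial>M)) \<longlonglongrightarrow> B * 0" by (intro tendsto_intros l1)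
      then show "(\<lambda>n. B * (\<integral>x. norm (grad (\<phi> n) x) \<partial>M)) \<longlonglongrightarrow> 0" by simp
      show "\<forall>\<^sub>F n in sequentially. norm (?I (\<phi> n)) \<le> B * (\<integral>x. norm (grad (\<phi> n) x) \<partial>M)"
      proof (intro always_eventually allI)
        fix n
        have "\<bar>\<integral>x. (grad (\<phi> n) x \<bullet> b) * \<psi> x \<partial>M\<bar> \<le> B * (\<integral>x. norm (grad (\<phi> n) x \<bullet> b) \<partial>M)"
          by (rule bm(2)[OF ip(2) _ B(2)]) measurable
        also have "\<dots> \<le> B * (\<integral>x. norm (grad (\<phi> n) x) \<partial>M)"
        proof (intro mult_left_mono integral_mono integrable_norm ip(2))
          show "integrable M (grad (\<phi> n))" by (intro Lr_integrable test_Lr p)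
          show "norm (grad (\<phi> n) x \<bullet> b) \<le> norm (grad (\<phi> n) x)" for x
            using Cauchy_Schwarz_ineq2[of "grad (\<phi> n) x" b] b by simp
        qed (use B in auto)
        finally show "norm (?I (\<phi> n)) \<le> B * (\<integral>x. norm (grad (\<phi> n) x) \<partial>M)"
          by (simp add: i0)
      qed
    qed
    have "(?I w) = 0"
      using tendsto_diff[OF 2 1] by (simp add: LIMSEQ_const_iff)
    also have "(?I w) = (\<integral>x. (if x \<in> \<Omega> then w x * (grad \<psi> x \<bullet> b) else 0) \<partial>lebesgue)"
      by (rule Lebesgue_Measure.integral_restrict_UNIV[OF OS, symmetric])
    also have "\<dots> = (\<integral>x. w' x * (grad \<psi> x \<bullet> b) \<partial>lebesgue)"
      by (intro Bochner_Integration.integral_cong) (auto simp: w'_def)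
    finally show "(\<integral>x. w' x * partial_deriv b \<psi> x \<partial>lebesgue_on UNIV) = - (\<integral>x. ((0::'a) \<bullet> b) * \<psi> x \<partial>lebesgue_on UNIV)"
      by (simp add: test_functionsD(7)[OF \<psi>] lebesgue_on_UNIV_eq)
  qed
  then obtain k where "AE x in lebesgue_on UNIV. w' x = k"
    using hwg_zero_constant[OF open_UNIV _ _ connected_UNIV, of w' "\<lambda>_. 0"] by auto
  then have k: "AE x in lborel. w' x = k" by (simp add: AE_lebesgue_on_iff[OF open_UNIV])
  obtain R where R: "\<And>x. x \<in> \<Omega> \<Longrightarrow> norm x \<le> R" using bdd by (auto simp: bounded_iff)
  have "AE x in lborel. x \<in> - cball (0::'a) R \<longrightarrow> k = 0"
    using k by eventually_elim (use R in \<open>auto simp: w'_def split: if_splits\<close>)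
  then obtain x :: 'a where k0: "k = 0"
  proof (rule not_AE_outside_open[rotated 2])
    have "\<not> bounded (UNIV :: 'a set)" by simp
    then show "- cball (0::'a) R \<noteq> {}" using bounded_cball[of "0::'a" R] by (metis Compl_empty_eq double_compl)
  qed auto
  from k have "AE x in lborel. x \<in> \<Omega> \<longrightarrow> w x = 0" by eventually_elim (auto simp: w'_def k0 split: if_splits)
  then show ?thesis by (simp add: AE_lebesgue_on_iff[OF \<Omega>])
qed

end

section \<open>The Sobolev embedding\<close>

text \<open>The integral is split at \<tau> = m powr (1/d), where m t powr (-d) has fallen to 1. The
  bounded part costs \<kappa> \<tau>, and the tail integrates to \<tau> / (d - 1).\<close>

lemma min_power_integral:
  fixes \<kappa> m d :: real
  assumes "0 \<le> \<kappa>" "0 < m" "1 < d"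
  shows "(\<integral>\<^sup>+t. indicator {0<..1} t * ennreal (min \<kappa> (m * t powr (- d))) \<partial>lborel) \<le> ennreal ((\<kappa> + 1 / (d - 1)) * m powr (1 / d))"
proof -
  define \<tau> where "\<tau> = m powr (1 / d)"
  have \<tau>: "0 < \<tau>" using assms by (simp add: \<tau>_def)
  have I1: "(\<integral>\<^sup>+t. ennreal \<kappa> * indicator {0..\<tau>} t \<partial>lborel) = ennreal (\<kappa> * \<tau>)"
    using \<tau> assms by (subst nn_integral_cmult_indicator) (auto simp: ennreal_mult)
  have I2: "(\<integral>\<^sup>+t. ennreal (m * t powr (- d)) * indicator {\<tau>..} t \<partial>lborel) = ennreal (0 - (- (m / (d - 1)) * \<tau> powr (1 - d)))"
  proof (rule nn_integral_FTC_atLeast)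
    fix t assume "\<tau> \<le> t"
    then have t: "0 < t" using \<tau> by simp
    have "((\<lambda>t. - (m / (d - 1)) * t powr (1 - d)) has_real_derivative - (m / (d - 1)) * ((1 - d) * t powr (1 - d - 1))) (at t)"
      by (intro DERIV_cmult has_real_derivative_powr t)
    then show "((\<lambda>t. - (m / (d - 1)) * t powr (1 - d)) has_real_derivative m * t powr (- d)) (at t)"
      by (rule DERIV_cong) (use assms in \<open>simp add: field_simps\<close>)
    show "0 \<le> m * t powr (- d)" using assms by simp
  next
    have "((\<lambda>t::real. t powr (1 - d)) \<longlongrightarrow> 0) at_top"
      using assms by (intro tendsto_neg_powr filterlim_ident) auto
    from tendsto_mult_left[OF this, of "- (m / (d - 1))"]
    show "((\<lambda>t. - (m / (d - 1)) * t powr (1 - d)) \<longlongrightarrow> 0) at_top" by simp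
  qed simp
  have e: "0 - (- (m / (d - 1)) * \<tau> powr (1 - d)) = 1 / (d - 1) * \<tau>"
  proof -
    have "m * \<tau> powr (1 - d) = m powr 1 * m powr (1 / d * (1 - d))" using assms by (simp add: \<tau>_def powr_powr)
    also have "\<dots> = m powr (1 + 1 / d * (1 - d))" by (simp only: powr_add)
    also have "1 + 1 / d * (1 - d) = 1 / d" using assms by (simp add: field_simps)
    finally have "m * \<tau> powr (1 - d) = \<tau>" by (simp add: \<tau>_def)
    then show ?thesis by (simp add: field_simps)
  qed
  have "(\<integral>\<^sup>+t. indicator {0<..1} t * ennreal (min \<kappa> (m * t powr (- d))) \<partial>lborel) \<le>
     (\<integral>\<^sup>+t. ennreal \<kappa> * indicator {0..\<tau>} t + ennreal (m * t powr (- d)) * indicator {\<tau>..} t \<partial>lborel)"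
  proof (rule nn_integral_mono)
    fix t :: real
    show "indicator {0<..1} t * ennreal (min \<kappa> (m * t powr (- d)))
        \<le> ennreal \<kappa> * indicator {0..\<tau>} t + ennreal (m * t powr (- d)) * indicator {\<tau>..} t"
    proof (cases "0 < t")
      case True
      show ?thesis
      proof (cases "t \<le> \<tau>")
        case True
        have "indicator {0<..1} t * ennreal (min \<kappa> (m * t powr (- d))) \<le> ennreal \<kappa> * indicator {0..\<tau>} t"
          using True \<open>0 < t\<close> by (auto simp: indicator_def intro: ennreal_leI)
        then show ?thesis by (rule order_trans) simp
      next
        case False
        then show ?thesis using \<open>0 < t\<close> by (auto simp: indicator_def intro: ennreal_leI)
      qed
    qed (simp add: indicator_def)
  qed
  also have "\<dots> = ennreal (\<kappa> * \<tau>) + ennreal (1 / (d - 1) * \<tau>)"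
    using I1 I2 e by (subst nn_integral_add) auto
  also have "\<dots> = ennreal (\<kappa> * \<tau> + 1 / (d - 1) * \<tau>)"
    using assms \<tau> by (intro ennreal_plus[symmetric]) auto
  also have "\<dots> = ennreal ((\<kappa> + 1 / (d - 1)) * m powr (1 / d))" by (simp add: \<tau>_def distrib_right)
  finally show ?thesis .
qed

lemma emeasure_scaled_reflection:
  fixes E :: "'a::euclidean_space set"
  assumes [measurable]: "E \<in> sets borel" and t: "0 < t"
  shows "(\<integral>\<^sup>+y. indicator E (z - t *\<^sub>R y) \<partial>lborel) = emeasure lborel E * ennreal (t powr (- real DIM('a)))"
proof -
  have "emeasure lborel E = (\<integral>\<^sup>+x. indicator E x \<partial>(lborel :: 'a measure))" by simp
  also have "\<dots> = (\<integral>\<^sup>+x. indicator E x \<partial>density (distr lborel borel (\<lambda>x. z + (- t) *\<^sub>R x)) (\<lambda>_. \<bar>- t\<bar> ^ DIM('a)))"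
    using t by (subst lborel_affine[of "- t" z]) auto
  also have "\<dots> = (\<integral>\<^sup>+y. ennreal (t ^ DIM('a)) * indicator E (z - t *\<^sub>R y) \<partial>lborel)"
    using t by (subst nn_integral_density, simp, simp, subst nn_integral_distr) (auto simp: )
  also have "\<dots> = ennreal (t ^ DIM('a)) * (\<integral>\<^sup>+y. indicator E (z - t *\<^sub>R y) \<partial>lborel)"
    by (rule nn_integral_cmult) simp
  finally have "emeasure lborel E * ennreal (t powr (- real DIM('a)))
     = (ennreal (t powr (- real DIM('a))) * ennreal (t ^ DIM('a))) * (\<integral>\<^sup>+y. indicator E (z - t *\<^sub>R y) \<partial>lborel)"
    by (simp add: ac_simps)
  also have "ennreal (t powr (- real DIM('a))) * ennreal (t ^ DIM('a)) = 1"
    using t by (simp add: ennreal_mult[symmetric] powr_realpow[symmetric] powr_add[symmetric])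
  finally show ?thesis by simp
qed

text \<open>For fixed t and z = x + t y, the vectors y in K with z - t y in E have measure at most
  the minimum of \<kappa> and m t^(-N), N being the dimension. As t is at most 1, N may be raised to
  d; an exponent above 1 makes the integral over t finite with the right power of m, also in
  dimension 1.\<close>

lemma cone_integral_bound:
  fixes K E :: "'a::euclidean_space set" and G :: "'a \<Rightarrow> ennreal"
  assumes [measurable]: "K \<in> sets borel" "E \<in> sets borel" "G \<in> borel_measurable borel"
    and \<kappa>: "emeasure lborel K = ennreal \<kappa>" "0 \<le> \<kappa>" and m: "emeasure lborel E = ennreal m" "0 < m"
    and d: "real DIM('a) \<le> d" "1 < d"
  shows "(\<integral>\<^sup>+y. \<integral>\<^sup>+x. \<integral>\<^sup>+t. indicator K y * indicator E x * (indicator {0..1::real} t * G (x + t *\<^sub>R y)) \<partial>lborel \<partial>lborel \<partial>lborel)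
    \<le> ennreal ((\<kappa> + 1 / (d - 1)) * m powr (1 / d)) * (\<integral>\<^sup>+z. G z \<partial>lborel)"
proof -
  let ?I = "\<lambda>t x y. indicator K y * indicator E x * (indicator {0..1::real} t * G (x + t *\<^sub>R y))" and ?J = "\<lambda>t z y. indicator K y * indicator E (z - t *\<^sub>R y)"
  have swap: "(\<integral>\<^sup>+y. \<integral>\<^sup>+x. \<integral>\<^sup>+t. ?I t x y \<partial>lborel \<partial>lborel \<partial>lborel)
     = (\<integral>\<^sup>+t. \<integral>\<^sup>+y. \<integral>\<^sup>+x. ?I t x y \<partial>lborel \<partial>lborel \<partial>lborel)"
  proof -
    have "(\<integral>\<^sup>+x. \<integral>\<^sup>+t. ?I t x y \<partial>lborel \<partial>lborel)
       = (\<integral>\<^sup>+t. \<integral>\<^sup>+x. ?I t x y \<partial>lborel \<partial>lborel)" for y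
      by (rule lborel_pair.Fubini') measurable
    then have "(\<integral>\<^sup>+y. \<integral>\<^sup>+x. \<integral>\<^sup>+t. ?I t x y \<partial>lborel \<partial>lborel \<partial>lborel)
      = (\<integral>\<^sup>+y. \<integral>\<^sup>+t. \<integral>\<^sup>+x. ?I t x y \<partial>lborel \<partial>lborel \<partial>lborel)"
      by simp
    also have "\<dots> = (\<integral>\<^sup>+t. \<integral>\<^sup>+y. \<integral>\<^sup>+x. ?I t x y \<partial>lborel \<partial>lborel \<partial>lborel)"
      by (rule lborel_pair.Fubini') measurable
    finally show ?thesis .
  qed
  have inner: "(\<integral>\<^sup>+y. \<integral>\<^sup>+x. ?I t x y \<partial>lborel \<partial>lborel)
     \<le> indicator {0<..1} t * ennreal (min \<kappa> (m * t powr (- d))) * (\<integral>\<^sup>+z. G z \<partial>lborel)" if t0: "t \<noteq> 0" for t :: real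
  proof (cases "t \<in> {0<..1}")
    case True
    then have t: "0 < t" "t \<le> 1" by auto
    have "(\<integral>\<^sup>+y. \<integral>\<^sup>+x. ?I t x y \<partial>lborel \<partial>lborel)
      = (\<integral>\<^sup>+y. \<integral>\<^sup>+z. ?J t z y * G z \<partial>lborel \<partial>lborel)"
    proof (rule nn_integral_cong)
      fix y :: 'a
      show "(\<integral>\<^sup>+x. ?I t x y \<partial>lborel)
          = (\<integral>\<^sup>+z. ?J t z y * G z \<partial>lborel)"
        using nn_integral_lborel_translate[of "\<lambda>z. ?J t z y * G z" "t *\<^sub>R y"] t
        by (simp add: add.commute)
    qed
    also have "\<dots> = (\<integral>\<^sup>+z. \<integral>\<^sup>+y. ?J t z y * G z \<partial>lborel \<partial>lborel)"
      by (rule lborel_pair.Fubini') measurable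
    also have "\<dots> \<le> (\<integral>\<^sup>+z. ennreal (min \<kappa> (m * t powr (- d))) * G z \<partial>lborel)"
    proof (rule nn_integral_mono)
      fix z :: 'a
      have "(\<integral>\<^sup>+y. ?J t z y * G z \<partial>lborel)
          = (\<integral>\<^sup>+y. ?J t z y \<partial>lborel) * G z"
        by (rule nn_integral_multc) measurable
      moreover have "(\<integral>\<^sup>+y. ?J t z y \<partial>lborel) \<le> ennreal (min \<kappa> (m * t powr (- d)))"
      proof -
        have 1: "(\<integral>\<^sup>+y. ?J t z y \<partial>lborel) \<le> ennreal \<kappa>"
        proof -
          have "(\<integral>\<^sup>+y. ?J t z y \<partial>lborel) \<le> (\<integral>\<^sup>+y. indicator K y \<partial>lborel)"
            by (rule nn_integral_mono) (auto simp: indicator_def)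
          also have "\<dots> = ennreal \<kappa>" using \<kappa> by simp
          finally show ?thesis .
        qed
        have 2: "(\<integral>\<^sup>+y. ?J t z y \<partial>lborel) \<le> ennreal (m * t powr (- d))"
        proof -
          have "(\<integral>\<^sup>+y. ?J t z y \<partial>lborel) \<le> (\<integral>\<^sup>+y. indicator E (z - t *\<^sub>R y) \<partial>lborel)"
            by (rule nn_integral_mono) (auto simp: indicator_def)
          also have "\<dots> = ennreal (m * t powr (- real DIM('a)))"
            using m t by (subst emeasure_scaled_reflection) (auto simp: ennreal_mult)
          also have "\<dots> \<le> ennreal (m * t powr (- d))"
            using m t d by (intro ennreal_leI mult_left_mono powr_mono') auto
          finally show ?thesis .
        qed
        show ?thesis using 1 2 by (simp add: min_def)
      qed
      ultimately show "(\<integral>\<^sup>+y. ?J t z y * G z \<partial>lborel) \<le> ennreal (min \<kappa> (m * t powr (- d))) * G z"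
        by (simp add: mult_right_mono)
    qed
    also have "\<dots> = ennreal (min \<kappa> (m * t powr (- d))) * (\<integral>\<^sup>+z. G z \<partial>lborel)"
      by (rule nn_integral_cmult) measurable
    finally show ?thesis using True by simp
  next
    case False
    then have "t \<notin> {0..1}" using t0 by auto
    then show ?thesis by simp
  qed
  have "(\<integral>\<^sup>+t. \<integral>\<^sup>+y. \<integral>\<^sup>+x. ?I t x y \<partial>lborel \<partial>lborel \<partial>lborel)
     \<le> (\<integral>\<^sup>+t. indicator {0<..1} t * ennreal (min \<kappa> (m * t powr (- d))) * (\<integral>\<^sup>+z. G z \<partial>lborel) \<partial>lborel)"
  proof (rule nn_integral_mono_AE)
    show "AE t in lborel. (\<integral>\<^sup>+y. \<integral>\<^sup>+x. ?I t x y \<partial>lborel \<partial>lborel)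
     \<le> indicator {0<..1} t * ennreal (min \<kappa> (m * t powr (- d))) * (\<integral>\<^sup>+z. G z \<partial>lborel)"
      using AE_lborel_singleton[of "0::real"] by eventually_elim (rule inner)
  qed
  also have "\<dots> = (\<integral>\<^sup>+t. indicator {0<..1} t * ennreal (min \<kappa> (m * t powr (- d))) \<partial>lborel) * (\<integral>\<^sup>+z. G z \<partial>lborel)"
    by (rule nn_integral_multc) measurable
  also have "\<dots> \<le> ennreal ((\<kappa> + 1 / (d - 1)) * m powr (1 / d)) * (\<integral>\<^sup>+z. G z \<partial>lborel)"
    by (intro mult_right_mono min_power_integral \<kappa> m d) auto
  finally show ?thesis unfolding swap .
qed

text \<open>For x in E and a cone vector y, either x + y lies in P or the gradient along the segment
  makes up for the drop of f below 1. The estimate is this alternative integrated over y in K and x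
  in E.\<close>

lemma truncation_estimate:
  fixes f :: "'a::euclidean_space \<Rightarrow> real"
  assumes w: "wgrad \<Omega> f Df" and [measurable]: "\<Omega> \<in> sets borel" "K \<in> sets borel" "E \<in> sets borel" "P \<in> sets borel"
    and O: "open O'" "E \<subseteq> O'" and cone: "\<And>x y t. x \<in> O' \<Longrightarrow> y \<in> K \<Longrightarrow> 0 \<le> t \<Longrightarrow> t \<le> 1 \<Longrightarrow> x + t *\<^sub>R y \<in> \<Omega>"
    and K1: "\<And>y. y \<in> K \<Longrightarrow> norm y \<le> 1"
    and P: "\<And>x. x \<in> \<Omega> \<Longrightarrow> f x \<le> indicator P x" and E1: "\<And>x. x \<in> E \<Longrightarrow> 1 \<le> f x"
    and \<kappa>: "emeasure lborel K = ennreal \<kappa>" "0 \<le> \<kappa>" and m: "emeasure lborel E = ennreal m" "0 < m"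
    and d: "real DIM('a) \<le> d" "1 < d"
  shows "ennreal (\<kappa> * m) \<le> ennreal m * emeasure lborel P +
     ennreal ((\<kappa> + 1 / (d - 1)) * m powr (1 / d)) * (\<integral>\<^sup>+z. ennreal (norm (Df z)) * indicator \<Omega> z \<partial>lborel)"
proof -
  note [measurable] = wgrad_borelD[OF w]
  define G where "G z = ennreal (norm (Df z)) * indicator \<Omega> z" for z
  have [measurable]: "G \<in> borel_measurable borel" unfolding G_def[abs_def] by measurable
  have pt: "AE x in lborel. x \<in> E \<longrightarrow> 1 \<le> indicator P (x + y) + (\<integral>\<^sup>+t. indicator {0..1::real} t * G (x + t *\<^sub>R y) \<partial>lborel)"
    if y: "y \<in> K" for y
  proof -
    have "AE x in lborel. x \<in> O' \<longrightarrow>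
       integrable lborel (\<lambda>s. indicator {0..1} s * (Df (x + s *\<^sub>R y) \<bullet> y)) \<and>
       f (x + y) - f x = (\<integral>s. indicator {0..1} s * (Df (x + s *\<^sub>R y) \<bullet> y) \<partial>lborel)"
      by (rule wgrad_translation[OF w O(1)]) (use cone y in auto)
    then show ?thesis
    proof (eventually_elim, intro impI)
      fix x assume *: "x \<in> O' \<longrightarrow>
       integrable lborel (\<lambda>s. indicator {0..1} s * (Df (x + s *\<^sub>R y) \<bullet> y)) \<and>
       f (x + y) - f x = (\<integral>s. indicator {0..1} s * (Df (x + s *\<^sub>R y) \<bullet> y) \<partial>lborel)" and x: "x \<in> E"
      define J where "J = (\<integral>s. indicator {0..1} s * (Df (x + s *\<^sub>R y) \<bullet> y) \<partial>lborel)"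
      have xO: "x \<in> O'" using x O by auto
      have xy: "x + y \<in> \<Omega>" using cone[OF xO y, of 1] by simp
      have "1 \<le> indicator P (x + y) + norm J"
        using * xO E1[OF x] P[OF xy] unfolding J_def by (smt (verit) real_norm_def)
      then have "1 \<le> ennreal (indicator P (x + y) + norm J)" by (metis ennreal_1 ennreal_leI)
      also have "\<dots> = indicator P (x + y) + ennreal (norm J)" by (simp add: ennreal_indicator)
      also have "ennreal (norm J) \<le> (\<integral>\<^sup>+s. ennreal (norm (indicator {0..1} s * (Df (x + s *\<^sub>R y) \<bullet> y))) \<partial>lborel)"
        unfolding J_def by (rule integral_norm_bound_ennreal) (use * xO in auto)
      also have "\<dots> \<le> (\<integral>\<^sup>+t. indicator {0..1::real} t * G (x + t *\<^sub>R y) \<partial>lborel)"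
      proof (rule nn_integral_mono)
        fix t :: real
        show "ennreal (norm (indicator {0..1} t * (Df (x + t *\<^sub>R y) \<bullet> y))) \<le> indicator {0..1} t * G (x + t *\<^sub>R y)"
        proof (cases "t \<in> {0..1}")
          case True
          have "\<bar>Df (x + t *\<^sub>R y) \<bullet> y\<bar> \<le> norm (Df (x + t *\<^sub>R y)) * norm y" by (rule Cauchy_Schwarz_ineq2)
          also have "\<dots> \<le> norm (Df (x + t *\<^sub>R y)) * 1" by (intro mult_left_mono K1 y) auto
          finally show ?thesis using True cone[OF xO y, of t] by (auto simp: G_def intro: ennreal_leI)
        qed simp
      qed
      finally show "1 \<le> indicator P (x + y) + (\<integral>\<^sup>+t. indicator {0..1::real} t * G (x + t *\<^sub>R y) \<partial>lborel)"
        by (simp add: add_left_mono)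
    qed
  qed
  define Q1 where "Q1 y x = (indicator K y * indicator E x * indicator P (x + y) :: ennreal)" for y x
  define Q2 where "Q2 y x = (\<integral>\<^sup>+t. indicator K y * indicator E x * (indicator {0..1::real} t * G (x + t *\<^sub>R y)) \<partial>lborel)" for y x
  have [measurable]: "case_prod Q1 \<in> borel_measurable (lborel \<Otimes>\<^sub>M lborel)" "case_prod Q2 \<in> borel_measurable (lborel \<Otimes>\<^sub>M lborel)"
    unfolding Q1_def Q2_def by measurable
  have "ennreal (\<kappa> * m) = (\<integral>\<^sup>+y. indicator K y * (\<integral>\<^sup>+x. indicator E x \<partial>lborel) \<partial>lborel)"
    using \<kappa> m by (simp add: nn_integral_multc ennreal_mult)
  also have "\<dots> = (\<integral>\<^sup>+y. \<integral>\<^sup>+x. indicator K y * indicator E x \<partial>lborel \<partial>lborel)"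
    by (simp add: nn_integral_cmult)
  also have "\<dots> \<le> (\<integral>\<^sup>+y. \<integral>\<^sup>+x. Q1 y x + Q2 y x \<partial>lborel \<partial>lborel)"
  proof (rule nn_integral_mono)
    fix y :: 'a
    show "(\<integral>\<^sup>+x. indicator K y * indicator E x \<partial>lborel) \<le> (\<integral>\<^sup>+x. Q1 y x + Q2 y x \<partial>lborel)"
    proof (cases "y \<in> K")
      case True
      show ?thesis
      proof (rule nn_integral_mono_AE)
        show "AE x in lborel. indicator K y * indicator E x \<le> Q1 y x + Q2 y x"
          using pt[OF True] by eventually_elim (use True in \<open>auto simp: Q1_def Q2_def indicator_def\<close>)
      qed
    qed simp
  qed
  also have "\<dots> = (\<integral>\<^sup>+y. \<integral>\<^sup>+x. Q1 y x \<partial>lborel \<partial>lborel) + (\<integral>\<^sup>+y. \<integral>\<^sup>+x. Q2 y x \<partial>lborel \<partial>lborel)"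
    by (subst nn_integral_add, measurable)+
  also have "\<dots> \<le> ennreal m * emeasure lborel P + ennreal ((\<kappa> + 1 / (d - 1)) * m powr (1 / d)) * (\<integral>\<^sup>+z. G z \<partial>lborel)"
  proof (rule add_mono)
    have "(\<integral>\<^sup>+y. \<integral>\<^sup>+x. Q1 y x \<partial>lborel \<partial>lborel) = (\<integral>\<^sup>+x. \<integral>\<^sup>+y. Q1 y x \<partial>lborel \<partial>lborel)"
      by (rule lborel_pair.Fubini') measurable
    also have "\<dots> \<le> (\<integral>\<^sup>+x. indicator E x * emeasure lborel P \<partial>lborel)"
    proof (rule nn_integral_mono)
      fix x :: 'a
      have "(\<integral>\<^sup>+y. Q1 y x \<partial>lborel) \<le> (\<integral>\<^sup>+y. indicator E x * indicator P (x + y) \<partial>lborel)"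
        unfolding Q1_def by (rule nn_integral_mono) (auto simp: indicator_def)
      also have "\<dots> = indicator E x * (\<integral>\<^sup>+y. indicator P (x + y) \<partial>lborel)" by (rule nn_integral_cmult) measurable
      also have "(\<integral>\<^sup>+y. indicator P (x + y) \<partial>lborel) = emeasure lborel P"
        using nn_integral_lborel_translate[of "indicator P" x] by simp
      finally show "(\<integral>\<^sup>+y. Q1 y x \<partial>lborel) \<le> indicator E x * emeasure lborel P" .
    qed
    also have "\<dots> = ennreal m * emeasure lborel P" using m by (simp add: nn_integral_multc)
    finally show "(\<integral>\<^sup>+y. \<integral>\<^sup>+x. Q1 y x \<partial>lborel \<partial>lborel) \<le> ennreal m * emeasure lborel P" .
    show "(\<integral>\<^sup>+y. \<integral>\<^sup>+x. Q2 y x \<partial>lborel \<partial>lborel) \<le> ennreal ((\<kappa> + 1 / (d - 1)) * m powr (1 / d)) * (\<integral>\<^sup>+z. G z \<partial>lborel)"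
      unfolding Q2_def by (rule cone_integral_bound[OF _ _ _ \<kappa> m d]) measurable
  qed
  finally show ?thesis unfolding G_def .
qed

section \<open>Interior cones of a smooth domain\<close>

lemma local_defining_functionD:
  assumes "local_defining_function \<Omega> U \<rho>"
  shows "open U" "\<And>y. y \<in> U \<Longrightarrow> (\<rho> has_derivative (\<lambda>v. grad \<rho> y \<bullet> v)) (at y)"
    "continuous_on U (grad \<rho>)" "\<And>y. y \<in> U \<Longrightarrow> grad \<rho> y \<noteq> 0" "\<And>y. y \<in> U \<Longrightarrow> y \<in> \<Omega> \<longleftrightarrow> \<rho> y < 0"
proof -
  have C: "Ck_on k U \<rho>" for k using assms by (simp add: local_defining_function_def smooth_fun_on_def)
  show "open U" using assms by (simp add: local_defining_function_def)
  show "(\<rho> has_derivative (\<lambda>v. grad \<rho> y \<bullet> v)) (at y)" if "y \<in> U" for y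
    using C[of 1] that by (intro has_derivative_grad) simp
  show "continuous_on U (grad \<rho>)" using C[of 1] by (intro continuous_on_grad) simp
  show "grad \<rho> y \<noteq> 0" if "y \<in> U" for y using assms that by (simp add: local_defining_function_def)
  show "y \<in> \<Omega> \<longleftrightarrow> \<rho> y < 0" if "y \<in> U" for y
    using assms that unfolding local_defining_function_def by blast
qed

text \<open>The points t y with y in \<open>cball e \<kappa>\<close> and t between 0 and 1 fill a
  truncated cone with vertex 0. One such cone, attached to any point of \<Omega> near x0, stays in
  \<Omega>; at an interior point it may be a full ball.\<close>

definition cone_at :: "'a::euclidean_space set \<Rightarrow> 'a \<Rightarrow> real \<Rightarrow> 'a \<Rightarrow> real \<Rightarrow> bool" where
  "cone_at \<Omega> x0 \<delta> e \<kappa> \<longleftrightarrow> 0 < \<delta> \<and> 0 < \<kappa> \<and> (\<forall>y\<in>cball e \<kappa>. norm y \<le> 1) \<and>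
     (\<forall>x\<in>\<Omega> \<inter> ball x0 \<delta>. \<forall>y\<in>cball e \<kappa>. \<forall>t. 0 \<le> t \<and> t \<le> 1 \<longrightarrow> x + t *\<^sub>R y \<in> \<Omega>)"

lemma cone_interior:
  assumes "open \<Omega>" "x0 \<in> \<Omega>"
  shows "\<exists>\<delta> e \<kappa>. cone_at \<Omega> x0 \<delta> e \<kappa>"
proof -
  obtain \<epsilon> where e: "0 < \<epsilon>" "ball x0 \<epsilon> \<subseteq> \<Omega>" using assms open_contains_ball by blast
  have "x + t *\<^sub>R y \<in> \<Omega>" if "x \<in> ball x0 (\<epsilon>/2)" "y \<in> cball 0 (min 1 (\<epsilon>/2))" "0 \<le> t" "t \<le> 1" for x y t
  proof -
    have "t * norm y \<le> 1 * (\<epsilon>/2)" using that by (intro mult_mono) auto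
    then have "dist x (x + t *\<^sub>R y) \<le> \<epsilon>/2" using that by (simp add: dist_segment)
    moreover have "dist x0 x < \<epsilon>/2" using that(1) by (simp only: mem_ball)
    ultimately have "x + t *\<^sub>R y \<in> ball x0 \<epsilon>" using dist_triangle[of x0 "x + t *\<^sub>R y" x] by simp
    then show ?thesis using e by auto
  qed
  then have "cone_at \<Omega> x0 (\<epsilon>/2) 0 (min 1 (\<epsilon>/2))"
    unfolding cone_at_def using e(1) by (auto simp del: mem_ball)
  then show ?thesis by blast
qed

text \<open>In directions close to minus the gradient the defining function decreases along the
  whole segment, so it remains negative. Continuity keeps the gradient within a quarter of its
  length near x0, which the opening of the cone is matched to.\<close>

lemma cone_boundary:
  assumes L: "local_defining_function \<Omega> U \<rho>" and x0: "x0 \<in> U"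
  shows "\<exists>\<delta> e \<kappa>. cone_at \<Omega> x0 \<delta> e \<kappa>"
proof -
  note D = local_defining_functionD[OF L]
  define g where "g = grad \<rho> x0"
  have g: "0 < norm g" using D(4)[OF x0] by (simp add: g_def)
  obtain \<delta>0 where d0: "0 < \<delta>0" "ball x0 \<delta>0 \<subseteq> U" using D(1) x0 open_contains_ball by blast
  have "isCont (grad \<rho>) x0" using D(1,3) x0 by (simp add: continuous_on_eq_continuous_at)
  then obtain \<delta>1 where d1: "0 < \<delta>1" "\<And>z. dist z x0 < \<delta>1 \<Longrightarrow> dist (grad \<rho> z) g < norm g / 4"
    using g unfolding continuous_at_eps_delta g_def by (metis zero_less_divide_iff zero_less_numeral)
  define \<delta> where "\<delta> = min \<delta>0 \<delta>1 / 2"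
  have \<delta>: "0 < \<delta>" "2 * \<delta> \<le> \<delta>0" "2 * \<delta> \<le> \<delta>1" using d0 d1 by (auto simp: \<delta>_def)
  \<comment> \<open>Vectors within \<eta>/4 of e have length at most 5/4 times \<eta>; the factor
    4/5 keeps this below both 1 and \<delta>.\<close>
  define \<eta> where "\<eta> = 4 / 5 * min 1 \<delta>"
  have \<eta>: "0 < \<eta>" "5 / 4 * \<eta> \<le> 1" "5 / 4 * \<eta> \<le> \<delta>" using \<delta> by (auto simp: \<eta>_def)
  define e where "e = (- \<eta> / norm g) *\<^sub>R g"
  have ne: "norm e = \<eta>" using g \<eta> by (simp add: e_def)
  have ny: "norm y \<le> 5 / 4 * \<eta>" if "y \<in> cball e (\<eta> / 4)" for y
  proof -
    have "norm y \<le> norm e + norm (y - e)" using norm_triangle_ineq[of e "y - e"] by simp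
    moreover have "norm (y - e) \<le> \<eta> / 4" using that by (simp add: dist_norm norm_minus_commute)
    ultimately show ?thesis using ne by simp
  qed
  have neg: "grad \<rho> z \<bullet> y < 0" if z: "dist z x0 < \<delta>1" and y: "y \<in> cball e (\<eta> / 4)" for z y
  proof -
    have 1: "g \<bullet> e = - \<eta> * norm g" using g by (simp add: e_def dot_square_norm power2_eq_square)
    have 2: "g \<bullet> (y - e) \<le> norm g * (\<eta> / 4)"
    proof -
      have "g \<bullet> (y - e) \<le> norm g * norm (y - e)" by (rule norm_cauchy_schwarz)
      also have "\<dots> \<le> norm g * (\<eta> / 4)" using y by (intro mult_left_mono) (auto simp: dist_norm norm_minus_commute)
      finally show ?thesis .
    qed
    have 3: "(grad \<rho> z - g) \<bullet> y \<le> (norm g / 4) * (5 / 4 * \<eta>)"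
    proof -
      have "(grad \<rho> z - g) \<bullet> y \<le> norm (grad \<rho> z - g) * norm y" by (rule norm_cauchy_schwarz)
      also have "\<dots> \<le> (norm g / 4) * (5 / 4 * \<eta>)"
        using d1(2)[OF z] ny[OF y] by (intro mult_mono) (auto simp: dist_norm)
      finally show ?thesis .
    qed
    have "grad \<rho> z \<bullet> y = g \<bullet> e + g \<bullet> (y - e) + (grad \<rho> z - g) \<bullet> y"
      by (simp add: inner_diff_left inner_diff_right)
    also have "\<dots> \<le> - \<eta> * norm g + norm g * (\<eta> / 4) + (norm g / 4) * (5 / 4 * \<eta>)" using 1 2 3 by linarith
    also have "\<dots> = - (7 / 16) * (\<eta> * norm g)" by (simp add: field_simps)
    also have "\<dots> < 0" using \<eta> g by simp
    finally show ?thesis .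
  qed
  have "x + t *\<^sub>R y \<in> \<Omega>" if x: "x \<in> \<Omega>" "x \<in> ball x0 \<delta>" and y: "y \<in> cball e (\<eta> / 4)" and t: "0 \<le> t" "t \<le> 1" for x y t
  proof -
    have near: "dist (x + s *\<^sub>R y) x0 < 2 * \<delta>" if "0 \<le> s" "s \<le> 1" for s
    proof -
      have "s * norm y \<le> 1 * \<delta>" using that ny[OF y] \<eta>(3) by (intro mult_mono) auto
      then have "dist (x + s *\<^sub>R y) x \<le> \<delta>" using that by (simp add: dist_commute dist_segment)
      moreover have "dist x x0 < \<delta>" using x(2) by (simp add: dist_commute)
      ultimately show ?thesis using dist_triangle[of "x + s *\<^sub>R y" x0 x] by linarith
    qed
    have inU: "x + s *\<^sub>R y \<in> U" if "0 \<le> s" "s \<le> 1" for s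
    proof -
      have "x + s *\<^sub>R y \<in> ball x0 \<delta>0" using near[OF that] \<delta>(2) by (simp add: dist_commute)
      then show ?thesis using d0(2) by auto
    qed
    have der: "((\<lambda>s. \<rho> (x + s *\<^sub>R y)) has_real_derivative grad \<rho> (x + s *\<^sub>R y) \<bullet> y) (at s)" if "0 \<le> s" "s \<le> 1" for s
    proof -
      have 1: "((\<lambda>t. x + t *\<^sub>R y) has_derivative (\<lambda>t. t *\<^sub>R y)) (at s)"
        by (auto intro!: derivative_eq_intros)
      have "((\<lambda>t. \<rho> (x + t *\<^sub>R y)) has_derivative (\<lambda>t. grad \<rho> (x + s *\<^sub>R y) \<bullet> (t *\<^sub>R y))) (at s)"
        using diff_chain_at[OF 1 D(2)[OF inU[OF that]]] by (simp add: o_def)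
      then show ?thesis unfolding has_field_derivative_def
        by (rule has_derivative_eq_rhs) (auto simp: fun_eq_iff)
    qed
    have "\<rho> (x + t *\<^sub>R y) \<le> \<rho> (x + 0 *\<^sub>R y)"
    proof (rule DERIV_nonpos_imp_nonincreasing[OF t(1)])
      fix s assume s: "0 \<le> s" "s \<le> t"
      then have s': "0 \<le> s" "s \<le> 1" using t by auto
      have "grad \<rho> (x + s *\<^sub>R y) \<bullet> y \<le> 0" using neg[of "x + s *\<^sub>R y", OF _ y] near[OF s'] \<delta>(3) by simp
      then show "\<exists>z. ((\<lambda>s. \<rho> (x + s *\<^sub>R y)) has_real_derivative z) (at s) \<and> z \<le> 0" using der[OF s'] by blast
    qed
    moreover have "\<rho> x < 0" using D(5)[of x] inU[of 0] x(1) by simp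
    ultimately show ?thesis using D(5)[OF inU[OF t]] by simp
  qed
  then have "cone_at \<Omega> x0 \<delta> e (\<eta> / 4)"
    unfolding cone_at_def using \<delta> \<eta> ny by fastforce
  then show ?thesis by blast
qed

lemma cone_condition:
  assumes "bounded_smooth_domain \<Omega>" "x0 \<in> closure \<Omega>"
  shows "\<exists>\<delta> e \<kappa>. cone_at \<Omega> x0 \<delta> e \<kappa>"
proof (cases "x0 \<in> \<Omega>")
  case True
  then show ?thesis using cone_interior assms by (auto simp: bounded_smooth_domain_def)
next
  case False
  then have "x0 \<in> frontier \<Omega>" using assms by (auto simp: bounded_smooth_domain_def frontier_def interior_open)
  then show ?thesis using cone_boundary assms unfolding bounded_smooth_domain_def by blast
qed

section \<open>Truncation at dyadic levels and the embedding\<close>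

lemma max_square_deriv: "((\<lambda>s. (max 0 s)\<^sup>2) has_real_derivative 2 * max 0 s) (at (s::real))"
proof -
  consider "0 < s" | "s < 0" | "s = 0" by linarith
  then show ?thesis
  proof cases
    case 1
    have "((\<lambda>s. s\<^sup>2) has_real_derivative 2 * max 0 s) (at s)"
      using 1 by (auto intro!: derivative_eq_intros)
    then show ?thesis
      by (rule has_field_derivative_transform_within_open[where S = "{0<..}"]) (use 1 in auto)
  next
    case 2
    have "((\<lambda>s. 0) has_real_derivative 2 * max 0 s) (at s)" using 2 by simp
    then show ?thesis
      by (rule has_field_derivative_transform_within_open[where S = "{..<0}"]) (use 2 in auto)
  next
    case 3
    have "(\<lambda>h. ((max 0 (0 + h))\<^sup>2 - (max 0 0)\<^sup>2) / h) \<midarrow>0\<rightarrow> (0::real)"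
    proof (rule Lim_null_comparison)
      show "\<forall>\<^sub>F h in at 0. norm (((max 0 (0 + h))\<^sup>2 - (max 0 0)\<^sup>2) / h) \<le> \<bar>h::real\<bar>"
        by (intro always_eventually allI) (auto simp: max_def power2_eq_square)
      show "(\<lambda>h. \<bar>h\<bar>) \<midarrow>0\<rightarrow> (0::real)" by (auto intro!: tendsto_eq_intros)
    qed
    then show ?thesis using 3 by (simp add: DERIV_def)
  qed
qed

text \<open>A piecewise quadratic C1 step that rises from 0 at s = 1 to 1 at s = 2. Its derivative
  is a hat with peak 2 at s = 3/2, so composing with w / c localises the gradient to the level set
  between c and 2 c.\<close>

definition smoothstep :: "real \<Rightarrow> real" where
  "smoothstep s = 2 * (max 0 (s - 1))\<^sup>2 - 4 * (max 0 (s - 3/2))\<^sup>2 + 2 * (max 0 (s - 2))\<^sup>2"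

definition smoothstep' :: "real \<Rightarrow> real" where
  "smoothstep' s = 4 * max 0 (s - 1) - 8 * max 0 (s - 3/2) + 4 * max 0 (s - 2)"

lemma smoothstep_deriv: "(smoothstep has_real_derivative smoothstep' s) (at s)"
proof -
  have 1: "((\<lambda>s. (max 0 (s - c))\<^sup>2) has_real_derivative 2 * max 0 (s - c)) (at s)" for c
  proof -
    have "((\<lambda>s. s - c) has_real_derivative 1) (at s)" by (auto intro!: derivative_eq_intros)
    from DERIV_chain2[OF max_square_deriv this] show ?thesis by simp
  qed
  have "(smoothstep has_real_derivative 2 * (2 * max 0 (s - 1)) - 4 * (2 * max 0 (s - 3/2)) + 2 * (2 * max 0 (s - 2))) (at s)"
    unfolding smoothstep_def[abs_def] by (intro DERIV_add DERIV_diff DERIV_cmult 1)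
  then show ?thesis by (simp add: smoothstep'_def)
qed

lemma smoothstep_simps:
  "s \<le> 1 \<Longrightarrow> smoothstep s = 0" "2 \<le> s \<Longrightarrow> smoothstep s = 1" "smoothstep s \<le> 1"
  "s \<le> 1 \<or> 2 \<le> s \<Longrightarrow> smoothstep' s = 0" "\<bar>smoothstep' s\<bar> \<le> 2"
proof -
  show "s \<le> 1 \<Longrightarrow> smoothstep s = 0" by (simp add: smoothstep_def)
  show 2: "2 \<le> s \<Longrightarrow> smoothstep s = 1" for s by (simp add: smoothstep_def power2_eq_square algebra_simps)
  show "s \<le> 1 \<or> 2 \<le> s \<Longrightarrow> smoothstep' s = 0" by (auto simp: smoothstep'_def max_def)
  show "\<bar>smoothstep' s\<bar> \<le> 2" by (auto simp: smoothstep'_def max_def)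
  consider "s \<le> 3/2" | "3/2 \<le> s" "s \<le> 2" | "2 \<le> s" by linarith
  then show "smoothstep s \<le> 1"
  proof cases
    case 1
    have "max 0 (s - 1) \<le> 1/2" using 1 by (simp add: max_def)
    then have "(max 0 (s - 1))\<^sup>2 \<le> (1/2)\<^sup>2" by (intro power_mono) auto
    then show ?thesis using 1 by (simp add: smoothstep_def power2_eq_square)
  next
    case 2
    have "smoothstep s = 1 - 2 * (2 - s)\<^sup>2" using 2 by (simp add: smoothstep_def power2_eq_square algebra_simps)
    then show ?thesis by simp
  qed (use 2 in simp)
qed

lemma C1_pair_smoothstep:
  assumes "0 < c"
  shows "C1_pair (\<lambda>a b. smoothstep (a / c)) (\<lambda>z. smoothstep' (fst z / c) / c) (\<lambda>_. 0) (2 / c)"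
proof
  show "((\<lambda>a. smoothstep (a / c)) has_real_derivative smoothstep' (fst (a, b) / c) / c) (at a)" for a b :: real
  proof -
    have "((\<lambda>a. a / c) has_real_derivative 1 / c) (at a)" using assms by (auto intro!: derivative_eq_intros)
    from DERIV_chain2[OF smoothstep_deriv this] show ?thesis by simp
  qed
  show "continuous_on UNIV (\<lambda>z::real\<times>real. smoothstep' (fst z / c) / c)"
    unfolding smoothstep'_def using assms by (auto intro!: continuous_intros)
  show "\<bar>smoothstep' (fst z / c) / c\<bar> \<le> 2 / c" for z :: "real \<times> real"
    using smoothstep_simps(5)[of "fst z / c"] assms by (simp add: abs_divide divide_right_mono)
qed (use assms in auto)

text \<open>The Young inequality with an arbitrarily small coefficient on x, obtained by comparing y
  with \<eta> x powr (1 - \<theta>) instead of through sharp constants.\<close>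

lemma young_split:
  fixes x y \<eta> \<theta> :: real
  assumes "0 < \<eta>" "0 < \<theta>" "\<theta> < 1" "0 \<le> x" "0 \<le> y"
  shows "x powr \<theta> * y \<le> \<eta> * x + \<eta> powr (- \<theta> / (1 - \<theta>)) * y powr (1 / (1 - \<theta>))"
proof (cases "x = 0 \<or> y = 0")
  case False
  then have xy: "0 < x" "0 < y" using assms by auto
  show ?thesis
  proof (cases "y \<le> \<eta> * x powr (1 - \<theta>)")
    case True
    have "x powr \<theta> * y \<le> x powr \<theta> * (\<eta> * x powr (1 - \<theta>))" using True by (intro mult_left_mono) auto
    also have "\<dots> = \<eta> * x" using xy by (simp flip: powr_add)
    finally show ?thesis by (rule order_trans) simp
  next
    case False
    then have "x powr (1 - \<theta>) < y / \<eta>" using assms by (simp add: field_simps)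
    then have "(x powr (1 - \<theta>)) powr (\<theta> / (1 - \<theta>)) \<le> (y / \<eta>) powr (\<theta> / (1 - \<theta>))"
      using assms by (intro powr_mono2) auto
    then have "x powr \<theta> \<le> (y / \<eta>) powr (\<theta> / (1 - \<theta>))" using assms by (simp add: powr_powr)
    then have "x powr \<theta> * y \<le> (y / \<eta>) powr (\<theta> / (1 - \<theta>)) * y" using xy by (intro mult_right_mono) auto
    also have "\<dots> = \<eta> powr (- \<theta> / (1 - \<theta>)) * (y powr (\<theta> / (1 - \<theta>)) * y powr 1)"
      using assms xy by (simp add: powr_divide powr_minus_divide)
    also have "\<dots> = \<eta> powr (- \<theta> / (1 - \<theta>)) * y powr (\<theta> / (1 - \<theta>) + 1)" by (simp only: powr_add)
    also have "\<theta> / (1 - \<theta>) + 1 = 1 / (1 - \<theta>)" using assms by (simp add: field_simps)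
    finally show ?thesis using assms by (simp add: add_increasing)
  qed
qed (use assms in auto)

text \<open>With s = d r / (d - r), the powers of 2 recombine so that a k = 2 powr (k s) * m k
  satisfies a (k + 1) \<le> a k / 2 + C2 * b k powr (s / r). The first term is absorbed in the sum,
  and the second is summable because the b k are and s / r is at least 1.\<close>

lemma Mazya_recursion:
  fixes m g b :: "nat \<Rightarrow> real"
  assumes r: "1 < r" "r < d"
    and m: "\<And>k. 0 \<le> m k" "\<And>k. m (Suc k) \<le> m k" and b: "\<And>k. 0 < b k" and C: "0 < C" and g0: "\<And>k. 0 \<le> g k"
    and rec: "\<And>k. k0 \<le> k \<Longrightarrow> m (Suc k) \<le> C * (2 powr (- real k) * g k) powr (d / (d - 1))"
    and g: "\<And>k \<mu>. 0 < \<mu> \<Longrightarrow> g k \<le> \<mu> * m k + \<mu> powr (1 - r) * b k"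
    and B: "\<And>n. (\<Sum>k<n. b k) \<le> B"
  shows "\<exists>S. \<forall>n. (\<Sum>k\<in>{k0..n}. 2 powr (real k * (d * r / (d - r))) * m k) \<le> S"
proof -
  define D where "D = d / (d - 1)"
  define s where "s = d * r / (d - r)"
  define \<alpha> where "\<alpha> = (1 - 1 / r) * D"
  have d1: "1 < d" using r by simp
  have D: "0 < D" using d1 by (simp add: D_def)
  have \<alpha>1: "1 - \<alpha> = (d - r) / (r * (d - 1))"
    using r d1 by (simp add: \<alpha>_def D_def field_simps)
  have \<alpha>: "0 < \<alpha>" "\<alpha> < 1"
  proof -
    show "0 < \<alpha>" using r D by (simp add: \<alpha>_def)
    have "0 < 1 - \<alpha>" unfolding \<alpha>1 using r d1 by simp
    then show "\<alpha> < 1" by simp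
  qed
  have "d * r / x * (x / (r * y)) = d / y" if "x \<noteq> 0" for x y using that r by simp
  from this[of "d - r" "d - 1"] have s: "s * (1 - \<alpha>) = D" unfolding s_def \<alpha>1 D_def using r by simp
  have "d / y / r * (1 / (x / (r * y))) = d * r / x / r" if "x \<noteq> 0" "y \<noteq> 0" for x y using that r by simp
  from this[of "d - r" "d - 1"] have e1: "D / r * (1 / (1 - \<alpha>)) = s / r"
    unfolding \<alpha>1 s_def D_def using r d1 by simp
  have s0: "0 < s" using r d1 by (simp add: s_def)
  have sr: "1 \<le> s / r" using r d1 by (simp add: s_def field_simps)
  define a where "a k = 2 powr (real k * s) * m k" for k
  have a0: "0 \<le> a k" for k using m by (simp add: a_def)
  define C1 where "C1 = C * 2 powr s * 2 powr D"
  have C1: "0 < C1" using C by (simp add: C1_def)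
  \<comment> \<open>The constant of \<open>young_split\<close> with small factor 1 / (2 C1), so that
    a k enters the recursion with coefficient exactly 1/2.\<close>
  define C2 where "C2 = C1 * (1 / (2 * C1)) powr (- \<alpha> / (1 - \<alpha>))"
  have C2: "0 \<le> C2" using C1 by (simp add: C2_def)
  have step: "a (Suc k) \<le> a k / 2 + C2 * b k powr (s / r)" if k: "k0 \<le> k" for k
  proof (cases "m k = 0")
    case True
    then have "m (Suc k) = 0" using m(1)[of "Suc k"] m(2)[of k] by simp
    then show ?thesis using a0[of k] C2 by (simp add: a_def)
  next
    case False
    then have mk: "0 < m k" using m(1)[of k] by simp
    \<comment> \<open>This choice makes the two terms in the bound for g k equal to b k powr (1/r) *
      m k powr (1 - 1/r), the Hoelder product. It has to be positive, hence the assumption that b k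
      is.\<close>
    define \<mu> where "\<mu> = (b k / m k) powr (1 / r)"
    have \<mu>: "0 < \<mu>" using b[of k] mk by (simp add: \<mu>_def)
    define h where "h = b k powr (1 / r) * m k powr (1 - 1 / r)"
    have h0: "0 \<le> h" by (simp add: h_def)
    have "\<mu> * m k = h"
    proof -
      have "\<mu> * m k = b k powr (1 / r) * (m k powr (- (1 / r)) * m k powr 1)"
        using b[of k] mk by (simp add: \<mu>_def powr_divide powr_minus_divide)
      also have "\<dots> = h" unfolding h_def powr_add[symmetric] by (simp add: algebra_simps)
      finally show ?thesis .
    qed
    moreover have "\<mu> powr (1 - r) * b k = h"
    proof -
      have "\<mu> powr (1 - r) * b k = b k powr (1 / r * (1 - r)) * b k powr 1 * m k powr (- (1 / r * (1 - r)))"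
        using b[of k] mk by (simp add: \<mu>_def powr_divide powr_powr powr_minus_divide)
      also have "\<dots> = b k powr (1 / r * (1 - r) + 1) * m k powr (- (1 / r * (1 - r)))" by (simp only: powr_add)
      also have "1 / r * (1 - r) + 1 = 1 / r" using r by (simp add: field_simps)
      also have "- (1 / r * (1 - r)) = 1 - 1 / r" using r by (simp add: field_simps)
      finally show ?thesis by (simp add: h_def)
    qed
    ultimately have gh: "g k \<le> 2 * h" using g[OF \<mu>, of k] by simp
    have "(2 powr (- real k) * g k) powr D \<le> (2 powr (- real k) * (2 * h)) powr D"
      using gh g0[of k] D by (intro powr_mono2 mult_left_mono) auto
    also have "\<dots> = 2 powr D * (2 powr (- real k * D) * h powr D)"
      using h0 by (simp add: powr_mult powr_powr)
    also have "h powr D = b k powr (D / r) * m k powr \<alpha>"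
      using b[of k] mk by (simp add: h_def powr_mult powr_powr \<alpha>_def)
    finally have 1: "(2 powr (- real k) * g k) powr D \<le> 2 powr D * (2 powr (- real k * D) * (b k powr (D / r) * m k powr \<alpha>))" .
    have "a (Suc k) \<le> 2 powr (real (Suc k) * s) * (C * (2 powr (- real k) * g k) powr D)"
      unfolding a_def using rec[OF k] by (intro mult_left_mono) (auto simp: D_def)
    also have "\<dots> \<le> 2 powr (real (Suc k) * s) * (C * (2 powr D * (2 powr (- real k * D) * (b k powr (D / r) * m k powr \<alpha>))))"
      using C 1 by (intro mult_left_mono) auto
    also have "\<dots> = C1 * ((2 powr (real k * s) * 2 powr (- real k * D)) * m k powr \<alpha> * b k powr (D / r))"
      by (simp add: C1_def algebra_simps powr_add)
    also have "2 powr (real k * s) * 2 powr (- real k * D) = 2 powr (real k * (s - D))"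
      unfolding powr_add[symmetric] by (simp add: algebra_simps)
    also have "s - D = s * \<alpha>" using s by (simp add: algebra_simps)
    also have "2 powr (real k * (s * \<alpha>)) * m k powr \<alpha> = a k powr \<alpha>"
      using mk by (simp add: a_def powr_mult powr_powr mult.assoc)
    finally have "a (Suc k) \<le> C1 * (a k powr \<alpha> * b k powr (D / r))" .
    also have "\<dots> \<le> C1 * (1 / (2 * C1) * a k + (1 / (2 * C1)) powr (- \<alpha> / (1 - \<alpha>)) * (b k powr (D / r)) powr (1 / (1 - \<alpha>)))"
      using C1 \<alpha> a0[of k] by (intro mult_left_mono young_split) auto
    also have "\<dots> = a k / 2 + C2 * b k powr (s / r)"
      using C1 unfolding powr_powr e1 by (simp add: C2_def algebra_simps)
    finally show ?thesis .
  qed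
  have B0: "0 < B" using B[of 1] b[of 0] by simp
  have bB: "b k \<le> B" for k
  proof -
    have "b k \<le> (\<Sum>k<Suc k. b k)" using b by (simp add: sum_nonneg less_imp_le)
    also have "\<dots> \<le> B" by (rule B)
    finally show ?thesis .
  qed
  \<comment> \<open>As s / r is at least 1, the excess power of b k is bounded by a power of the
    total B, and b k itself remains to be summed.\<close>
  define C3 where "C3 = C2 * B powr (s / r - 1)"
  have C3: "0 \<le> C3" using C2 by (simp add: C3_def)
  have bs: "C2 * b k powr (s / r) \<le> C3 * b k" for k
  proof -
    have "b k powr (s / r) = b k powr (s / r - 1) * b k powr 1" unfolding powr_add[symmetric] by simp
    also have "\<dots> \<le> B powr (s / r - 1) * b k"
      using b[of k] bB[of k] sr by (intro mult_mono powr_mono2) auto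
    finally show ?thesis using C2 by (simp add: C3_def mult.assoc mult_left_mono)
  qed
  \<comment> \<open>The sum over shifted indices reproduces at most half of the original sum, which
    is finite and can be subtracted; this bounds it independently of n.\<close>
  have sum: "(\<Sum>k\<in>{k0..n}. a k) \<le> 2 * (a k0 + C3 * B)" for n
  proof -
    have p: "(\<Sum>k\<in>{k0..n}. a k) \<le> a k0 + (\<Sum>k\<in>{k0..n}. a (Suc k))"
    proof (cases "k0 \<le> n")
      case True
      have "(\<Sum>k\<in>{k0..n}. a k) = a k0 + (\<Sum>k\<in>{Suc k0..n}. a k)" using True by (rule sum.atLeast_Suc_atMost)
      also have "(\<Sum>k\<in>{Suc k0..n}. a k) \<le> (\<Sum>k\<in>{Suc k0..Suc n}. a k)" using a0 by (intro sum_mono2) auto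
      also have "\<dots> = (\<Sum>k\<in>{k0..n}. a (Suc k))" by (rule sum.shift_bounds_cl_Suc_ivl)
      finally show ?thesis by simp
    qed (use a0 in simp)
    also have "(\<Sum>k\<in>{k0..n}. a (Suc k)) \<le> (\<Sum>k\<in>{k0..n}. a k / 2 + C3 * b k)"
      using step bs by (intro sum_mono) (smt (verit) atLeastAtMost_iff)
    also have "\<dots> = (\<Sum>k\<in>{k0..n}. a k) / 2 + C3 * (\<Sum>k\<in>{k0..n}. b k)"
      by (simp add: sum.distrib sum_divide_distrib sum_distrib_left)
    also have "C3 * (\<Sum>k\<in>{k0..n}. b k) \<le> C3 * B"
    proof (intro mult_left_mono C3)
      have "(\<Sum>k\<in>{k0..n}. b k) \<le> (\<Sum>k<Suc n. b k)" using b by (intro sum_mono2) (auto simp: less_imp_le)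
      then show "(\<Sum>k\<in>{k0..n}. b k) \<le> B" using B[of "Suc n"] by linarith
    qed
    finally show ?thesis by simp
  qed
  then show ?thesis unfolding a_def s_def by (intro exI allI)
qed

text \<open>\<open>truncation_estimate\<close> is applied to the step of w between c and 2 c, whose
  gradient lives on the intermediate level set. The smallness assumption is what lets the term with
  the superlevel set be absorbed.\<close>

lemma level_set_decay_local:
  fixes w :: "'a::euclidean_space \<Rightarrow> real"
  assumes w: "wgrad \<Omega> w W" and \<Omega>: "open \<Omega>" "bounded \<Omega>"
    and W: "integrable lborel (\<lambda>x. indicator \<Omega> x * norm (W x))"
    and cone: "cone_at \<Omega> x0 \<delta> e \<kappa>" and d: "real DIM('a) \<le> d" "1 < d" and c: "0 < c"
    and small: "measure lborel {x \<in> \<Omega>. c < w x} \<le> measure lborel (cball e \<kappa>) / 2"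
  shows "measure lborel {x \<in> \<Omega> \<inter> ball x0 \<delta>. 2 * c < w x} powr (1 - 1 / d) \<le>
    2 * (measure lborel (cball e \<kappa>) + 1 / (d - 1)) / measure lborel (cball e \<kappa>) *
      (2 / c * (\<integral>x. indicator {x \<in> \<Omega>. c < w x \<and> w x < 2 * c} x * norm (W x) \<partial>lborel))"
proof -
  note [measurable] = wgrad_borelD[OF w]
  have [measurable]: "\<Omega> \<in> sets borel" using \<Omega> by simp
  define P where "P = {x \<in> \<Omega>. c < w x}"
  define E where "E = {x \<in> \<Omega> \<inter> ball x0 \<delta>. 2 * c < w x}"
  define A where "A = {x \<in> \<Omega>. c < w x \<and> w x < 2 * c}"
  define k where "k = measure lborel (cball e \<kappa>)"
  have [measurable]: "P \<in> sets borel" "E \<in> sets borel" "A \<in> sets borel"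
    unfolding P_def E_def A_def by measurable
  note cn = cone[unfolded cone_at_def]
  have k: "0 < k" unfolding k_def using cn content_cball_pos[of \<kappa> e] by simp
  have ek: "emeasure lborel (cball e \<kappa>) = ennreal k"
    unfolding k_def using emeasure_lborel_cball_finite by (metis emeasure_eq_ennreal_measure infinity_ennreal_def less_irrefl)
  have fin: "emeasure lborel B < \<infinity>" if "B \<subseteq> \<Omega>" for B
    using bounded_subset[OF \<Omega>(2) that] by (rule emeasure_bounded_finite)
  have EP: "E \<subseteq> \<Omega>" "P \<subseteq> \<Omega>" by (auto simp: E_def P_def)
  have em: "emeasure lborel E = ennreal (measure lborel E)" "emeasure lborel P = ennreal (measure lborel P)"
    using fin[OF EP(1)] fin[OF EP(2)] by (auto intro: emeasure_eq_ennreal_measure)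
  define I where "I = 2 / c * (\<integral>x. indicator A x * norm (W x) \<partial>lborel)"
  have I0: "0 \<le> I" using c by (simp add: I_def)
  define C0 where "C0 = k + 1 / (d - 1)"
  have C0: "0 < C0" using k d by (simp add: C0_def add_pos_pos)
  show ?thesis
  proof (cases "measure lborel E = 0")
    case True
    have "0 \<le> 2 * C0 / k * I" using k C0 I0 by simp
    then show ?thesis
      unfolding E_def[symmetric] A_def[symmetric] k_def[symmetric] C0_def[symmetric] I_def[symmetric]
      using True by simp
  next
    case False
    define m where "m = measure lborel E"
    have m: "0 < m" using False by (simp add: m_def zero_less_measure_iff)
    interpret T: C1_pair "\<lambda>a b. smoothstep (a / c)" "\<lambda>z. smoothstep' (fst z / c) / c" "\<lambda>_. 0" "2 / c"
      by (rule C1_pair_smoothstep[OF c])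
    note f = T.wgrad_chain[OF w w \<Omega>(1), simplified]
    have "ennreal (k * m) \<le> ennreal m * emeasure lborel P +
       ennreal ((k + 1 / (d - 1)) * m powr (1 / d)) * (\<integral>\<^sup>+z. ennreal (norm ((smoothstep' (w z / c) / c) *\<^sub>R W z)) * indicator \<Omega> z \<partial>lborel)"
    proof (rule truncation_estimate[OF f, where K = "cball e \<kappa>" and E = E and P = P and O' = "\<Omega> \<inter> ball x0 \<delta>"])
      show "open (\<Omega> \<inter> ball x0 \<delta>)" using \<Omega> by auto
      show "E \<subseteq> \<Omega> \<inter> ball x0 \<delta>" by (auto simp: E_def)
      show "x + t *\<^sub>R y \<in> \<Omega>" if "x \<in> \<Omega> \<inter> ball x0 \<delta>" "y \<in> cball e \<kappa>" "0 \<le> t" "t \<le> 1" for x y t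
        using cn that by blast
      show "norm y \<le> 1" if "y \<in> cball e \<kappa>" for y using cn that by blast
      show "smoothstep (w x / c) \<le> indicator P x" if "x \<in> \<Omega>" for x
        using that c smoothstep_simps(3)[of "w x / c"] smoothstep_simps(1)[of "w x / c"] by (auto simp: P_def indicator_def)
      show "1 \<le> smoothstep (w x / c)" if "x \<in> E" for x
        using that c smoothstep_simps(2)[of "w x / c"] by (auto simp: E_def field_simps)
    qed (use ek k em m d in \<open>auto simp: m_def\<close>)
    also have "(\<integral>\<^sup>+z. ennreal (norm ((smoothstep' (w z / c) / c) *\<^sub>R W z)) * indicator \<Omega> z \<partial>lborel) \<le> ennreal I"
    proof -
      have iA: "integrable lborel (\<lambda>x. 2 / c * (indicator A x * norm (W x)))"
      proof (intro integrable_mult_right Bochner_Integration.integrable_bound[OF W])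
        show "AE x in lborel. norm (indicator A x * norm (W x)) \<le> norm (indicator \<Omega> x * norm (W x))"
          by (auto simp: A_def indicator_def)
      qed measurable
      have "(\<integral>\<^sup>+z. ennreal (norm ((smoothstep' (w z / c) / c) *\<^sub>R W z)) * indicator \<Omega> z \<partial>lborel)
          \<le> (\<integral>\<^sup>+z. ennreal (2 / c * (indicator A z * norm (W z))) \<partial>lborel)"
      proof (rule nn_integral_mono)
        fix z
        show "ennreal (norm ((smoothstep' (w z / c) / c) *\<^sub>R W z)) * indicator \<Omega> z \<le> ennreal (2 / c * (indicator A z * norm (W z)))"
        proof (cases "z \<in> A")
          case True
          have "norm ((smoothstep' (w z / c) / c) *\<^sub>R W z) \<le> 2 / c * norm (W z)"
            using smoothstep_simps(5)[of "w z / c"] c by (auto simp: abs_divide intro!: mult_right_mono divide_right_mono)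
          then show ?thesis using True by (auto simp: indicator_def intro: ennreal_leI)
        next
          case False
          then have "z \<notin> \<Omega> \<or> smoothstep' (w z / c) = 0"
            using c smoothstep_simps(4)[of "w z / c"] by (auto simp: A_def field_simps not_less)
          then show ?thesis by auto
        qed
      qed
      also have "\<dots> = ennreal (\<integral>z. 2 / c * (indicator A z * norm (W z)) \<partial>lborel)"
        using iA c by (intro nn_integral_eq_integral) auto
      finally show ?thesis by (simp add: I_def)
    qed
    finally have "ennreal (k * m) \<le> ennreal m * ennreal (measure lborel P) + ennreal (C0 * m powr (1 / d)) * ennreal I"
      unfolding em C0_def by (simp add: mult_left_mono)
    also have "\<dots> = ennreal (m * measure lborel P + C0 * m powr (1 / d) * I)"
      using m C0 I0 by (simp add: ennreal_mult ennreal_plus)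
    finally have "k * m \<le> m * measure lborel P + C0 * m powr (1 / d) * I"
      using m C0 I0 by (subst (asm) ennreal_le_iff) auto
    \<comment> \<open>Half of the left-hand side k m is given away here; the other half survives and
      is compared with the gradient term.\<close>
    also have "m * measure lborel P \<le> m * (k / 2)"
      using small m by (intro mult_left_mono) (auto simp: P_def k_def)
    finally have "k / 2 * m \<le> C0 * m powr (1 / d) * I" by (simp add: algebra_simps)
    moreover have "m = m powr (1 / d) * m powr (1 - 1 / d)" using m by (simp flip: powr_add)
    ultimately have "m powr (1 / d) * (k / 2 * m powr (1 - 1 / d)) \<le> m powr (1 / d) * (C0 * I)"
      by (metis (no_types, opaque_lifting) mult.assoc mult.commute)
    then have "k / 2 * m powr (1 - 1 / d) \<le> C0 * I" using m by simp
    then have "m powr (1 - 1 / d) \<le> 2 * C0 / k * I" using k by (simp add: field_simps)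
    then show ?thesis by (simp add: m_def E_def A_def k_def C0_def I_def)
  qed
qed

text \<open>Finitely many of the local cones cover the compact closure. Half the smallest measure of
  their direction balls is the threshold \<eta>, and subadditivity over the cover adds up the local
  constants.\<close>

lemma level_set_decay:
  fixes w :: "'a::euclidean_space \<Rightarrow> real"
  assumes dom: "bounded_smooth_domain \<Omega>" and w: "wgrad \<Omega> w W"
    and W: "integrable lborel (\<lambda>x. indicator \<Omega> x * norm (W x))" and d: "real DIM('a) \<le> d" "1 < d"
  shows "\<exists>C>0. \<exists>\<eta>>0. \<forall>c>0. measure lborel {x \<in> \<Omega>. c < w x} \<le> \<eta> \<longrightarrow>
    measure lborel {x \<in> \<Omega>. 2 * c < w x} \<le>
      C * (1 / c * (\<integral>x. indicator {x \<in> \<Omega>. c < w x \<and> w x < 2 * c} x * norm (W x) \<partial>lborel)) powr (d / (d - 1))"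
proof -
  have \<Omega>: "open \<Omega>" "bounded \<Omega>" "\<Omega> \<noteq> {}" using dom by (auto simp: bounded_smooth_domain_def)
  have [measurable]: "\<Omega> \<in> sets borel" using \<Omega> by simp
  note [measurable] = wgrad_borelD[OF w]
  have "\<forall>x0\<in>closure \<Omega>. \<exists>p. cone_at \<Omega> x0 (fst p) (fst (snd p)) (snd (snd p))"
    using cone_condition[OF dom] by (metis fst_conv snd_conv)
  then obtain p where p: "\<And>x0. x0 \<in> closure \<Omega> \<Longrightarrow> cone_at \<Omega> x0 (fst (p x0)) (fst (snd (p x0))) (snd (snd (p x0)))"
    by metis
  define \<delta> where "\<delta> x = fst (p x)" for x
  define K where "K x = cball (fst (snd (p x))) (snd (snd (p x)))" for x
  define k where "k x = measure lborel (K x)" for x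
  have kpos: "0 < k x" if "x \<in> closure \<Omega>" for x
    using p[OF that] content_cball_pos[of "snd (snd (p x))" "fst (snd (p x))"] by (simp add: cone_at_def k_def K_def)
  have "closure \<Omega> \<subseteq> (\<Union>x\<in>closure \<Omega>. ball x (\<delta> x))"
    using p by (auto simp: cone_at_def \<delta>_def)
  moreover have "compact (closure \<Omega>)" using \<Omega>(2) by simp
  ultimately obtain X where X: "X \<subseteq> closure \<Omega>" "finite X" "closure \<Omega> \<subseteq> (\<Union>x\<in>X. ball x (\<delta> x))"
    using compactE_image[of "closure \<Omega>" "closure \<Omega>" "\<lambda>x. ball x (\<delta> x)"] by auto
  have Xne: "X \<noteq> {}" using X(3) \<Omega>(3) closure_subset by fastforce
  define \<eta> where "\<eta> = Min (k ` X) / 2"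
  have \<eta>: "0 < \<eta>" "\<And>x. x \<in> X \<Longrightarrow> \<eta> \<le> k x / 2"
  proof -
    have "0 < Min (k ` X)" using X Xne kpos by (subst Min_gr_iff) auto
    then show "0 < \<eta>" by (simp add: \<eta>_def)
    show "\<eta> \<le> k x / 2" if "x \<in> X" for x using X(2) that by (simp add: \<eta>_def)
  qed
  define D where "D = d / (d - 1)"
  \<comment> \<open>The factor 4 collects the 2 from the absorption and the slope bound 2 of the
    step; the exponent D inverts 1 - 1/d.\<close>
  define B where "B x = 4 * (k x + 1 / (d - 1)) / k x" for x
  have B: "0 < B x" if "x \<in> X" for x using kpos[of x] that X(1) d by (auto simp: B_def intro!: divide_pos_pos add_pos_pos)
  define C where "C = (\<Sum>x\<in>X. B x powr D)"
  have C: "0 < C" unfolding C_def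
    by (rule sum_pos[OF X(2) Xne]) (metis B less_irrefl powr_gt_zero)
  show ?thesis
  proof (rule exI[of _ C], rule conjI[OF C], rule exI[of _ \<eta>], rule conjI[OF \<eta>(1)], intro allI impI)
    fix c :: real assume c: "0 < c" and small: "measure lborel {x \<in> \<Omega>. c < w x} \<le> \<eta>"
    define J where "J = 1 / c * (\<integral>x. indicator {x \<in> \<Omega>. c < w x \<and> w x < 2 * c} x * norm (W x) \<partial>lborel)"
    have J0: "0 \<le> J" using c by (simp add: J_def)
    define E where "E x0 = {x \<in> \<Omega> \<inter> ball x0 (\<delta> x0). 2 * c < w x}" for x0
    have [measurable]: "E x0 \<in> sets borel" for x0 unfolding E_def by measurable
    have fm: "B \<in> fmeasurable lborel" if "B \<subseteq> \<Omega>" "B \<in> sets borel" for B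
      using emeasure_bounded_finite[OF bounded_subset[OF \<Omega>(2) that(1)]] that(2) by (simp add: fmeasurable_def)
    have Em: "measure lborel (E x) \<le> B x powr D * J powr D" if x: "x \<in> X" for x
    proof -
      have xc: "x \<in> closure \<Omega>" using X(1) x by auto
      have "measure lborel (E x) powr (1 - 1 / d) \<le> 2 * (k x + 1 / (d - 1)) / k x * (2 / c * (\<integral>x. indicator {x \<in> \<Omega>. c < w x \<and> w x < 2 * c} x * norm (W x) \<partial>lborel))"
        unfolding E_def k_def K_def \<delta>_def
        by (rule level_set_decay_local[OF w \<Omega>(1,2) W p[OF xc] d c])
          (use small \<eta>(2)[OF x] in \<open>simp add: k_def K_def\<close>)
      also have "\<dots> = B x * J" by (simp add: B_def J_def)
      finally have "(measure lborel (E x) powr (1 - 1 / d)) powr D \<le> (B x * J) powr D"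
        using d by (intro powr_mono2) (auto simp: D_def)
      moreover have "(1 - 1 / d) * D = 1" using d by (simp add: D_def field_simps)
      ultimately show ?thesis using B[OF x] J0 by (simp add: powr_powr powr_mult)
    qed
    have "measure lborel {x \<in> \<Omega>. 2 * c < w x} \<le> measure lborel (\<Union>x\<in>X. E x)"
    proof (rule measure_mono_fmeasurable)
      show "{x \<in> \<Omega>. 2 * c < w x} \<subseteq> (\<Union>x\<in>X. E x)"
      proof
        fix x assume x: "x \<in> {x \<in> \<Omega>. 2 * c < w x}"
        then have "x \<in> (\<Union>x\<in>X. ball x (\<delta> x))" using X(3) closure_subset[of \<Omega>] by blast
        then show "x \<in> (\<Union>x\<in>X. E x)" using x unfolding E_def by blast
      qed
      show "(\<Union>x\<in>X. E x) \<in> fmeasurable lborel"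
        by (rule fm) (use X(2) in \<open>auto simp: E_def\<close>)
    qed measurable
    also have "\<dots> \<le> (\<Sum>x\<in>X. measure lborel (E x))"
      by (rule measure_UNION_le[OF X(2)]) simp
    also have "\<dots> \<le> (\<Sum>x\<in>X. B x powr D * J powr D)" by (intro sum_mono Em)
    also have "\<dots> = C * J powr D" by (simp add: C_def sum_distrib_right)
    finally show "measure lborel {x \<in> \<Omega>. 2 * c < w x} \<le>
      C * (1 / c * (\<integral>x. indicator {x \<in> \<Omega>. c < w x \<and> w x < 2 * c} x * norm (W x) \<partial>lborel)) powr (d / (d - 1))"
      by (simp add: J_def D_def)
  qed
qed

text \<open>The intermediate level sets at the heights 2^k are disjoint, so the gradient integrals
  over them sum to at most the full one. The recursion turns the level-set decay into summability of
  2 powr (k s) times the measures, which bounds the integral of the power s.\<close>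

lemma sobolev_positive_part:
  fixes w :: "'a::euclidean_space \<Rightarrow> real"
  assumes dom: "bounded_smooth_domain \<Omega>" and w: "wgrad \<Omega> w W"
    and w1: "integrable lborel (\<lambda>x. indicator \<Omega> x * \<bar>w x\<bar>)"
    and W1: "integrable lborel (\<lambda>x. indicator \<Omega> x * norm (W x))"
    and Wr: "integrable lborel (\<lambda>x. indicator \<Omega> x * norm (W x) powr r)"
    and d: "real DIM('a) \<le> d" and rd: "1 < r" "r < d"
  shows "(\<integral>\<^sup>+x. indicator \<Omega> x * ennreal (max 0 (w x) powr (d * r / (d - r))) \<partial>lborel) < \<infinity>"
proof -
  have \<Omega>: "open \<Omega>" "bounded \<Omega>" using dom by (auto simp: bounded_smooth_domain_def)
  interpret bounded_open \<Omega> r by unfold_locales (use \<Omega> rd in auto)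
  have [measurable]: "\<Omega> \<in> sets borel" using \<Omega> by simp
  note [measurable] = wgrad_borelD[OF w]
  have d1: "1 < d" using rd by simp
  define s where "s = d * r / (d - r)"
  have s0: "0 < s" using rd by (simp add: s_def)
  define P where "P k = {x \<in> \<Omega>. 2 ^ k < w x}" for k :: nat
  define A where "A k = {x \<in> \<Omega>. 2 ^ k < w x \<and> w x < 2 * 2 ^ k}" for k :: nat
  let ?I = "(\<integral>x. indicator \<Omega> x * norm (W x) powr r \<partial>lborel)" and ?L = "(\<integral>x. indicator \<Omega> x * \<bar>w x\<bar> \<partial>lborel)"
  have [measurable]: "P k \<in> sets borel" "A k \<in> sets borel" for k unfolding P_def A_def by measurable
  define m where "m k = measure lborel (P k)" for k
  define g where "g k = (\<integral>x. indicator (A k) x * norm (W x) \<partial>lborel)" for k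
  \<comment> \<open>The summand (1/2)^k makes b k positive, as the recursion demands, and costs at
    most 2 in total, which explains the 2 in B.\<close>
  define b where "b k = (\<integral>x. indicator (A k) x * norm (W x) powr r \<partial>lborel) + (1 / 2) ^ k" for k
  define B where "B = ?I + 2"
  have fm: "T \<in> fmeasurable lborel" if "T \<subseteq> \<Omega>" "T \<in> sets borel" for T
    using emeasure_bounded_finite[OF bounded_subset[OF bdd that(1)]] that(2) by (simp add: fmeasurable_def)
  have PO: "P k \<subseteq> \<Omega>" "A k \<subseteq> P k" "A k \<subseteq> \<Omega>" for k by (auto simp: P_def A_def)
  have em: "emeasure lborel (P k) = ennreal (m k)" for k
    unfolding m_def using emeasure_bounded_finite[OF bounded_subset[OF bdd PO(1)], of k]
    by (intro emeasure_eq_ennreal_measure) (simp add: less_top)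
  have iA: "integrable lborel (\<lambda>x. indicator (A k) x * f x)" if "integrable lborel (\<lambda>x. indicator \<Omega> x * f x)" "f \<in> borel_measurable borel"
    for f :: "'a \<Rightarrow> real" and k
  proof (rule Bochner_Integration.integrable_bound[OF that(1)])
    show "AE x in lborel. norm (indicator (A k) x * f x) \<le> norm (indicator \<Omega> x * f x)"
      using PO(3)[of k] by (auto simp: indicator_def)
  qed (use that(2) in measurable)
  note iA1 = iA[OF W1, simplified] note iAr = iA[OF Wr, simplified]
  obtain C \<eta> where C: "0 < C" and \<eta>: "0 < \<eta>" and dec: "\<And>c. 0 < c \<Longrightarrow> measure lborel {x \<in> \<Omega>. c < w x} \<le> \<eta> \<Longrightarrow>
    measure lborel {x \<in> \<Omega>. 2 * c < w x} \<le>
      C * (1 / c * (\<integral>x. indicator {x \<in> \<Omega>. c < w x \<and> w x < 2 * c} x * norm (W x) \<partial>lborel)) powr (d / (d - 1))"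
    using level_set_decay[OF dom w W1 d d1] by blast
  have cheb: "2 ^ k * m k \<le> ?L" for k
  proof -
    have "2 ^ k * m k = (\<integral>x. 2 ^ k * indicator (P k) x \<partial>lborel)" by (simp add: m_def)
    also have "\<dots> \<le> ?L"
    proof (rule integral_mono[OF _ w1])
      show "integrable lborel (\<lambda>x. 2 ^ k * indicator (P k) x :: real)"
        using fm[OF PO(1)] by (intro integrable_mult_right) (simp add: integrable_indicator_iff fmeasurable_def)
    qed (auto simp: P_def indicator_def)
    finally show ?thesis .
  qed
  \<comment> \<open>From this level on the Chebyshev bound brings the superlevel sets below the
    threshold of \<open>level_set_decay\<close>; lower levels are bounded trivially.\<close>
  obtain k0 where k0: "?L / \<eta> < 2 ^ k0"
    using real_arch_pow[of 2 "?L / \<eta>"] by auto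
  have small: "m k \<le> \<eta>" if "k0 \<le> k" for k
  proof -
    have "?L < \<eta> * 2 ^ k0" using k0 \<eta> by (simp add: field_simps)
    also have "\<dots> \<le> \<eta> * 2 ^ k" using \<eta> that by (intro mult_left_mono power_increasing) auto
    finally have "2 ^ k * m k < \<eta> * 2 ^ k" by (rule order.strict_trans1[OF cheb[of k]])
    then have "2 ^ k * m k < 2 ^ k * \<eta>" by (simp only: mult.commute[of \<eta>])
    then show ?thesis by simp
  qed
  have "\<exists>S. \<forall>n. (\<Sum>k\<in>{k0..n}. 2 powr (real k * (d * r / (d - r))) * m k) \<le> S"
  proof (rule Mazya_recursion[OF rd _ _ _ C, where g = g and b = b and B = B])
    show "0 \<le> m k" for k by (simp add: m_def)
    show "m (Suc k) \<le> m k" for k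
      unfolding m_def
    proof (rule measure_mono_fmeasurable[OF _ _ fm[OF PO(1)]])
      have "(2::real) ^ k \<le> 2 ^ Suc k" by simp
      then show "P (Suc k) \<subseteq> P k" unfolding P_def by (smt (verit) Collect_mono)
    qed auto
    show "0 < b k" for k unfolding b_def by (intro add_nonneg_pos) auto
    show "0 \<le> g k" for k by (simp add: g_def)
    show "m (Suc k) \<le> C * (2 powr (- real k) * g k) powr (d / (d - 1))" if "k0 \<le> k" for k
    proof -
      have "1 / 2 ^ k = 2 powr (- real k)" by (simp add: powr_minus_divide powr_realpow)
      then show ?thesis using dec[of "2 ^ k"] small[OF that] by (simp add: m_def g_def P_def A_def)
    qed
    show "g k \<le> \<mu> * m k + \<mu> powr (1 - r) * b k" if \<mu>: "0 < \<mu>" for k \<mu>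
    proof -
      have i: "integrable lborel (indicator (P k) :: 'a \<Rightarrow> real)"
        using fm[OF PO(1)] by (simp add: integrable_indicator_iff fmeasurable_def)
      have "g k \<le> (\<integral>x. \<mu> * indicator (P k) x + \<mu> powr (1 - r) * (indicator (A k) x * norm (W x) powr r) \<partial>lborel)"
        unfolding g_def
      proof (rule integral_mono)
        show "indicator (A k) x * norm (W x) \<le> \<mu> * indicator (P k) x + \<mu> powr (1 - r) * (indicator (A k) x * norm (W x) powr r)" for x
          using le_add_powr[OF \<mu>, of "norm (W x)"] \<mu> PO(2)[of k] by (auto simp: indicator_def)
      qed (use i iA1 iAr in auto)
      also have "\<dots> = \<mu> * m k + \<mu> powr (1 - r) * (\<integral>x. indicator (A k) x * norm (W x) powr r \<partial>lborel)"
        using i iAr by (simp add: m_def)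
      also have "\<dots> \<le> \<mu> * m k + \<mu> powr (1 - r) * b k"
        unfolding b_def by (intro add_left_mono mult_left_mono) auto
      finally show ?thesis .
    qed
    show "(\<Sum>k<n. b k) \<le> B" for n
    proof -
      have disj: "disjoint_family_on A {..<n}"
        unfolding disjoint_family_on_def
      proof (intro ballI impI)
        fix i j :: nat assume "i \<noteq> j"
        have "A i \<inter> A j = {}" if "i < j" for i j
        proof -
          have "(2::real) * 2 ^ i \<le> 2 ^ j" using power_increasing[of "Suc i" j "2::real"] that by simp
          then show ?thesis unfolding A_def by fastforce
        qed
        then show "A i \<inter> A j = {}" using \<open>i \<noteq> j\<close> by (metis inf_commute linorder_neqE_nat)
      qed
      have "(\<Sum>k<n. \<integral>x. indicator (A k) x * norm (W x) powr r \<partial>lborel) = (\<integral>x. (\<Sum>k<n. indicator (A k) x * norm (W x) powr r) \<partial>lborel)"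
        using iAr by (subst Bochner_Integration.integral_sum) auto
      also have "\<dots> \<le> ?I"
      proof (rule integral_mono[OF _ Wr])
        show "integrable lborel (\<lambda>x. \<Sum>k<n. indicator (A k) x * norm (W x) powr r)" by (intro Bochner_Integration.integrable_sum iAr)
        fix x
        have "(\<Sum>k<n. indicator (A k) x :: real) = indicator (\<Union>k<n. A k) x"
          by (rule indicator_UN_disjoint[OF _ disj, symmetric]) simp
        also have "\<dots> \<le> indicator \<Omega> x" using PO(3) by (auto simp: indicator_def)
        finally show "(\<Sum>k<n. indicator (A k) x * norm (W x) powr r) \<le> indicator \<Omega> x * norm (W x) powr r"
          unfolding sum_distrib_right[symmetric] by (rule mult_right_mono) simp
      qed
      finally have s1: "(\<Sum>k<n. \<integral>x. indicator (A k) x * norm (W x) powr r \<partial>lborel) \<le> ?I" .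
      have "(\<Sum>k<n. (1 / 2) ^ k) = 2 - 2 * (1 / 2 :: real) ^ n" by (induction n) auto
      then have s2: "(\<Sum>k<n. (1 / 2) ^ k) \<le> (2::real)" by simp
      show ?thesis unfolding b_def B_def sum.distrib by (rule add_mono[OF s1 s2])
    qed
  qed
  then obtain S where S: "\<And>n. (\<Sum>k\<in>{k0..n}. 2 powr (real k * s) * m k) \<le> S" by (auto simp: s_def)
  \<comment> \<open>The coefficient belongs to the level one higher than the set: where w lies
    between 2^(k0 + j) and twice that, its power s is at most the value at the upper end.\<close>
  define F where "F j x = ennreal (2 powr (real (Suc (k0 + j)) * s)) * indicator (P (k0 + j)) x" for j x
  have pt: "indicator \<Omega> x * ennreal (max 0 (w x) powr s) \<le> ennreal (2 powr (real k0 * s)) * indicator \<Omega> x + (\<Sum>j. F j x)" for x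
  proof (cases "x \<in> \<Omega>")
    case True
    show ?thesis
    proof (cases "w x \<le> 2 ^ k0")
      case le: True
      have "max 0 (w x) powr s \<le> (2 ^ k0) powr s" using le s0 by (intro powr_mono2) auto
      also have "\<dots> = 2 powr (real k0 * s)" by (simp add: powr_realpow[symmetric] powr_powr)
      finally show ?thesis using True by (simp add: ennreal_leI add_increasing2)
    next
      case False
      have ex: "\<exists>n. w x \<le> 2 ^ n" using real_arch_pow[of 2 "w x"] by (auto intro: less_imp_le)
      define n where "n = (LEAST n. w x \<le> 2 ^ n)"
      have n: "w x \<le> 2 ^ n" unfolding n_def by (rule LeastI_ex[OF ex])
      have kn: "k0 < n"
      proof (rule ccontr)
        assume "\<not> k0 < n"
        then have "(2::real) ^ n \<le> 2 ^ k0" by (intro power_increasing) auto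
        then show False using n False by linarith
      qed
      \<comment> \<open>n is the least exponent with w x \<le> 2^n, so x exceeds the level n - 1,
        and that level is k0 + j.\<close>
      define j where "j = n - 1 - k0"
      have nj: "n = Suc (k0 + j)" using kn by (simp add: j_def)
      have "\<not> w x \<le> 2 ^ (k0 + j)" using not_less_Least[of "k0 + j" "\<lambda>n. w x \<le> 2 ^ n"] nj unfolding n_def by simp
      then have xP: "x \<in> P (k0 + j)" using True by (simp add: P_def)
      have "max 0 (w x) powr s \<le> (2 ^ n) powr s" using n s0 by (intro powr_mono2) auto
      also have "\<dots> = 2 powr (real (Suc (k0 + j)) * s)" unfolding nj by (simp add: powr_realpow[symmetric] powr_powr del: power_Suc of_nat_Suc)
      finally have "ennreal (max 0 (w x) powr s) \<le> F j x" using xP by (simp add: F_def ennreal_leI)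
      also have "F j x \<le> (\<Sum>j. F j x)"
        using sum_le_suminf[of "\<lambda>j. F j x" "{j}"] by simp
      finally show ?thesis using True by (simp add: add_increasing)
    qed
  qed simp
  have Fm [measurable]: "F j \<in> borel_measurable borel" for j unfolding F_def[abs_def] by measurable
  have "(\<integral>\<^sup>+x. indicator \<Omega> x * ennreal (max 0 (w x) powr s) \<partial>lborel) \<le>
     (\<integral>\<^sup>+x. ennreal (2 powr (real k0 * s)) * indicator \<Omega> x + (\<Sum>j. F j x) \<partial>lborel)"
    by (intro nn_integral_mono pt)
  also have "\<dots> = ennreal (2 powr (real k0 * s)) * emeasure lborel \<Omega> + (\<Sum>j. \<integral>\<^sup>+x. F j x \<partial>lborel)"
    by (subst nn_integral_add) (auto simp: nn_integral_cmult_indicator nn_integral_suminf)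
  also have "(\<Sum>j. \<integral>\<^sup>+x. F j x \<partial>lborel) \<le> ennreal (2 powr s * S)"
    unfolding suminf_eq_SUP
  proof (rule SUP_least)
    fix n
    have "(\<Sum>j<n. \<integral>\<^sup>+x. F j x \<partial>lborel) = (\<Sum>j<n. ennreal (2 powr s * (2 powr (real (k0 + j) * s) * m (k0 + j))))"
    proof (rule sum.cong)
      fix j
      have "(\<integral>\<^sup>+x. F j x \<partial>lborel) = ennreal (2 powr (real (Suc (k0 + j)) * s)) * ennreal (m (k0 + j))"
        unfolding F_def by (subst nn_integral_cmult_indicator) (auto simp: em)
      also have "\<dots> = ennreal (2 powr s * (2 powr (real (k0 + j) * s) * m (k0 + j)))"
        by (simp add: ennreal_mult[symmetric] m_def powr_add algebra_simps)
      finally show "(\<integral>\<^sup>+x. F j x \<partial>lborel) = ennreal (2 powr s * (2 powr (real (k0 + j) * s) * m (k0 + j)))" .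
    qed simp
    also have "\<dots> = ennreal (2 powr s * (\<Sum>j<n. 2 powr (real (k0 + j) * s) * m (k0 + j)))"
      by (subst sum_ennreal) (auto simp: m_def sum_distrib_left)
    also have "\<dots> \<le> ennreal (2 powr s * S)"
    proof (intro ennreal_leI mult_left_mono)
      have "(\<Sum>j<n. 2 powr (real (k0 + j) * s) * m (k0 + j)) = (\<Sum>k\<in>{k0..<k0 + n}. 2 powr (real k * s) * m k)"
        by (rule sum.reindex_bij_witness[where i = "\<lambda>k. k - k0" and j = "\<lambda>j. k0 + j"]) auto
      also have "\<dots> \<le> (\<Sum>k\<in>{k0..k0 + n}. 2 powr (real k * s) * m k)" by (intro sum_mono2) (auto simp: m_def)
      also have "\<dots> \<le> S" by (rule S)
      finally show "(\<Sum>j<n. 2 powr (real (k0 + j) * s) * m (k0 + j)) \<le> S" .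
    qed simp
    finally show "(\<Sum>j<n. \<integral>\<^sup>+x. F j x \<partial>lborel) \<le> ennreal (2 powr s * S)" .
  qed
  also have "ennreal (2 powr (real k0 * s)) * emeasure lborel \<Omega> + ennreal (2 powr s * S) < \<infinity>"
    using emeasure_bounded_finite[OF bdd] by (simp add: ennreal_mult_less_top)
  finally show ?thesis by (simp add: s_def)
qed

text \<open>Positive and negative parts are treated separately, and the dimension enters only
  through a real parameter d that may exceed it. The condition on s expresses that s does not exceed
  the critical exponent if r is less than the dimension, and holds for every nonnegative s
  otherwise.\<close>

theorem sobolev_embedding:
  fixes u :: "'a::euclidean_space \<Rightarrow> real"
  assumes dom: "bounded_smooth_domain \<Omega>" and r1: "1 < r" and u: "u \<in> W1 r \<Omega>"
    and s: "0 \<le> s" "s * (real DIM('a) - r) \<le> r * real DIM('a)"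
  shows "integrable (lebesgue_on \<Omega>) (\<lambda>x. \<bar>u x\<bar> powr s)"
proof -
  have \<Omega>: "open \<Omega>" "bounded \<Omega>" using dom by (auto simp: bounded_smooth_domain_def)
  interpret bounded_open \<Omega> r by unfold_locales (use \<Omega> r1 in auto)
  have O [measurable]: "\<Omega> \<in> sets borel" using \<Omega> by simp
  note U = W1D[OF u]
  obtain w W where w: "wgrad \<Omega> w W" "AE x in lborel. x \<in> \<Omega> \<longrightarrow> u x = w x" "AE x in lborel. x \<in> \<Omega> \<longrightarrow> gr u x = W x"
    using has_weak_gradientE[OF \<Omega>(1) U(3)] .
  note [measurable] = wgrad_borelD[OF w(1)] Lr_measurable[OF U(1)] Lr_measurable[OF U(2)]
  have i1: "integrable lborel (\<lambda>x. indicator \<Omega> x *\<^sub>R \<bar>w x\<bar>)"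
  proof (rule integral_lebesgue_on_borel(1)[OF O, THEN iffD1])
    show "AE x in lborel. x \<in> \<Omega> \<longrightarrow> \<bar>u x\<bar> = \<bar>w x\<bar>" using w(2) by eventually_elim auto
  qed (use Lr_integrable[OF U(1)] in auto)
  have i2: "integrable lborel (\<lambda>x. indicator \<Omega> x *\<^sub>R norm (W x))"
  proof (rule integral_lebesgue_on_borel(1)[OF O, THEN iffD1])
    show "AE x in lborel. x \<in> \<Omega> \<longrightarrow> norm (gr u x) = norm (W x)" using w(3) by eventually_elim auto
  qed (use Lr_integrable[OF U(2)] in auto)
  have i3: "integrable lborel (\<lambda>x. indicator \<Omega> x *\<^sub>R norm (W x) powr r)"
  proof (rule integral_lebesgue_on_borel(1)[OF O, THEN iffD1])
    show "AE x in lborel. x \<in> \<Omega> \<longrightarrow> norm (gr u x) powr r = norm (W x) powr r" using w(3) by eventually_elim auto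
  qed (use Lr_integrable_powr[OF U(2)] in auto)
  \<comment> \<open>Below the dimension d is the dimension itself and gives the critical exponent.
    Otherwise d lies above r by r^2 / (s + 1), so that d r / (d - r) is larger than s.\<close>
  obtain d where d: "real DIM('a) \<le> d" "r < d" "s \<le> d * r / (d - r)"
  proof (cases "r < real DIM('a)")
    case True
    then show ?thesis using s that[of "real DIM('a)"] by (simp add: field_simps)
  next
    case False
    define d where "d = r + r\<^sup>2 / (s + 1)"
    have p: "0 < r\<^sup>2 / (s + 1)" using r1 s by simp
    have "s \<le> d * r / (d - r)"
    proof -
      have "s * (d - r) \<le> r\<^sup>2" using s r1 by (simp add: d_def field_simps)
      also have "\<dots> \<le> d * r" using p r1 by (simp add: d_def power2_eq_square)
      finally have "s * (d - r) \<le> d * r" .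
      moreover have "0 < d - r" using p by (simp add: d_def)
      ultimately show ?thesis by (simp only: pos_le_divide_eq)
    qed
    then show ?thesis using that[of d] False p by (simp add: d_def)
  qed
  define s' where "s' = d * r / (d - r)"
  have m1: "wgrad \<Omega> (\<lambda>x. - w x) (\<lambda>x. - W x)"
    using wgrad_lincomb[OF w(1) w(1) \<Omega>(1), of "-1" 0] by simp
  have p1: "(\<integral>\<^sup>+x. indicator \<Omega> x * ennreal (max 0 (w x) powr s') \<partial>lborel) < \<infinity>"
    unfolding s'_def by (rule sobolev_positive_part[OF dom w(1) _ _ _ d(1) r1 d(2)]) (use i1 i2 i3 in simp_all)
  have p2: "(\<integral>\<^sup>+x. indicator \<Omega> x * ennreal (max 0 (- w x) powr s') \<partial>lborel) < \<infinity>"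
    unfolding s'_def by (rule sobolev_positive_part[OF dom m1 _ _ _ d(1) r1 d(2)]) (use i1 i2 i3 in simp_all)
  have "integrable lborel (\<lambda>x. indicator \<Omega> x *\<^sub>R \<bar>w x\<bar> powr s)"
  proof (rule integrableI_bounded)
    have pt: "ennreal (norm (indicator \<Omega> x *\<^sub>R \<bar>w x\<bar> powr s)) \<le>
        indicator \<Omega> x + (indicator \<Omega> x * ennreal (max 0 (w x) powr s') + indicator \<Omega> x * ennreal (max 0 (- w x) powr s'))" for x
    proof (cases "x \<in> \<Omega>")
      case True
      have "\<bar>w x\<bar> powr s \<le> 1 + \<bar>w x\<bar> powr s'"
      proof (cases "\<bar>w x\<bar> \<le> 1")
        case True
        then have "\<bar>w x\<bar> powr s \<le> 1" using s by (intro powr_le1) auto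
        then show ?thesis by (simp add: add_increasing2)
      next
        case False
        then have "\<bar>w x\<bar> powr s \<le> \<bar>w x\<bar> powr s'" using d(3) by (intro powr_mono) (auto simp: s'_def)
        then show ?thesis by simp
      qed
      also have "\<bar>w x\<bar> powr s' \<le> max 0 (w x) powr s' + max 0 (- w x) powr s'" by (auto simp: max_def abs_if)
      finally have "\<bar>w x\<bar> powr s \<le> 1 + (max 0 (w x) powr s' + max 0 (- w x) powr s')" by simp
      then have "ennreal (\<bar>w x\<bar> powr s) \<le> ennreal (1 + (max 0 (w x) powr s' + max 0 (- w x) powr s'))" by (rule ennreal_leI)
      then show ?thesis using True by (simp add: ennreal_plus)
    qed simp
    have "(\<integral>\<^sup>+x. ennreal (norm (indicator \<Omega> x *\<^sub>R \<bar>w x\<bar> powr s)) \<partial>lborel) \<le>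
       (\<integral>\<^sup>+x. indicator \<Omega> x + (indicator \<Omega> x * ennreal (max 0 (w x) powr s') + indicator \<Omega> x * ennreal (max 0 (- w x) powr s')) \<partial>lborel)"
      by (rule nn_integral_mono) (rule pt)
    also have "\<dots> = emeasure lborel \<Omega> + ((\<integral>\<^sup>+x. indicator \<Omega> x * ennreal (max 0 (w x) powr s') \<partial>lborel)
        + (\<integral>\<^sup>+x. indicator \<Omega> x * ennreal (max 0 (- w x) powr s') \<partial>lborel))"
      by (simp add: nn_integral_add)
    also have "\<dots> < \<infinity>" using p1 p2 emeasure_bounded_finite[OF bdd] by simp
    finally show "(\<integral>\<^sup>+x. ennreal (norm (indicator \<Omega> x *\<^sub>R \<bar>w x\<bar> powr s)) \<partial>lborel) < \<infinity>" .
  qed measurable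
  then show ?thesis
  proof (rule integral_lebesgue_on_borel(1)[OF O, THEN iffD2, rotated -1])
    show "AE x in lborel. x \<in> \<Omega> \<longrightarrow> \<bar>u x\<bar> powr s = \<bar>w x\<bar> powr s" using w(2) by eventually_elim auto
  qed auto
qed

section \<open>Hidden convexity\<close>

lemma bernoulli_powr_strict:
  fixes z s :: real
  assumes "0 \<le> z" "1 < s" "z \<noteq> 1"
  shows "1 + s * (z - 1) < z powr s"
proof (cases "z = 0")
  case True
  then show ?thesis using assms by simp
next
  case False
  then have z: "0 < z" using assms by simp
  define f where "f z = z powr s - s * z" for z
  have d: "(f has_real_derivative s * (z powr (s - 1) - 1)) (at z)" if "0 < z" for z
    unfolding f_def[abs_def] using that by (auto intro!: derivative_eq_intros simp: algebra_simps)
  have "f 1 < f z"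
  proof (cases "1 < z")
    case True
    show ?thesis
    proof (rule DERIV_pos_imp_increasing_open[OF True])
      fix x :: real assume x: "1 < x" "x < z"
      then have "1 < x powr (s - 1)" using assms by (intro gr_one_powr) auto
      then show "\<exists>y. (f has_real_derivative y) (at x) \<and> 0 < y"
        using d[of x] x assms by (intro exI[of _ "s * (x powr (s - 1) - 1)"]) auto
    next
      show "continuous_on {1..z} f" unfolding f_def[abs_def] by (auto intro!: continuous_intros)
    qed
  next
    case False
    then have zl: "z < 1" using assms by simp
    show ?thesis
    proof (rule DERIV_neg_imp_decreasing_open[OF zl])
      fix x :: real assume x: "z < x" "x < 1"
      then have "x powr (s - 1) < 1" using assms z powr_less_mono2[of "s - 1" x 1] by simp
      then show "\<exists>y. (f has_real_derivative y) (at x) \<and> y < 0"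
        using d[of x] x z assms by (intro exI[of _ "s * (x powr (s - 1) - 1)"]) (auto simp: mult_pos_neg)
    next
      show "continuous_on {z..1} f" unfolding f_def[abs_def] using z by (auto intro!: continuous_intros)
    qed
  qed
  then show ?thesis by (simp add: f_def algebra_simps)
qed

lemma bernoulli_powr: "0 \<le> z \<Longrightarrow> 1 < s \<Longrightarrow> 1 + s * (z - 1) \<le> (z::real) powr s"
  using bernoulli_powr_strict[of z s] by (cases "z = 1") auto

lemma powr_tangent:
  fixes z c s :: real
  assumes "0 < c" "0 \<le> z" "1 < s"
  shows "c powr s + s * c powr (s - 1) * (z - c) \<le> z powr s"
    "z \<noteq> c \<Longrightarrow> c powr s + s * c powr (s - 1) * (z - c) < z powr s"
proof -
  have e: "c powr s * (1 + s * (z / c - 1)) = c powr s + s * c powr (s - 1) * (z - c)"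
  proof -
    have "c powr s = c powr (s - 1) * c" using assms by (simp add: powr_diff)
    then show ?thesis using assms by (simp add: field_simps)
  qed
  have f: "c powr s * (z / c) powr s = z powr s" using assms by (simp add: powr_divide)
  have cp: "0 < c powr s" using assms by simp
  show "c powr s + s * c powr (s - 1) * (z - c) \<le> z powr s"
    using mult_left_mono[OF bernoulli_powr[of "z / c" s], of "c powr s"] assms e f by simp
  assume "z \<noteq> c"
  then have "1 + s * (z / c - 1) < (z / c) powr s"
    using assms by (intro bernoulli_powr_strict) auto
  then have "c powr s * (1 + s * (z / c - 1)) < c powr s * (z / c) powr s"
    using cp by (rule mult_strict_left_mono)
  then show "c powr s + s * c powr (s - 1) * (z - c) < z powr s" using e f by simp
qed

text \<open>Averaging the tangent inequalities at the mean cancels their linear terms. The tangent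
  is strictly below the power away from its point of contact, which settles the equality
  case.\<close>

lemma powr_convex:
  fixes x y s t :: real
  assumes t: "0 < t" "t < 1" and x: "0 \<le> x" "0 \<le> y" and s: "1 < s"
  shows "((1 - t) * x + t * y) powr s \<le> (1 - t) * x powr s + t * y powr s"
    "((1 - t) * x + t * y) powr s = (1 - t) * x powr s + t * y powr s \<Longrightarrow> x = y"
proof -
  define c where "c = (1 - t) * x + t * y"
  have c0: "0 \<le> c" using t x by (simp add: c_def)
  have "((1 - t) * x + t * y) powr s \<le> (1 - t) * x powr s + t * y powr s \<and>
    (((1 - t) * x + t * y) powr s = (1 - t) * x powr s + t * y powr s \<longrightarrow> x = y)"
  proof (cases "c = 0")
    case True
    then have "(1 - t) * x = 0" "t * y = 0" using t x by (auto simp: c_def add_nonneg_eq_0_iff)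
    then have "x = 0" "y = 0" using t by auto
    then show ?thesis by simp
  next
    case False
    then have c: "0 < c" using c0 by simp
    have sum: "(1 - t) * (c powr s + s * c powr (s - 1) * (x - c)) + t * (c powr s + s * c powr (s - 1) * (y - c)) = c powr s"
    proof -
      have "(1 - t) * (x - c) + t * (y - c) = 0" by (simp add: c_def algebra_simps)
      moreover have "(1 - t) * (c powr s + s * c powr (s - 1) * (x - c)) + t * (c powr s + s * c powr (s - 1) * (y - c))
        = c powr s + s * c powr (s - 1) * ((1 - t) * (x - c) + t * (y - c))" by (simp add: algebra_simps)
      ultimately show ?thesis by simp
    qed
    note T = powr_tangent[OF c x(1) s] powr_tangent[OF c x(2) s]
    have le: "c powr s \<le> (1 - t) * x powr s + t * y powr s"
      using add_mono[OF mult_left_mono[OF T(1)] mult_left_mono[OF T(3)], of "1 - t" t] t unfolding sum by simp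
    have "x = y" if eq: "c powr s = (1 - t) * x powr s + t * y powr s"
    proof (rule ccontr)
      assume "x \<noteq> y"
      have "x \<noteq> c"
      proof
        assume "x = c"
        then have "t * (y - x) = 0" unfolding c_def by argo
        then show False using \<open>x \<noteq> y\<close> t by auto
      qed
      then have "c powr s < (1 - t) * x powr s + t * y powr s"
        using add_less_le_mono[OF mult_strict_left_mono[OF T(2)] mult_left_mono[OF T(3)], of "1 - t" t] t unfolding sum by simp
      then show False using eq by simp
    qed
    then show ?thesis using le by (simp add: c_def)
  qed
  then show "((1 - t) * x + t * y) powr s \<le> (1 - t) * x powr s + t * y powr s"
    "((1 - t) * x + t * y) powr s = (1 - t) * x powr s + t * y powr s \<Longrightarrow> x = y" by auto
qed

text \<open>Bernoulli at 1/z, multiplied by z powr q / q. The strict form identifies z = 1 as the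
  only case of equality.\<close>

lemma young_powr:
  fixes z q :: real
  assumes "0 \<le> z" "1 < q"
  shows "z powr (q - 1) \<le> (1 - 1 / q) * z powr q + 1 / q"
    "z \<noteq> 1 \<Longrightarrow> z powr (q - 1) < (1 - 1 / q) * z powr q + 1 / q"
proof -
  have "z powr (q - 1) < (1 - 1 / q) * z powr q + 1 / q" if "z \<noteq> 1"
  proof (cases "z = 0")
    case True
    then show ?thesis using assms by simp
  next
    case False
    then have z: "0 < z" using assms by simp
    have "1 + q * (1 / z - 1) < (1 / z) powr q"
      using z \<open>z \<noteq> 1\<close> assms by (intro bernoulli_powr_strict) auto
    then have "z powr q / q * (1 + q * (1 / z - 1)) < z powr q / q * (1 / z) powr q"
      using z assms by (intro mult_strict_left_mono) auto
    also have "z powr q / q * (1 / z) powr q = 1 / q" using z by (simp add: powr_divide)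
    also have "z powr q / q * (1 + q * (1 / z - 1)) = z powr (q - 1) - (1 - 1 / q) * z powr q"
    proof -
      have "z powr q = z powr (q - 1) * z" using z by (simp add: powr_diff)
      then show ?thesis using z assms by (simp add: field_simps)
    qed
    finally show ?thesis by simp
  qed
  then show "z \<noteq> 1 \<Longrightarrow> z powr (q - 1) < (1 - 1 / q) * z powr q + 1 / q" .
  then show "z powr (q - 1) \<le> (1 - 1 / q) * z powr q + 1 / q"
    by (cases "z = 1") auto
qed

lemma qmean_nonneg: "0 \<le> qmean q t a b"
  by (simp add: qmean_def)

lemma qmean_powr:
  assumes "0 < q" "0 \<le> t" "t \<le> 1"
  shows "qmean q t a b powr q = (1 - t) * \<bar>a\<bar> powr q + t * \<bar>b\<bar> powr q"
proof -
  have "0 \<le> (1 - t) * \<bar>a\<bar> powr q + t * \<bar>b\<bar> powr q" using assms by simp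
  then show ?thesis using assms by (simp add: qmean_def powr_powr)
qed

lemma qmean_pos:
  assumes "0 < t" "t < 1" "0 < a \<or> 0 < b"
  shows "0 < qmean q t a b"
proof -
  have "0 < (1 - t) * \<bar>a\<bar> powr q + t * \<bar>b\<bar> powr q"
    using assms by (auto intro: add_pos_nonneg add_nonneg_pos)
  then show ?thesis by (simp add: qmean_def)
qed

text \<open>With \<alpha> = a / m and \<beta> = b / m for the mean m, the weights take the form (1 -
  t) \<alpha>^(q - 1) and t \<beta>^(q - 1), where (1 - t) \<alpha>^q + t \<beta>^q = 1. The
  gradient of the mean thus becomes a Hoelder pairing with a normalised weight.\<close>

lemma qmean_deriv_alt:
  assumes q: "1 < q" and t: "0 < t" "t < 1" and a: "0 \<le> a" "0 \<le> b" and m: "0 < qmean q t a b"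
  shows "qmean_deriv q t a b = (1 - t) * (a / qmean q t a b) powr (q - 1)"
proof -
  define S where "S = (1 - t) * \<bar>a\<bar> powr q + t * \<bar>b\<bar> powr q"
  have S0: "0 \<le> S" using t by (simp add: S_def)
  have S: "0 < S" using m S0 unfolding qmean_def S_def[symmetric] by (cases "S = 0") auto
  have "qmean q t a b powr (q - 1) = S powr (1 / q * (q - 1))" by (simp add: qmean_def S_def powr_powr)
  also have "1 / q * (q - 1) = 1 - 1 / q" using q by (simp add: field_simps)
  finally have "S powr (1 / q - 1) = 1 / qmean q t a b powr (q - 1)"
    using S by (simp add: powr_minus_divide[symmetric])
  moreover have "\<bar>a\<bar> powr (q - 1) * sgn a = a powr (q - 1)" using a by (cases "a = 0") auto
  ultimately show ?thesis unfolding qmean_deriv_def S_def[symmetric]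
    using a m by (simp add: powr_divide)
qed

lemma qmean_commute: "qmean q (1 - t) b a = qmean q t a b"
  by (simp add: qmean_def add.commute)

lemma qmean_deriv_zero: "qmean_deriv q t 0 b = 0"
  by (simp add: qmean_deriv_def)

lemma qmean_deriv_nonneg: "0 \<le> a \<Longrightarrow> t < 1 \<Longrightarrow> 0 \<le> qmean_deriv q t a b"
  by (simp add: qmean_deriv_def)

text \<open>Two inequalities are chained through X, the q-mean of the norms of A and B: the norm of
  D is at most X by Young, and X powr p is at most the average of the p-th powers because p / q
  exceeds 1. Equality in the second forces equal norms, and then equality in the first forces equal
  weights and equal vectors.\<close>

lemma hidden_convexity:
  fixes A B :: "'a::euclidean_space"
  assumes q: "1 < q" "q < p" and t: "0 < t" "t < 1" and ab: "0 \<le> a" "0 \<le> b"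
  defines "D \<equiv> qmean_deriv q t a b *\<^sub>R A + qmean_deriv q (1 - t) b a *\<^sub>R B"
  shows "norm D powr p \<le> (1 - t) * norm A powr p + t * norm B powr p"
    "norm D powr p = (1 - t) * norm A powr p + t * norm B powr p \<Longrightarrow> A = B \<and> (a = b \<or> A = 0)"
proof -
  have t': "0 < 1 - t" "1 - t < 1" using t by auto
  define x where "x = norm A"
  define y where "y = norm B"
  have xy: "0 \<le> x" "0 \<le> y" by (auto simp: x_def y_def)
  define Xq where "Xq = (1 - t) * x powr q + t * y powr q"
  have Xq0: "0 \<le> Xq" using t by (simp add: Xq_def)
  define X where "X = Xq powr (1 / q)"
  have X0: "0 \<le> X" by (simp add: X_def)
  have XXq: "X powr q = Xq" using q Xq0 by (simp add: X_def powr_powr)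
  have Xp: "X powr p = Xq powr (p / q)" by (simp add: X_def powr_powr)
  have pq: "1 < p / q" using q by simp
  have xp: "(x powr q) powr (p / q) = x powr p" "(y powr q) powr (p / q) = y powr p"
    using q by (simp_all add: powr_powr)
  note pc = powr_convex[OF t _ _ pq, of "x powr q" "y powr q", folded Xq_def, unfolded xp]
  have R: "X powr p \<le> (1 - t) * x powr p + t * y powr p" using pc(1) by (simp add: Xp)
  have Rstrict: "x = y" if "X powr p = (1 - t) * x powr p + t * y powr p"
  proof -
    have "x powr q = y powr q" using pc(2) that by (simp add: Xp)
    then have "(x powr q) powr (1 / q) = (y powr q) powr (1 / q)" by simp
    then show ?thesis using q xy by (simp add: powr_powr)
  qed
  define c1 where "c1 = qmean_deriv q t a b"
  define c2 where "c2 = qmean_deriv q (1 - t) b a"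
  have c: "0 \<le> c1" "0 \<le> c2" using ab t by (auto simp: c1_def c2_def intro: qmean_deriv_nonneg)
  have nD: "norm D \<le> c1 * x + c2 * y"
    unfolding D_def c1_def[symmetric] c2_def[symmetric]
    by (rule order_trans[OF norm_triangle_ineq]) (use c in \<open>simp add: x_def y_def\<close>)
  have main: "norm D \<le> X \<and> (norm D = X \<and> x = y \<longrightarrow> A = B \<and> (a = b \<or> A = 0))"
  proof (cases "a = 0 \<and> b = 0")
    case True
    \<comment> \<open>By the value of \<open>qmean_deriv\<close> at zero. Here a = b already, so
      only A = B has to be checked.\<close>
    then have "D = 0" by (simp add: D_def qmean_deriv_zero)
    moreover have "A = B" if "X = 0" "x = y"
    proof -
      have "Xq = 0" using XXq that(1) q by simp
      then have "(1 - t) * x powr q = 0" unfolding Xq_def using t by (auto simp: add_nonneg_eq_0_iff)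
      then show ?thesis using t that(2) by (simp add: x_def y_def)
    qed
    ultimately show ?thesis using X0 True by auto
  next
    case False
    then have "0 < a \<or> 0 < b" using ab by auto
    define m where "m = qmean q t a b"
    have m: "0 < m" unfolding m_def by (rule qmean_pos[OF t \<open>0 < a \<or> 0 < b\<close>])
    define \<alpha> where "\<alpha> = a / m"
    define \<beta> where "\<beta> = b / m"
    have \<alpha>\<beta>: "0 \<le> \<alpha>" "0 \<le> \<beta>" using ab m by (auto simp: \<alpha>_def \<beta>_def)
    have c1: "c1 = (1 - t) * \<alpha> powr (q - 1)"
      using qmean_deriv_alt[OF q(1) t ab] m by (simp add: c1_def \<alpha>_def m_def)
    have c2: "c2 = t * \<beta> powr (q - 1)"
      using qmean_deriv_alt[OF q(1) t' ab(2,1)] m by (simp add: c2_def \<beta>_def m_def qmean_commute)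
    have one: "(1 - t) * \<alpha> powr q + t * \<beta> powr q = 1"
    proof -
      have "(1 - t) * \<alpha> powr q + t * \<beta> powr q = ((1 - t) * a powr q + t * b powr q) / m powr q"
        using ab m by (simp add: \<alpha>_def \<beta>_def powr_divide add_divide_distrib)
      also have "(1 - t) * a powr q + t * b powr q = m powr q" using qmean_powr[of q t a b] q t ab by (simp add: m_def)
      also have "m powr q / m powr q = 1" using m by simp
      finally show ?thesis .
    qed
    show ?thesis
    proof (cases "X = 0")
      case True
      then have "Xq = 0" using XXq q by simp
      then have "(1 - t) * x powr q = 0" "t * y powr q = 0" unfolding Xq_def using t by (auto simp: add_nonneg_eq_0_iff)
      then have "A = 0" "B = 0" using t by (auto simp: x_def y_def)
      then show ?thesis using X0 by (simp add: D_def)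
    next
      case False
      then have X: "0 < X" using X0 by simp
      \<comment> \<open>Young applied to \<alpha> and z / X, scaled back by homogeneity; the
        normalisations of \<alpha>, \<beta> and of the norms divided by X then make the averaged
        right-hand side equal to X.\<close>
      have young2: "\<alpha> powr (q - 1) * z \<le> X * ((1 - 1 / q) * \<alpha> powr q + 1 / q * (z / X) powr q)" if "0 \<le> \<alpha>" "0 \<le> z" for \<alpha> z
      proof (cases "z = 0")
        case True
        then show ?thesis using X q by simp
      next
        case False
        then have z: "0 < z" using that by simp
        define \<zeta> where "\<zeta> = z / X"
        have \<zeta>: "0 < \<zeta>" using z X by (simp add: \<zeta>_def)
        have "(\<alpha> / \<zeta>) powr (q - 1) \<le> (1 - 1 / q) * (\<alpha> / \<zeta>) powr q + 1 / q"
          using that \<zeta> q by (intro young_powr) auto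
        then have "\<zeta> powr q * (\<alpha> / \<zeta>) powr (q - 1) \<le> \<zeta> powr q * ((1 - 1 / q) * (\<alpha> / \<zeta>) powr q + 1 / q)"
          by (rule mult_left_mono) simp
        also have "\<zeta> powr q * (\<alpha> / \<zeta>) powr (q - 1) = \<alpha> powr (q - 1) * \<zeta>"
          using \<zeta> that by (simp add: powr_divide powr_diff)
        also have "\<zeta> powr q * ((1 - 1 / q) * (\<alpha> / \<zeta>) powr q + 1 / q) = (1 - 1 / q) * \<alpha> powr q + 1 / q * \<zeta> powr q"
          using \<zeta> that by (simp add: powr_divide distrib_left)
        finally have "X * (\<alpha> powr (q - 1) * \<zeta>) \<le> X * ((1 - 1 / q) * \<alpha> powr q + 1 / q * \<zeta> powr q)"
          using X by (intro mult_left_mono) auto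
        then show ?thesis using X by (simp add: \<zeta>_def)
      qed
      have "c1 * x + c2 * y = (1 - t) * (\<alpha> powr (q - 1) * x) + t * (\<beta> powr (q - 1) * y)"
        by (simp add: c1 c2)
      also have "\<dots> \<le> (1 - t) * (X * ((1 - 1 / q) * \<alpha> powr q + 1 / q * (x / X) powr q)) + t * (X * ((1 - 1 / q) * \<beta> powr q + 1 / q * (y / X) powr q))"
        using t by (intro add_mono mult_left_mono young2 \<alpha>\<beta> xy) auto
      also have "\<dots> = X * ((1 - 1 / q) * ((1 - t) * \<alpha> powr q + t * \<beta> powr q) + 1 / q * ((1 - t) * (x / X) powr q + t * (y / X) powr q))"
        by (simp add: algebra_simps add_divide_distrib diff_divide_distrib)
      also have "(1 - t) * (x / X) powr q + t * (y / X) powr q = 1"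
      proof -
        have "(1 - t) * (x / X) powr q + t * (y / X) powr q = Xq / X powr q"
          using xy X by (simp add: powr_divide Xq_def add_divide_distrib)
        then show ?thesis using XXq X powr_gt_zero[of X q] by (metis divide_self less_irrefl)
      qed
      finally have le: "c1 * x + c2 * y \<le> X" unfolding one by simp
      have "A = B \<and> (a = b \<or> A = 0)" if eq: "norm D = X" "x = y"
      proof -
        have "Xq = x powr q" using eq(2) by (simp add: Xq_def algebra_simps)
        then have Xx: "X = x" using xy q by (simp add: X_def powr_powr)
        \<comment> \<open>In the equality case X is the common norm and is at most (c1 + c2) X.
          Strict Young would give a sum of weights below 1 unless \<alpha> = \<beta> = 1.\<close>
        have "1 \<le> c1 + c2"
        proof -
          have "x * 1 \<le> x * (c1 + c2)" using nD eq Xx by (simp add: algebra_simps)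
          then show ?thesis using X Xx by simp
        qed
        have "\<alpha> = 1 \<and> \<beta> = 1"
        proof (rule ccontr)
          assume *: "\<not> (\<alpha> = 1 \<and> \<beta> = 1)"
          have "(1 - t) * \<alpha> powr (q - 1) + t * \<beta> powr (q - 1) < (1 - t) * ((1 - 1 / q) * \<alpha> powr q + 1 / q) + t * ((1 - 1 / q) * \<beta> powr q + 1 / q)"
          proof (cases "\<alpha> = 1")
            case True
            then show ?thesis
              using * t q by (intro add_le_less_mono mult_left_mono mult_strict_left_mono young_powr \<alpha>\<beta>) auto
          next
            case False
            then show ?thesis
              using t q by (intro add_less_le_mono mult_left_mono mult_strict_left_mono young_powr \<alpha>\<beta>) auto
          qed
          also have "\<dots> = (1 - 1 / q) * ((1 - t) * \<alpha> powr q + t * \<beta> powr q) + 1 / q" by (simp add: algebra_simps add_divide_distrib diff_divide_distrib)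
          also have "\<dots> = 1" using one by simp
          finally show False using \<open>1 \<le> c1 + c2\<close> by (simp add: c1 c2)
        qed
        then have "\<alpha> = 1" "\<beta> = 1" by auto
        then have "a = b" using m by (simp add: \<alpha>_def \<beta>_def)
        have "D = (1 - t) *\<^sub>R A + t *\<^sub>R B"
          unfolding D_def c1_def[symmetric] c2_def[symmetric] c1 c2 using \<open>\<alpha> = 1\<close> \<open>\<beta> = 1\<close> by simp
        \<comment> \<open>Strict convexity of the Euclidean ball: a convex combination of two
          vectors of length X has length X only if their inner product is X^2.\<close>
        then have "X\<^sup>2 = ((1 - t) *\<^sub>R A + t *\<^sub>R B) \<bullet> ((1 - t) *\<^sub>R A + t *\<^sub>R B)"
          using eq(1) by (simp add: power2_norm_eq_inner[symmetric])
        also have "\<dots> = (1 - t)\<^sup>2 * (A \<bullet> A) + t\<^sup>2 * (B \<bullet> B) + 2 * t * (1 - t) * (A \<bullet> B)"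
          by (simp add: inner_simps power2_eq_square algebra_simps inner_commute)
        finally have s: "X\<^sup>2 = (1 - t)\<^sup>2 * X\<^sup>2 + t\<^sup>2 * X\<^sup>2 + 2 * t * (1 - t) * (A \<bullet> B)"
          using Xx eq(2) by (simp add: x_def y_def power2_norm_eq_inner[symmetric])
        have "2 * t * (1 - t) * (X\<^sup>2 - A \<bullet> B) = 0" using s by (simp add: power2_eq_square algebra_simps)
        then have "A \<bullet> B = X\<^sup>2" using t by simp
        moreover have "(A - B) \<bullet> (A - B) = A \<bullet> A - 2 * (A \<bullet> B) + B \<bullet> B"
          by (simp add: inner_diff_left inner_diff_right inner_commute)
        ultimately have "(A - B) \<bullet> (A - B) = 0"
          using Xx eq(2) dot_square_norm[of A] dot_square_norm[of B] unfolding x_def y_def proof - assume *: "A \<bullet> B = X\<^sup>2" "(A - B) \<bullet> (A - B) = A \<bullet> A - 2 * (A \<bullet> B) + B \<bullet> B" "X = norm A" "norm A = norm B" "A \<bullet> A = (norm A)\<^sup>2" "B \<bullet> B = (norm B)\<^sup>2" show ?thesis unfolding *(2) unfolding *(1,5,6) unfolding *(3) unfolding *(4) by simp qed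
        then show ?thesis using \<open>a = b\<close> by simp
      qed
      then show ?thesis using le nD by auto
    qed
  qed
  have DX: "norm D powr p \<le> X powr p" using main q by (intro powr_mono2) auto
  show "norm D powr p \<le> (1 - t) * norm A powr p + t * norm B powr p"
    using DX R by (simp add: x_def y_def)
  assume eq: "norm D powr p = (1 - t) * norm A powr p + t * norm B powr p"
  then have e1: "X powr p = (1 - t) * x powr p + t * y powr p" and e2: "norm D powr p = X powr p"
    using DX R by (auto simp: x_def y_def)
  have "(norm D powr p) powr (1 / p) = (X powr p) powr (1 / p)" using e2 by simp
  then have "norm D = X" using X0 q by (simp add: powr_powr)
  with main Rstrict[OF e1] show "A = B \<and> (a = b \<or> A = 0)" by blast
qed

section \<open>Primitives: convexity of H and concavity of G in the q-th power\<close>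

lemma primitive_eq:
  assumes "continuous_on {0..} f" "0 \<le> t"
  shows "primitive f t = integral {0..t} f"
proof -
  have c: "continuous_on {0..t} f" using assms by (auto intro: continuous_on_subset)
  have "primitive f t = (LBINT s:{0..t}. f s)"
    unfolding primitive_def using interval_integral_Icc[of 0 t f] assms by (simp add: zero_ereal_def)
  also have "\<dots> = integral {0..t} f"
    by (rule set_borel_integral_eq_integral(2)[OF borel_integrable_atLeastAtMost'[OF c]])
  finally show ?thesis .
qed

lemma primitive_deriv:
  assumes c: "continuous_on {0..} f" and t: "0 < t"
  shows "(primitive f has_real_derivative f t) (at t)"
proof -
  have c': "continuous_on {0..t + 1} f" using c by (auto intro: continuous_on_subset)
  have "((\<lambda>x. integral {0..x} f) has_real_derivative f t) (at t within {0..t + 1})"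
    using t by (intro integral_has_real_derivative[OF c']) auto
  then have "((\<lambda>x. integral {0..x} f) has_real_derivative f t) (at t)"
    using t by (subst (asm) at_within_interior) auto
  then show ?thesis
    by (rule has_field_derivative_transform_within_open[where S = "{0<..}"])
      (use t primitive_eq[OF c] in auto)
qed

lemma primitive_continuous:
  assumes c: "continuous_on {0..} f"
  shows "continuous_on {0..} (primitive f)"
proof -
  have "continuous (at x within {0..}) (primitive f)" if "0 \<le> x" for x
  proof (cases "x = 0")
    case False
    then show ?thesis using primitive_deriv[OF c, of x] that
      by (auto intro: continuous_at_imp_continuous_at_within DERIV_isCont)
  next
    case True
    have c': "continuous_on {0..1} f" using c by (auto intro: continuous_on_subset)
    have "continuous_on {0..1} (\<lambda>x. integral {0..x} f)"
      by (intro indefinite_integral_continuous_1 integrable_continuous_interval c')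
    then have "continuous (at 0 within {0..1}) (\<lambda>x. integral {0..x} f)" by (simp add: continuous_on_eq_continuous_within)
    moreover have "at (0::real) within {0..1} = at 0 within {0..}"
      by (rule at_within_nhd[of _ "{..<1}"]) auto
    ultimately have "continuous (at 0 within {0..}) (\<lambda>x. integral {0..x} f)" by simp
    then have "continuous (at 0 within {0..}) (primitive f)"
      by (rule continuous_transform_within[where \<delta> = 1]) (auto simp: primitive_eq[OF c])
    then show ?thesis using True by simp
  qed
  then show ?thesis by (simp add: continuous_on_eq_continuous_within)
qed

lemma primitive_zero [simp]: "primitive f 0 = 0"
  by (simp add: primitive_def zero_ereal_def)

text \<open>\<open>e = 1\<close> serves the concavity of \<open>s \<mapsto> G (x, root of s)\<close> and \<open>e = -1\<close> the convexity of \<open>H\<close>; \<open>K\<close> is affine in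
  the respective variable.\<close>

lemma primitive_tangent:
  assumes c: "continuous_on {0..} f" and K: "\<And>s. 0 < s \<Longrightarrow> (K has_real_derivative k s) (at s)" "continuous_on {0..} K"
    and \<gamma>: "0 \<le> \<gamma>" "0 \<le> a" and e: "e \<in> {-1, 1}"
    and below: "\<And>s. 0 < s \<Longrightarrow> s < \<gamma> \<Longrightarrow> e * k s \<le> e * f s" and above: "\<And>s. \<gamma> < s \<Longrightarrow> e * f s \<le> e * k s"
  shows "e * (primitive f a - primitive f \<gamma>) \<le> e * (K a - K \<gamma>)"
proof -
  define F where "F s = e * (primitive f s - K s)" for s
  have d: "(F has_real_derivative e * (f s - k s)) (at s)" if "0 < s" for s
    unfolding F_def[abs_def] by (intro DERIV_cmult DERIV_diff primitive_deriv c that K)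
  have Fc: "continuous_on {0..} F" unfolding F_def[abs_def] by (intro continuous_intros primitive_continuous c K)
  consider "a = \<gamma>" | "a < \<gamma>" | "\<gamma> < a" by linarith
  then have "F a \<le> F \<gamma>"
  proof cases
    case 2
    show ?thesis
    proof (rule DERIV_nonneg_imp_increasing_open[of a \<gamma> F])
      show "\<exists>y. (F has_real_derivative y) (at x) \<and> 0 \<le> y" if "a < x" "x < \<gamma>" for x
        using that \<gamma> below[of x] d[of x] by (intro exI[of _ "e * (f x - k x)"]) (auto simp: right_diff_distrib)
      show "continuous_on {a..\<gamma>} F" using Fc \<gamma> by (auto intro: continuous_on_subset)
    qed (use 2 in simp)
  next
    case 3
    show ?thesis
    proof (rule DERIV_nonpos_imp_decreasing_open[of \<gamma> a F])
      show "\<exists>y. (F has_real_derivative y) (at x) \<and> y \<le> 0" if "\<gamma> < x" "x < a" for x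
        using that \<gamma> above[of x] d[of x] by (intro exI[of _ "e * (f x - k x)"]) (auto simp: right_diff_distrib)
      show "continuous_on {\<gamma>..a} F" using Fc \<gamma> by (auto intro: continuous_on_subset)
    qed (use 3 in simp)
  qed simp
  then show ?thesis by (simp add: F_def right_diff_distrib)
qed

lemma primitive_growth:
  assumes c: "continuous_on {0..} f" and t: "0 \<le> t" and le: "\<And>s. 0 \<le> s \<Longrightarrow> s \<le> t \<Longrightarrow> \<bar>f s\<bar> \<le> B"
  shows "\<bar>primitive f t\<bar> \<le> B * t"
proof -
  have c': "continuous_on {0..t} f" using c by (auto intro: continuous_on_subset)
  have "norm (integral {0..t} f) \<le> B * (t - 0)"
    by (rule integral_bound[OF t c']) (use le in auto)
  then show ?thesis by (simp add: primitive_eq[OF c t])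
qed

locale monotone_density =
  fixes h :: "real \<Rightarrow> real"
  assumes h_nonneg: "\<And>t. 0 \<le> t \<Longrightarrow> 0 \<le> h t" and h_cont: "continuous_on {0..} h"
    and h_mono: "mono_on {0..} h" and h_pos: "\<And>t. 0 < t \<Longrightarrow> 0 < h t"
begin

text \<open>A nondecreasing h lies below the constant h \<gamma> to the left of \<gamma> and above
  it to the right; the supporting line with slope h \<gamma> follows, and it also yields
  monotonicity and convexity.\<close>

lemma H_tangent:
  assumes "0 \<le> \<gamma>" "0 \<le> a"
  shows "primitive h \<gamma> + h \<gamma> * (a - \<gamma>) \<le> primitive h a"
proof -
  have "- 1 * (primitive h a - primitive h \<gamma>) \<le> - 1 * (h \<gamma> * a - h \<gamma> * \<gamma>)"
    by (rule primitive_tangent[OF h_cont, where k = "\<lambda>_. h \<gamma>"])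
      (use assms mono_onD[OF h_mono] in \<open>auto intro!: derivative_eq_intros continuous_intros\<close>)
  then show ?thesis by (simp add: algebra_simps)
qed

lemma H_mono: "0 \<le> a \<Longrightarrow> a \<le> b \<Longrightarrow> primitive h a \<le> primitive h b"
  using H_tangent[of a b] h_nonneg[of a] by (smt (verit) mult_nonneg_nonneg)

lemma H_strict_mono:
  assumes "0 \<le> a" "a < b"
  shows "primitive h a < primitive h b"
proof -
  \<comment> \<open>The supporting line is taken at the midpoint, which is positive even if a = 0,
    where h may vanish.\<close>
  define c where "c = (a + b) / 2"
  have c: "a \<le> c" "c < b" "0 < c" using assms by (auto simp: c_def)
  have "0 < h c * (b - c)" using h_pos[OF c(3)] c by simp
  then show ?thesis using H_mono[OF assms(1) c(1)] H_tangent[of c b] c by linarith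
qed

lemma H_convex:
  assumes "0 \<le> a" "0 \<le> b" "0 < t" "t < 1"
  shows "primitive h ((1 - t) * a + t * b) \<le> (1 - t) * primitive h a + t * primitive h b"
proof -
  define \<gamma> where "\<gamma> = (1 - t) * a + t * b"
  have \<gamma>: "0 \<le> \<gamma>" using assms by (simp add: \<gamma>_def)
  have "(1 - t) * (primitive h \<gamma> + h \<gamma> * (a - \<gamma>)) + t * (primitive h \<gamma> + h \<gamma> * (b - \<gamma>))
      \<le> (1 - t) * primitive h a + t * primitive h b"
    using assms \<gamma> by (intro add_mono mult_left_mono H_tangent) auto
  moreover have "(1 - t) * (primitive h \<gamma> + h \<gamma> * (a - \<gamma>)) + t * (primitive h \<gamma> + h \<gamma> * (b - \<gamma>))
     = primitive h \<gamma> + h \<gamma> * ((1 - t) * a + t * b - \<gamma>)" by (simp add: algebra_simps)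
  ultimately show ?thesis by (simp add: \<gamma>_def)
qed

end

text \<open>By the quotient condition f lies above k s powr (q - 1) to the left of \<gamma> and
  below it to the right, k being the quotient at \<gamma>. Hence the primitive lies below K up to a
  constant, with contact at \<gamma>, and K is affine in s powr q, the quantity that
  \<open>qmean\<close> averages.\<close>

lemma G_concave:
  fixes f :: "real \<Rightarrow> real"
  assumes c: "continuous_on UNIV f" and q: "1 < q" and anti: "antimono_on {0<..} (\<lambda>t. f t / t powr (q - 1))"
    and t: "0 < t" "t < 1" and ab: "0 \<le> a" "0 \<le> b"
  shows "(1 - t) * primitive f a + t * primitive f b \<le> primitive f (qmean q t a b)"
proof (cases "a = 0 \<and> b = 0")
  case True
  then have "qmean q t a b = 0" using q by (simp add: qmean_def)
  then show ?thesis using True by simp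
next
  case False
  define \<gamma> where "\<gamma> = qmean q t a b"
  have \<gamma>: "0 < \<gamma>" unfolding \<gamma>_def using False ab t by (intro qmean_pos) auto
  have c': "continuous_on {0..} f" using c by (rule continuous_on_subset) simp
  define k where "k = f \<gamma> / \<gamma> powr (q - 1)"
  define K where "K s = k / q * s powr q" for s
  have T: "primitive f x - primitive f \<gamma> \<le> K x - K \<gamma>" if "0 \<le> x" for x
  proof (rule primitive_tangent[OF c', where k = "\<lambda>s. k * s powr (q - 1)" and e = 1, simplified mult_1])
    show "(K has_real_derivative k * s powr (q - 1)) (at s)" if "0 < s" for s
      unfolding K_def[abs_def] using that q by (auto intro!: derivative_eq_intros)
    show "continuous_on {0..} K" unfolding K_def[abs_def]
      by (intro continuous_on_mult continuous_on_const continuous_on_powr' continuous_on_id) (use q in auto)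
    show "k * s powr (q - 1) \<le> f s" if s: "0 < s" "s < \<gamma>" for s
    proof -
      have "k \<le> f s / s powr (q - 1)"
        unfolding k_def using monotone_onD[OF anti, of s \<gamma>] s by auto
      then show ?thesis using s by (simp add: field_simps)
    qed
    show "f s \<le> k * s powr (q - 1)" if s: "\<gamma> < s" for s
    proof -
      have "f s / s powr (q - 1) \<le> k"
        unfolding k_def using monotone_onD[OF anti, of \<gamma> s] s \<gamma> by auto
      then show ?thesis using s \<gamma> by (simp add: field_simps)
    qed
  qed (use that \<gamma> in auto)
  have "(1 - t) * (primitive f a - primitive f \<gamma>) + t * (primitive f b - primitive f \<gamma>)
     \<le> (1 - t) * (K a - K \<gamma>) + t * (K b - K \<gamma>)"
    using t ab by (intro add_mono mult_left_mono T) auto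
  also have "\<dots> = k / q * ((1 - t) * a powr q + t * b powr q - \<gamma> powr q)" by (simp add: K_def algebra_simps add_divide_distrib diff_divide_distrib)
  also have "\<dots> = 0" using qmean_powr[of q t a b] q t ab by (simp add: \<gamma>_def)
  finally show ?thesis by (simp add: \<gamma>_def algebra_simps)
qed

section \<open>The energy\<close>

lemma powr_lipschitz:
  fixes \<alpha> b :: real
  obtains L where "0 \<le> L" "\<And>s. 1 / 2 \<le> s \<Longrightarrow> s \<le> b \<Longrightarrow> \<bar>s powr \<alpha> - 1\<bar> \<le> L * \<bar>s - 1\<bar>"
proof -
  define c where "c = max b 1"
  have "continuous_on {1/2..c} (\<lambda>s::real. \<alpha> * s powr (\<alpha> - 1))"
    by (intro continuous_intros) auto
  then have "bounded ((\<lambda>s::real. \<alpha> * s powr (\<alpha> - 1)) ` {1/2..c})"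
    by (intro compact_imp_bounded compact_continuous_image) auto
  then obtain L where L: "0 < L" "\<And>s::real. s \<in> {1/2..c} \<Longrightarrow> \<bar>\<alpha> * s powr (\<alpha> - 1)\<bar> \<le> L"
    by (auto simp: bounded_pos)
  show thesis
  proof (rule that)
    show "0 \<le> L" using L by simp
    fix s :: real assume s: "1 / 2 \<le> s" "s \<le> b"
    have "norm (s powr \<alpha> - 1 powr \<alpha>) \<le> L * norm (s - 1)"
    proof (rule field_differentiable_bound[of "{1/2..c}" "\<lambda>s. s powr \<alpha>" "\<lambda>s. \<alpha> * s powr (\<alpha> - 1)"])
      fix z :: real assume z: "z \<in> {1/2..c}"
      then show "((\<lambda>s. s powr \<alpha>) has_field_derivative \<alpha> * z powr (\<alpha> - 1)) (at z within {1/2..c})"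
        by (auto intro!: derivative_eq_intros)
      show "norm (\<alpha> * z powr (\<alpha> - 1)) \<le> L" using L(2)[OF z] by simp
    qed (use s in \<open>auto simp: c_def\<close>)
    then show "\<bar>s powr \<alpha> - 1\<bar> \<le> L * \<bar>s - 1\<bar>" by simp
  qed
qed

text \<open>By homogeneity everything depends on \<rho> = b / a, confined to a bounded interval by
  comparability, and on s = 1 + t (\<rho>^q - 1), which stays in a compact part of the positive axis
  where powers are Lipschitz. The weight of the second gradient carries an explicit factor
  t.\<close>

lemma qmean_perturbation:
  assumes q: "1 < q"
  obtains K where "0 \<le> K"
    "\<And>a b t. 0 < a \<Longrightarrow> 0 \<le> b \<Longrightarrow> b \<le> R * a \<Longrightarrow> 0 < t \<Longrightarrow> t \<le> 1 / 2 \<Longrightarrow>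
       \<bar>qmean q t a b - a\<bar> \<le> K * t * a \<and> \<bar>qmean_deriv q t a b - 1\<bar> \<le> K * t \<and> \<bar>qmean_deriv q (1 - t) b a\<bar> \<le> K * t"
proof -
  define P where "P = \<bar>R\<bar> powr q + 1"
  have P: "1 \<le> P" by (simp add: P_def)
  obtain L1 where L1: "0 \<le> L1" "\<And>s. 1 / 2 \<le> s \<Longrightarrow> s \<le> 1 + P \<Longrightarrow> \<bar>s powr (1 / q) - 1\<bar> \<le> L1 * \<bar>s - 1\<bar>"
    using powr_lipschitz[of "1 + P" "1 / q"] by metis
  obtain L2 where L2: "0 \<le> L2" "\<And>s. 1 / 2 \<le> s \<Longrightarrow> s \<le> 1 + P \<Longrightarrow> \<bar>s powr (1 / q - 1) - 1\<bar> \<le> L2 * \<bar>s - 1\<bar>"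
    using powr_lipschitz[of "1 + P" "1 / q - 1"] by metis
  define Q where "Q = 1 + L2 * P"
  define Rq where "Rq = \<bar>R\<bar> powr (q - 1)"
  define K where "K = L1 * P + (L2 * P + Q) + Q * Rq"
  have Q: "0 \<le> Q" using L2 P by (simp add: Q_def)
  have Rq: "0 \<le> Rq" by (simp add: Rq_def)
  have Kle: "L1 * P \<le> K" "L2 * P + Q \<le> K" "Q * Rq \<le> K"
    using L1 L2 P Q Rq by (simp_all add: K_def)
  show thesis
  proof (rule that)
    show "0 \<le> K" using Kle(3) Q Rq by (smt (verit) mult_nonneg_nonneg)
    fix a b t :: real
    assume a: "0 < a" and b: "0 \<le> b" "b \<le> R * a" and t: "0 < t" "t \<le> 1 / 2"
    define \<rho> where "\<rho> = b / a"
    have \<rho>: "0 \<le> \<rho>" "\<rho> \<le> \<bar>R\<bar>" using a b by (auto simp: \<rho>_def divide_le_eq intro: order_trans[OF _ mult_right_mono[OF abs_ge_self]])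
    have bq: "b = a * \<rho>" using a by (simp add: \<rho>_def)
    define s where "s = 1 + t * (\<rho> powr q - 1)"
    have "\<rho> powr q \<le> \<bar>R\<bar> powr q" using \<rho> q by (intro powr_mono2) auto
    then have \<rho>P: "\<bar>\<rho> powr q - 1\<bar> \<le> P" using powr_ge_zero[of \<rho> q] powr_ge_zero[of "\<bar>R\<bar>" q] unfolding P_def by linarith
    have s1: "\<bar>s - 1\<bar> \<le> t * P" using \<rho>P t by (simp add: s_def abs_mult)
    have "t * P \<le> P" using t P by simp
    then have s2: "s \<le> 1 + P" using s1 by linarith
    \<comment> \<open>Since s \<ge> 1 - t, the restriction t \<le> 1/2 keeps s away from 0.\<close>
    have "0 \<le> t * \<rho> powr q" using t by simp
    then have s3: "1 / 2 \<le> s" using t unfolding s_def right_diff_distrib by linarith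
    have S: "(1 - t) * \<bar>a\<bar> powr q + t * \<bar>b\<bar> powr q = a powr q * s"
      using a \<rho> by (simp add: bq s_def abs_mult powr_mult algebra_simps)
    have m: "qmean q t a b = a * s powr (1 / q)"
      unfolding qmean_def S using a q s3 by (simp add: powr_mult powr_powr)
    have s4: "s powr (1 / q - 1) \<le> Q" "\<bar>s powr (1 / q - 1) - 1\<bar> \<le> t * (L2 * P)"
    proof -
      have *: "\<bar>s powr (1 / q - 1) - 1\<bar> \<le> L2 * (t * P)"
        using L2(2)[OF s3 s2] mult_left_mono[OF s1 L2(1)] by linarith
      then show "\<bar>s powr (1 / q - 1) - 1\<bar> \<le> t * (L2 * P)" by (simp add: mult.left_commute)
      have "L2 * (t * P) \<le> L2 * P" using L2(1) \<open>t * P \<le> P\<close> by (rule mult_left_mono[rotated])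
      then show "s powr (1 / q - 1) \<le> Q" using * by (simp add: Q_def)
    qed
    have Sq: "(a powr q * s) powr (1 / q - 1) * a powr (q - 1) = s powr (1 / q - 1)"
    proof -
      have "q * (1 / q - 1) = 1 - q" using q by (simp add: field_simps)
      then have "(a powr q * s) powr (1 / q - 1) = a powr (1 - q) * s powr (1 / q - 1)"
        using a s3 by (simp add: powr_mult powr_powr)
      moreover have "a powr (1 - q) * a powr (q - 1) = 1" using a by (simp flip: powr_add)
      ultimately show ?thesis by (simp add: mult.assoc mult.commute[of "s powr _"])
    qed
    have d1: "qmean_deriv q t a b = (1 - t) * s powr (1 / q - 1)"
      unfolding qmean_deriv_def S using Sq a by simp
    have d2: "qmean_deriv q (1 - t) b a = t * s powr (1 / q - 1) * \<rho> powr (q - 1)"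
    proof -
      have "(1 - (1 - t)) * \<bar>b\<bar> powr q + (1 - t) * \<bar>a\<bar> powr q = a powr q * s" using S by simp
      moreover have "\<bar>b\<bar> powr (q - 1) * sgn b = a powr (q - 1) * \<rho> powr (q - 1)"
        using a b \<rho> by (cases "b = 0") (auto simp: bq powr_mult sgn_mult)
      ultimately show ?thesis unfolding qmean_deriv_def using Sq by (simp add: mult.assoc)
    qed
    show "\<bar>qmean q t a b - a\<bar> \<le> K * t * a \<and> \<bar>qmean_deriv q t a b - 1\<bar> \<le> K * t \<and> \<bar>qmean_deriv q (1 - t) b a\<bar> \<le> K * t"
    proof (intro conjI)
      have "\<bar>s powr (1 / q) - 1\<bar> \<le> L1 * (t * P)"
        using L1(2)[OF s3 s2] mult_left_mono[OF s1 L1(1)] by linarith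
      also have "\<dots> \<le> K * t" using mult_right_mono[OF Kle(1), of t] t by (simp add: algebra_simps)
      finally have "a * \<bar>s powr (1 / q) - 1\<bar> \<le> a * (K * t)" using a by (intro mult_left_mono) auto
      moreover have "\<bar>qmean q t a b - a\<bar> = a * \<bar>s powr (1 / q) - 1\<bar>"
      proof -
        have "qmean q t a b - a = a * (s powr (1 / q) - 1)" by (simp add: m right_diff_distrib)
        then show ?thesis using a by (simp add: abs_mult)
      qed
      ultimately show "\<bar>qmean q t a b - a\<bar> \<le> K * t * a" by (simp add: algebra_simps)
      have "\<bar>qmean_deriv q t a b - 1\<bar> \<le> \<bar>s powr (1 / q - 1) - 1\<bar> + t * s powr (1 / q - 1)"
        using t by (simp add: d1 left_diff_distrib) (smt (verit) mult_nonneg_nonneg powr_ge_zero)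
      also have "\<dots> \<le> t * (L2 * P) + t * Q" using s4 t by (intro add_mono mult_left_mono) auto
      also have "\<dots> \<le> K * t" using mult_right_mono[OF Kle(2), of t] t by (simp add: algebra_simps)
      finally show "\<bar>qmean_deriv q t a b - 1\<bar> \<le> K * t" .
      have "\<rho> powr (q - 1) \<le> Rq" unfolding Rq_def using \<rho> q by (intro powr_mono2) auto
      then have "s powr (1 / q - 1) * \<rho> powr (q - 1) \<le> Q * Rq" using s4(1) Q by (intro mult_mono) auto
      then have "t * (s powr (1 / q - 1) * \<rho> powr (q - 1)) \<le> t * K" using Kle(3) t by (intro mult_left_mono) auto
      then show "\<bar>qmean_deriv q (1 - t) b a\<bar> \<le> K * t" using t by (simp add: d2 mult.assoc mult.commute)
    qed
  qed
qed

text \<open>A function that is measurable in x and continuous in t is jointly measurable;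
  integrating it over the region 0 \<le> s \<le> u x then gives a measurable function of x.\<close>

lemma caratheodory_primitive_measurable:
  fixes g :: "'a::euclidean_space \<Rightarrow> real \<Rightarrow> real"
  assumes \<Omega>: "open \<Omega>" and g: "caratheodory_fun \<Omega> g" and u: "u \<in> borel_measurable (lebesgue_on \<Omega>)"
    and u0: "AE x in lebesgue_on \<Omega>. 0 \<le> u x"
  shows "(\<lambda>x. primitive (g x) (u x)) \<in> borel_measurable (lebesgue_on \<Omega>)"
proof -
  note [measurable] = u
  have gm: "(\<lambda>x. g x t) \<in> borel_measurable (lebesgue_on \<Omega>)" for t using g by (simp add: caratheodory_fun_def)
  have "AE x in lebesgue_on \<Omega>. continuous_on UNIV (g x)" using g by (simp add: caratheodory_fun_def)
  then obtain N where N: "{x \<in> space (lebesgue_on \<Omega>). \<not> continuous_on UNIV (g x)} \<subseteq> N" "N \<in> null_sets (lebesgue_on \<Omega>)"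
    unfolding eventually_ae_filter by auto
  have [measurable]: "N \<in> sets (lebesgue_on \<Omega>)" using N(2) by auto
  \<comment> \<open>Set to zero on the null set where continuity fails, so that g' is continuous in
    t at every point of the space.\<close>
  define g' where "g' x s = (if x \<in> N then 0 else g x s)" for x s
  have [measurable]: "(\<lambda>x. g' x t) \<in> borel_measurable (lebesgue_on \<Omega>)" for t unfolding g'_def using gm[of t] by measurable
  have g'c: "continuous_on UNIV (g' x)" if "x \<in> space (lebesgue_on \<Omega>)" for x
  proof (cases "x \<in> N")
    case True
    then have "g' x = (\<lambda>s. 0)" by (intro ext) (simp add: g'_def)
    then show ?thesis by simp
  next
    case False
    then have "g' x = g x" by (auto simp: g'_def)
    then show ?thesis using N(1) that False by auto
  qed
  \<comment> \<open>Joint measurability by discretising t: g' is evaluated at the grid point of mesh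
    1 / (n + 1) at or below t, a countable choice of measurable functions, and continuity in t gives
    the limit.\<close>
  have [measurable]: "(\<lambda>z. g' (fst z) (snd z)) \<in> borel_measurable (lebesgue_on \<Omega> \<Otimes>\<^sub>M lborel)"
  proof (rule borel_measurable_LIMSEQ_real)
    fix n :: nat
    have 1: "(\<lambda>z. g' (fst z) (real_of_int i / real (Suc n))) \<in> borel_measurable (lebesgue_on \<Omega> \<Otimes>\<^sub>M (lborel::real measure))" for i
      by measurable
    have 2: "(\<lambda>z. \<lfloor>real (Suc n) * snd z\<rfloor>) \<in> measurable (lebesgue_on \<Omega> \<Otimes>\<^sub>M (lborel::real measure)) (count_space UNIV)"
      by measurable
    show "(\<lambda>z. g' (fst z) (real_of_int \<lfloor>real (Suc n) * snd z\<rfloor> / real (Suc n))) \<in> borel_measurable (lebesgue_on \<Omega> \<Otimes>\<^sub>M lborel)"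
      by (rule measurable_compose_countable[OF 1 2])
  next
    fix z assume z: "z \<in> space (lebesgue_on \<Omega> \<Otimes>\<^sub>M (lborel::real measure))"
    have lim: "(\<lambda>n. real_of_int \<lfloor>real (Suc n) * snd z\<rfloor> / real (Suc n)) \<longlonglongrightarrow> snd z"
    proof (rule real_tendsto_sandwich)
      have "(\<lambda>n. snd z - inverse (real (Suc n))) \<longlonglongrightarrow> snd z - 0" by (intro tendsto_intros LIMSEQ_inverse_real_of_nat)
      then show "(\<lambda>n. snd z - inverse (real (Suc n))) \<longlonglongrightarrow> snd z" by simp
      show "\<forall>\<^sub>F n in sequentially. snd z - inverse (real (Suc n)) \<le> real_of_int \<lfloor>real (Suc n) * snd z\<rfloor> / real (Suc n)"
      proof (intro always_eventually allI)
        fix n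
        have "real (Suc n) * snd z - 1 \<le> real_of_int \<lfloor>real (Suc n) * snd z\<rfloor>" by linarith
        then have "(real (Suc n) * snd z - 1) / real (Suc n) \<le> real_of_int \<lfloor>real (Suc n) * snd z\<rfloor> / real (Suc n)"
          by (rule divide_right_mono) simp
        then show "snd z - inverse (real (Suc n)) \<le> real_of_int \<lfloor>real (Suc n) * snd z\<rfloor> / real (Suc n)"
          by (simp add: diff_divide_distrib inverse_eq_divide del: of_nat_Suc)
      qed
      show "\<forall>\<^sub>F n in sequentially. real_of_int \<lfloor>real (Suc n) * snd z\<rfloor> / real (Suc n) \<le> snd z"
      proof (intro always_eventually allI)
        fix n
        have "real_of_int \<lfloor>real (Suc n) * snd z\<rfloor> / real (Suc n) \<le> (real (Suc n) * snd z) / real (Suc n)"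
          by (rule divide_right_mono) (auto simp del: of_nat_Suc)
        then show "real_of_int \<lfloor>real (Suc n) * snd z\<rfloor> / real (Suc n) \<le> snd z" by (simp del: of_nat_Suc)
      qed
    qed simp
    have "isCont (g' (fst z)) (snd z)"
      using g'c[of "fst z"] z by (auto simp: space_pair_measure continuous_on_eq_continuous_at)
    then show "(\<lambda>n. g' (fst z) (real_of_int \<lfloor>real (Suc n) * snd z\<rfloor> / real (Suc n))) \<longlonglongrightarrow> g' (fst z) (snd z)"
      using lim by (rule isCont_tendsto_compose)
  qed
  define F where "F x = (\<integral>s. (if 0 \<le> s \<and> s \<le> u x then g' x s else 0) \<partial>lborel)" for x
  have "(\<lambda>(x, s). if 0 \<le> s \<and> s \<le> u x then g' x s else 0) \<in> borel_measurable (lebesgue_on \<Omega> \<Otimes>\<^sub>M lborel)"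
    unfolding case_prod_beta by measurable
  then have Fm: "F \<in> borel_measurable (lebesgue_on \<Omega>)"
    unfolding F_def[abs_def] by (rule lborel.borel_measurable_lebesgue_integral)
  have "AE x in lebesgue_on \<Omega>. x \<notin> N" using N(2) by (rule AE_not_in)
  then have eq: "AE x in lebesgue_on \<Omega>. primitive (g x) (u x) = F x"
    using u0 AE_space
  proof eventually_elim
    case (elim x)
    then have c: "continuous_on {0..} (g x)" "continuous_on {0..u x} (g x)"
      using N(1) by (auto intro: continuous_on_subset[of UNIV])
    have "F x = (LBINT s:{0..u x}. g x s)"
      unfolding F_def set_lebesgue_integral_def
      by (rule Bochner_Integration.integral_cong) (use elim in \<open>auto simp: g'_def indicator_def\<close>)
    also have "\<dots> = integral {0..u x} (g x)"
      by (rule set_borel_integral_eq_integral(2)[OF borel_integrable_atLeastAtMost'[OF c(2)]])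
    finally show ?case using primitive_eq[OF c(1) elim(2)] by simp
  qed
  obtain F' where F': "F' \<in> borel_measurable borel" "AE x in lborel. x \<in> \<Omega> \<longrightarrow> F x = F' x"
    using lebesgue_on_borel_version[OF \<Omega> Fm] .
  show ?thesis
  proof (rule lebesgue_on_measurable_AE[OF \<Omega> F'(1)])
    show "AE x in lborel. x \<in> \<Omega> \<longrightarrow> primitive (g x) (u x) = F' x"
      using F'(2) eq[unfolded AE_lebesgue_on_iff[OF \<Omega>]] by eventually_elim auto
  qed
qed

section \<open>Finite energy and convexity along power means\<close>

locale energy_problem = bounded_open \<Omega> r + monotone_density h
  for \<Omega> :: "'a::euclidean_space set" and r :: real and h :: "real \<Rightarrow> real" +
  fixes p q Ch Cg \<sigma> :: real and g :: "'a \<Rightarrow> real \<Rightarrow> real"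
  assumes dom: "bounded_smooth_domain \<Omega>" and q: "1 < q" "q < p" and pr: "p < r"
    and h_growth: "\<And>t. 0 \<le> t \<Longrightarrow> h t \<le> Ch * (1 + t powr (r / p - 1))" and Ch: "0 < Ch"
    and g_car: "caratheodory_fun \<Omega> g" and Cg: "0 < Cg" and \<sigma>: "0 < \<sigma>" "\<sigma> * (real DIM('a) - r) \<le> (r - 1) * real DIM('a) + r"
    and g_growth: "\<And>x t. x \<in> \<Omega> \<Longrightarrow> \<bar>g x t\<bar> \<le> Cg * (1 + \<bar>t\<bar> powr \<sigma>)"
    and g_quot: "AE x in lebesgue_on \<Omega>. antimono_on {0<..} (\<lambda>t. g x t / t powr (q - 1))"
begin

abbreviation "J \<equiv> energy \<Omega> p h g"

definition e where "e u x = 1 / p * primitive h (norm (gr u x) powr p) - primitive (g x) (u x)"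

lemma J_eq: "J u = (\<integral>x. e u x \<partial>M)"
  by (simp add: energy_def e_def)

lemma H_bound:
  assumes "0 \<le> z"
  shows "0 \<le> primitive h (z powr p)" "primitive h (z powr p) \<le> 2 * Ch * (1 + z powr r)"
proof -
  define \<tau> where "\<tau> = z powr p"
  have \<tau>: "0 \<le> \<tau>" by (simp add: \<tau>_def)
  have p: "1 < p" using q by simp
  have rp: "0 < r / p - 1" using p pr by (simp add: field_simps)
  show "0 \<le> primitive h (z powr p)" using H_mono[of 0 \<tau>] \<tau> by (simp add: \<tau>_def)
  have "\<bar>primitive h \<tau>\<bar> \<le> Ch * (1 + \<tau> powr (r / p - 1)) * \<tau>"
  proof (rule primitive_growth[OF h_cont \<tau>])
    fix s assume s: "0 \<le> s" "s \<le> \<tau>"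
    then have "s powr (r / p - 1) \<le> \<tau> powr (r / p - 1)" using rp by (intro powr_mono2) auto
    then have "Ch * (1 + s powr (r / p - 1)) \<le> Ch * (1 + \<tau> powr (r / p - 1))" using Ch by (intro mult_left_mono) auto
    then show "\<bar>h s\<bar> \<le> Ch * (1 + \<tau> powr (r / p - 1))" using h_growth[OF s(1)] h_nonneg[OF s(1)] by simp
  qed
  moreover have "\<tau> powr (r / p - 1) * \<tau> = z powr r"
  proof -
    have "\<tau> powr (r / p - 1) * \<tau> = \<tau> powr (r / p)" using \<tau> by (cases "\<tau> = 0") (auto simp: powr_diff)
    also have "\<dots> = z powr r" using p by (simp add: \<tau>_def powr_powr)
    finally show ?thesis .
  qed
  moreover have "\<tau> \<le> 1 + z powr r"
  proof (cases "z \<le> 1")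
    case True
    then have "\<tau> \<le> 1 powr p" unfolding \<tau>_def using assms p by (intro powr_mono2) auto
    then show ?thesis using powr_ge_zero[of z r] by (simp only: powr_one_eq_one)
  next
    case False
    then have "\<tau> \<le> z powr r" unfolding \<tau>_def using pr by (intro powr_mono) auto
    then show ?thesis by simp
  qed
  ultimately have "primitive h \<tau> \<le> Ch * (\<tau> + z powr r)" by (simp add: distrib_right distrib_left mult.assoc)
  also have "\<dots> \<le> Ch * (2 * (1 + z powr r))" using \<open>\<tau> \<le> 1 + z powr r\<close> Ch by (intro mult_left_mono) auto
  finally show "primitive h (z powr p) \<le> 2 * Ch * (1 + z powr r)" by (simp add: \<tau>_def algebra_simps)
qed

lemma g_continuous: "AE x in M. continuous_on UNIV (g x)"
  using g_car by (simp add: caratheodory_fun_def)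

lemma G_bound:
  assumes x: "x \<in> \<Omega>" and c: "continuous_on UNIV (g x)" and t: "0 \<le> t"
  shows "\<bar>primitive (g x) t\<bar> \<le> 2 * Cg * (1 + t powr (\<sigma> + 1))"
proof -
  have "\<bar>primitive (g x) t\<bar> \<le> Cg * (1 + t powr \<sigma>) * t"
  proof (rule primitive_growth[OF continuous_on_subset[OF c] t])
    fix s assume s: "0 \<le> s" "s \<le> t"
    then have "s powr \<sigma> \<le> t powr \<sigma>" using \<sigma> by (intro powr_mono2) auto
    then have "Cg * (1 + s powr \<sigma>) \<le> Cg * (1 + t powr \<sigma>)" using Cg by (intro mult_left_mono) auto
    then show "\<bar>g x s\<bar> \<le> Cg * (1 + t powr \<sigma>)" using g_growth[OF x, of s] s by simp
  qed simp
  moreover have "t powr \<sigma> * t = t powr (\<sigma> + 1)" using t by (cases "t = 0") (auto simp: powr_add)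
  moreover have "t \<le> 1 + t powr (\<sigma> + 1)"
  proof (cases "t \<le> 1")
    case True
    then show ?thesis using powr_ge_zero[of t "\<sigma> + 1"] by linarith
  next
    case False
    then have "t powr 1 \<le> t powr (\<sigma> + 1)" using \<sigma> by (intro powr_mono) auto
    then show ?thesis using False by simp
  qed
  ultimately have "\<bar>primitive (g x) t\<bar> \<le> Cg * (t + t powr (\<sigma> + 1))" by (simp add: distrib_right distrib_left mult.assoc)
  also have "\<dots> \<le> Cg * (2 * (1 + t powr (\<sigma> + 1)))"
    using \<open>t \<le> 1 + t powr (\<sigma> + 1)\<close> Cg by (intro mult_left_mono) auto
  finally show ?thesis by (simp add: algebra_simps)
qed

text \<open>The assumption on \<sigma> says precisely that \<sigma> + 1, the growth exponent of the
  primitive, satisfies the exponent condition of \<open>sobolev_embedding\<close>: adding DIM('a) -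
  r to both sides gives (\<sigma> + 1) * (DIM('a) - r) \<le> r * DIM('a).\<close>

lemma e_integrable:
  assumes u: "u \<in> W1 r \<Omega>" and u0: "AE x in M. 0 \<le> u x"
  shows "integrable M (e u)"
proof -
  note [measurable] = Lr_measurable[OF W1D(1)[OF u]] Lr_measurable[OF W1D(2)[OF u]]
  have p: "1 < p" using q by simp
  \<comment> \<open>Continuity of the primitive is known on the nonnegative half-line; composing
    with the maximum of 0 and s makes it a Borel function of a real variable.\<close>
  have "continuous_on UNIV (\<lambda>s::real. primitive h (max 0 s))"
    by (rule continuous_on_compose2[OF primitive_continuous[OF h_cont]]) (auto intro!: continuous_intros)
  then have [measurable]: "(\<lambda>s::real. primitive h (max 0 s)) \<in> borel_measurable borel"
    by (rule borel_measurable_continuous_onI)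
  have "(\<lambda>x. primitive h (max 0 (norm (gr u x) powr p))) \<in> borel_measurable M" by measurable
  then have Hm: "(\<lambda>x. primitive h (norm (gr u x) powr p)) \<in> borel_measurable M" by simp
  have 1: "integrable M (\<lambda>x. primitive h (norm (gr u x) powr p))"
  proof (rule Bochner_Integration.integrable_bound[OF _ Hm])
    show "integrable M (\<lambda>x. 2 * Ch * (1 + norm (gr u x) powr r))"
      using Lr_integrable_powr[OF W1D(2)[OF u]] by simp
    show "AE x in M. norm (primitive h (norm (gr u x) powr p)) \<le> norm (2 * Ch * (1 + norm (gr u x) powr r))"
    proof (rule AE_I2)
      fix x
      show "norm (primitive h (norm (gr u x) powr p)) \<le> norm (2 * Ch * (1 + norm (gr u x) powr r))"
        using H_bound[OF norm_ge_zero[of "gr u x"]] by simp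
    qed
  qed
  have 2: "integrable M (\<lambda>x. primitive (g x) (u x))"
  proof (rule Bochner_Integration.integrable_bound[OF _ caratheodory_primitive_measurable[OF \<Omega> g_car _ u0]])
    have "integrable M (\<lambda>x. \<bar>u x\<bar> powr (\<sigma> + 1))"
      using \<sigma> p pr by (intro sobolev_embedding[OF dom _ u]) (auto simp: algebra_simps)
    then show "integrable M (\<lambda>x. 2 * Cg * (1 + \<bar>u x\<bar> powr (\<sigma> + 1)))" by simp
    show "AE x in M. norm (primitive (g x) (u x)) \<le> norm (2 * Cg * (1 + \<bar>u x\<bar> powr (\<sigma> + 1)))"
      using u0 g_continuous AE_space
    proof eventually_elim
      case (elim x)
      then have "\<bar>primitive (g x) (u x)\<bar> \<le> 2 * Cg * (1 + u x powr (\<sigma> + 1))" by (intro G_bound) auto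
      then show ?case using elim(1) by simp
    qed
  qed simp
  show ?thesis unfolding e_def[abs_def] using 1 2 by simp
qed

lemma e_convex:
  assumes t: "0 < t" "t < 1" and u: "u \<in> W1 r \<Omega>" "AE x in M. 0 \<le> u x" and v: "v \<in> W1 r \<Omega>" "AE x in M. 0 \<le> v x"
  defines "w \<equiv> \<lambda>x. qmean q t (u x) (v x)"
  shows "AE x in M. e w x \<le> (1 - t) * e u x + t * e v x \<and>
    (e w x = (1 - t) * e u x + t * e v x \<longrightarrow> gr u x = gr v x \<and> (u x = v x \<or> gr u x = 0))"
  using W1_qmean(2)[OF q(1) t u(1) v(1)] u(2) v(2) g_continuous g_quot
proof eventually_elim
  case (elim x)
  define T where "T = (1 - t) * norm (gr u x) powr p + t * norm (gr v x) powr p"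
  define N where "N = norm (gr w x) powr p"
  have p: "0 < p" using q by simp
  have D: "N \<le> T" "N = T \<Longrightarrow> gr u x = gr v x \<and> (u x = v x \<or> gr u x = 0)"
    unfolding N_def T_def w_def elim(1) by (rule hidden_convexity[OF q t elim(2,3)], assumption?)+
  have N0: "0 \<le> N" by (simp add: N_def)
  have T: "primitive h T \<le> (1 - t) * primitive h (norm (gr u x) powr p) + t * primitive h (norm (gr v x) powr p)"
    unfolding T_def using t by (intro H_convex) auto
  have G: "(1 - t) * primitive (g x) (u x) + t * primitive (g x) (v x) \<le> primitive (g x) (w x)"
    unfolding w_def by (rule G_concave[OF elim(4) q(1) elim(5) t elim(2,3)])
  \<comment> \<open>The convexity defect is the sum of a gradient part and a potential part, both
    nonnegative; if it vanishes, each part does, and the gradient part alone yields the equality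
    case.\<close>
  have R: "(1 - t) * e u x + t * e v x - e w x = 1 / p * ((1 - t) * primitive h (norm (gr u x) powr p) + t * primitive h (norm (gr v x) powr p) - primitive h N)
     + (primitive (g x) (w x) - ((1 - t) * primitive (g x) (u x) + t * primitive (g x) (v x)))"
    unfolding e_def N_def[symmetric] by (simp add: algebra_simps add_divide_distrib diff_divide_distrib)
  have NT: "primitive h N \<le> primitive h T" by (rule H_mono[OF N0 D(1)])
  have 1: "0 \<le> 1 / p * ((1 - t) * primitive h (norm (gr u x) powr p) + t * primitive h (norm (gr v x) powr p) - primitive h N)"
    using p T NT by (intro mult_nonneg_nonneg) auto
  show ?case
  proof (intro conjI impI)
    show "e w x \<le> (1 - t) * e u x + t * e v x" using R 1 G by linarith
    assume "e w x = (1 - t) * e u x + t * e v x"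
    then have "1 / p * ((1 - t) * primitive h (norm (gr u x) powr p) + t * primitive h (norm (gr v x) powr p) - primitive h N) = 0"
      using R 1 G by linarith
    then have "primitive h N = primitive h T" using p T NT by simp
    then have "N = T" using H_strict_mono[OF N0, of T] D(1) by fastforce
    then show "gr u x = gr v x" "u x = v x \<or> gr u x = 0" using D(2) by auto
  qed
qed

text \<open>The pointwise defect is nonnegative and integrable, so the reversed inequality of the
  energies makes it vanish almost everywhere. Finite energies allow its integral to be
  split.\<close>

lemma J_convex:
  assumes t: "0 < t" "t < 1" and u: "u \<in> W1 r \<Omega>" "AE x in M. 0 \<le> u x" and v: "v \<in> W1 r \<Omega>" "AE x in M. 0 \<le> v x"
  defines "w \<equiv> \<lambda>x. qmean q t (u x) (v x)"
  shows "J w \<le> (1 - t) * J u + t * J v"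
    "(1 - t) * J u + t * J v \<le> J w \<Longrightarrow> AE x in M. gr u x = gr v x \<and> (u x = v x \<or> gr u x = 0)"
proof -
  have w: "w \<in> W1 r \<Omega>" "AE x in M. 0 \<le> w x"
    unfolding w_def using W1_qmean(1)[OF q(1) t u(1) v(1)] by (auto simp: qmean_nonneg)
  note iu = e_integrable[OF u] and iv = e_integrable[OF v] and iw = e_integrable[OF w]
  note C = e_convex[OF t u v, folded w_def]
  define d where "d x = (1 - t) * e u x + t * e v x - e w x" for x
  have d: "integrable M d" unfolding d_def[abs_def] using iu iv iw by simp
  have d0: "AE x in M. 0 \<le> d x" using C by eventually_elim (simp add: d_def)
  have eq: "(\<integral>x. d x \<partial>M) = (1 - t) * J u + t * J v - J w"
    unfolding d_def J_eq using iu iv iw by simp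
  show "J w \<le> (1 - t) * J u + t * J v" using integral_nonneg_AE[OF d0] eq by simp
  assume "(1 - t) * J u + t * J v \<le> J w"
  then have "(\<integral>x. d x \<partial>M) = 0" using integral_nonneg_AE[OF d0] eq by simp
  then have "AE x in M. d x = 0" using integral_nonneg_eq_0_iff_AE[OF d d0] by simp
  then show "AE x in M. gr u x = gr v x \<and> (u x = v x \<or> gr u x = 0)"
    using C by eventually_elim (auto simp: d_def)
qed

lemma closed_space:
  assumes X: "X = W1 r \<Omega> \<or> X = W1_0 r \<Omega>" and u: "u \<in> X" and v: "v \<in> X"
  shows "u \<in> W1 r \<Omega>" "(\<lambda>x. u x - v x) \<in> X" "0 < t \<Longrightarrow> t < 1 \<Longrightarrow> (\<lambda>x. qmean q t (u x) (v x)) \<in> X"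
  using X u v W1_diff(1) W1_0_diff W1_qmean(1,3)[OF q(1)] W1_0D by blast+

lemma minimizers_rigid:
  assumes X: "X = W1 r \<Omega> \<or> X = W1_0 r \<Omega>" and u: "u \<in> nonneg_global_minimizers \<Omega> X J" and v: "v \<in> nonneg_global_minimizers \<Omega> X J"
  shows "AE x in M. gr u x = gr v x \<and> (u x = v x \<or> gr u x = 0)"
proof -
  have uv: "u \<in> X" "v \<in> X" "AE x in M. 0 \<le> u x" "AE x in M. 0 \<le> v x" "\<And>w. w \<in> X \<Longrightarrow> J u \<le> J w" "\<And>w. w \<in> X \<Longrightarrow> J v \<le> J w"
    using u v by (auto simp: nonneg_global_minimizers_def)
  have W: "u \<in> W1 r \<Omega>" "v \<in> W1 r \<Omega>" using closed_space(1)[OF X] uv(1,2) by auto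
  have t: "0 < 1 / (2::real)" "1 / 2 < (1::real)" by auto
  have "(\<lambda>x. qmean q (1 / 2) (u x) (v x)) \<in> X" using closed_space(3)[OF X uv(1,2) t] .
  from uv(5)[OF this] uv(6)[OF this]
  show ?thesis by (intro J_convex(2)[OF t W(1) uv(3) W(2) uv(4)]) simp
qed

lemma Nr_le_const:
  fixes f :: "'a \<Rightarrow> 'b::euclidean_space"
  assumes "f \<in> borel_measurable M" "AE x in M. norm (f x) \<le> c" "0 \<le> c"
  shows "Nr f \<le> c powr r * measure M (space M)"
proof -
  have "Nr f \<le> \<bar>c\<bar> powr r * Nr (\<lambda>x. 1::real)"
    by (rule Lr_bound(2)[OF Lr_const assms(1)]) (use assms(2) in simp)
  then show ?thesis using assms(3) by (simp add: Nr_def)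
qed

text \<open>The curve \<open>t \<mapsto> qmean q t u w\<close> leaves \<open>u\<close> with bounded speed in the Sobolev norm, while the energy is
  convex along it.\<close>

lemma critical_le:
  assumes X: "X = W1 r \<Omega> \<or> X = W1_0 r \<Omega>" and u: "u \<in> critical_points X (W1_norm r \<Omega>) J" and w: "w \<in> X"
    and pos: "AE x in M. 0 < u x \<and> u x \<le> B" and le: "AE x in M. 0 \<le> w x \<and> w x \<le> R * u x"
    and gb: "AE x in M. norm (gr u x) \<le> B \<and> norm (gr w x) \<le> B" and B: "0 \<le> B"
  shows "J u \<le> J w"
proof -
  have uX: "u \<in> X" using u by (simp add: critical_points_def)
  have W: "u \<in> W1 r \<Omega>" "w \<in> W1 r \<Omega>" using closed_space(1)[OF X] uX w by auto
  have u0: "AE x in M. 0 \<le> u x" using pos by eventually_elim simp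
  have w0: "AE x in M. 0 \<le> w x" using le by eventually_elim simp
  obtain K where K: "0 \<le> K"
    "\<And>a b t. 0 < a \<Longrightarrow> 0 \<le> b \<Longrightarrow> b \<le> R * a \<Longrightarrow> 0 < t \<Longrightarrow> t \<le> 1 / 2 \<Longrightarrow>
       \<bar>qmean q t a b - a\<bar> \<le> K * t * a \<and> \<bar>qmean_deriv q t a b - 1\<bar> \<le> K * t \<and> \<bar>qmean_deriv q (1 - t) b a\<bar> \<le> K * t"
    using qmean_perturbation[OF q(1), of R] by blast
  \<comment> \<open>The change of the gradient consists of two terms of size K t B, whence the
    factor 2; the change of the value needs only one.\<close>
  define A where "A = 2 * K * B"
  define m where "m = measure M (space M)"
  define K' where "K' = A * (2 * m) powr (1 / r)"
  have A: "0 \<le> A" using K B by (simp add: A_def)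
  have K': "0 \<le> K'" using A by (simp add: K'_def)
  define d where "d t x = qmean q t (u x) (w x) - u x" for t x
  have dX: "d t \<in> X" if t: "0 < t" "t < 1" for t
    using closed_space(2)[OF X closed_space(3)[OF X uX w t] uX] by (simp add: d_def[abs_def])
  have small: "W1_norm r \<Omega> (d t) \<le> K' * t" if t: "0 < t" "t \<le> 1 / 2" for t
  proof -
    have t1: "t < 1" using t by simp
    have dW: "d t \<in> W1 r \<Omega>" using closed_space(1)[OF X] dX[OF t(1) t1] by blast
    have At: "0 \<le> A * t" using A t by simp
    have b1: "AE x in M. norm (d t x) \<le> A * t"
      using pos le
    proof eventually_elim
      case (elim x)
      then have "\<bar>d t x\<bar> \<le> K * t * u x" using K(2)[of "u x" "w x" t] t by (simp add: d_def)
      also have "\<dots> \<le> K * t * B" using elim K t by (intro mult_left_mono) auto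
      also have "\<dots> \<le> A * t" using K B t by (simp add: A_def)
      finally show ?case by simp
    qed
    have b2: "AE x in M. norm (gr (d t) x) \<le> A * t"
      using W1_diff(2)[OF W1_qmean(1)[OF q(1) t(1) t1 W] W(1), folded d_def] W1_qmean(2)[OF q(1) t(1) t1 W] pos le gb
    proof eventually_elim
      case (elim x)
      define c1 where "c1 = qmean_deriv q t (u x) (w x)"
      define c2 where "c2 = qmean_deriv q (1 - t) (w x) (u x)"
      have c: "\<bar>c1 - 1\<bar> \<le> K * t" "\<bar>c2\<bar> \<le> K * t"
        using K(2)[of "u x" "w x" t] elim t by (auto simp: c1_def c2_def)
      have "gr (d t) x = (c1 - 1) *\<^sub>R gr u x + c2 *\<^sub>R gr w x"
        using elim(1,2) by (simp add: c1_def c2_def d_def[abs_def] algebra_simps)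
      then have "norm (gr (d t) x) \<le> \<bar>c1 - 1\<bar> * norm (gr u x) + \<bar>c2\<bar> * norm (gr w x)"
        using norm_triangle_ineq[of "(c1 - 1) *\<^sub>R gr u x" "c2 *\<^sub>R gr w x"] by simp
      also have "\<dots> \<le> (K * t) * B + (K * t) * B" using c elim K t by (intro add_mono mult_mono) auto
      finally show ?case by (simp add: A_def mult_ac)
    qed
    have "Nr (d t) + Nr (gr (d t)) \<le> (A * t) powr r * m + (A * t) powr r * m"
      unfolding m_def using Lr_measurable[OF W1D(1)[OF dW]] Lr_measurable[OF W1D(2)[OF dW]]
      by (intro add_mono Nr_le_const b1 b2 At)
    then have "W1_norm r \<Omega> (d t) \<le> ((A * t) powr r * (2 * m)) powr (1 / r)"
      unfolding W1_norm_eq using r by (intro powr_mono2) (auto simp: Nr_nonneg mult_ac)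
    also have "\<dots> = K' * t"
      using A t r by (simp add: powr_mult powr_powr K'_def m_def)
    finally show ?thesis .
  qed
  \<comment> \<open>The critical point condition bounds the energy on the curve from below by J u -
    \<epsilon> K' t, and convexity bounds it from above by J u + t (J w - J u). Dividing by t leaves
    an error that is arbitrarily small.\<close>
  have key: "- (\<epsilon> * K') \<le> J w - J u" if \<epsilon>: "0 < \<epsilon>" for \<epsilon>
  proof -
    have "has_frechet_derivative_in X (W1_norm r \<Omega>) J u (\<lambda>_. 0)" using u by (simp add: critical_points_def)
    then obtain \<delta> where \<delta>: "0 < \<delta>" "\<And>v. v \<in> X \<Longrightarrow> W1_norm r \<Omega> v < \<delta> \<Longrightarrow> \<bar>J (\<lambda>x. u x + v x) - J u\<bar> \<le> \<epsilon> * W1_norm r \<Omega> v"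
      unfolding has_frechet_derivative_in_def using \<epsilon> by force
    \<comment> \<open>The bound 1/2 is the range of \<open>qmean_perturbation\<close>; the other one
      brings the Sobolev norm of the step below \<delta>, with the summand 1 in case K' is
      0.\<close>
    define t where "t = min (1 / 2) (\<delta> / (2 * (K' + 1)))"
    have "t \<le> 1 / 2" unfolding t_def by (rule min.cobounded1)
    moreover have "0 < t" using \<delta> K' by (simp add: t_def)
    ultimately have t: "0 < t" "t \<le> 1 / 2" "t < 1" by linarith+
    have "K' * t \<le> (K' + 1) * (\<delta> / (2 * (K' + 1)))" using K' t \<delta> by (intro mult_mono) (auto simp: t_def)
    also have "\<dots> = \<delta> / 2" using K' by (simp add: field_simps)
    also have "\<dots> < \<delta>" using \<delta> by simp
    finally have "W1_norm r \<Omega> (d t) < \<delta>" using small[OF t(1,2)] by simp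
    from \<delta>(2)[OF dX[OF t(1,3)] this]
    have "\<bar>J (\<lambda>x. qmean q t (u x) (w x)) - J u\<bar> \<le> \<epsilon> * W1_norm r \<Omega> (d t)" by (simp add: d_def)
    also have "\<dots> \<le> \<epsilon> * (K' * t)" using small[OF t(1,2)] \<epsilon> by (intro mult_left_mono) auto
    finally have "J u - \<epsilon> * (K' * t) \<le> (1 - t) * J u + t * J w"
      using J_convex(1)[OF t(1,3) W(1) u0 W(2) w0] by linarith
    then have "t * (- (\<epsilon> * K')) \<le> t * (J w - J u)" by (simp add: algebra_simps)
    then show ?thesis using t mult_le_cancel_left_pos by blast
  qed
  show ?thesis
  proof (rule ccontr)
    assume "\<not> J u \<le> J w"
    then have "0 < (J u - J w) / (2 * (K' + 1))" using K' by simp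
    from key[OF this] have "J u - J w \<le> (J u - J w) * (K' / (2 * (K' + 1)))" by simp
    also have "\<dots> < (J u - J w) * 1" using K' \<open>\<not> J u \<le> J w\<close> by (intro mult_strict_left_mono) auto
    finally show False by simp
  qed
qed

text \<open>Each function is compared with the midpoint w instead of with the other one: J u \<le> J
  w and J v \<le> J w together reverse the convexity inequality at t = 1/2. Comparability and
  gradient bounds pass from u and v to w.\<close>

lemma critical_rigid:
  assumes X: "X = W1 r \<Omega> \<or> X = W1_0 r \<Omega>"
    and u: "u \<in> critical_points X (W1_norm r \<Omega>) J" and v: "v \<in> critical_points X (W1_norm r \<Omega>) J"
    and pos: "AE x in M. 0 < u x \<and> u x \<le> B \<and> 0 < v x \<and> v x \<le> B"
    and gb: "AE x in M. norm (gr u x) \<le> B \<and> norm (gr v x) \<le> B"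
    and le: "AE x in M. u x \<le> R * v x \<and> v x \<le> R * u x"
  shows "AE x in M. gr u x = gr v x \<and> (u x = v x \<or> gr u x = 0)"
proof -
  have uX: "u \<in> X" "v \<in> X" using u v by (simp_all add: critical_points_def)
  have W: "u \<in> W1 r \<Omega>" "v \<in> W1 r \<Omega>" using closed_space(1)[OF X] uX by auto
  have t: "0 < 1 / (2::real)" "1 / 2 < (1::real)" "1 / 2 \<le> 1 / (2::real)" by auto
  define w where "w x = qmean q (1 / 2) (u x) (v x)" for x
  have wX: "w \<in> X" using closed_space(3)[OF X uX t(1,2)] by (simp add: w_def[abs_def])
  obtain K where K: "0 \<le> K"
    "\<And>a b t. 0 < a \<Longrightarrow> 0 \<le> b \<Longrightarrow> b \<le> R * a \<Longrightarrow> 0 < t \<Longrightarrow> t \<le> 1 / 2 \<Longrightarrow>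
       \<bar>qmean q t a b - a\<bar> \<le> K * t * a \<and> \<bar>qmean_deriv q t a b - 1\<bar> \<le> K * t \<and> \<bar>qmean_deriv q (1 - t) b a\<bar> \<le> K * t"
    using qmean_perturbation[OF q(1), of R] by blast
  have Kw: "qmean q (1 / 2) a b \<le> (1 + K) * a" if "0 < a" "0 \<le> b" "b \<le> R * a" for a b
  proof -
    have "\<bar>qmean q (1 / 2) a b - a\<bar> \<le> K * (1 / 2) * a" using K(2)[OF that, of "1 / 2"] by simp
    moreover have "0 \<le> K * a" using K(1) that by simp
    ultimately show ?thesis unfolding distrib_right by linarith
  qed
  have w1: "AE x in M. 0 \<le> w x \<and> w x \<le> (1 + K) * u x" "AE x in M. 0 \<le> w x \<and> w x \<le> (1 + K) * v x"
    using pos le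
  proof (eventually_elim, goal_cases)
    case (1 x)
    then show ?case using Kw[of "u x" "v x"] by (simp add: w_def qmean_nonneg)
  next
    case 2
    show ?case using pos le
    proof eventually_elim
      case (elim x)
      then show ?case using Kw[of "v x" "u x"] qmean_commute[of q "1 / 2" "v x" "u x"] by (simp add: w_def qmean_nonneg)
    qed
  qed
  \<comment> \<open>The derivatives of the mean are at most 1 + K and K in absolute value, so (1 + 2
    K) B bounds the gradient of w. The maximum with 0 is taken because B is seen to be nonnegative
    only through the almost everywhere bounds.\<close>
  define B' where "B' = max 0 ((1 + 2 * K) * B)"
  have gw: "AE x in M. norm (gr w x) \<le> B' \<and> norm (gr u x) \<le> B' \<and> norm (gr v x) \<le> B' \<and> B \<le> B'"
    using W1_qmean(2)[OF q(1) t(1,2) W, folded w_def] pos le gb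
  proof eventually_elim
    case (elim x)
    define c1 where "c1 = qmean_deriv q (1 / 2) (u x) (v x)"
    define c2 where "c2 = qmean_deriv q (1 / 2) (v x) (u x)"
    have B: "0 \<le> B" using elim by linarith
    have "\<bar>c1 - 1\<bar> \<le> K / 2" "\<bar>c2\<bar> \<le> K / 2"
      using K(2)[of "u x" "v x" "1 / 2"] elim by (auto simp: c1_def c2_def)
    then have c: "\<bar>c1\<bar> \<le> 1 + K" "\<bar>c2\<bar> \<le> K" using K(1) by linarith+
    have "norm (gr w x) \<le> \<bar>c1\<bar> * norm (gr u x) + \<bar>c2\<bar> * norm (gr v x)"
      using elim(1) norm_triangle_ineq[of "c1 *\<^sub>R gr u x" "c2 *\<^sub>R gr v x"] by (simp add: c1_def c2_def w_def[abs_def])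
    also have "\<dots> \<le> (1 + K) * B + K * B" using c elim K by (intro add_mono mult_mono) auto
    finally have "norm (gr w x) \<le> B'" by (simp add: B'_def algebra_simps)
    moreover have "B \<le> B'" using mult_right_mono[of 1 "1 + 2 * K" B] K B by (simp add: B'_def)
    ultimately show ?case using elim by auto
  qed
  have B': "0 \<le> B'" by (simp add: B'_def)
  have "J u \<le> J w" by (rule critical_le[OF X u wX _ w1(1) _ B']; use pos gw in eventually_elim) auto
  moreover have "J v \<le> J w" by (rule critical_le[OF X v wX _ w1(2) _ B']; use pos gw in eventually_elim) auto
  moreover have "AE x in M. 0 \<le> u x" "AE x in M. 0 \<le> v x" using pos by (eventually_elim, simp)+
  ultimately show ?thesis
    unfolding w_def[abs_def] by (intro J_convex(2)[OF t(1,2) W(1) _ W(2)]) auto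
qed

lemma rigid_dirichlet:
  assumes u: "u \<in> W1_0 r \<Omega>" and v: "v \<in> W1_0 r \<Omega>" and R: "AE x in M. gr u x = gr v x \<and> (u x = v x \<or> gr u x = 0)"
  shows "AE x in M. u x = v x"
proof -
  have "AE x in M. gr (\<lambda>x. u x - v x) x = 0"
    using W1_diff(2)[OF W1_0D[OF u] W1_0D[OF v]] R by eventually_elim simp
  from W1_0_zero_gradient[OF W1_0_diff[OF u v] this] show ?thesis by simp
qed

text \<open>The difference is a constant k. If k were nonzero, u and v would differ almost
  everywhere, so the alternative in the rigidity statement would give zero gradient for u, against
  nonconstancy.\<close>

lemma rigid_neumann:
  assumes u: "u \<in> W1 r \<Omega>" "nonconstant_ae \<Omega> u" and v: "v \<in> W1 r \<Omega>"
    and R: "AE x in M. gr u x = gr v x \<and> (u x = v x \<or> gr u x = 0)"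
  shows "AE x in M. u x = v x"
proof -
  have c: "connected \<Omega>" using dom by (simp add: bounded_smooth_domain_def)
  have z: "AE x in M. gr (\<lambda>x. u x - v x) x = 0"
    using W1_diff(2)[OF u(1) v] R by eventually_elim simp
  obtain k where k: "AE x in M. u x - v x = k"
    using hwg_zero_constant[OF \<Omega> W1D(3)[OF W1_diff(1)[OF u(1) v]] z c] by metis
  have "k = 0"
  proof (rule ccontr)
    assume "k \<noteq> 0"
    have z: "AE x in M. gr u x = 0" using R k by eventually_elim (use \<open>k \<noteq> 0\<close> in auto)
    obtain k' where "AE x in M. u x = k'"
      using hwg_zero_constant[OF \<Omega> W1D(3)[OF u(1)] z c] by metis
    then show False using u(2) by (auto simp: nonconstant_ae_def)
  qed
  then show ?thesis using k by simp
qed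

end

section \<open>Comparison of strongly positive functions\<close>

lemma segment_closure:
  fixes x \<nu> :: "'a::euclidean_space"
  assumes s: "0 < s" and seg: "\<And>\<tau>. 0 \<le> \<tau> \<Longrightarrow> \<tau> < s \<Longrightarrow> x + \<tau> *\<^sub>R \<nu> \<in> \<Omega>"
  shows "(\<lambda>\<tau>. x + \<tau> *\<^sub>R \<nu>) ` {0..s} \<subseteq> closure \<Omega>"
proof -
  have "(\<lambda>\<tau>. x + \<tau> *\<^sub>R \<nu>) ` closure {0..<s} \<subseteq> closure \<Omega>"
  proof (rule image_closure_subset)
    show "(\<lambda>\<tau>. x + \<tau> *\<^sub>R \<nu>) ` {0..<s} \<subseteq> closure \<Omega>" using seg closure_subset[of \<Omega>] by fastforce
  qed (auto intro!: continuous_intros)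
  then show ?thesis using s by simp
qed

text \<open>The end point may lie on the boundary, where only continuity is available; the interior
  of the segment lies in \<Omega>.\<close>

lemma directional_mvt:
  fixes u :: "'a::euclidean_space \<Rightarrow> real"
  assumes c: "continuous_on (closure \<Omega>) u" and d: "\<And>y. y \<in> \<Omega> \<Longrightarrow> (u has_derivative (\<lambda>z. D y \<bullet> z)) (at y)"
    and s: "0 < s" and seg: "\<And>\<tau>. 0 \<le> \<tau> \<Longrightarrow> \<tau> < s \<Longrightarrow> x + \<tau> *\<^sub>R \<nu> \<in> \<Omega>"
  obtains \<tau> where "0 < \<tau>" "\<tau> < s" "u (x + s *\<^sub>R \<nu>) - u x = s * (D (x + \<tau> *\<^sub>R \<nu>) \<bullet> \<nu>)"
proof -
  have cont: "continuous_on {0..s} (\<lambda>\<tau>. x + \<tau> *\<^sub>R \<nu>)" by (intro continuous_intros)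
  note sub = segment_closure[OF s seg]
  have "\<exists>\<tau>\<in>{0<..<s}. u (x + s *\<^sub>R \<nu>) - u (x + 0 *\<^sub>R \<nu>) = D (x + \<tau> *\<^sub>R \<nu>) \<bullet> ((s - 0) *\<^sub>R \<nu>)"
  proof (rule mvt[OF s, of "\<lambda>\<tau>. u (x + \<tau> *\<^sub>R \<nu>)" "\<lambda>\<tau> k. D (x + \<tau> *\<^sub>R \<nu>) \<bullet> (k *\<^sub>R \<nu>)"])
    show "continuous_on {0..s} (\<lambda>\<tau>. u (x + \<tau> *\<^sub>R \<nu>))"
      by (rule continuous_on_compose2[OF c cont sub])
    fix \<tau> assume t: "0 < \<tau>" "\<tau> < s"
    have "((\<lambda>\<tau>. x + \<tau> *\<^sub>R \<nu>) has_derivative (\<lambda>k. k *\<^sub>R \<nu>)) (at \<tau>)" by (auto intro!: derivative_eq_intros)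
    from has_derivative_compose[OF this d]
    show "((\<lambda>\<tau>. u (x + \<tau> *\<^sub>R \<nu>)) has_derivative (\<lambda>k. D (x + \<tau> *\<^sub>R \<nu>) \<bullet> (k *\<^sub>R \<nu>))) (at \<tau>)"
      using seg[of \<tau>] t by auto
  qed auto
  then show thesis using that by auto
qed

text \<open>Near x0 the function v decreases along \<nu> at a rate of at least c, and it is positive
  in \<Omega>, so the ray from x leaves \<Omega> no later than at time v x / c. At the exit u
  vanishes, and the gradient bound controls u x by the elapsed time. This avoids flattening the
  boundary.\<close>

lemma boundary_comparable:
  fixes u v :: "'a::euclidean_space \<Rightarrow> real"
  assumes \<Omega>: "open \<Omega>"
    and u: "C1_closure_gradient \<Omega> u D" "\<And>x. x \<in> frontier \<Omega> \<Longrightarrow> u x = 0"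
    and v: "C1_closure_gradient \<Omega> v E" "\<And>x. x \<in> frontier \<Omega> \<Longrightarrow> v x = 0" "\<And>x. x \<in> \<Omega> \<Longrightarrow> 0 < v x"
    and B: "\<And>x. x \<in> \<Omega> \<Longrightarrow> norm (D x) \<le> B"
    and x0: "x0 \<in> frontier \<Omega>" "E x0 \<bullet> \<nu> < 0"
  obtains \<epsilon> R where "0 < \<epsilon>" "\<And>x. x \<in> \<Omega> \<Longrightarrow> dist x x0 < \<epsilon> \<Longrightarrow> u x \<le> R * v x"
proof -
  have uc: "continuous_on (closure \<Omega>) u" "\<And>y. y \<in> \<Omega> \<Longrightarrow> (u has_derivative (\<lambda>z. D y \<bullet> z)) (at y)"
    using u(1) by (auto simp: C1_closure_gradient_def)
  have vc: "continuous_on (closure \<Omega>) v" "continuous_on (closure \<Omega>) E" "\<And>y. y \<in> \<Omega> \<Longrightarrow> (v has_derivative (\<lambda>z. E y \<bullet> z)) (at y)"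
    using v(1) by (auto simp: C1_closure_gradient_def)
  have x0c: "x0 \<in> closure \<Omega>" using x0(1) by (simp add: frontier_def)
  define c where "c = - (E x0 \<bullet> \<nu>) / 2"
  have c: "0 < c" using x0(2) by (simp add: c_def)
  have \<nu>: "0 < norm \<nu>" using x0(2) by auto
  have "continuous_on (closure \<Omega>) (\<lambda>y. E y \<bullet> \<nu>)" by (intro continuous_intros vc)
  then obtain \<epsilon>1 where \<epsilon>1: "0 < \<epsilon>1" "\<And>y. y \<in> closure \<Omega> \<Longrightarrow> dist y x0 < \<epsilon>1 \<Longrightarrow> dist (E y \<bullet> \<nu>) (E x0 \<bullet> \<nu>) < c"
    using x0c c unfolding continuous_on_iff by blast
  have slope: "E y \<bullet> \<nu> < - c" if "y \<in> \<Omega>" "dist y x0 < \<epsilon>1" for y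
    using \<epsilon>1(2)[of y] that closure_subset[of \<Omega>] by (auto simp: dist_real_def c_def)
  \<comment> \<open>With v below this value the ray travels less than \<epsilon>1 / 2 within time v
    x / c, so it stays where the slope estimate holds.\<close>
  have "0 < \<epsilon>1 * c / (2 * norm \<nu>)" using \<epsilon>1 c \<nu> by simp
  then obtain \<epsilon>2 where \<epsilon>2: "0 < \<epsilon>2" "\<And>y. y \<in> closure \<Omega> \<Longrightarrow> dist y x0 < \<epsilon>2 \<Longrightarrow> dist (v y) (v x0) < \<epsilon>1 * c / (2 * norm \<nu>)"
    using vc(1) x0c unfolding continuous_on_iff by blast
  show thesis
  proof (rule that)
    show "0 < min (\<epsilon>1 / 2) \<epsilon>2" using \<epsilon>1 \<epsilon>2 by simp
    fix x assume x: "x \<in> \<Omega>" "dist x x0 < min (\<epsilon>1 / 2) \<epsilon>2"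
    define T where "T = v x / c"
    have T: "0 < T" using v(3)[OF x(1)] c by (simp add: T_def)
    have "v x < \<epsilon>1 * c / (2 * norm \<nu>)" using \<epsilon>2(2)[of x] x v(2)[OF x0(1)] closure_subset[of \<Omega>] by auto
    then have T\<nu>: "T * norm \<nu> < \<epsilon>1 / 2" using c \<nu> by (simp add: T_def field_simps)
    have near: "dist (x + \<tau> *\<^sub>R \<nu>) x0 < \<epsilon>1" if "0 \<le> \<tau>" "\<tau> \<le> T" for \<tau>
    proof -
      have "dist (x + \<tau> *\<^sub>R \<nu>) x0 \<le> dist (x + \<tau> *\<^sub>R \<nu>) x + dist x x0" by (rule dist_triangle)
      moreover have "dist (x + \<tau> *\<^sub>R \<nu>) x = \<tau> * norm \<nu>" using that by (simp add: dist_norm)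
      moreover have "\<tau> * norm \<nu> \<le> T * norm \<nu>" using that by (intro mult_right_mono) auto
      ultimately show ?thesis using T\<nu> x(2) by simp
    qed
    \<comment> \<open>The set of exit times up to T is compact; its minimum s is the first exit,
      with the segment before it inside \<Omega>.\<close>
    define S where "S = {0..T} \<inter> (\<lambda>\<tau>. x + \<tau> *\<^sub>R \<nu>) -` (- \<Omega>)"
    have "closed S" unfolding S_def by (rule continuous_closed_preimage) (use \<Omega> in \<open>auto intro!: continuous_intros\<close>)
    then have "compact S" by (metis S_def bounded_Int bounded_closed_interval compact_eq_bounded_closed)
    \<comment> \<open>If the ray stayed in \<Omega> up to time T, the mean value theorem would push
      v below v x - c T = 0, against positivity.\<close>
    have "S \<noteq> {}"
    proof
      assume "S = {}"
      then have seg: "x + \<tau> *\<^sub>R \<nu> \<in> \<Omega>" if "0 \<le> \<tau>" "\<tau> \<le> T" for \<tau> using that by (auto simp: S_def)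
      obtain \<tau> where \<tau>: "0 < \<tau>" "\<tau> < T" "v (x + T *\<^sub>R \<nu>) - v x = T * (E (x + \<tau> *\<^sub>R \<nu>) \<bullet> \<nu>)"
        using directional_mvt[OF vc(1) vc(3) T, of x \<nu>] seg by (metis less_imp_le)
      have "E (x + \<tau> *\<^sub>R \<nu>) \<bullet> \<nu> < - c" using slope[OF seg near] \<tau> by simp
      then have "T * (E (x + \<tau> *\<^sub>R \<nu>) \<bullet> \<nu>) < T * (- c)" using T by (rule mult_strict_left_mono)
      also have "T * (- c) = - v x" using c by (simp add: T_def)
      finally show False using \<tau>(3) v(3)[OF seg[of T]] T by simp
    qed
    then obtain s where s: "s \<in> S" "\<And>s'. s' \<in> S \<Longrightarrow> s \<le> s'" using compact_attains_inf[OF \<open>compact S\<close>] by blast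
    have sT: "0 \<le> s" "s \<le> T" and sO: "x + s *\<^sub>R \<nu> \<notin> \<Omega>" using s(1) by (auto simp: S_def)
    have s0: "0 < s" using sT(1) sO x(1) by (cases "s = 0") auto
    have seg: "x + \<tau> *\<^sub>R \<nu> \<in> \<Omega>" if "0 \<le> \<tau>" "\<tau> < s" for \<tau>
      using s(2)[of \<tau>] that sT by (auto simp: S_def)
    have "x + s *\<^sub>R \<nu> \<in> closure \<Omega>" by (rule subsetD[OF segment_closure[OF s0 seg]]) (use s0 in auto)
    then have fr: "x + s *\<^sub>R \<nu> \<in> frontier \<Omega>" using sO \<Omega> by (simp add: frontier_def interior_open)
    obtain \<tau> where \<tau>: "0 < \<tau>" "\<tau> < s" "u (x + s *\<^sub>R \<nu>) - u x = s * (D (x + \<tau> *\<^sub>R \<nu>) \<bullet> \<nu>)"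
      using directional_mvt[OF uc s0 seg] .
    have "- (D (x + \<tau> *\<^sub>R \<nu>) \<bullet> \<nu>) \<le> norm (D (x + \<tau> *\<^sub>R \<nu>)) * norm \<nu>"
      using Cauchy_Schwarz_ineq2[of "D (x + \<tau> *\<^sub>R \<nu>)" \<nu>] by linarith
    also have "\<dots> \<le> B * norm \<nu>" using B[OF seg[of \<tau>]] \<tau> by (intro mult_right_mono) auto
    finally have "s * (- (D (x + \<tau> *\<^sub>R \<nu>) \<bullet> \<nu>)) \<le> T * (B * norm \<nu>)"
      using sT s0 order_trans[OF norm_ge_zero B[OF x(1)]]
      by (intro order_trans[OF mult_left_mono mult_right_mono]) (auto intro!: mult_nonneg_nonneg)
    then have "u x \<le> T * (B * norm \<nu>)" using \<tau>(3) u(2)[OF fr] by simp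
    then show "u x \<le> (B * norm \<nu> / c) * v x" by (simp add: T_def mult_ac)
  qed
qed

text \<open>If no constant worked, points at which u exceeds n times v would accumulate in the
  compact closure, and the local constant at the accumulation point would be exceeded.\<close>

lemma locally_comparable_imp_comparable:
  fixes u v :: "'a::euclidean_space \<Rightarrow> real"
  assumes bdd: "bounded \<Omega>" and v: "\<And>x. x \<in> \<Omega> \<Longrightarrow> 0 < v x"
    and loc: "\<And>x0. x0 \<in> closure \<Omega> \<Longrightarrow> \<exists>\<epsilon>>0. \<exists>R. \<forall>x\<in>\<Omega>. dist x x0 < \<epsilon> \<longrightarrow> u x \<le> R * v x"
  obtains R where "\<And>x. x \<in> \<Omega> \<Longrightarrow> u x \<le> R * v x"
proof (rule ccontr)
  assume no: "\<not> thesis"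
  have "\<exists>x\<in>\<Omega>. real n * v x < u x" for n :: nat
    using no that[of "real n"] by (meson not_le)
  then obtain f where f: "\<And>n. f n \<in> \<Omega>" "\<And>n. real n * v (f n) < u (f n)" by metis
  have "compact (closure \<Omega>)" using bdd by simp
  moreover have "\<forall>n. f n \<in> closure \<Omega>" using f(1) closure_subset by blast
  ultimately obtain l s where l: "l \<in> closure \<Omega>" "strict_mono (s :: nat \<Rightarrow> nat)" "(f \<circ> s) \<longlonglongrightarrow> l"
    unfolding compact_def by metis
  obtain \<epsilon> R where \<epsilon>: "0 < \<epsilon>" "\<And>x. x \<in> \<Omega> \<Longrightarrow> dist x l < \<epsilon> \<Longrightarrow> u x \<le> R * v x" using loc[OF l(1)] by blast
  obtain N where N: "\<And>n. N \<le> n \<Longrightarrow> dist ((f \<circ> s) n) l < \<epsilon>"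
    using l(3) \<epsilon>(1) unfolding lim_sequentially by blast
  obtain n0 :: nat where n0: "R \<le> real n0" using real_arch_simple by blast
  define n where "n = max N n0"
  have "real (s n) * v (f (s n)) < R * v (f (s n))"
    using f(2)[of "s n"] \<epsilon>(2)[OF f(1), of "s n"] N[of n] by (simp add: n_def)
  then have "real (s n) < R" using v[OF f(1)[of "s n"]] by (simp add: mult_less_cancel_right)
  moreover have "n \<le> s n" using seq_suble[OF l(2)] .
  ultimately show False using n0 by (simp add: n_def)
qed

lemma interior_comparable:
  fixes u v :: "'a::euclidean_space \<Rightarrow> real"
  assumes "continuous_on S u" "continuous_on S v" "x0 \<in> S" "0 < v x0" "\<Omega> \<subseteq> S"
  shows "\<exists>\<epsilon>>0. \<exists>R. \<forall>x\<in>\<Omega>. dist x x0 < \<epsilon> \<longrightarrow> u x \<le> R * v x"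
proof -
  define R where "R = (\<bar>u x0\<bar> + 1) / (v x0 / 2)"
  obtain \<epsilon>1 where 1: "0 < \<epsilon>1" "\<And>y. y \<in> S \<Longrightarrow> dist y x0 < \<epsilon>1 \<Longrightarrow> dist (u y) (u x0) < 1"
    using assms(1,3) unfolding continuous_on_iff by (metis zero_less_one)
  obtain \<epsilon>2 where 2: "0 < \<epsilon>2" "\<And>y. y \<in> S \<Longrightarrow> dist y x0 < \<epsilon>2 \<Longrightarrow> dist (v y) (v x0) < v x0 / 2"
    using assms(2,3,4) unfolding continuous_on_iff by (metis half_gt_zero)
  have "u x \<le> R * v x" if "x \<in> \<Omega>" "dist x x0 < min \<epsilon>1 \<epsilon>2" for x
  proof -
    have "u x \<le> \<bar>u x0\<bar> + 1" using 1(2)[of x] that assms(5) by (auto simp: dist_real_def)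
    moreover have "\<bar>u x0\<bar> + 1 = R * (v x0 / 2)" using assms(4) by (simp add: R_def)
    moreover have "\<bar>v x - v x0\<bar> < v x0 / 2" using 2(2)[of x] that assms(5) by (auto simp: dist_real_def)
    then have "v x0 / 2 \<le> v x" by argo
    then have "R * (v x0 / 2) \<le> R * v x" using assms(4) by (intro mult_left_mono) (auto simp: R_def)
    ultimately show ?thesis by simp
  qed
  then show ?thesis using 1(1) 2(1) by (intro exI[of _ "min \<epsilon>1 \<epsilon>2"]) auto
qed

lemma C1_closure_bounded:
  assumes "bounded \<Omega>" "C1_closure_gradient \<Omega> u D"
  obtains B where "0 \<le> B" "\<And>x. x \<in> \<Omega> \<Longrightarrow> \<bar>u x\<bar> \<le> B" "\<And>x. x \<in> \<Omega> \<Longrightarrow> norm (D x) \<le> B"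
proof -
  have c: "continuous_on (closure \<Omega>) u" "continuous_on (closure \<Omega>) D" "compact (closure \<Omega>)"
    using assms by (auto simp: C1_closure_gradient_def)
  obtain B1 where B1: "\<And>x. x \<in> closure \<Omega> \<Longrightarrow> norm (u x) \<le> B1"
    using compact_imp_bounded[OF compact_continuous_image[OF c(1,3)]] by (auto simp: bounded_iff)
  obtain B2 where B2: "\<And>x. x \<in> closure \<Omega> \<Longrightarrow> norm (D x) \<le> B2"
    using compact_imp_bounded[OF compact_continuous_image[OF c(2,3)]] by (auto simp: bounded_iff)
  show thesis
    by (rule that[of "max 0 (max B1 B2)"])
      (use B1 B2 closure_subset[of \<Omega>] in \<open>auto simp: le_max_iff_disj subset_iff\<close>)
qed

lemma dirichlet_comparable:
  assumes "open \<Omega>" "bounded \<Omega>" "u \<in> strongly_positive_dirichlet \<Omega>" "v \<in> strongly_positive_dirichlet \<Omega>"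
  obtains R where "\<And>x. x \<in> \<Omega> \<Longrightarrow> u x \<le> R * v x"
proof -
  obtain D where D: "C1_closure_gradient \<Omega> u D" "\<forall>x\<in>frontier \<Omega>. u x = 0"
    using assms(3) by (auto simp: strongly_positive_dirichlet_def)
  obtain E where E: "C1_closure_gradient \<Omega> v E" "\<forall>x\<in>frontier \<Omega>. v x = 0" "\<forall>x\<in>\<Omega>. 0 < v x" "\<forall>x\<in>frontier \<Omega>. E x \<bullet> outward_unit_normal \<Omega> x < 0"
    using assms(4) by (auto simp: strongly_positive_dirichlet_def)
  obtain B where B: "\<And>x. x \<in> \<Omega> \<Longrightarrow> norm (D x) \<le> B" using C1_closure_bounded[OF assms(2) D(1)] by metis
  have "\<exists>\<epsilon>>0. \<exists>R. \<forall>x\<in>\<Omega>. dist x x0 < \<epsilon> \<longrightarrow> u x \<le> R * v x" if x0: "x0 \<in> closure \<Omega>" for x0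
  proof (cases "x0 \<in> \<Omega>")
    case True
    then show ?thesis using D(1) E(1,3) closure_subset[of \<Omega>] x0
      by (intro interior_comparable[of "closure \<Omega>"]) (auto simp: C1_closure_gradient_def)
  next
    case False
    then have f: "x0 \<in> frontier \<Omega>" using x0 assms(1) by (simp add: frontier_def interior_open)
    show ?thesis
      using boundary_comparable[OF assms(1) D(1) _ E(1) _ _ B f, of "outward_unit_normal \<Omega> x0"] D(2) E f by metis
  qed
  with locally_comparable_imp_comparable[OF assms(2), of v u] E(3) that show thesis by blast
qed

lemma neumann_comparable:
  assumes "bounded \<Omega>" "u \<in> strongly_positive_neumann \<Omega>" "v \<in> strongly_positive_neumann \<Omega>"
  obtains R where "\<And>x. x \<in> \<Omega> \<Longrightarrow> u x \<le> R * v x"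
proof -
  have c: "continuous_on (closure \<Omega>) u" "continuous_on (closure \<Omega>) v" "\<And>x. x \<in> closure \<Omega> \<Longrightarrow> 0 < v x"
    using assms(2,3) by (auto simp: strongly_positive_neumann_def C1_closure_gradient_def)
  have "\<exists>\<epsilon>>0. \<exists>R. \<forall>x\<in>\<Omega>. dist x x0 < \<epsilon> \<longrightarrow> u x \<le> R * v x" if "x0 \<in> closure \<Omega>" for x0
    by (rule interior_comparable[OF c(1,2) that c(3)[OF that] closure_subset])
  moreover have "\<And>x. x \<in> \<Omega> \<Longrightarrow> 0 < v x" using c(3) closure_subset by blast
  ultimately show thesis using locally_comparable_imp_comparable[OF assms(1), of v u] that by blast
qed

section \<open>Rigidity of strongly positive critical points and the final uniqueness
  statements\<close>

context energy_problem
begin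

abbreviation "crit X \<equiv> nontrivial_nonneg_critical_points \<Omega> X (W1_norm r \<Omega>) J"
abbreviation "minim X \<equiv> nonneg_global_minimizers \<Omega> X J"

text \<open>The classical gradient is a weak gradient and hence agrees almost everywhere with the
  chosen one; being continuous up to the compact closure, it is bounded. This supplies the
  hypotheses of \<open>critical_rigid\<close>.\<close>

lemma critical_strongly_positive_rigid:
  assumes X: "X = W1 r \<Omega> \<or> X = W1_0 r \<Omega>"
    and u: "u \<in> critical_points X (W1_norm r \<Omega>) J" and v: "v \<in> critical_points X (W1_norm r \<Omega>) J"
    and D: "C1_closure_gradient \<Omega> u D" "C1_closure_gradient \<Omega> v E"
    and pos: "\<And>x. x \<in> \<Omega> \<Longrightarrow> 0 < u x \<and> 0 < v x"
    and le: "\<And>x. x \<in> \<Omega> \<Longrightarrow> u x \<le> R1 * v x" "\<And>x. x \<in> \<Omega> \<Longrightarrow> v x \<le> R2 * u x"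
  shows "AE x in M. gr u x = gr v x \<and> (u x = v x \<or> gr u x = 0)"
proof -
  obtain B1 where B1: "\<And>x. x \<in> \<Omega> \<Longrightarrow> \<bar>u x\<bar> \<le> B1" "\<And>x. x \<in> \<Omega> \<Longrightarrow> norm (D x) \<le> B1"
    using C1_closure_bounded[OF bdd D(1)] by metis
  obtain B2 where B2: "\<And>x. x \<in> \<Omega> \<Longrightarrow> \<bar>v x\<bar> \<le> B2" "\<And>x. x \<in> \<Omega> \<Longrightarrow> norm (E x) \<le> B2"
    using C1_closure_bounded[OF bdd D(2)] by metis
  have g: "AE x in M. gr w x = F x" if "w \<in> W1 r \<Omega>" "C1_closure_gradient \<Omega> w F" for w F
  proof -
    have "has_weak_gradient \<Omega> w F"
      using that(2) closure_subset[of \<Omega>]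
      by (intro hwg_C1[OF \<Omega>]) (auto simp: C1_closure_gradient_def intro: continuous_on_subset)
    then show ?thesis by (rule hwg_unique[OF \<Omega> W1D(3)[OF that(1)]]) simp
  qed
  have W: "u \<in> W1 r \<Omega>" "v \<in> W1 r \<Omega>"
    using closed_space(1)[OF X] u v by (auto simp: critical_points_def)
  have s: "AE x in M. x \<in> \<Omega>" by (rule AE_I2) simp
  define B where "B = max B1 B2"
  define R where "R = max R1 R2"
  show ?thesis
  proof (rule critical_rigid[OF X u v])
    show "AE x in M. 0 < u x \<and> u x \<le> B \<and> 0 < v x \<and> v x \<le> B"
      using s by eventually_elim (use pos B1(1) B2(1) in \<open>force simp: B_def\<close>)
    show "AE x in M. norm (gr u x) \<le> B \<and> norm (gr v x) \<le> B"
      using s g[OF W(1) D(1)] g[OF W(2) D(2)] by eventually_elim (use B1(2) B2(2) in \<open>force simp: B_def\<close>)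
    show "AE x in M. u x \<le> R * v x \<and> v x \<le> R * u x"
      using s
    proof eventually_elim
      case (elim x)
      have "R1 * v x \<le> R * v x" "R2 * u x \<le> R * u x"
        using pos[OF elim] by (auto intro!: mult_right_mono simp: R_def)
      then show ?case using le[OF elim] by linarith
    qed
  qed
qed

lemma dirichlet_unique:
  "at_most_one_ae \<Omega> (crit (W1_0 r \<Omega>) \<inter> strongly_positive_dirichlet \<Omega>)"
  "at_most_one_ae \<Omega> (minim (W1_0 r \<Omega>))"
proof -
  show "at_most_one_ae \<Omega> (crit (W1_0 r \<Omega>) \<inter> strongly_positive_dirichlet \<Omega>)"
    unfolding at_most_one_ae_def
  proof (intro ballI, elim IntE)
    fix u v
    assume u: "u \<in> crit (W1_0 r \<Omega>)" "u \<in> strongly_positive_dirichlet \<Omega>"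
      and v: "v \<in> crit (W1_0 r \<Omega>)" "v \<in> strongly_positive_dirichlet \<Omega>"
    have c: "u \<in> critical_points (W1_0 r \<Omega>) (W1_norm r \<Omega>) J" "v \<in> critical_points (W1_0 r \<Omega>) (W1_norm r \<Omega>) J"
      using u(1) v(1) by (simp_all add: nontrivial_nonneg_critical_points_def)
    obtain R1 where R1: "\<And>x. x \<in> \<Omega> \<Longrightarrow> u x \<le> R1 * v x" using dirichlet_comparable[OF \<Omega> bdd u(2) v(2)] by blast
    obtain R2 where R2: "\<And>x. x \<in> \<Omega> \<Longrightarrow> v x \<le> R2 * u x" using dirichlet_comparable[OF \<Omega> bdd v(2) u(2)] by blast
    obtain D E where DE: "C1_closure_gradient \<Omega> u D" "C1_closure_gradient \<Omega> v E" "\<And>x. x \<in> \<Omega> \<Longrightarrow> 0 < u x \<and> 0 < v x"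
      using u(2) v(2) by (auto simp: strongly_positive_dirichlet_def)
    show "AE x in M. u x = v x"
      by (rule rigid_dirichlet[OF _ _ critical_strongly_positive_rigid[OF disjI2[OF refl] c DE R1 R2]])
        (use c in \<open>auto simp: critical_points_def\<close>)
  qed
  show "at_most_one_ae \<Omega> (minim (W1_0 r \<Omega>))"
    unfolding at_most_one_ae_def
    by (intro ballI rigid_dirichlet minimizers_rigid[OF disjI2[OF refl]]) (auto simp: nonneg_global_minimizers_def)
qed

lemma singleton_aeI:
  assumes "u \<in> S" "\<And>v. v \<in> S \<Longrightarrow> AE x in M. u x = v x"
  shows "singleton_ae \<Omega> S"
  unfolding singleton_ae_def at_most_one_ae_def
proof (intro conjI ballI)
  fix v w assume "v \<in> S" "w \<in> S"
  from assms(2)[OF this(1)] assms(2)[OF this(2)] show "AE x in M. v x = w x" by eventually_elim simp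
qed (use assms(1) in blast)

lemma neumann_unique:
  "u \<in> crit (W1 r \<Omega>) \<inter> strongly_positive_neumann \<Omega> \<Longrightarrow> nonconstant_ae \<Omega> u \<Longrightarrow>
    singleton_ae \<Omega> (crit (W1 r \<Omega>) \<inter> strongly_positive_neumann \<Omega>)"
  "u \<in> minim (W1 r \<Omega>) \<Longrightarrow> nonconstant_ae \<Omega> u \<Longrightarrow> singleton_ae \<Omega> (minim (W1 r \<Omega>))"
proof -
  assume u: "u \<in> crit (W1 r \<Omega>) \<inter> strongly_positive_neumann \<Omega>" and n: "nonconstant_ae \<Omega> u"
  show "singleton_ae \<Omega> (crit (W1 r \<Omega>) \<inter> strongly_positive_neumann \<Omega>)"
  proof (rule singleton_aeI[OF u])
    fix v assume v: "v \<in> crit (W1 r \<Omega>) \<inter> strongly_positive_neumann \<Omega>"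
    have c: "u \<in> critical_points (W1 r \<Omega>) (W1_norm r \<Omega>) J" "v \<in> critical_points (W1 r \<Omega>) (W1_norm r \<Omega>) J"
      using u v by (simp_all add: nontrivial_nonneg_critical_points_def)
    have sp: "u \<in> strongly_positive_neumann \<Omega>" "v \<in> strongly_positive_neumann \<Omega>" using u v by auto
    obtain R1 where R1: "\<And>x. x \<in> \<Omega> \<Longrightarrow> u x \<le> R1 * v x" using neumann_comparable[OF bdd sp] by blast
    obtain R2 where R2: "\<And>x. x \<in> \<Omega> \<Longrightarrow> v x \<le> R2 * u x" using neumann_comparable[OF bdd sp(2,1)] by blast
    obtain D E where DE: "C1_closure_gradient \<Omega> u D" "C1_closure_gradient \<Omega> v E" "\<And>x. x \<in> \<Omega> \<Longrightarrow> 0 < u x \<and> 0 < v x"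
      using sp closure_subset[of \<Omega>] unfolding strongly_positive_neumann_def by blast
    show "AE x in M. u x = v x"
      by (rule rigid_neumann[OF _ n _ critical_strongly_positive_rigid[OF disjI1[OF refl] c DE R1 R2]])
        (use c in \<open>auto simp: critical_points_def\<close>)
  qed
next
  assume u: "u \<in> minim (W1 r \<Omega>)" and n: "nonconstant_ae \<Omega> u"
  show "singleton_ae \<Omega> (minim (W1 r \<Omega>))"
    by (rule singleton_aeI[OF u], rule rigid_neumann[OF _ n _ minimizers_rigid[OF disjI1[OF refl] u]])
      (use u in \<open>auto simp: nonneg_global_minimizers_def\<close>)
qed

end

theorem theorem1p6:
  fixes \<Omega> :: "'a::euclidean_space set"
    and p r :: real
    and h :: "real \<Rightarrow> real"
    and g :: "'a \<Rightarrow> real \<Rightarrow> real"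
  assumes domain: "bounded_smooth_domain \<Omega>"
    and exponents: "1 < p" "p < r"
    and h_nonneg: "\<And>t. 0 \<le> t \<Longrightarrow> 0 \<le> h t"
    and h_cont: "continuous_on {0..} h"
    and h_mono: "mono_on {0..} h"
    and h_growth: "\<exists>C>0. \<forall>t\<ge>0. h t \<le> C * (1 + t powr (r / p - 1))"
    and h_pos: "\<And>t. 0 < t \<Longrightarrow> 0 < h t"
    and g_caratheodory: "caratheodory_fun \<Omega> g"
    and g_growth: "\<exists>C>0. \<exists>\<sigma>>0.
          \<sigma> * (real DIM('a) - r) \<le> (r - 1) * real DIM('a) + r \<and>
          (\<forall>x\<in>\<Omega>. \<forall>t. \<bar>g x t\<bar> \<le> C * (1 + \<bar>t\<bar> powr \<sigma>))"
    and g_quotient: "\<exists>q. 1 < q \<and> q < p \<and>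
          (AE x in lebesgue_on \<Omega>. antimono_on {0<..} (\<lambda>t. g x t / t powr (q - 1)))"
  shows
    "at_most_one_ae \<Omega> (nontrivial_nonneg_critical_points \<Omega> (W1_0 r \<Omega>) (W1_norm r \<Omega>) (energy \<Omega> p h g) \<inter> strongly_positive_dirichlet \<Omega>) \<and>
     at_most_one_ae \<Omega> (nonneg_global_minimizers \<Omega> (W1_0 r \<Omega>) (energy \<Omega> p h g)) \<and>
     ((\<exists>u \<in> nontrivial_nonneg_critical_points \<Omega> (W1 r \<Omega>) (W1_norm r \<Omega>) (energy \<Omega> p h g) \<inter> strongly_positive_neumann \<Omega>. nonconstant_ae \<Omega> u) \<longrightarrow>
        singleton_ae \<Omega> (nontrivial_nonneg_critical_points \<Omega> (W1 r \<Omega>) (W1_norm r \<Omega>) (energy \<Omega> p h g) \<inter> strongly_positive_neumann \<Omega>)) \<and>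
     ((\<exists>u \<in> nonneg_global_minimizers \<Omega> (W1 r \<Omega>) (energy \<Omega> p h g). nonconstant_ae \<Omega> u) \<longrightarrow> singleton_ae \<Omega> (nonneg_global_minimizers \<Omega> (W1 r \<Omega>) (energy \<Omega> p h g)))"
proof -
  obtain Ch where Ch: "0 < Ch" "\<And>t. 0 \<le> t \<Longrightarrow> h t \<le> Ch * (1 + t powr (r / p - 1))"
    using h_growth by blast
  obtain Cg \<sigma> where Cg: "0 < Cg" "0 < \<sigma>" "\<sigma> * (real DIM('a) - r) \<le> (r - 1) * real DIM('a) + r"
    "\<And>x t. x \<in> \<Omega> \<Longrightarrow> \<bar>g x t\<bar> \<le> Cg * (1 + \<bar>t\<bar> powr \<sigma>)"
    using g_growth by blast
  obtain q where q: "1 < q" "q < p" "AE x in lebesgue_on \<Omega>. antimono_on {0<..} (\<lambda>t. g x t / t powr (q - 1))"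
    using g_quotient by blast
  have "energy_problem \<Omega> r h p q Ch Cg \<sigma> g"
    by unfold_locales
      (use domain exponents h_nonneg h_cont h_mono h_pos g_caratheodory Ch Cg q in \<open>auto simp: bounded_smooth_domain_def\<close>)
  then interpret energy_problem \<Omega> r h p q Ch Cg \<sigma> g .
  show ?thesis using dirichlet_unique neumann_unique by blast
qed

end
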